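(* Let $n\in\mathbb N$, $n\ge1$, let $s\in(0,\infty)\setminus\mathbb N$ and let $A$ be a Young function. Then $$\mathcal O^{s,A}(\mathbb R^n)=W^{s,A}(\mathbb R^n),$$ with norms equivalent up to constants depending on $n$ and $s$; that is, there exist positive constants $c_1,c_2$ depending only on $n$ and $s$ such that $c_1\|u\|_{\mathcal O^{s,A}(\mathbb R^n)}\le\|u\|_{W^{s,A}(\mathbb R^n)}\le c_2\|u\|_{\mathcal O^{s,A}(\mathbb R^n)}$ for every $u$ in this common space.
   Context: A Young function is a function $A:[0,\infty)\to[0,\infty]$ that is convex, left-continuous, vanishes at $0$, and is neither identically $0$ nor identically $\infty$ (on $(0,\infty)$). $\mathcal M(\mathbb R^n)$ is the space of real-valued measurable functions on $\mathbb R^n$. The Luxemburg norm is $\|u\|_{L^A(\mathbb R^n)}=\inf\{\lambda>0:\int_{\mathbb R^n}A(|u(x)|/\lambda)\,dx\le1\}$, and $L^A(\mathbb R^n)$ is the set of $u\in\mathcal M(\mathbb R^n)$ with finite norm. For $m\in\mathbb N$, $W^{m,A}(\mathbb R^n)=\{u\in L^A(\mathbb R^n):|\nabla^ku|\in L^A(\mathbb R^n),\ k=1,\dots,m\}$ with norm $\sum_{k=0}^m\|\nabla^ku\|_{L^A(\mathbb R^n)}$, where $\nabla^ku$ is the vector of all weak derivatives of $u$ of order $k$ and $\nabla^0u=u$. Fractional Orlicz-Sobolev spaces: for $s\in(0,1)$, $$|u|_{s,A,\mathbb R^n}=\inf\Big\{\lambda>0:\int_{\mathbb R^n}\int_{\mathbb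 R^n}A\Big(\frac{|u(x)-u(y)|}{\lambda|x-y|^s}\Big)\frac{dx\,dy}{|x-y|^n}\le1\Big\}$$ (also for vector-valued $u$), $W^{s,A}(\mathbb R^n)=\{u\in L^A(\mathbb R^n):|u|_{s,A,\mathbb R^n}<\infty\}$, with norm $\|u\|_{L^A(\mathbb R^n)}+|u|_{s,A,\mathbb R^n}$. For $s\in(1,\infty)\setminus\mathbb N$, with $[s]$ the integer part and $\{s\}=s-[s]$, $W^{s,A}(\mathbb R^n)=\{u\in W^{[s],A}(\mathbb R^n):|\nabla^{[s]}u|_{\{s\},A,\mathbb R^n}<\infty\}$ with norm $\|u\|_{W^{[s],A}(\mathbb R^n)}+|\nabla^{[s]}u|_{\{s\},A,\mathbb R^n}$. Oscillation spaces: for $x\in\mathbb R^n$ and $r>0$, set $$\mathrm{osc}^su(x,r)=\inf_{\mathfrak q\in\mathcal P_{[s]}}\frac1{|B_r(x)|}\int_{B_r(x)}\frac{|u(y)-\mathfrak q(y)|}{r^s}\,dy,$$ where $B_r(x)$ is the ball centered at $x$ with radius $r$ and $\mathcal P_{[s]}$ is the space of polynomials on $\mathbb R^n$ of degree at most $[s]$. Define $$|u|_{\mathcal O^{s,A}(\mathbb R^n)}=\inf\Big\{\lambda>0:\int_0^1\int_{\mathbb R^n}A\Big(\frac{\mathrm{osc}^su(x,r)}{\lambda}\Big)dx\,\frac{dr}{r}\le1\Big\},$$ $\mathcal O^{s,A}(\mathbb R^n)=\{u\in L^A(\mathbb R^n):|u|_{\mathcal O^{s,A}(\mathbb R^n)}<\infty\}$,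 and $\|u\|_{\mathcal O^{s,A}(\mathbb R^n)}=\|u\|_{L^A(\mathbb R^n)}+|u|_{\mathcal O^{s,A}(\mathbb R^n)}$. *)

theory Defs
  imports "HOL-Analysis.Analysis"
begin

section \<open>Young functions and Luxemburg functionals\<close>

text \<open>Young functions are represented on the whole real line; only their values on
  \<open>[0, \<infinity>)\<close> are constrained, and only these are ever used.\<close>

definition young_function :: "(real \<Rightarrow> ennreal) \<Rightarrow> bool" where
  "young_function A \<longleftrightarrow>
     (\<forall>a\<ge>0. \<forall>b\<ge>0. \<forall>u\<ge>0. \<forall>v\<ge>0. u + v = 1 \<longrightarrow>
        A (u * a + v * b) \<le> ennreal u * A a + ennreal v * A b) \<and>
     (\<forall>t>0. continuous (at_left t) A) \<and>
     A 0 = 0 \<and>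
     (\<exists>t>0. A t \<noteq> 0) \<and>
     (\<exists>t>0. A t \<noteq> \<infinity>)"

text \<open>A Young function is nondecreasing and unbounded, hence \<open>A(\<infinity>) = \<infinity>\<close>. The extension is
  needed because \<open>osc\<close> is infinite where \<open>u\<close> fails to be locally integrable; this does not
  happen for \<open>u\<close> in \<open>L\<^sup>A\<close>.\<close>

definition young_ext :: "(real \<Rightarrow> ennreal) \<Rightarrow> ennreal \<Rightarrow> ennreal" where
  "young_ext A t = (if t = \<infinity> then \<infinity> else A (enn2real t))"

text \<open>Value \<open>\<infinity>\<close> if there is no admissible \<open>\<lambda>\<close>.\<close>

definition luxemburg :: "(real \<Rightarrow> ennreal) \<Rightarrow> ennreal" where
  "luxemburg \<Phi> = Inf {ennreal l |l. l > 0 \<and> \<Phi> l \<le> 1}"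

definition orlicz_norm :: "(real \<Rightarrow> ennreal) \<Rightarrow> (real ^ 'n \<Rightarrow> real) \<Rightarrow> ennreal" where
  "orlicz_norm A u = luxemburg (\<lambda>l. \<integral>\<^sup>+x. A (\<bar>u x\<bar> / l) \<partial>lebesgue)"

definition orlicz_space :: "(real \<Rightarrow> ennreal) \<Rightarrow> (real ^ 'n \<Rightarrow> real) set" where
  "orlicz_space A = {u. u \<in> borel_measurable lebesgue \<and> orlicz_norm A u < \<infinity>}"


section \<open>Weak derivatives\<close>

definition multi_indices :: "nat \<Rightarrow> ('n::finite \<Rightarrow> nat) set" where
  "multi_indices k = {\<alpha>. (\<Sum>i\<in>UNIV. \<alpha> i) = k}"

definition partial_derivative :: "'n \<Rightarrow> (real ^ 'n \<Rightarrow> real) \<Rightarrow> real ^ 'n \<Rightarrow> real" where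
  "partial_derivative i f x = frechet_derivative f (at x) (axis i 1)"

definition iterated_partial :: "'n list \<Rightarrow> (real ^ 'n \<Rightarrow> real) \<Rightarrow> real ^ 'n \<Rightarrow> real" where
  "iterated_partial js f = foldr partial_derivative js f"

text \<open>\<open>C\<^sub>c\<^sup>\<infinity>(\<real>\<^sup>n)\<close>: a function is smooth iff all of its iterated partial derivatives are
  (totally) differentiable everywhere.\<close>

definition test_function :: "(real ^ 'n \<Rightarrow> real) \<Rightarrow> bool" where
  "test_function \<phi> \<longleftrightarrow>
     (\<forall>js x. iterated_partial js \<phi> differentiable at x) \<and>
     compact (closure (support_on UNIV \<phi>))"

definition locally_integrable :: "(real ^ 'n \<Rightarrow> real) \<Rightarrow> bool" where
  "locally_integrable u \<longleftrightarrow> (\<forall>K. compact K \<longrightarrow> u absolutely_integrable_on K)"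

text \<open>\<open>D\<^sup>\<alpha>\<phi>\<close> is the iterated partial derivative along any list \<open>js\<close> in which each
  coordinate \<open>i\<close> occurs \<open>\<alpha> i\<close> times; by Schwarz's theorem the order is immaterial.\<close>

definition has_weak_derivative ::
    "(real ^ 'n \<Rightarrow> real) \<Rightarrow> ('n \<Rightarrow> nat) \<Rightarrow> (real ^ 'n \<Rightarrow> real) \<Rightarrow> bool" where
  "has_weak_derivative u \<alpha> v \<longleftrightarrow>
     locally_integrable u \<and> locally_integrable v \<and>
     (\<forall>\<phi> js. test_function \<phi> \<and> (\<forall>i. count_list js i = \<alpha> i) \<longrightarrow>
        (\<integral>x. u x * iterated_partial js \<phi> x \<partial>lebesgue) =
        (- 1) ^ (\<Sum>i\<in>UNIV. \<alpha> i) * (\<integral>x. v x * \<phi> x \<partial>lebesgue))"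

text \<open>Weak derivatives are unique up to null sets, so the choice of representative does not
  affect any of the norms below. The representative for \<open>\<alpha> = 0\<close> is fixed by \<open>\<nabla>\<^sup>0u = u\<close>.\<close>

definition weak_derivative ::
    "(real ^ 'n \<Rightarrow> real) \<Rightarrow> ('n \<Rightarrow> nat) \<Rightarrow> real ^ 'n \<Rightarrow> real" where
  "weak_derivative u \<alpha> = (if \<alpha> = (\<lambda>_. 0) then u else SOME v. has_weak_derivative u \<alpha> v)"

text \<open>\<open>\<bar>\<nabla>\<^sup>ku\<bar>\<close>\<close>

definition weak_gradient_norm :: "nat \<Rightarrow> (real ^ 'n \<Rightarrow> real) \<Rightarrow> real ^ 'n \<Rightarrow> real" where
  "weak_gradient_norm k u x = L2_set (\<lambda>\<alpha>. weak_derivative u \<alpha> x) (multi_indices k)"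


section \<open>Orlicz--Sobolev spaces of integer and fractional order\<close>

definition sobolev_space :: "nat \<Rightarrow> (real \<Rightarrow> ennreal) \<Rightarrow> (real ^ 'n \<Rightarrow> real) set" where
  "sobolev_space m A = {u \<in> orlicz_space A. \<forall>k\<in>{1..m}.
     (\<forall>\<alpha>\<in>multi_indices k. \<exists>v. has_weak_derivative u \<alpha> v) \<and>
     weak_gradient_norm k u \<in> orlicz_space A}"

definition sobolev_norm :: "nat \<Rightarrow> (real \<Rightarrow> ennreal) \<Rightarrow> (real ^ 'n \<Rightarrow> real) \<Rightarrow> ennreal" where
  "sobolev_norm m A u = (\<Sum>k=0..m. orlicz_norm A (weak_gradient_norm k u))"

text \<open>Seminorm of order \<open>\<sigma> \<in> (0, 1)\<close> of a vector-valued function, given by its finite family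
  of components \<open>(U i)\<close>, \<open>i \<in> I\<close>.\<close>

definition frac_seminorm ::
    "real \<Rightarrow> (real \<Rightarrow> ennreal) \<Rightarrow> 'i set \<Rightarrow> ('i \<Rightarrow> real ^ 'n \<Rightarrow> real) \<Rightarrow> ennreal" where
  "frac_seminorm \<sigma> A I U = luxemburg (\<lambda>l.
     \<integral>\<^sup>+y. \<integral>\<^sup>+x. A (L2_set (\<lambda>i. U i x - U i y) I / (l * norm (x - y) powr \<sigma>)) /
         ennreal (norm (x - y) ^ CARD('n)) \<partial>lebesgue \<partial>lebesgue)"

text \<open>One definition for \<open>0 < s < 1\<close> and \<open>s > 1\<close>: for \<open>[s] = 0\<close> one has \<open>W\<^sup>0\<^sup>,\<^sup>A = L\<^sup>A\<close> and
  \<open>\<nabla>\<^sup>0u = u\<close>; see the two lemmas at the end of this section.\<close>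

definition frac_sobolev_space :: "real \<Rightarrow> (real \<Rightarrow> ennreal) \<Rightarrow> (real ^ 'n \<Rightarrow> real) set" where
  "frac_sobolev_space s A = {u \<in> sobolev_space (nat \<lfloor>s\<rfloor>) A.
     frac_seminorm (frac s) A (multi_indices (nat \<lfloor>s\<rfloor>)) (weak_derivative u) < \<infinity>}"

definition frac_sobolev_norm ::
    "real \<Rightarrow> (real \<Rightarrow> ennreal) \<Rightarrow> (real ^ 'n \<Rightarrow> real) \<Rightarrow> ennreal" where
  "frac_sobolev_norm s A u = sobolev_norm (nat \<lfloor>s\<rfloor>) A u +
     frac_seminorm (frac s) A (multi_indices (nat \<lfloor>s\<rfloor>)) (weak_derivative u)"

lemma multi_indices_0: "multi_indices 0 = {\<lambda>_. 0}"
  by (auto simp: multi_indices_def)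

lemma orlicz_norm_gradient_0: "orlicz_norm A (weak_gradient_norm 0 u) = orlicz_norm A u"
  by (simp add: orlicz_norm_def weak_gradient_norm_def multi_indices_0 weak_derivative_def)

lemma frac_seminorm_0:
  "frac_seminorm \<sigma> A (multi_indices 0) (weak_derivative (u :: real ^ 'n \<Rightarrow> real)) = luxemburg (\<lambda>l.
     \<integral>\<^sup>+y. \<integral>\<^sup>+x. A (\<bar>u x - u y\<bar> / (l * norm (x - y) powr \<sigma>)) /
         ennreal (norm (x - y) ^ CARD('n)) \<partial>lebesgue \<partial>lebesgue)"
  by (simp add: frac_seminorm_def multi_indices_0 weak_derivative_def)

lemma frac_sobolev_space_less_1:
  assumes "0 < s" "s < 1"
  shows "(frac_sobolev_space s A :: (real ^ 'n \<Rightarrow> real) set) = {u \<in> orlicz_space A. luxemburg (\<lambda>l.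
     \<integral>\<^sup>+y. \<integral>\<^sup>+x. A (\<bar>u x - u y\<bar> / (l * norm (x - y) powr s)) /
         ennreal (norm (x - y) ^ CARD('n)) \<partial>lebesgue \<partial>lebesgue) < \<infinity>}"
proof -
  have "\<lfloor>s\<rfloor> = 0" and "frac s = s"
    using assms by (simp_all add: floor_eq_iff frac_eq)
  then show ?thesis
    by (simp add: frac_sobolev_space_def sobolev_space_def frac_seminorm_0)
qed

lemma frac_sobolev_norm_less_1:
  assumes "0 < s" "s < 1"
  shows "frac_sobolev_norm s A (u :: real ^ 'n \<Rightarrow> real) = orlicz_norm A u + luxemburg (\<lambda>l.
     \<integral>\<^sup>+y. \<integral>\<^sup>+x. A (\<bar>u x - u y\<bar> / (l * norm (x - y) powr s)) /
         ennreal (norm (x - y) ^ CARD('n)) \<partial>lebesgue \<partial>lebesgue)"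
proof -
  have "\<lfloor>s\<rfloor> = 0" and "frac s = s"
    using assms by (simp_all add: floor_eq_iff frac_eq)
  then show ?thesis
    by (simp add: frac_sobolev_norm_def sobolev_norm_def orlicz_norm_gradient_0 frac_seminorm_0)
qed


section \<open>Oscillation spaces\<close>

definition polynomials :: "nat \<Rightarrow> (real ^ 'n \<Rightarrow> real) set" where
  "polynomials m = {q. \<exists>c. \<forall>x.
     q x = (\<Sum>k=0..m. \<Sum>\<alpha>\<in>multi_indices k. c \<alpha> * (\<Prod>i\<in>UNIV. (x $ i) ^ \<alpha> i))}"

definition osc :: "real \<Rightarrow> (real ^ 'n \<Rightarrow> real) \<Rightarrow> real ^ 'n \<Rightarrow> real \<Rightarrow> ennreal" where
  "osc s u x r = (INF q\<in>polynomials (nat \<lfloor>s\<rfloor>).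
     (\<integral>\<^sup>+y\<in>ball x r. ennreal (\<bar>u y - q y\<bar> / r powr s) \<partial>lebesgue) / emeasure lebesgue (ball x r))"

definition osc_seminorm ::
    "real \<Rightarrow> (real \<Rightarrow> ennreal) \<Rightarrow> (real ^ 'n \<Rightarrow> real) \<Rightarrow> ennreal" where
  "osc_seminorm s A u = luxemburg (\<lambda>l.
     \<integral>\<^sup>+r\<in>{0<..<1}. ((\<integral>\<^sup>+x. young_ext A (osc s u x r / ennreal l) \<partial>lebesgue) / ennreal r) \<partial>lebesgue)"

definition osc_space :: "real \<Rightarrow> (real \<Rightarrow> ennreal) \<Rightarrow> (real ^ 'n \<Rightarrow> real) set" where
  "osc_space s A = {u \<in> orlicz_space A. osc_seminorm s A u < \<infinity>}"

definition osc_norm ::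
    "real \<Rightarrow> (real \<Rightarrow> ennreal) \<Rightarrow> (real ^ 'n \<Rightarrow> real) \<Rightarrow> ennreal" where
  "osc_norm s A u = orlicz_norm A u + osc_seminorm s A u"

end

theory Submission
  imports Defs
begin

text \<open>For the bound of the oscillation seminorm, a function with weak derivatives up to order \<open>[s]\<close>
  is compared with its Taylor polynomials: the remainder averages the increments of \<open>\<nabla>\<^sup>[\<^sup>s\<^sup>]u\<close>, so
  Jensen's inequality yields the seminorm bound.

  Conversely, \<open>u\<close> is convolved with dilates \<open>K\<^sub>t\<close> of a kernel that reproduces polynomials of degree
  \<open>[s]\<close>. Polynomials drop out of the difference of \<open>D\<^sup>\<alpha>(K\<^sub>t * u)\<close> at neighbouring dyadic scales
  or points, so this difference is at most \<open>C t\<^sup>s\<^sup>-\<^sup>|\<^sup>\<alpha>\<^sup>| osc\<^sup>su(x, t)\<close>. The dyadic sums converge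
  geometrically, their limits are the weak derivatives of \<open>u\<close>, and splitting the increments
  \<open>D\<^sup>\<alpha>u(x + z) - D\<^sup>\<alpha>u(x)\<close> over the shells \<open>|z| \<sim> t\<close> bounds the modular of the fractional seminorm.
  For \<open>|z| > 1/4\<close> the Orlicz norm of \<open>D\<^sup>\<alpha>u\<close> suffices.\<close>

text \<open>The constants may depend only on n and s, while \<open>A\<close> may jump to infinity
  and need not be doubling, so constants cannot simply be moved out of \<open>A\<close>. Every
  passage of \<open>A\<close> through a sum or an integral is therefore Jensen's inequality for
  weights of total mass 1, and surplus factors are absorbed into the Luxemburg parameter by A(x / K)
  <= A(x) / K for K >= 1. This dictates the normalised geometric weights of \<open>osc_avg\<close>,
  the ball means, and the averages of two or three terms. That s is not an integer enters through 0
  < frac s: it makes the sums over small scales and over large shells geometric. The oscillation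
  modular contains only radii below 1, and the dyadic estimates control radii up to 1/2. The
  derivatives are therefore compared with mollifications at scale 1/2, which the Orlicz norm of
  \<open>u\<close> controls. Lebesgue measurable functions are replaced by Borel representatives,
  since Fubini's theorem is applied to functions of several points.\<close>

lemma young_ext_ennreal [simp]: "0 \<le> t \<Longrightarrow> young_ext A (ennreal t) = A t"
  by (simp add: young_ext_def)

lemma young_ext_top [simp]: "young_ext A top = top"
  by (simp add: young_ext_def)

section \<open>Young functions: measurability, affine minorants and Jensen's inequality\<close>

context
  fixes A :: "real \<Rightarrow> ennreal"
  assumes yA: "young_function A"
begin

lemma young_0: "A 0 = 0"
  using yA by (simp add: young_function_def)

lemma young_convex:
  assumes "0 \<le> a" "0 \<le> b" "0 \<le> u" "0 \<le> v" "u + v = 1"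
  shows "A (u * a + v * b) \<le> ennreal u * A a + ennreal v * A b"
  using yA assms by (simp add: young_function_def)

text \<open>Convexity along the segment from 0, where \<open>A\<close> vanishes. Without a doubling
  condition this is how a factor leaves \<open>A\<close>.\<close>

lemma young_scale:
  assumes "0 \<le> \<theta>" "\<theta> \<le> 1" "0 \<le> t"
  shows "A (\<theta> * t) \<le> ennreal \<theta> * A t"
  using young_convex[of t 0 \<theta> "1 - \<theta>"] assms by (simp add: young_0)

lemma young_mono:
  assumes "0 \<le> a" "a \<le> b"
  shows "A a \<le> A b"
proof (cases "b = 0")
  case False
  with assms have "0 < b" by simp
  then have "A (a / b * b) \<le> ennreal (a / b) * A b"
    using assms by (intro young_scale) auto
  also have "\<dots> \<le> 1 * A b"
    using assms \<open>0 < b\<close> by (intro mult_right_mono) (auto simp: ennreal_le_1)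
  finally show ?thesis using \<open>0 < b\<close> by simp
qed (use assms in simp)

lemma young_ext_mono: "a \<le> b \<Longrightarrow> young_ext A a \<le> young_ext A b"
  by (auto simp: young_ext_def top_unique less_top intro!: young_mono enn2real_mono)

lemma young_ext_0: "young_ext A 0 = 0"
  by (simp add: young_ext_def young_0)

lemma young_ext_scale:
  assumes "0 \<le> \<theta>" "\<theta> \<le> 1"
  shows "young_ext A (ennreal \<theta> * t) \<le> ennreal \<theta> * young_ext A t"
proof (cases "t = top")
  case True
  then show ?thesis using assms
    by (cases "\<theta> = 0") (auto simp: young_ext_0 ennreal_mult_top)
next
  case False
  then obtain r where "t = ennreal r" "0 \<le> r" by (cases t) auto
  then show ?thesis using assms young_scale[of \<theta> r]
    by (simp flip: ennreal_mult)
qed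

text \<open>Superlevel sets of a monotone function are upward closed, hence half-lines that start at
  their infimum, with or without it.\<close>

lemma young_ext_measurable [measurable]: "young_ext A \<in> borel_measurable borel"
proof (rule borel_measurableI_greater)
  fix y :: ennreal
  let ?U = "{x. y < young_ext A x}"
  define m where "m = Inf ?U"
  have up: "x \<in> ?U \<Longrightarrow> x \<le> x' \<Longrightarrow> x' \<in> ?U" for x x'
    using young_ext_mono[of x x'] by (auto intro: less_le_trans)
  have "?U = (if m \<in> ?U then {m..} else {m<..})"
  proof (cases "m \<in> ?U")
    case True
    moreover have "?U \<subseteq> {m..}" unfolding m_def by (auto intro: Inf_lower)
    ultimately show ?thesis using up[of m] by auto
  next
    case False
    have "x \<in> ?U" if "m < x" for x
    proof -
      obtain z where "z \<in> ?U" "z < x" using \<open>m < x\<close> by (auto simp: m_def Inf_less_iff)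
      then show ?thesis using up[of z x] by auto
    qed
    moreover have "m < x" if "x \<in> ?U" for x
      using that False unfolding m_def by (metis Inf_lower order_neq_le_trans)
    ultimately show ?thesis using False by auto
  qed
  then have "?U \<in> sets borel" by (metis atLeast_borel greaterThan_borel)
  then show "{x \<in> space borel. y < young_ext A x} \<in> sets borel" by simp
qed

text \<open>A supporting line a t - c for a convex function with values in [0, infinity], lying
  above y at t0. The constant c is added on the other side to avoid subtraction of extended reals.
  Left continuity is essential: the line touches \<open>A\<close> slightly to the left of
  t0.\<close>

lemma young_affine_minorant:
  assumes "0 \<le> t0" "y < A t0"
  obtains a c where "0 \<le> a" "0 \<le> c" "\<And>t. 0 \<le> t \<Longrightarrow> ennreal (a * t) \<le> A t + ennreal c"
    "y + ennreal c < ennreal (a * t0)"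
proof -
  note minorant = that
  have t0: "0 < t0" using assms young_0 by (cases "t0 = 0") auto
  obtain yr where yr: "y = ennreal yr" "0 \<le> yr" using assms(2) by (cases y) auto
  \<comment> \<open>If \<open>A\<close> is already infinite at some t1 < t0, every increasing line
    that vanishes at t1 is a minorant; the slope is chosen so that the line reaches yr + 1 at
    t0.\<close>
  have steep: thesis if t1: "0 \<le> t1" "t1 < t0" "A t1 = top" for t1
  proof (rule minorant)
    let ?a = "(yr + 1) / (t0 - t1)"
    show "0 \<le> ?a" using t1 yr by simp
    show "0 \<le> ?a * t1" using t1 yr by simp
    show "ennreal (?a * t) \<le> A t + ennreal (?a * t1)" if "0 \<le> t" for t
    proof (cases "t \<le> t1")
      case True
      then have "ennreal (?a * t) \<le> ennreal (?a * t1)"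
        using t1 yr by (intro ennreal_leI mult_left_mono) auto
      then show ?thesis by (simp add: add_increasing)
    next
      case False
      then have "A t = top" using young_mono[of t1 t] t1 by (simp add: top_unique)
      then show ?thesis by simp
    qed
    have "?a * t0 = (yr + 1) + ?a * t1" using t1 by (simp add: field_simps)
    then have "yr + ?a * t1 < ?a * t0" by linarith
    then show "y + ennreal (?a * t1) < ennreal (?a * t0)"
      using yr t1 by (simp add: ennreal_less_iff flip: ennreal_plus)
  qed
  \<comment> \<open>Left continuity supplies t1 < t0 at which \<open>A\<close> still exceeds y. At
    t0 itself a supporting line of finite slope might fail to exist, since t0 may lie on the
    boundary of the domain of finiteness or beyond it.\<close>
  have "(A \<longlongrightarrow> A t0) (at_left t0)"
    using yA t0 by (simp add: young_function_def continuous_within)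
  then have "\<forall>\<^sub>F t in at_left t0. y < A t" using assms(2) by (rule order_tendstoD)
  moreover have "\<forall>\<^sub>F t in at_left t0. t \<in> {0<..<t0}"
    by (rule eventually_at_leftI[OF _ t0]) auto
  ultimately obtain t1 where t1: "0 < t1" "t1 < t0" "y < A t1"
    by (metis (mono_tags, lifting) eventually_conj eventually_happens' greaterThanLessThan_iff
        trivial_limit_at_left_real)
  \<comment> \<open>The point t2 separates the cases: if \<open>A\<close> is finite there, then t1
    is interior to the domain of finiteness.\<close>
  obtain t2 where t2: "t1 < t2" "t2 < t0" using dense t1(2) by blast
  show thesis
  proof (cases "A t2 = top")
    case True
    then show ?thesis using steep[of t2] t1 t2 by auto
  next
    case False
    define I where "I = {t. 0 \<le> t \<and> A t \<noteq> top}"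
    define f where "f t = enn2real (A t)" for t
    have Af: "A t = ennreal (f t)" if "t \<in> I" for t
      using that by (auto simp: I_def f_def less_top)
    have conv: "u * a + v * b \<in> I \<and> f (u * a + v * b) \<le> u * f a + v * f b"
      if "a \<in> I" "b \<in> I" "0 \<le> u" "0 \<le> v" "u + v = 1" for u v a b
    proof -
      have le: "A (u * a + v * b) \<le> ennreal (u * f a + v * f b)"
      proof -
        have "ennreal (u * f a + v * f b) = ennreal u * A a + ennreal v * A b"
          using that Af[of a] Af[of b] by (simp add: f_def ennreal_mult)
        then show ?thesis
          using young_convex[of a b u v] that by (simp add: I_def)
      qed
      then have I: "u * a + v * b \<in> I"
        using that by (auto simp: I_def top_unique)
      then show ?thesis using le Af[OF I] that
        by (auto simp: f_def[of a] f_def[of b] simp del: ennreal_plus)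
    qed
    have cI: "convex_on I f"
      by (rule convex_onI, use conv in \<open>auto simp: convex_def\<close>)
    have sub: "{0..t2} \<subseteq> I"
      using False by (auto simp: I_def) (metis top_unique young_mono)
    have int: "t1 \<in> interior I"
      by (rule interiorI[of "{0<..<t2}"]) (use t1 t2 sub in auto)
    \<comment> \<open>The infimum of the slopes to the right of t1, that is, the right derivative,
      which is a subgradient at t1.\<close>
    define k where "k = (INF t\<in>{t1<..} \<inter> I. (f t1 - f t) / (t1 - t))"
    have below: "f t1 + k * (t - t1) \<le> f t" if "t \<in> I" for t
      using convex_le_Inf_differential[OF cI int that] by (simp add: k_def)
    have It1: "t1 \<in> I" and I0: "0 \<in> I" using sub t1 t2 by auto
    have f0: "f 0 = 0" by (simp add: f_def young_0)
    have c0: "0 \<le> k * t1 - f t1" using below[OF I0] f0 by simp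
    have f1: "yr < f t1" using t1(3) yr Af[OF It1] by (simp add: ennreal_less_iff)
    have k0: "0 \<le> k"
    proof -
      have "0 < k * t1" using c0 f1 yr by linarith
      then show ?thesis using t1 by (simp add: zero_less_mult_iff)
    qed
    show ?thesis
    proof (rule minorant[OF k0 c0])
      fix t :: real assume t: "0 \<le> t"
      show "ennreal (k * t) \<le> A t + ennreal (k * t1 - f t1)"
      proof (cases "t \<in> I")
        case True
        have "k * t \<le> f t + (k * t1 - f t1)" using below[OF True] by (simp add: algebra_simps)
        then have "ennreal (k * t) \<le> ennreal (f t + (k * t1 - f t1))" by (rule ennreal_leI)
        also have "\<dots> = A t + ennreal (k * t1 - f t1)"
          using Af[OF True] c0 by (simp add: f_def)
        finally show ?thesis .
      qed (use t in \<open>auto simp: I_def\<close>)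
    next
      have "k * t1 \<le> k * t0" using k0 t1 by (intro mult_left_mono) auto
      then have "yr + (k * t1 - f t1) < k * t0" using f1 by linarith
      then show "y + ennreal (k * t1 - f t1) < ennreal (k * t0)"
        using yr c0 by (simp add: ennreal_less_iff flip: ennreal_plus)
    qed
  qed
qed

text \<open>A minorant taken at a point where \<open>A\<close> is positive has positive slope. It
  yields local integrability from finite modulars, and an infinite mean of \<open>A\<close> when the
  mean itself is infinite.\<close>

lemma young_linear_growth:
  obtains a c where "0 < a" "0 \<le> c" "\<And>t. ennreal a * t \<le> young_ext A t + ennreal c"
proof -
  obtain t where t: "0 < t" "A t \<noteq> 0" using yA by (auto simp: young_function_def)
  then have "0 < A t" by (simp add: zero_less_iff_neq_zero)
  then obtain a c where ac: "0 \<le> a" "0 \<le> c" "\<And>t. 0 \<le> t \<Longrightarrow> ennreal (a * t) \<le> A t + ennreal c"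
    "0 + ennreal c < ennreal (a * t)"
    using young_affine_minorant[of t 0] t by (metis less_imp_le)
  have "0 < ennreal (a * t)" using ac(4) by (metis not_less_zero zero_less_iff_neq_zero)
  then have "0 < a" using t by (auto simp: zero_less_mult_iff)
  show thesis
  proof (rule that[OF \<open>0 < a\<close> ac(2)])
    fix t show "ennreal a * t \<le> young_ext A t + ennreal c"
    proof (cases t)
      case (real r)
      then show ?thesis using ac(3)[of r] ac(1) by (simp add: ennreal_mult)
    qed auto
  qed
qed

text \<open>Affine minorants can be integrated against a probability measure, and
  \<open>young_affine_minorant\<close> separates any value below \<open>A\<close> at the mean by one
  of them. An infinite mean is covered by the minorant of positive slope.\<close>

theorem young_jensen:
  assumes M: "emeasure M (space M) = 1" and [measurable]: "f \<in> borel_measurable M"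
  shows "young_ext A (\<integral>\<^sup>+x. f x \<partial>M) \<le> (\<integral>\<^sup>+x. young_ext A (f x) \<partial>M)"
proof -
  have lin: "ennreal a * (\<integral>\<^sup>+x. f x \<partial>M) \<le> (\<integral>\<^sup>+x. young_ext A (f x) \<partial>M) + ennreal c"
    if "\<And>t. ennreal a * t \<le> young_ext A t + ennreal c" for a c
  proof -
    have "ennreal a * (\<integral>\<^sup>+x. f x \<partial>M) = (\<integral>\<^sup>+x. ennreal a * f x \<partial>M)"
      by (rule nn_integral_cmult[symmetric]) measurable
    also have "\<dots> \<le> (\<integral>\<^sup>+x. young_ext A (f x) + ennreal c \<partial>M)"
      by (intro nn_integral_mono that)
    also have "\<dots> = (\<integral>\<^sup>+x. young_ext A (f x) \<partial>M) + ennreal c"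
      by (subst nn_integral_add) (auto simp: M)
    finally show ?thesis .
  qed
  show ?thesis
  proof (cases "\<integral>\<^sup>+x. f x \<partial>M")
    case top
    obtain a c where "0 < a" "0 \<le> c" and g: "\<And>t. ennreal a * t \<le> young_ext A t + ennreal c"
      using young_linear_growth by blast
    then have "top \<le> (\<integral>\<^sup>+x. young_ext A (f x) \<partial>M) + ennreal c"
      using lin[of a c, OF g] top by (simp add: ennreal_mult_top)
    then show ?thesis by (auto simp: top_unique)
  next
    case (real t0)
    show ?thesis
    proof (rule ccontr)
      assume "\<not> ?thesis"
      then have "(\<integral>\<^sup>+x. young_ext A (f x) \<partial>M) < A t0" using real by simp
      then obtain a c where ac: "0 \<le> a" "0 \<le> c"
          "\<And>t. 0 \<le> t \<Longrightarrow> ennreal (a * t) \<le> A t + ennreal c"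
          "(\<integral>\<^sup>+x. young_ext A (f x) \<partial>M) + ennreal c < ennreal (a * t0)"
        using young_affine_minorant[OF real(1)] by blast
      have "ennreal a * t \<le> young_ext A t + ennreal c" for t
        using ac(3)[of "enn2real t"] ac(1)
        by (cases t) (auto simp: ennreal_mult)
      from lin[of a c, OF this] ac(1,4) real show False
        by (simp add: ennreal_mult)
    qed
  qed
qed

lemma young_jensen_sum:
  assumes "finite I" "\<And>i. i \<in> I \<Longrightarrow> 0 \<le> w i" "sum w I = 1"
  shows "young_ext A (\<Sum>i\<in>I. ennreal (w i) * t i) \<le> (\<Sum>i\<in>I. ennreal (w i) * young_ext A (t i))"
proof -
  let ?M = "density (count_space I) (\<lambda>i. ennreal (w i))"
  have "emeasure ?M (space ?M) = (\<Sum>i\<in>I. ennreal (w i))"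
    using assms by (simp add: emeasure_density nn_integral_count_space_finite)
  also have "\<dots> = 1" using assms by simp
  finally have "emeasure ?M (space ?M) = 1" .
  from young_jensen[OF this, of t] show ?thesis
    using assms(1) by (simp add: nn_integral_density nn_integral_count_space_finite)
qed

text \<open>Jensen's inequality for the counting measure with density \<open>w\<close>; the weights
  will be geometric over dyadic scales.\<close>

lemma young_jensen_suminf:
  assumes "\<And>i. 0 \<le> w i" "w sums 1"
  shows "young_ext A (\<Sum>i. ennreal (w i) * t i) \<le> (\<Sum>i. ennreal (w i) * young_ext A (t i))"
proof -
  let ?M = "density (count_space UNIV) (\<lambda>i. ennreal (w i))"
  have "emeasure ?M (space ?M) = (\<Sum>i. ennreal (w i))"
    using assms by (simp add: emeasure_density nn_integral_count_space_nat)
  also have "\<dots> = ennreal 1" using assms by (metis suminf_ennreal2 sums_iff)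
  finally have "emeasure ?M (space ?M) = 1" by simp
  from young_jensen[OF this, of t] show ?thesis
    by (simp add: nn_integral_density nn_integral_count_space_nat)
qed

lemma young_ext_average:
  assumes "finite I" "I \<noteq> {}"
  shows "young_ext A ((\<Sum>i\<in>I. t i) / of_nat (card I)) \<le> (\<Sum>i\<in>I. young_ext A (t i)) / of_nat (card I)"
proof -
  have c: "0 < card I" using assms by (simp add: card_gt_0_iff)
  have e: "x / of_nat (card I) = ennreal (1 / real (card I)) * x" for x
    using c by (simp add: divide_ennreal_def mult.commute inverse_ennreal ennreal_of_nat_eq_real_of_nat
        inverse_eq_divide)
  show ?thesis
    using young_jensen_sum[of I "\<lambda>_. 1 / real (card I)" t] assms c
    unfolding e by (simp add: sum_distrib_left)
qed

end

text \<open>If l1 and l2 are admissible for the two modulars, then l1 + l2 is admissible for both,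
  because modulars decrease in l. Hence only a common parameter has to be treated in
  \<open>le\<close>. The infima need not be attained, which forces the argument with slightly larger
  parameters.\<close>

lemma luxemburg_le_add:
  assumes c: "0 < c"
    and le: "\<And>l. 0 < l \<Longrightarrow> \<Phi>1 l \<le> 1 \<Longrightarrow> \<Phi>2 l \<le> 1 \<Longrightarrow> \<Phi> (c * l) \<le> 1"
    and anti1: "\<And>l l'. 0 < l \<Longrightarrow> l \<le> l' \<Longrightarrow> \<Phi>1 l' \<le> \<Phi>1 l"
    and anti2: "\<And>l l'. 0 < l \<Longrightarrow> l \<le> l' \<Longrightarrow> \<Phi>2 l' \<le> \<Phi>2 l"
  shows "luxemburg \<Phi> \<le> ennreal c * (luxemburg \<Phi>1 + luxemburg \<Phi>2)"
proof -
  let ?S = "\<lambda>\<Phi>. {ennreal l |l. l > 0 \<and> \<Phi> l \<le> 1}"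
  have lt: "luxemburg \<Phi> \<le> ennreal c * (a + b)" if "a \<in> ?S \<Phi>1" "b \<in> ?S \<Phi>2" for a b
  proof -
    obtain l1 l2 where l: "a = ennreal l1" "b = ennreal l2" "0 < l1" "0 < l2" "\<Phi>1 l1 \<le> 1" "\<Phi>2 l2 \<le> 1"
      using \<open>a \<in> _\<close> \<open>b \<in> _\<close> by auto
    have "\<Phi> (c * (l1 + l2)) \<le> 1"
      using l anti1[of l1 "l1 + l2"] anti2[of l2 "l1 + l2"] by (intro le) (auto intro: order_trans)
    then have "luxemburg \<Phi> \<le> ennreal (c * (l1 + l2))"
      unfolding luxemburg_def using c l by (intro Inf_lower) auto
    then show ?thesis using c l by (simp add: ennreal_mult)
  qed
  show ?thesis
  proof (rule ccontr)
    assume "\<not> ?thesis"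
    then have less: "ennreal c * (luxemburg \<Phi>1 + luxemburg \<Phi>2) < luxemburg \<Phi>" by simp
    then have "ennreal c * (luxemburg \<Phi>1 + luxemburg \<Phi>2) < top" using less_le_trans top_greatest by blast
    then have "luxemburg \<Phi>1 < top" "luxemburg \<Phi>2 < top"
      using c by (auto simp: ennreal_mult_less_top)
    then obtain p q where pq: "luxemburg \<Phi>1 = ennreal p" "0 \<le> p" "luxemburg \<Phi>2 = ennreal q" "0 \<le> q"
      by (metis ennreal_cases less_top)
    obtain z where z: "ennreal (c * (p + q)) < z" "z < luxemburg \<Phi>"
      using less dense pq c by (metis ennreal_mult ennreal_plus add_nonneg_nonneg less_imp_le)
    then obtain r where r: "z = ennreal r" "0 \<le> r" by (cases z) auto
    \<comment> \<open>Half of the room between p + q and r / c: admissible values below p + e and q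
      + e still give the bound r, which lies below \<open>luxemburg \<Phi>\<close>.\<close>
    define e where "e = (r / c - (p + q)) / 2"
    have "c * (p + q) < r" using z r by (simp add: ennreal_less_iff c pq less_imp_le)
    then have e: "0 < e" using c by (simp add: e_def field_simps)
    have "luxemburg \<Phi>1 < ennreal (p + e)" "luxemburg \<Phi>2 < ennreal (q + e)"
      using pq e by (simp_all add: ennreal_less_iff del: ennreal_plus)
    then obtain a b where ab: "a \<in> ?S \<Phi>1" "a < ennreal (p + e)" "b \<in> ?S \<Phi>2" "b < ennreal (q + e)"
      unfolding luxemburg_def Inf_less_iff by blast
    have "luxemburg \<Phi> \<le> ennreal c * (a + b)" using lt ab by blast
    also have "\<dots> \<le> ennreal c * (ennreal (p + e) + ennreal (q + e))"
      using ab by (intro mult_left_mono add_mono) auto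
    also have "\<dots> = ennreal (c * (p + e + (q + e)))"
      using pq e c by (simp add: ennreal_mult del: ennreal_plus flip: ennreal_plus)
    also have "c * (p + e + (q + e)) = r" using c by (simp add: e_def field_simps)
    finally show False using z r by simp
  qed
qed

section \<open>Smooth functions\<close>

text \<open>Smoothness of finite order, because stability under products is proved by induction on
  the order.\<close>

definition smooth_upto :: "nat \<Rightarrow> (real ^ 'n \<Rightarrow> real) \<Rightarrow> bool" where
  "smooth_upto k f \<longleftrightarrow> (\<forall>js x. length js \<le> k \<longrightarrow> iterated_partial js f differentiable at x)"

definition smooth :: "(real ^ 'n \<Rightarrow> real) \<Rightarrow> bool" where
  "smooth f \<longleftrightarrow> (\<forall>js x. iterated_partial js f differentiable at x)"

lemma iterated_partial_Nil [simp]: "iterated_partial [] f = f"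
  by (simp add: iterated_partial_def)

lemma iterated_partial_Cons [simp]:
  "iterated_partial (i # js) f = partial_derivative i (iterated_partial js f)"
  by (simp add: iterated_partial_def)

lemma iterated_partial_append:
  "iterated_partial (js @ ks) f = iterated_partial js (iterated_partial ks f)"
  by (simp add: iterated_partial_def)

lemma partial_derivative_eq:
  "(f has_derivative f') (at x) \<Longrightarrow> partial_derivative i f x = f' (axis i 1)"
  by (simp add: partial_derivative_def frechet_derivative_at[symmetric])

lemma has_derivative_frechet:
  "f differentiable at x \<Longrightarrow> (f has_derivative frechet_derivative f (at x)) (at x)"
  by (simp add: frechet_derivative_works)

lemma frechet_derivative_eq_sum:
  fixes f :: "real ^ 'n \<Rightarrow> real"
  assumes "f differentiable at x"
  shows "frechet_derivative f (at x) h = (\<Sum>i\<in>UNIV. h $ i * partial_derivative i f x)"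
proof -
  interpret linear "frechet_derivative f (at x)" by (rule linear_frechet_derivative[OF assms])
  have "h = (\<Sum>i\<in>UNIV. h $ i *\<^sub>R axis i 1)"
    using basis_expansion[of h] by (simp add: scalar_mult_eq_scaleR)
  then have "frechet_derivative f (at x) h = frechet_derivative f (at x) (\<Sum>i\<in>UNIV. h $ i *\<^sub>R axis i 1)"
    by simp
  then show ?thesis by (simp add: sum scale partial_derivative_def)
qed

lemma smooth_upto_0: "smooth_upto 0 f \<longleftrightarrow> (\<forall>x. f differentiable at x)"
  by (simp add: smooth_upto_def)

text \<open>The derivative is split off at the end of the list, where it acts first, so that an
  induction hypothesis applies to the first partials of \<open>f\<close>.\<close>

lemma smooth_upto_Suc:
  "smooth_upto (Suc k) f \<longleftrightarrow> (\<forall>x. f differentiable at x) \<and> (\<forall>i. smooth_upto k (partial_derivative i f))"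
proof safe
  assume f: "smooth_upto (Suc k) f"
  show "f differentiable at x" for x
    using f unfolding smooth_upto_def by (metis iterated_partial_Nil list.size(3) zero_le)
  show "smooth_upto k (partial_derivative i f)" for i
    unfolding smooth_upto_def
  proof safe
    fix js :: "'a list" and x assume "length js \<le> k"
    then have "iterated_partial (js @ [i]) f differentiable at x"
      using f unfolding smooth_upto_def by simp
    then show "iterated_partial js (partial_derivative i f) differentiable at x"
      by (simp add: iterated_partial_append)
  qed
next
  assume f: "\<forall>x. f differentiable at x" "\<forall>i. smooth_upto k (partial_derivative i f)"
  show "smooth_upto (Suc k) f"
    unfolding smooth_upto_def
  proof safe
    fix js :: "'a list" and x assume "length js \<le> Suc k"
    then show "iterated_partial js f differentiable at x"
      using f by (cases js rule: rev_cases) (auto simp: iterated_partial_append smooth_upto_def)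
  qed
qed

lemma smooth_iff: "smooth f \<longleftrightarrow> (\<forall>k. smooth_upto k f)"
  by (auto simp: smooth_def smooth_upto_def)

lemma smooth_differentiable: "smooth f \<Longrightarrow> f differentiable at x"
  unfolding smooth_def by (metis iterated_partial_Nil)

lemma smooth_partial_derivative: "smooth f \<Longrightarrow> smooth (partial_derivative i f)"
  unfolding smooth_iff by (meson smooth_upto_Suc)

lemma smooth_iterated_partial: "smooth f \<Longrightarrow> smooth (iterated_partial js f)"
  by (induction js) (auto simp: smooth_partial_derivative)

lemma smooth_continuous: "smooth f \<Longrightarrow> continuous_on S f"
  by (meson continuous_at_imp_continuous_on differentiable_imp_continuous_within smooth_differentiable)

lemma smooth_measurable: "smooth f \<Longrightarrow> f \<in> borel_measurable borel"
  by (intro borel_measurable_continuous_onI smooth_continuous)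

lemma partial_derivative_const [simp]: "partial_derivative i (\<lambda>x. c) = (\<lambda>x. 0)"
  by (simp add: partial_derivative_def fun_eq_iff)

lemma partial_derivative_add:
  assumes "f differentiable at x" "g differentiable at x"
  shows "partial_derivative i (\<lambda>x. f x + g x) x = partial_derivative i f x + partial_derivative i g x"
  by (subst partial_derivative_eq[OF has_derivative_add[OF assms[THEN has_derivative_frechet]]])
    (simp add: partial_derivative_def)

lemma partial_derivative_mult:
  assumes "f differentiable at x" "g differentiable at x"
  shows "partial_derivative i (\<lambda>x. f x * g x) x = f x * partial_derivative i g x + partial_derivative i f x * g x"
  by (subst partial_derivative_eq[OF has_derivative_mult[OF assms[THEN has_derivative_frechet]]])
    (simp add: partial_derivative_def)

lemma partial_derivative_affine:
  assumes "f differentiable at (a + c *\<^sub>R x)"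
  shows "partial_derivative i (\<lambda>x. f (a + c *\<^sub>R x)) x = c * partial_derivative i f (a + c *\<^sub>R x)"
proof -
  have "((\<lambda>x. a + c *\<^sub>R x) has_derivative (\<lambda>h. c *\<^sub>R h)) (at x)"
    by (auto intro!: derivative_eq_intros)
  from partial_derivative_eq[OF has_derivative_compose[OF this has_derivative_frechet[OF assms]]]
  show ?thesis using linear_frechet_derivative[OF assms]
    by (simp add: partial_derivative_def linear_scale)
qed

lemma smooth_upto_const: "smooth_upto k (\<lambda>x. c)"
  by (induction k arbitrary: c) (auto simp: smooth_upto_0 smooth_upto_Suc)

lemma smooth_upto_add: "smooth_upto k f \<Longrightarrow> smooth_upto k g \<Longrightarrow> smooth_upto k (\<lambda>x. f x + g x)"
proof (induction k arbitrary: f g)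
  case (Suc k)
  have "partial_derivative i (\<lambda>x. f x + g x) = (\<lambda>x. partial_derivative i f x + partial_derivative i g x)" for i
    using Suc.prems by (intro ext partial_derivative_add) (auto simp: smooth_upto_Suc)
  then show ?case using Suc by (simp add: smooth_upto_Suc)
qed (simp add: smooth_upto_0)

lemma smooth_upto_lower: "smooth_upto k f \<Longrightarrow> l \<le> k \<Longrightarrow> smooth_upto l f"
  by (auto simp: smooth_upto_def)

lemma smooth_upto_mult: "smooth_upto k f \<Longrightarrow> smooth_upto k g \<Longrightarrow> smooth_upto k (\<lambda>x. f x * g x)"
proof (induction k arbitrary: f g)
  case (Suc k)
  have "partial_derivative i (\<lambda>x. f x * g x) =
      (\<lambda>x. f x * partial_derivative i g x + partial_derivative i f x * g x)" for i
    using Suc.prems by (intro ext partial_derivative_mult) (auto simp: smooth_upto_Suc)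
  moreover have "smooth_upto k (\<lambda>x. f x * partial_derivative i g x + partial_derivative i f x * g x)" for i
    using Suc.prems smooth_upto_lower[OF Suc.prems(1), of k] smooth_upto_lower[OF Suc.prems(2), of k]
    by (intro smooth_upto_add Suc.IH) (auto simp: smooth_upto_Suc)
  ultimately show ?case using Suc by (simp add: smooth_upto_Suc)
qed (simp add: smooth_upto_0)

lemma smooth_const: "smooth (\<lambda>x. c)"
  by (simp add: smooth_iff smooth_upto_const)

lemma smooth_add: "smooth f \<Longrightarrow> smooth g \<Longrightarrow> smooth (\<lambda>x. f x + g x)"
  by (simp add: smooth_iff smooth_upto_add)

lemma smooth_mult: "smooth f \<Longrightarrow> smooth g \<Longrightarrow> smooth (\<lambda>x. f x * g x)"
  by (simp add: smooth_iff smooth_upto_mult)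

lemma smooth_cmult: "smooth f \<Longrightarrow> smooth (\<lambda>x. c * f x)"
  by (intro smooth_mult smooth_const)

lemma smooth_prod: "(\<And>i. i \<in> I \<Longrightarrow> smooth (f i)) \<Longrightarrow> smooth (\<lambda>x. \<Prod>i\<in>I. f i x)"
  by (induction I rule: infinite_finite_induct) (auto intro: smooth_mult smooth_const)

lemma differentiable_affine_compose:
  fixes f :: "'a::real_normed_vector \<Rightarrow> 'b::real_normed_vector"
  assumes "f differentiable at (a + c *\<^sub>R x)"
  shows "(\<lambda>x. f (a + c *\<^sub>R x)) differentiable at x"
proof -
  have "((\<lambda>x. a + c *\<^sub>R x) has_derivative (\<lambda>h. c *\<^sub>R h)) (at x)"
    by (auto intro!: derivative_eq_intros)
  from has_derivative_compose[OF this has_derivative_frechet[OF assms]]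
  show ?thesis by (auto simp: differentiable_def)
qed

lemma iterated_partial_affine:
  assumes "smooth f"
  shows "iterated_partial js (\<lambda>x. f (a + c *\<^sub>R x)) =
    (\<lambda>x. c ^ length js * iterated_partial js f (a + c *\<^sub>R x))"
proof (induction js)
  case (Cons i js)
  show ?case
  proof
    fix x
    have d: "(\<lambda>x. iterated_partial js f (a + c *\<^sub>R x)) differentiable at x"
      using assms by (intro differentiable_affine_compose) (simp add: smooth_def)
    show "iterated_partial (i # js) (\<lambda>x. f (a + c *\<^sub>R x)) x =
      c ^ length (i # js) * iterated_partial (i # js) f (a + c *\<^sub>R x)"
      using d assms
      by (simp add: Cons partial_derivative_mult partial_derivative_affine smooth_def)
  qed
qed simp

lemma smooth_affine: assumes "smooth f" shows "smooth (\<lambda>x. f (a + c *\<^sub>R x))"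
  unfolding smooth_def iterated_partial_affine[OF assms]
  using assms by (auto simp: smooth_def intro!: differentiable_mult differentiable_affine_compose)

lemma iterated_partial_add:
  "smooth f \<Longrightarrow> smooth g \<Longrightarrow>
    iterated_partial js (\<lambda>x. f x + g x) = (\<lambda>x. iterated_partial js f x + iterated_partial js g x)"
proof (induction js)
  case (Cons i js)
  then show ?case
    by (intro ext) (simp add: Cons.IH[OF Cons.prems] partial_derivative_add smooth_def)
qed simp

lemma iterated_partial_cmult:
  "smooth f \<Longrightarrow> iterated_partial js (\<lambda>x. c * f x) = (\<lambda>x. c * iterated_partial js f x)"
proof (induction js)
  case (Cons i js)
  then show ?case
    by (intro ext) (simp add: Cons.IH[OF Cons.prems] partial_derivative_mult smooth_def)
qed simp

lemma iterated_partial_const_0 [simp]: "iterated_partial js (\<lambda>x. 0) = (\<lambda>x. 0)"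
  by (induction js) auto

lemma smooth_has_real_derivative:
  assumes "smooth f"
  shows "((\<lambda>t. f (a + t *\<^sub>R h)) has_real_derivative (\<Sum>i\<in>UNIV. h $ i * partial_derivative i f (a + t *\<^sub>R h)))
    (at t within S)"
proof -
  have f: "f differentiable at (a + t *\<^sub>R h)" by (rule smooth_differentiable[OF assms])
  have "((\<lambda>t. a + t *\<^sub>R h) has_derivative (\<lambda>s. s *\<^sub>R h)) (at t)"
    by (auto intro!: derivative_eq_intros)
  from has_derivative_compose[OF this has_derivative_frechet[OF f]]
  have "((\<lambda>t. f (a + t *\<^sub>R h)) has_derivative
    (\<lambda>s. (\<Sum>i\<in>UNIV. h $ i * partial_derivative i f (a + t *\<^sub>R h)) * s)) (at t)"
    by (simp add: frechet_derivative_eq_sum[OF f] sum_distrib_left mult_ac)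
  then show ?thesis
    unfolding has_field_derivative_def by (rule has_derivative_at_withinI)
qed

lemma smooth_mvt_axis:
  assumes "smooth f" "0 < h"
  obtains \<theta> where "0 < \<theta>" "\<theta> < h"
    "f (a + h *\<^sub>R axis i 1) - f a = h * partial_derivative i f (a + \<theta> *\<^sub>R axis i 1)"
proof -
  have "\<exists>\<theta>. 0 < \<theta> \<and> \<theta> < h \<and> f (a + h *\<^sub>R axis i 1) - f (a + 0 *\<^sub>R axis i 1) =
    (h - 0) * (\<Sum>j\<in>UNIV. axis i 1 $ j * partial_derivative j f (a + \<theta> *\<^sub>R axis i 1))"
    by (rule MVT2[OF assms(2)]) (rule smooth_has_real_derivative[OF assms(1)])
  then show thesis using that
    by (auto simp: axis_def if_distrib[of "\<lambda>x. x * _"] cong: if_cong)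
qed

text \<open>Schwarz's theorem: both mixed derivatives are limits of the same second difference quotient.\<close>

lemma second_difference:
  fixes f :: "real ^ 'n \<Rightarrow> real"
  assumes "smooth f" "0 < h"
  shows "\<exists>\<xi>\<in>cball x (2 * h). f (x + h *\<^sub>R axis i 1 + h *\<^sub>R axis j 1) - f (x + h *\<^sub>R axis i 1)
    - f (x + h *\<^sub>R axis j 1) + f x = h\<^sup>2 * partial_derivative j (partial_derivative i f) \<xi>"
proof -
  \<comment> \<open>The first difference of f in direction j. The mean value theorem in direction i
    for g, and then in direction j for the i-th partial of f, produces the mixed derivative.\<close>
  define g where "g y = f (h *\<^sub>R axis j 1 + 1 *\<^sub>R y) + (-1) * f y" for y
  have g: "smooth g" unfolding g_def
    using assms by (intro smooth_add smooth_cmult smooth_affine)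
  obtain \<theta> where t: "0 < \<theta>" "\<theta> < h"
    "g (x + h *\<^sub>R axis i 1) - g x = h * partial_derivative i g (x + \<theta> *\<^sub>R axis i 1)"
    using smooth_mvt_axis[OF g assms(2)] by blast
  have "iterated_partial [i] g y = iterated_partial [i] f (h *\<^sub>R axis j 1 + 1 *\<^sub>R y) + (-1) * iterated_partial [i] f y" for y
    unfolding g_def using assms
    by (simp only: iterated_partial_add[OF smooth_affine[OF assms(1)] smooth_cmult[OF assms(1)]]
        iterated_partial_affine[OF assms(1)] iterated_partial_cmult[OF assms(1)]) simp
  then have pg: "partial_derivative i g y = partial_derivative i f (y + h *\<^sub>R axis j 1) - partial_derivative i f y" for y
    by (simp add: add.commute)
  obtain \<eta> where e: "0 < \<eta>" "\<eta> < h" "partial_derivative i f (x + \<theta> *\<^sub>R axis i 1 + h *\<^sub>R axis j 1)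
     - partial_derivative i f (x + \<theta> *\<^sub>R axis i 1)
     = h * partial_derivative j (partial_derivative i f) (x + \<theta> *\<^sub>R axis i 1 + \<eta> *\<^sub>R axis j 1)"
    using smooth_mvt_axis[OF smooth_partial_derivative[OF assms(1)] assms(2)] by blast
  show ?thesis
  proof (intro bexI)
    have "norm (\<theta> *\<^sub>R axis i 1 + \<eta> *\<^sub>R axis j (1::real)) \<le> \<theta> + \<eta>"
      using t e by (intro norm_triangle_le) (simp add: norm_axis_1)
    moreover have "dist x (x + \<theta> *\<^sub>R axis i 1 + \<eta> *\<^sub>R axis j 1)
        = norm (\<theta> *\<^sub>R axis i 1 + \<eta> *\<^sub>R axis j (1::real))"
      by (metis add.assoc add_diff_cancel_left' dist_commute dist_norm)
    ultimately show "x + \<theta> *\<^sub>R axis i 1 + \<eta> *\<^sub>R axis j 1 \<in> cball x (2 * h)"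
      using t e by simp
    have "f (x + h *\<^sub>R axis i 1 + h *\<^sub>R axis j 1) - f (x + h *\<^sub>R axis i 1)
      - f (x + h *\<^sub>R axis j 1) + f x = g (x + h *\<^sub>R axis i 1) - g x"
      by (simp add: g_def add_ac)
    then show "f (x + h *\<^sub>R axis i 1 + h *\<^sub>R axis j 1) - f (x + h *\<^sub>R axis i 1)
      - f (x + h *\<^sub>R axis j 1) + f x
      = h\<^sup>2 * partial_derivative j (partial_derivative i f) (x + \<theta> *\<^sub>R axis i 1 + \<eta> *\<^sub>R axis j 1)"
      using t(3) e(3) by (simp add: pg power2_eq_square)
  qed
qed

lemma partial_derivative_commute:
  fixes f :: "real ^ 'n \<Rightarrow> real"
  assumes "smooth f"
  shows "partial_derivative i (partial_derivative j f) = partial_derivative j (partial_derivative i f)"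
proof
  fix x
  let ?p = "partial_derivative i (partial_derivative j f)"
  let ?q = "partial_derivative j (partial_derivative i f)"
  have cont: "isCont ?p x" "isCont ?q x"
    using assms by (meson smooth_partial_derivative smooth_differentiable differentiable_imp_continuous_within)+
  show "?p x = ?q x"
  proof (rule ccontr)
    assume ne: "?p x \<noteq> ?q x"
    define e where "e = \<bar>?p x - ?q x\<bar> / 2"
    have "0 < e" using ne by (simp add: e_def)
    with cont obtain d1 d2 where d: "0 < d1" "0 < d2"
      "\<And>y. dist y x < d1 \<Longrightarrow> dist (?p y) (?p x) < e" "\<And>y. dist y x < d2 \<Longrightarrow> dist (?q y) (?q x) < e"
      unfolding continuous_at_eps_delta by metis
    define h where "h = min d1 d2 / 4"
    have h: "0 < h" using d by (simp add: h_def)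
    obtain \<xi> where x1: "\<xi> \<in> cball x (2*h)" "f (x + h *\<^sub>R axis i 1 + h *\<^sub>R axis j 1) - f (x + h *\<^sub>R axis i 1)
    - f (x + h *\<^sub>R axis j 1) + f x = h\<^sup>2 * ?q \<xi>" using second_difference[OF assms h] by blast
    obtain \<eta> where x2: "\<eta> \<in> cball x (2*h)" "f (x + h *\<^sub>R axis j 1 + h *\<^sub>R axis i 1) - f (x + h *\<^sub>R axis j 1)
    - f (x + h *\<^sub>R axis i 1) + f x = h\<^sup>2 * ?p \<eta>" using second_difference[OF assms h] by blast
    have "h\<^sup>2 * ?q \<xi> = h\<^sup>2 * ?p \<eta>" using x1(2) x2(2) by (simp add: algebra_simps)
    then have "?q \<xi> = ?p \<eta>" using h by simp
    moreover have "dist \<xi> x < d2" "dist \<eta> x < d1"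
      using x1(1) x2(1) h d by (auto simp: dist_commute h_def)
    then have "dist (?q \<xi>) (?q x) < e" "dist (?p \<eta>) (?p x) < e" using d by auto
    ultimately show False unfolding e_def dist_real_def by (auto simp: abs_if split: if_splits)
  qed
qed

lemma iterated_partial_swap:
  assumes "smooth f"
  shows "iterated_partial js (partial_derivative i f) = partial_derivative i (iterated_partial js f)"
  by (induction js) (simp_all add: partial_derivative_commute smooth_iterated_partial assms)

text \<open>Schwarz's theorem moves the first coordinate of one list to its position in the other.
  \<open>has_weak_derivative\<close> quantifies over every list with given counts, whereas the
  kernel argument treats one list at a time.\<close>

lemma iterated_partial_cong_count:
  assumes "smooth f" "\<And>i. count_list js i = count_list ks i"
  shows "iterated_partial js f = iterated_partial ks f"
  using assms(2)
proof (induction js arbitrary: ks)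
  case Nil
  have "i \<notin> set ks" for i using Nil[of i] by (metis count_list.simps(1) count_list_0_iff)
  then have "ks = []" by (cases ks) auto
  then show ?case by simp
next
  case (Cons i js)
  have "count_list ks i \<noteq> 0" using Cons.prems[of i] by simp
  then have "i \<in> set ks" by (metis count_list_0_iff)
  then obtain us vs where ks: "ks = us @ i # vs" by (auto simp: in_set_conv_decomp)
  have "count_list js j = count_list (us @ vs) j" for j
    using Cons.prems[of j] by (simp add: ks split: if_splits)
  then have "iterated_partial js f = iterated_partial (us @ vs) f" by (rule Cons.IH)
  then show ?case
    by (simp add: ks iterated_partial_append iterated_partial_swap smooth_iterated_partial assms(1))
qed

section \<open>Test functions\<close>

lemma test_functionI:
  assumes "smooth \<phi>" "\<And>x. R < norm x \<Longrightarrow> \<phi> x = 0"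
  shows "test_function \<phi>"
proof -
  have "support_on UNIV \<phi> \<subseteq> cball 0 R" using assms(2) by (force simp: support_on_def)
  then have "bounded (support_on UNIV \<phi>)" using bounded_cball bounded_subset by blast
  then show ?thesis using assms(1) by (simp add: test_function_def smooth_def)
qed

lemma test_function_smooth: "test_function \<phi> \<Longrightarrow> smooth \<phi>"
  by (simp add: test_function_def smooth_def)

lemma test_function_bound:
  assumes "test_function \<phi>"
  obtains R where "0 < R" "\<And>x. R < norm x \<Longrightarrow> \<phi> x = 0"
proof -
  have "bounded (support_on UNIV \<phi>)"
    using assms unfolding test_function_def by (meson bounded_subset closure_subset compact_imp_bounded)
  then obtain R where "0 < R" "\<And>x. x \<in> support_on UNIV \<phi> \<Longrightarrow> norm x \<le> R"
    using bounded_pos by blast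
  then show thesis using that[of R] by (force simp: support_on_def)
qed

lemma partial_derivative_vanish:
  assumes "\<And>x. R < norm x \<Longrightarrow> \<phi> x = 0" "R < norm x"
  shows "partial_derivative i \<phi> x = 0"
proof -
  have o: "open (- cball 0 R)" by (intro open_Compl closed_cball)
  have "(\<phi> has_derivative (\<lambda>h. 0)) (at x)"
    by (rule has_derivative_transform_within_open[OF has_derivative_const[of 0] o]) (use assms in auto)
  then show ?thesis by (simp add: partial_derivative_eq)
qed

lemma iterated_partial_vanish:
  assumes "\<And>x. R < norm x \<Longrightarrow> \<phi> x = 0"
  shows "R < norm x \<Longrightarrow> iterated_partial js \<phi> x = 0"
  by (induction js arbitrary: x) (auto intro: partial_derivative_vanish assms)

lemma test_function_iterated_partial: "test_function \<phi> \<Longrightarrow> test_function (iterated_partial js \<phi>)"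
proof -
  assume t: "test_function \<phi>"
  obtain R where R: "\<And>x. R < norm x \<Longrightarrow> \<phi> x = 0" using test_function_bound[OF t] by blast
  show ?thesis
    by (rule test_functionI[OF smooth_iterated_partial[OF test_function_smooth[OF t]]
          iterated_partial_vanish[OF R]])
qed

lemma test_function_partial: "test_function \<phi> \<Longrightarrow> test_function (partial_derivative j \<phi>)"
  using test_function_iterated_partial[of \<phi> "[j]"] by simp

lemma test_function_mult: "test_function \<phi> \<Longrightarrow> smooth g \<Longrightarrow> test_function (\<lambda>x. g x * \<phi> x)"
proof -
  assume t: "test_function \<phi>" and g: "smooth g"
  obtain R where R: "\<And>x. R < norm x \<Longrightarrow> \<phi> x = 0" using test_function_bound[OF t] by blast
  show ?thesis
    by (rule test_functionI[where R=R, OF smooth_mult[OF g test_function_smooth[OF t]]]) (simp add: R)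
qed

lemma test_function_cmult: "test_function \<phi> \<Longrightarrow> test_function (\<lambda>x. c * \<phi> x)"
  by (intro test_function_mult smooth_const)

lemma test_function_add:
  assumes "test_function \<phi>" "test_function \<psi>" shows "test_function (\<lambda>x. \<phi> x + \<psi> x)"
proof -
  obtain R where R: "\<And>x. R < norm x \<Longrightarrow> \<phi> x = 0" using test_function_bound[OF assms(1)] by blast
  obtain R' where R': "\<And>x. R' < norm x \<Longrightarrow> \<psi> x = 0" using test_function_bound[OF assms(2)] by blast
  show ?thesis
    by (rule test_functionI[where R="max R R'"])
      (use assms R R' in \<open>auto intro: smooth_add test_function_smooth\<close>)
qed

lemma test_function_sum:
  assumes "\<And>i. i \<in> I \<Longrightarrow> test_function (f i)" shows "test_function (\<lambda>x. \<Sum>i\<in>I. f i x)"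
proof -
  have "test_function (\<lambda>x. 0)" by (rule test_functionI[where R=0]) (auto intro: smooth_const)
  then show ?thesis using assms
    by (induction I rule: infinite_finite_induct) (auto intro: test_function_add)
qed

lemma test_function_affine:
  assumes "test_function \<phi>" "c \<noteq> 0" shows "test_function (\<lambda>x. \<phi> (a + c *\<^sub>R x))"
proof -
  obtain R where R: "\<And>x. R < norm x \<Longrightarrow> \<phi> x = 0" using test_function_bound[OF assms(1)] by blast
  have "\<phi> (a + c *\<^sub>R x) = 0" if "(R + norm a) / \<bar>c\<bar> < norm x" for x
  proof (rule R)
    have "R + norm a < norm (c *\<^sub>R x)" using that assms(2) by (simp add: field_simps)
    also have "norm (c *\<^sub>R x) \<le> norm (a + c *\<^sub>R x) + norm a"
      using norm_triangle_ineq4[of "a + c *\<^sub>R x" a] by simp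
    finally show "R < norm (a + c *\<^sub>R x)" by simp
  qed
  then show ?thesis
    by (rule test_functionI[OF smooth_affine[OF test_function_smooth[OF assms(1)]]])
qed

lemma continuous_compact_support_bounded:
  fixes f :: "real ^ 'n \<Rightarrow> real"
  assumes "continuous_on UNIV f" "\<And>x. R < norm x \<Longrightarrow> f x = 0"
  obtains M where "0 < M" "\<And>x. \<bar>f x\<bar> \<le> M"
proof -
  have "compact (f ` cball 0 R)"
    using assms(1) by (intro compact_continuous_image) (auto intro: continuous_on_subset)
  then obtain M where M: "0 < M" "\<And>x. x \<in> cball 0 R \<Longrightarrow> \<bar>f x\<bar> \<le> M"
    using compact_imp_bounded bounded_pos by (metis imageI real_norm_def)
  have "\<bar>f x\<bar> \<le> M" for x
    using M assms(2)[of x] by (cases "norm x \<le> R") auto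
  then show thesis using that M by blast
qed

lemma test_function_bounded:
  assumes "test_function \<phi>" obtains M where "0 < M" "\<And>x. \<bar>\<phi> x\<bar> \<le> M"
proof -
  obtain R where R: "\<And>x. R < norm x \<Longrightarrow> \<phi> x = 0" using test_function_bound[OF assms] by blast
  show thesis
    by (rule continuous_compact_support_bounded[OF smooth_continuous[OF test_function_smooth[OF assms]] R that])
qed

section \<open>Smooth cutoff functions of boxes\<close>

definition flat :: "real poly \<Rightarrow> real \<Rightarrow> real" where
  "flat p x = (if x > 0 then poly p (1 / x) * exp (- (1 / x)) else 0)"

lemma tendsto_poly_mult_exp_0:
  fixes p :: "real poly"
  shows "((\<lambda>y. poly p y * exp (- y)) \<longlongrightarrow> 0) at_top"
proof -
  have "((\<lambda>y. \<Sum>i\<le>degree p. coeff p i * (y ^ i / exp y)) \<longlongrightarrow> (\<Sum>i\<le>degree p. coeff p i * 0)) at_top"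
    by (intro tendsto_sum tendsto_mult tendsto_const tendsto_power_div_exp_0)
  then show ?thesis
    by (simp add: poly_altdef sum_distrib_right exp_minus divide_inverse mult.assoc)
qed

text \<open>The functions p(1/x) exp(-1/x), extended by 0, are closed under differentiation: with X
  = 1/x the polynomial p becomes X^2 (p - p'). Only x = 0 needs a limit; there the right difference
  quotient is X p(X) exp(-X), which vanishes as X tends to infinity.\<close>

lemma flat_has_derivative:
  "(flat p has_real_derivative flat ([:0, 0, 1:] * (p - pderiv p)) x) (at x)"
proof -
  consider "x < 0" | "x = 0" | "0 < x" by linarith
  then show ?thesis
  proof cases
    case 1
    have "((\<lambda>x. 0) has_real_derivative 0) (at x)" by simp
    then have "(flat p has_real_derivative 0) (at x)"
      by (rule has_field_derivative_transform_within_open[where S="{..<0}"]) (use 1 in \<open>auto simp: flat_def\<close>)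
    then show ?thesis using 1 by (simp add: flat_def)
  next
    case 3
    have "((\<lambda>x. poly p (1 / x) * exp (- (1 / x))) has_real_derivative
        flat ([:0, 0, 1:] * (p - pderiv p)) x) (at x)"
      using 3 by (auto intro!: derivative_eq_intros DERIV_chain2[OF poly_DERIV]
          simp: flat_def algebra_simps power2_eq_square divide_simps)
    then show ?thesis
      by (rule has_field_derivative_transform_within_open[where S="{0<..}"]) (use 3 in \<open>auto simp: flat_def\<close>)
  next
    case 2
    have "((\<lambda>h. (flat p h - flat p 0) / (h - 0)) \<longlongrightarrow> 0) (at_right 0)"
    proof -
      have "((\<lambda>h. poly ([:0, 1:] * p) (inverse h) * exp (- (inverse h))) \<longlongrightarrow> 0) (at_right 0)"
        by (rule filterlim_compose[OF tendsto_poly_mult_exp_0 filterlim_inverse_at_top_right])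
      then show ?thesis
        by (rule Lim_transform_eventually)
          (auto simp: flat_def eventually_at_filter divide_simps intro!: always_eventually)
    qed
    moreover have "((\<lambda>h. (flat p h - flat p 0) / (h - 0)) \<longlongrightarrow> 0) (at_left 0)"
      by (rule Lim_transform_eventually[OF tendsto_const])
        (auto simp: flat_def eventually_at_filter intro!: always_eventually)
    ultimately have "((\<lambda>h. (flat p h - flat p 0) / (h - 0)) \<longlongrightarrow> 0) (at 0)"
      by (simp add: filterlim_split_at)
    then show ?thesis using 2 by (simp add: has_field_derivative_iff flat_def)
  qed
qed

text \<open>The induction runs over all polynomials at once, since the derivative replaces p by
  another one.\<close>

lemma smooth_flat_coordinate: "smooth (\<lambda>x :: real ^ 'n. flat p (c * x $ i + d))"
proof -
  have d: "((\<lambda>x. flat p (c * x $ i + d)) has_derivative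
      (\<lambda>h. (c * h $ i) * flat ([:0, 0, 1:] * (p - pderiv p)) (c * x $ i + d))) (at x)"
    for p and x :: "real ^ 'n"
    by (rule DERIV_compose_FDERIV[OF flat_has_derivative])
      (auto intro!: derivative_eq_intros bounded_linear_imp_has_derivative[OF bounded_linear_vec_nth])
  have "smooth_upto k (\<lambda>x. flat p (c * x $ i + d))" for k
  proof (induction k arbitrary: p)
    case 0
    show ?case unfolding smooth_upto_0 differentiable_def using d by blast
  next
    case (Suc k)
    have p: "partial_derivative j (\<lambda>x. flat p (c * x $ i + d)) =
        (\<lambda>x. (c * axis j 1 $ i) * flat ([:0, 0, 1:] * (p - pderiv p)) (c * x $ i + d))" for j
      by (rule ext) (rule partial_derivative_eq[OF d])
    show ?case unfolding smooth_upto_Suc p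
      by (intro conjI allI smooth_upto_mult smooth_upto_const Suc) (use d in \<open>auto simp only: differentiable_def\<close>)
  qed
  then show ?thesis by (simp add: smooth_iff)
qed

text \<open>A product of the cutoffs exp(-1/x) at both ends of every side. As the steepness k grows,
  the functions converge to the indicator of the open box; this is how test functions reach
  indicators in \<open>fundamental_lemma\<close>.\<close>

definition bump :: "real ^ 'n \<Rightarrow> real ^ 'n \<Rightarrow> real \<Rightarrow> real ^ 'n \<Rightarrow> real" where
  "bump a b k x = (\<Prod>i\<in>UNIV. flat 1 (k * (x $ i - a $ i)) * flat 1 (k * (b $ i - x $ i)))"

lemma bump_nonneg: "0 \<le> bump a b k x"
  by (auto simp: bump_def flat_def intro!: prod_nonneg)

lemma bump_le_1: "bump a b k x \<le> 1"
  unfolding bump_def by (intro prod_le_1) (auto simp: flat_def mult_le_one)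

lemma bump_pos_iff:
  assumes "0 < k" shows "0 < bump a b k x \<longleftrightarrow> x \<in> box a b"
proof
  assume "x \<in> box a b"
  then show "0 < bump a b k x"
    using assms by (auto simp: bump_def flat_def mem_box_cart intro!: prod_pos)
next
  assume "0 < bump a b k x"
  then have "flat 1 (k * (x $ i - a $ i)) * flat 1 (k * (b $ i - x $ i)) \<noteq> 0" for i
    unfolding bump_def by (metis (mono_tags, lifting) UNIV_I finite prod_zero less_irrefl)
  then have "0 < k * (x $ i - a $ i) \<and> 0 < k * (b $ i - x $ i)" for i
    by (metis flat_def mult_zero_left mult_zero_right)
  then show "x \<in> box a b" using assms by (simp add: mem_box_cart zero_less_mult_iff)
qed

lemma bump_eq_0: "0 < k \<Longrightarrow> x \<notin> box a b \<Longrightarrow> bump a b k x = 0"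
  using bump_pos_iff bump_nonneg by (metis less_eq_real_def)

lemma test_function_bump:
  assumes "0 < k" shows "test_function (bump a b k)"
proof -
  have "smooth (\<lambda>x. bump a b k x)"
  proof -
    have "smooth (\<lambda>x. flat 1 (k * (x $ i - a $ i)) * flat 1 (k * (b $ i - x $ i)))" for i
      using smooth_mult[OF smooth_flat_coordinate[of 1 k i "- k * a $ i"]
          smooth_flat_coordinate[of 1 "- k" i "k * b $ i"]]
      by (simp add: algebra_simps)
    then show ?thesis unfolding bump_def by (intro smooth_prod)
  qed
  moreover obtain R where R: "\<And>x. x \<in> box a b \<Longrightarrow> norm x \<le> R"
    using bounded_box[of a b] by (auto simp: bounded_iff)
  ultimately show ?thesis
    by (intro test_functionI[where R=R]) (use bump_eq_0[OF assms] R in force)+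
qed

lemma bump_tendsto: "(\<lambda>k. bump a b (real (Suc k)) x) \<longlonglongrightarrow> indicator (box a b) x"
proof (cases "x \<in> box a b")
  case True
  have *: "(\<lambda>k. flat 1 (real (Suc k) * c)) \<longlonglongrightarrow> 1" if "0 < c" for c
  proof -
    have "(\<lambda>k. exp (- (1 / c * (1 / real (Suc k))))) \<longlonglongrightarrow> exp (- (1 / c * 0))"
      by (intro tendsto_intros LIMSEQ_Suc lim_1_over_n)
    then show ?thesis using that by (simp add: flat_def mult.commute)
  qed
  have "(\<lambda>k. bump a b (real (Suc k)) x) \<longlonglongrightarrow> (\<Prod>i\<in>(UNIV::'a set). 1 * 1)"
    unfolding bump_def using True
    by (intro tendsto_prod tendsto_mult *) (auto simp: mem_box_cart)
  then show ?thesis using True by simp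
qed (simp add: bump_eq_0)

section \<open>Integration on Euclidean space\<close>

lemma ball_sets_borel [measurable]:
  "cball a r \<in> sets borel" "ball a r \<in> sets borel"
  by simp_all

lemma nn_integral_affine:
  fixes f :: "'a::euclidean_space \<Rightarrow> ennreal"
  assumes [measurable]: "f \<in> borel_measurable borel" and "c \<noteq> 0"
  shows "(\<integral>\<^sup>+x. f x \<partial>lborel) = ennreal (\<bar>c\<bar> ^ DIM('a)) * (\<integral>\<^sup>+x. f (a + c *\<^sub>R x) \<partial>lborel)"
  by (subst lborel_affine[OF assms(2), of a])
    (simp add: nn_integral_density nn_integral_distr nn_integral_cmult)

lemma nn_integral_translate:
  fixes f :: "'a::euclidean_space \<Rightarrow> ennreal"
  assumes "f \<in> borel_measurable borel"
  shows "(\<integral>\<^sup>+x. f (a + x) \<partial>lborel) = (\<integral>\<^sup>+x. f x \<partial>lborel)"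
  using nn_integral_affine[OF assms, of 1 a] by simp

lemma integral_affine:
  fixes f :: "'a::euclidean_space \<Rightarrow> real"
  assumes [measurable]: "f \<in> borel_measurable borel" and "c \<noteq> 0"
  shows "(\<integral>x. f x \<partial>lborel) = \<bar>c\<bar> ^ DIM('a) * (\<integral>x. f (a + c *\<^sub>R x) \<partial>lborel)"
  by (subst lborel_affine[OF assms(2), of a])
    (simp add: integral_density integral_distr)

lemma integrable_affine:
  fixes f :: "'a::euclidean_space \<Rightarrow> real"
  assumes f: "integrable lborel f" and "c \<noteq> 0"
  shows "integrable lborel (\<lambda>x. f (a + c *\<^sub>R x))"
proof -
  have [measurable]: "f \<in> borel_measurable borel" using f by (simp add: borel_measurable_integrable)
  have "integrable (density (distr lborel borel (\<lambda>x. a + c *\<^sub>R x)) (\<lambda>_. ennreal (\<bar>c\<bar> ^ DIM('a)))) f"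
    using f lborel_affine[OF assms(2), of a] by simp
  then show ?thesis
    using assms(2) by (simp add: integrable_density integrable_distr_eq)
qed

lemma integral_translate:
  fixes f :: "'a::euclidean_space \<Rightarrow> real"
  assumes "f \<in> borel_measurable borel"
  shows "(\<integral>x. f (a + x) \<partial>lborel) = (\<integral>x. f x \<partial>lborel)"
  using integral_affine[OF assms, of 1 a] by simp

text \<open>Counterpart of \<open>locally_integrable\<close> for Borel functions: finiteness on
  balls around 0 with respect to \<open>lborel\<close>, where the theorems on product measures apply
  without completions.\<close>

definition loc_int :: "(real ^ 'n \<Rightarrow> real) \<Rightarrow> bool" where
  "loc_int u \<longleftrightarrow> u \<in> borel_measurable borel \<and>
    (\<forall>R. (\<integral>\<^sup>+x. ennreal \<bar>u x\<bar> * indicator (cball 0 R) x \<partial>lborel) < \<infinity>)"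

lemma loc_int_finite:
  assumes "loc_int u" "\<And>x. x \<in> S \<Longrightarrow> norm x \<le> R"
  shows "(\<integral>\<^sup>+x. ennreal \<bar>u x\<bar> * indicator S x \<partial>lborel) < \<infinity>"
proof -
  have "(\<integral>\<^sup>+x. ennreal \<bar>u x\<bar> * indicator S x \<partial>lborel) \<le> (\<integral>\<^sup>+x. ennreal \<bar>u x\<bar> * indicator (cball 0 R) x \<partial>lborel)"
    by (intro nn_integral_mono mult_left_mono) (use assms(2) in \<open>auto simp: indicator_def\<close>)
  also have "\<dots> < \<infinity>" using assms by (simp add: loc_int_def)
  finally show ?thesis .
qed

lemma loc_int_integrable_mult:
  assumes u: "loc_int u" and [measurable]: "\<phi> \<in> borel_measurable borel"
    and \<phi>: "\<And>x. \<bar>\<phi> x\<bar> \<le> M" "\<And>x. R < norm x \<Longrightarrow> \<phi> x = 0"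
  shows "integrable lborel (\<lambda>x. u x * \<phi> x)"
proof (rule integrableI_bounded)
  have [measurable]: "u \<in> borel_measurable borel" using u by (simp add: loc_int_def)
  show "(\<lambda>x. u x * \<phi> x) \<in> borel_measurable lborel" by simp
  have "0 \<le> M" using \<phi>(1)[of 0] by linarith
  have "(\<integral>\<^sup>+x. ennreal (norm (u x * \<phi> x)) \<partial>lborel)
      \<le> (\<integral>\<^sup>+x. ennreal M * (ennreal \<bar>u x\<bar> * indicator (cball 0 R) x) \<partial>lborel)"
  proof (rule nn_integral_mono)
    fix x
    have "ennreal (norm (u x * \<phi> x)) \<le> ennreal (M * \<bar>u x\<bar>)" if "norm x \<le> R"
      using \<phi>(1)[of x] by (intro ennreal_leI) (simp add: abs_mult mult.commute mult_right_mono)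
    then show "ennreal (norm (u x * \<phi> x)) \<le> ennreal M * (ennreal \<bar>u x\<bar> * indicator (cball 0 R) x)"
      using \<phi>(2)[of x] \<open>0 \<le> M\<close> by (cases "norm x \<le> R") (auto simp: ennreal_mult)
  qed
  also have "\<dots> = ennreal M * (\<integral>\<^sup>+x. ennreal \<bar>u x\<bar> * indicator (cball 0 R) x \<partial>lborel)"
    by (rule nn_integral_cmult) measurable
  also have "\<dots> < \<infinity>" using u by (simp add: loc_int_def ennreal_mult_less_top)
  finally show "(\<integral>\<^sup>+x. ennreal (norm (u x * \<phi> x)) \<partial>lborel) < \<infinity>" .
qed

lemma loc_int_integrable_test:
  assumes "loc_int u" "test_function \<phi>"
  shows "integrable lborel (\<lambda>x. u x * \<phi> x)"
proof -
  obtain R where R: "\<And>x. R < norm x \<Longrightarrow> \<phi> x = 0" using test_function_bound[OF assms(2)] by blast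
  obtain M where M: "\<And>x. \<bar>\<phi> x\<bar> \<le> M" using test_function_bounded[OF assms(2)] by blast
  show ?thesis
    by (rule loc_int_integrable_mult[OF assms(1) smooth_measurable[OF test_function_smooth[OF assms(2)]] M R])
qed

lemma loc_int_continuous:
  fixes f :: "real ^ 'n \<Rightarrow> real"
  assumes "continuous_on UNIV f"
  shows "loc_int f"
  unfolding loc_int_def
proof (intro conjI allI)
  show [measurable]: "f \<in> borel_measurable borel" by (rule borel_measurable_continuous_onI[OF assms])
  fix R
  have "compact (f ` cball 0 R)"
    using assms by (intro compact_continuous_image) (auto intro: continuous_on_subset)
  then obtain M where M: "0 < M" "\<And>x. x \<in> cball 0 R \<Longrightarrow> \<bar>f x\<bar> \<le> M"
    using compact_imp_bounded bounded_pos by (metis imageI real_norm_def)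
  have "(\<integral>\<^sup>+x. ennreal \<bar>f x\<bar> * indicator (cball 0 R) x \<partial>lborel)
      \<le> (\<integral>\<^sup>+x. ennreal M * indicator (cball (0 :: real ^ 'n) R) x \<partial>lborel)"
    using M(2) by (intro nn_integral_mono) (auto simp: indicator_def intro!: ennreal_leI)
  also have "\<dots> = ennreal M * emeasure lborel (cball (0 :: real ^ 'n) R)" by (simp add: nn_integral_cmult_indicator)
  also have "\<dots> < \<infinity>" using emeasure_bounded_finite[of "cball (0::real^'n) R"]
    by (simp add: ennreal_mult_less_top)
  finally show "(\<integral>\<^sup>+x. ennreal \<bar>f x\<bar> * indicator (cball 0 R) x \<partial>lborel) < \<infinity>" .
qed

lemma test_function_integrable:
  assumes "test_function \<phi>" shows "integrable lborel \<phi>"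
  using loc_int_integrable_test[OF loc_int_continuous[OF continuous_on_const[of UNIV 1]] assms] by simp

lemma loc_int_translate:
  fixes u :: "real ^ 'n \<Rightarrow> real"
  assumes "loc_int u"
  shows "loc_int (\<lambda>x. u (a + x))"
  unfolding loc_int_def
proof (intro conjI allI)
  have [measurable]: "u \<in> borel_measurable borel" using assms by (simp add: loc_int_def)
  show "(\<lambda>x. u (a + x)) \<in> borel_measurable borel" by measurable
  fix R
  have "(\<integral>\<^sup>+x. ennreal \<bar>u (a + x)\<bar> * indicator (cball 0 R) x \<partial>lborel)
     = (\<integral>\<^sup>+x. (\<lambda>y. ennreal \<bar>u y\<bar> * indicator (cball a R) y) (a + x) \<partial>lborel)"
    by (intro nn_integral_cong) (simp add: indicator_def dist_norm)
  also have "\<dots> = (\<integral>\<^sup>+y. ennreal \<bar>u y\<bar> * indicator (cball a R) y \<partial>lborel)"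
    by (intro nn_integral_translate) measurable
  also have "\<dots> < \<infinity>"
  proof (rule loc_int_finite[OF assms, where R="norm a + R"])
    fix x assume "x \<in> cball a R"
    then show "norm x \<le> norm a + R"
      using norm_triangle_sub[of x a] by (simp add: dist_norm norm_minus_commute)
  qed
  finally show "(\<integral>\<^sup>+x. ennreal \<bar>u (a + x)\<bar> * indicator (cball 0 R) x \<partial>lborel) < \<infinity>" .
qed

lemma loc_int_add:
  assumes u: "loc_int u" and v: "loc_int v"
  shows "loc_int (\<lambda>x. u x + v x)"
  unfolding loc_int_def
proof (intro conjI allI)
  have [measurable]: "u \<in> borel_measurable borel" "v \<in> borel_measurable borel"
    using u v by (auto simp: loc_int_def)
  show "(\<lambda>x. u x + v x) \<in> borel_measurable borel" by measurable
  fix R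
  have "(\<integral>\<^sup>+x. ennreal \<bar>u x + v x\<bar> * indicator (cball 0 R) x \<partial>lborel)
     \<le> (\<integral>\<^sup>+x. ennreal \<bar>u x\<bar> * indicator (cball 0 R) x + ennreal \<bar>v x\<bar> * indicator (cball 0 R) x \<partial>lborel)"
    by (intro nn_integral_mono) (auto simp: indicator_def simp flip: ennreal_plus)
  also have "\<dots> = (\<integral>\<^sup>+x. ennreal \<bar>u x\<bar> * indicator (cball 0 R) x \<partial>lborel)
      + (\<integral>\<^sup>+x. ennreal \<bar>v x\<bar> * indicator (cball 0 R) x \<partial>lborel)"
    by (intro nn_integral_add) measurable
  also have "\<dots> < \<infinity>" using u v by (simp add: loc_int_def)
  finally show "(\<integral>\<^sup>+x. ennreal \<bar>u x + v x\<bar> * indicator (cball 0 R) x \<partial>lborel) < \<infinity>" .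
qed

lemma loc_int_cmult:
  assumes u: "loc_int u"
  shows "loc_int (\<lambda>x. c * u x)"
  unfolding loc_int_def
proof (intro conjI allI)
  have [measurable]: "u \<in> borel_measurable borel"
    using u by (auto simp: loc_int_def)
  show "(\<lambda>x. c * u x) \<in> borel_measurable borel" by measurable
  fix R
  have "(\<integral>\<^sup>+x. ennreal \<bar>c * u x\<bar> * indicator (cball 0 R) x \<partial>lborel)
     = ennreal \<bar>c\<bar> * (\<integral>\<^sup>+x. ennreal \<bar>u x\<bar> * indicator (cball 0 R) x \<partial>lborel)"
    by (subst nn_integral_cmult[symmetric]) (auto simp: abs_mult ennreal_mult mult.assoc)
  also have "\<dots> < \<infinity>" using u by (simp add: loc_int_def ennreal_mult_less_top)
  finally show "(\<integral>\<^sup>+x. ennreal \<bar>c * u x\<bar> * indicator (cball 0 R) x \<partial>lborel) < \<infinity>" .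
qed

lemma loc_int_diff: "loc_int u \<Longrightarrow> loc_int v \<Longrightarrow> loc_int (\<lambda>x. u x - v x)"
  using loc_int_add[of u "\<lambda>x. -1 * v x"] loc_int_cmult[of v "-1"] by simp

lemma loc_int_sum: "(\<And>i. i \<in> I \<Longrightarrow> loc_int (u i)) \<Longrightarrow> loc_int (\<lambda>x. \<Sum>i\<in>I. u i x)"
  by (induction I rule: infinite_finite_induct)
    (auto intro: loc_int_add loc_int_continuous[OF continuous_on_const])

lemma locally_integrable_iff_loc_int:
  fixes u :: "real ^ 'n \<Rightarrow> real"
  assumes "u \<in> borel_measurable borel"
  shows "locally_integrable u \<longleftrightarrow> loc_int u"
proof -
  have [measurable]: "u \<in> borel_measurable borel" by fact
  have eq: "u absolutely_integrable_on K \<longleftrightarrow> (\<integral>\<^sup>+x. ennreal \<bar>u x\<bar> * indicator K x \<partial>lborel) < \<infinity>"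
    if [measurable]: "K \<in> sets borel" for K
  proof -
    have "u absolutely_integrable_on K \<longleftrightarrow> integrable lborel (\<lambda>x. indicator K x *\<^sub>R u x)"
      unfolding set_integrable_def by (rule integrable_completion) measurable
    also have "\<dots> \<longleftrightarrow> (\<integral>\<^sup>+x. ennreal \<bar>u x\<bar> * indicator K x \<partial>lborel) < \<infinity>"
      unfolding integrable_iff_bounded
      by (auto simp: abs_mult ennreal_mult indicator_def intro!: arg_cong[where f="\<lambda>x. x < top"] nn_integral_cong)
    finally show ?thesis .
  qed
  show ?thesis
  proof
    assume "locally_integrable u"
    then have "u absolutely_integrable_on cball 0 R" for R by (simp add: locally_integrable_def)
    then show "loc_int u" using eq assms
      by (simp add: loc_int_def)
  next
    assume u: "loc_int u"
    show "locally_integrable u"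
      unfolding locally_integrable_def
    proof (intro allI impI)
      fix K :: "(real^'n) set" assume K: "compact K"
      then obtain R where R: "\<And>x. x \<in> K \<Longrightarrow> norm x \<le> R"
        using compact_imp_bounded by (meson bounded_iff)
      show "u absolutely_integrable_on K"
        using loc_int_finite[OF u R] K eq by (simp add: borel_compact)
    qed
  qed
qed

text \<open>The function is the pointwise limit of its restrictions to growing balls, and each of
  these is measurable because it is integrable.\<close>

lemma locally_integrable_measurable:
  fixes u :: "real ^ 'n \<Rightarrow> real"
  assumes "locally_integrable u"
  shows "u \<in> borel_measurable lebesgue"
proof (rule borel_measurable_LIMSEQ_real)
  fix k :: nat
  have "u absolutely_integrable_on cball 0 (real k)"
    using assms by (simp add: locally_integrable_def)
  then show "(\<lambda>x. indicator (cball 0 (real k)) x *\<^sub>R u x) \<in> borel_measurable lebesgue"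
    unfolding set_integrable_def by (rule borel_measurable_integrable)
next
  fix x :: "real ^ 'n"
  have "\<forall>\<^sub>F k in sequentially. indicator (cball 0 (real k)) x *\<^sub>R u x = u x"
    using eventually_ge_at_top[of "nat \<lceil>norm x\<rceil>"]
    by eventually_elim (auto simp: indicator_def nat_le_iff ceiling_le_iff)
  then show "(\<lambda>k. indicator (cball 0 (real k)) x *\<^sub>R u x) \<longlonglongrightarrow> u x"
    by (rule tendsto_eventually)
qed

text \<open>Fubini's theorem needs joint measurability of u(x + h) in x and h, which is immediate
  for Borel \<open>u\<close>. All integral identities are therefore proved for
  representatives.\<close>

lemma borel_representative:
  fixes u :: "real ^ 'n \<Rightarrow> real"
  assumes "u \<in> borel_measurable lebesgue"
  obtains u' where "u' \<in> borel_measurable borel" "AE x in lebesgue. u x = u' x"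
proof -
  obtain u' where u': "u' \<in> borel_measurable lborel" "AE x in lborel. u x = u' x"
    using completion_ex_borel_measurable_real[OF assms] by blast
  show thesis by (rule that[OF _ AE_completion[OF u'(2)]]) (use u'(1) in simp)
qed

lemma locally_integrable_cong_AE:
  fixes u v :: "real ^ 'n \<Rightarrow> real"
  assumes "AE x in lebesgue. u x = v x" "v \<in> borel_measurable lebesgue" "locally_integrable u"
  shows "locally_integrable v"
  unfolding locally_integrable_def
proof (intro allI impI)
  fix K :: "(real^'n) set" assume K: "compact K"
  have K': "K \<in> sets lebesgue" using K by (simp add: borel_compact)
  have "integrable lebesgue (\<lambda>x. indicator K x *\<^sub>R u x)"
    using assms(3) K by (simp add: locally_integrable_def set_integrable_def)
  moreover have "(\<lambda>x. indicator K x *\<^sub>R u x) \<in> borel_measurable lebesgue"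
    using calculation by (rule borel_measurable_integrable)
  moreover have "(\<lambda>x. indicator K x *\<^sub>R v x) \<in> borel_measurable lebesgue"
    using K' assms(2) by (intro borel_measurable_scaleR borel_measurable_indicator) auto
  moreover have "AE x in lebesgue. indicator K x *\<^sub>R u x = indicator K x *\<^sub>R v x"
    using assms(1) by eventually_elim simp
  ultimately show "v absolutely_integrable_on K"
    unfolding set_integrable_def using integrable_cong_AE by blast
qed

text \<open>Translates the integrals in \<open>has_weak_derivative\<close> into integrals of
  representatives over \<open>lborel\<close>.\<close>

lemma integral_lebesgue_cong_AE_borel:
  fixes u v \<phi> :: "real ^ 'n \<Rightarrow> real"
  assumes "AE x in lebesgue. u x = v x" "u \<in> borel_measurable lebesgue"
    and [measurable]: "v \<in> borel_measurable borel" "\<phi> \<in> borel_measurable borel"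
  shows "(\<integral>x. u x * \<phi> x \<partial>lebesgue) = (\<integral>x. v x * \<phi> x \<partial>lborel)"
proof -
  have "(\<integral>x. u x * \<phi> x \<partial>lebesgue) = (\<integral>x. v x * \<phi> x \<partial>lebesgue)"
  proof (rule integral_cong_AE)
    show "(\<lambda>x. u x * \<phi> x) \<in> borel_measurable lebesgue"
      by (rule borel_measurable_times[OF assms(2) measurable_completion]) simp
    show "(\<lambda>x. v x * \<phi> x) \<in> borel_measurable lebesgue" by (rule measurable_completion) measurable
    show "AE x in lebesgue. u x * \<phi> x = v x * \<phi> x" using assms(1) by eventually_elim simp
  qed
  also have "\<dots> = (\<integral>x. v x * \<phi> x \<partial>lborel)" by (rule integral_completion) measurable
  finally show ?thesis .
qed

section \<open>Integration by parts and the fundamental lemma\<close>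

text \<open>Difference quotients have integral 0 by translation invariance, and they converge to the
  partial derivative. They are dominated: the mean value theorem bounds them by a bound of the
  derivative, and steps of length at most 1 enlarge the support by at most 1.\<close>

lemma integral_partial_test:
  fixes \<phi> :: "real ^ 'n \<Rightarrow> real"
  assumes \<phi>: "test_function \<phi>"
  shows "(\<integral>x. partial_derivative i \<phi> x \<partial>lborel) = 0"
proof -
  have sm: "smooth \<phi>" by (rule test_function_smooth[OF \<phi>])
  have [measurable]: "\<phi> \<in> borel_measurable borel" "partial_derivative i \<phi> \<in> borel_measurable borel"
    by (intro smooth_measurable smooth_partial_derivative sm)+
  obtain R where R: "0 < R" "\<And>x. R < norm x \<Longrightarrow> \<phi> x = 0" using test_function_bound[OF \<phi>] by blast
  obtain M where M: "0 < M" "\<And>x. \<bar>partial_derivative i \<phi> x\<bar> \<le> M"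
    using test_function_bounded[OF test_function_partial[OF \<phi>]] by blast
  define h where "h k = inverse (real (Suc k))" for k
  have h: "0 < h k" "h k \<le> 1" for k by (auto simp: h_def field_simps)
  define g where "g k x = (\<phi> (x + h k *\<^sub>R axis i 1) - \<phi> x) / h k" for k x
  have ig: "(\<integral>x. g k x \<partial>lborel) = 0" for k
  proof -
    have "integrable lborel (\<lambda>x. \<phi> (h k *\<^sub>R axis i 1 + x))"
      using integrable_affine[OF test_function_integrable[OF \<phi>], of 1] by simp
    then have "(\<integral>x. g k x \<partial>lborel) =
        ((\<integral>x. \<phi> (h k *\<^sub>R axis i 1 + x) \<partial>lborel) - (\<integral>x. \<phi> x \<partial>lborel)) / h k"
      using test_function_integrable[OF \<phi>] by (simp add: g_def add.commute)
    then show ?thesis by (simp add: integral_translate)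
  qed
  have "(\<lambda>k. \<integral>x. g k x \<partial>lborel) \<longlonglongrightarrow> (\<integral>x. partial_derivative i \<phi> x \<partial>lborel)"
  proof (rule integral_dominated_convergence)
    show "partial_derivative i \<phi> \<in> borel_measurable lborel" "g k \<in> borel_measurable lborel" for k
      unfolding g_def by measurable
    show "integrable lborel (\<lambda>x. M * indicator (cball (0 :: real ^ 'n) (R + 1)) x :: real)"
      using emeasure_bounded_finite[of "cball (0::real^'n) (R + 1)"]
      by (intro integrable_mult_right integrable_real_indicator) auto
    show "AE x in lborel. norm (g k x) \<le> M * indicator (cball 0 (R + 1)) x" for k
    proof (rule AE_I2)
      fix x
      obtain \<theta> where \<theta>: "\<phi> (x + h k *\<^sub>R axis i 1) - \<phi> x = h k * partial_derivative i \<phi> (x + \<theta> *\<^sub>R axis i 1)"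
        using smooth_mvt_axis[OF sm h(1)] by blast
      then have b: "norm (g k x) \<le> M" using h(1)[of k] M(2) by (simp add: g_def)
      show "norm (g k x) \<le> M * indicator (cball 0 (R + 1)) x"
      proof (cases "norm x \<le> R + 1")
        case False
        have "norm x \<le> norm (x + h k *\<^sub>R axis i 1) + norm (h k *\<^sub>R axis i (1::real))"
          using norm_triangle_ineq4[of "x + h k *\<^sub>R axis i 1" "h k *\<^sub>R axis i 1"] by simp
        also have "norm (h k *\<^sub>R axis i (1::real)) \<le> 1" using h[of k] by (simp add: norm_axis_1)
        finally have "\<phi> (x + h k *\<^sub>R axis i 1) = 0" using False by (intro R) auto
        then show ?thesis using False R by (simp add: g_def)
      qed (use b in simp)
    qed
    show "AE x in lborel. (\<lambda>k. g k x) \<longlonglongrightarrow> partial_derivative i \<phi> x"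
    proof (rule AE_I2)
      fix x
      have "((\<lambda>t. \<phi> (x + t *\<^sub>R axis i 1)) has_real_derivative
        (\<Sum>j\<in>UNIV. axis i 1 $ j * partial_derivative j \<phi> (x + 0 *\<^sub>R axis i 1))) (at 0)"
        by (rule smooth_has_real_derivative[OF sm])
      then have "((\<lambda>t. (\<phi> (x + t *\<^sub>R axis i 1) - \<phi> x) / t) \<longlongrightarrow> partial_derivative i \<phi> x) (at 0)"
        by (simp add: has_field_derivative_iff axis_def if_distrib[of "\<lambda>x. x * _"] cong: if_cong)
      moreover have "filterlim h (at 0) sequentially"
        unfolding h_def filterlim_at using LIMSEQ_inverse_real_of_nat by auto
      ultimately show "(\<lambda>k. g k x) \<longlonglongrightarrow> partial_derivative i \<phi> x"
        unfolding g_def by (rule filterlim_compose)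
    qed
  qed
  then show ?thesis by (simp add: ig LIMSEQ_const_iff)
qed

lemma integration_by_parts:
  assumes g: "smooth g" and \<phi>: "test_function \<phi>"
  shows "(\<integral>x. g x * partial_derivative i \<phi> x \<partial>lborel) = - (\<integral>x. partial_derivative i g x * \<phi> x \<partial>lborel)"
proof -
  have "partial_derivative i (\<lambda>x. g x * \<phi> x) = (\<lambda>x. g x * partial_derivative i \<phi> x + partial_derivative i g x * \<phi> x)"
    by (intro ext partial_derivative_mult smooth_differentiable g test_function_smooth[OF \<phi>])
  moreover have "integrable lborel (\<lambda>x. g x * partial_derivative i \<phi> x)"
    "integrable lborel (\<lambda>x. partial_derivative i g x * \<phi> x)"
    by (intro test_function_integrable test_function_mult g \<phi> smooth_partial_derivative test_function_partial)+
  ultimately show ?thesis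
    using integral_partial_test[OF test_function_mult[OF \<phi> g], of i] by simp
qed

lemma iterated_integration_by_parts:
  assumes "smooth g" "test_function \<phi>"
  shows "(\<integral>x. g x * iterated_partial js \<phi> x \<partial>lborel) =
    (- 1) ^ length js * (\<integral>x. iterated_partial js g x * \<phi> x \<partial>lborel)"
  using assms(1)
proof (induction js arbitrary: g)
  case (Cons i js)
  have "(\<integral>x. g x * iterated_partial (i # js) \<phi> x \<partial>lborel) =
      - (\<integral>x. partial_derivative i g x * iterated_partial js \<phi> x \<partial>lborel)"
    using integration_by_parts[OF Cons.prems test_function_iterated_partial[OF assms(2)]] by simp
  then show ?case using Cons.IH[OF smooth_partial_derivative[OF Cons.prems]]
    by (simp add: iterated_partial_swap[OF Cons.prems])
qed simp

text \<open>The positive and the negative part of \<open>g\<close> are densities of measures that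
  agree on the open boxes, an intersection-stable generator of the Borel sets, and densities are
  unique almost everywhere.\<close>

lemma AE_zero_of_box_integrals:
  fixes g :: "real ^ 'n \<Rightarrow> real"
  assumes g: "loc_int g" and 0: "\<And>a b. (\<integral>x. g x * indicator (box a b) x \<partial>lborel) = 0"
  shows "AE x in lborel. g x = 0"
proof -
  have [measurable]: "g \<in> borel_measurable borel" using g by (simp add: loc_int_def)
  have int: "integrable lborel (\<lambda>x. g x * indicator (box a b) x)" for a b
  proof -
    obtain R where "\<And>x. x \<in> box a b \<Longrightarrow> norm x \<le> R" using bounded_box[of a b] by (auto simp: bounded_iff)
    then show ?thesis
      by (intro loc_int_integrable_mult[OF g, where M=1 and R=R]) (auto simp: indicator_def, force)
  qed
  let ?p = "\<lambda>x. ennreal (g x)" and ?q = "\<lambda>x. ennreal (- g x)"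
  have em: "emeasure (density lborel (\<lambda>x. ennreal (c * g x))) (box a b) =
      (\<integral>\<^sup>+x. ennreal (c * (g x * indicator (box a b) x)) \<partial>lborel)" for c a b
    by (subst emeasure_density) (auto simp: indicator_def intro!: nn_integral_cong)
  have fin: "(\<integral>\<^sup>+x. ennreal (c * (g x * indicator (box a b) x)) \<partial>lborel) < \<infinity>" if "\<bar>c\<bar> = 1" for c a b
  proof -
    have "(\<integral>\<^sup>+x. ennreal (c * (g x * indicator (box a b) x)) \<partial>lborel) \<le> (\<integral>\<^sup>+x. ennreal (norm (g x * indicator (box a b) x)) \<partial>lborel)"
    proof (intro nn_integral_mono ennreal_leI)
      fix x show "c * (g x * indicator (box a b) x) \<le> norm (g x * indicator (box a b) x)"
        using abs_ge_self[of "c * (g x * indicator (box a b) x)"] that by (simp add: abs_mult)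
    qed
    also have "\<dots> < \<infinity>" using int[of a b] by (simp add: integrable_iff_bounded)
    finally show ?thesis .
  qed
  have "density lborel (\<lambda>x. ennreal (1 * g x)) = density lborel (\<lambda>x. ennreal (-1 * g x))"
  proof (rule measure_eqI_generator_eq)
    let ?E = "range (\<lambda>(a, b). box a b::(real^'n) set)"
    show "Int_stable ?E" by (auto simp: Int_stable_def box_Int_box)
    show "?E \<subseteq> Pow UNIV" "sets (density lborel (\<lambda>x. ennreal (1 * g x))) = sigma_sets UNIV ?E"
      "sets (density lborel (\<lambda>x. ennreal (-1 * g x))) = sigma_sets UNIV ?E"
      by (simp_all add: borel_eq_box)
    let ?A = "\<lambda>n::nat. box (- (real n *\<^sub>R One)) (real n *\<^sub>R One) :: (real^'n) set"
    show "range ?A \<subseteq> ?E" "(\<Union>i. ?A i) = UNIV" unfolding UN_box_eq_UNIV by auto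
    show "emeasure (density lborel (\<lambda>x. ennreal (1 * g x))) (?A i) \<noteq> \<infinity>" for i
      unfolding em using fin[of 1 "- (real i *\<^sub>R One)" "real i *\<^sub>R One"] by auto
    fix X assume "X \<in> ?E"
    then obtain a b where X: "X = box a b" by auto
    define f where "f x = g x * indicator (box a b) x" for x
    have "enn2real (\<integral>\<^sup>+x. ennreal (f x) \<partial>lborel) = enn2real (\<integral>\<^sup>+x. ennreal (- f x) \<partial>lborel)"
      using 0[of a b] real_lebesgue_integral_def[OF int[of a b]] by (simp add: f_def)
    moreover have "(\<integral>\<^sup>+x. ennreal (f x) \<partial>lborel) < \<infinity>" "(\<integral>\<^sup>+x. ennreal (- f x) \<partial>lborel) < \<infinity>"
      using fin[of 1 a b] fin[of "-1" a b] by (simp_all add: f_def)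
    ultimately have "(\<integral>\<^sup>+x. ennreal (f x) \<partial>lborel) = (\<integral>\<^sup>+x. ennreal (- f x) \<partial>lborel)"
      by (metis ennreal_enn2real infinity_ennreal_def)
    then show "emeasure (density lborel (\<lambda>x. ennreal (1 * g x))) X = emeasure (density lborel (\<lambda>x. ennreal (-1 * g x))) X"
      unfolding X em by (simp add: f_def)
  qed
  then have "AE x in lborel. ennreal (1 * g x) = ennreal (-1 * g x)"
    by (subst (asm) sigma_finite_measure.density_unique_iff[OF lborel.sigma_finite_measure_axioms]) auto
  then show ?thesis
  proof eventually_elim
    case (elim x)
    show "g x = 0"
    proof (cases "0 \<le> g x")
      case True
      then have "ennreal (- g x) = 0" by (intro ennreal_neg) simp
      then show ?thesis using elim True by simp
    next
      case False
      then have "ennreal (g x) = 0" by (intro ennreal_neg) simp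
      then show ?thesis using elim False by simp
    qed
  qed
qed

text \<open>Bumps converge boundedly to indicators of boxes, so the condition on test functions
  passes to box integrals by dominated convergence.\<close>

theorem fundamental_lemma:
  fixes g :: "real ^ 'n \<Rightarrow> real"
  assumes g: "loc_int g" and 0: "\<And>\<phi>. test_function \<phi> \<Longrightarrow> (\<integral>x. g x * \<phi> x \<partial>lborel) = 0"
  shows "AE x in lborel. g x = 0"
proof (rule AE_zero_of_box_integrals[OF g])
  fix a b :: "real ^ 'n"
  have [measurable]: "g \<in> borel_measurable borel" using g by (simp add: loc_int_def)
  have [measurable]: "bump a b (real (Suc k)) \<in> borel_measurable borel" for k
    by (intro smooth_measurable test_function_smooth test_function_bump) simp
  obtain R where R: "\<And>x. x \<in> box a b \<Longrightarrow> norm x \<le> R" using bounded_box[of a b] by (auto simp: bounded_iff)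
  have int: "integrable lborel (\<lambda>x. g x * indicator (box a b) x)"
    using R by (intro loc_int_integrable_mult[OF g, where M=1 and R=R]) (auto simp: indicator_def, force)
  have "(\<lambda>k. \<integral>x. g x * bump a b (real (Suc k)) x \<partial>lborel) \<longlonglongrightarrow> (\<integral>x. g x * indicator (box a b) x \<partial>lborel)"
  proof (rule integral_dominated_convergence)
    show "integrable lborel (\<lambda>x. \<bar>g x * indicator (box a b) x\<bar>)" using int by simp
    show "AE x in lborel. (\<lambda>k. g x * bump a b (real (Suc k)) x) \<longlonglongrightarrow> g x * indicator (box a b) x"
      by (intro AE_I2 tendsto_intros bump_tendsto)
    show "AE x in lborel. norm (g x * bump a b (real (Suc k)) x) \<le> \<bar>g x * indicator (box a b) x\<bar>" for k
    proof (rule AE_I2)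
      fix x
      have "\<bar>bump a b (real (Suc k)) x\<bar> \<le> indicator (box a b) x"
        using bump_eq_0[of "real (Suc k)" x a b] bump_nonneg[of a b "real (Suc k)" x] bump_le_1[of a b "real (Suc k)" x]
        by (auto simp: indicator_def simp del: of_nat_Suc)
      then show "norm (g x * bump a b (real (Suc k)) x) \<le> \<bar>g x * indicator (box a b) x\<bar>"
        by (simp add: abs_mult mult_left_mono)
    qed
  qed measurable
  then show "(\<integral>x. g x * indicator (box a b) x \<partial>lborel) = 0"
    using 0[OF test_function_bump] by (simp add: LIMSEQ_const_iff)
qed

section \<open>Taylor's formula for weakly differentiable functions\<close>

lemma finite_lists_length [simp]: "finite {js :: 'n::finite list. length js = k}"
  using finite_lists_length_eq[of "UNIV :: 'n set" k] by simp

lemma sum_lists_Suc: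
  fixes F :: "'n::finite list \<Rightarrow> 'b::comm_monoid_add"
  shows "(\<Sum>js | length js = Suc k. F js) = (\<Sum>js | length js = k. \<Sum>i\<in>UNIV. F (i # js))"
proof -
  have "{js :: 'n list. length js = Suc k} = (\<lambda>(js, i). i # js) ` ({js. length js = k} \<times> UNIV)"
    by (auto simp: length_Suc_conv image_iff)
  moreover have "inj_on (\<lambda>(js, i). i # js) ({js :: 'n list. length js = k} \<times> UNIV)"
    by (auto simp: inj_on_def)
  ultimately show ?thesis
    by (simp add: sum.reindex sum.cartesian_product case_prod_unfold)
qed

definition coord_prod :: "real ^ 'n \<Rightarrow> 'n list \<Rightarrow> real" where
  "coord_prod h js = prod_list (map (\<lambda>j. h $ j) js)"

lemma coord_prod_simps [simp]:
  "coord_prod h [] = 1" "coord_prod h (i # js) = h $ i * coord_prod h js"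
  by (simp_all add: coord_prod_def)

lemma coord_prod_minus: "coord_prod (- h) js = (- 1) ^ length js * coord_prod h js"
  by (induction js) auto

lemma abs_coord_prod_le: "\<bar>coord_prod h js\<bar> \<le> norm h ^ length js"
  by (induction js) (auto simp: abs_mult intro!: mult_mono component_le_norm_cart)

text \<open>The k-fold derivative of f at x in direction h. Summing over ordered lists instead of
  multi-indices spares the multinomial coefficients.\<close>

definition dir_derivative :: "nat \<Rightarrow> real ^ 'n \<Rightarrow> (real ^ 'n \<Rightarrow> real) \<Rightarrow> real ^ 'n \<Rightarrow> real" where
  "dir_derivative k h f x = (\<Sum>js | length js = k. coord_prod h js * iterated_partial js f x)"

lemma dir_derivative_0 [simp]: "dir_derivative 0 h f x = f x"
  by (simp add: dir_derivative_def)

lemma dir_derivative_has_derivative: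
  assumes "smooth f"
  shows "((\<lambda>t. dir_derivative k h f (a + t *\<^sub>R h)) has_real_derivative
    dir_derivative (Suc k) h f (a + t *\<^sub>R h)) (at t within S)"
proof -
  have "((\<lambda>t. dir_derivative k h f (a + t *\<^sub>R h)) has_real_derivative
    (\<Sum>js | length js = k. coord_prod h js *
      (\<Sum>i\<in>UNIV. h $ i * partial_derivative i (iterated_partial js f) (a + t *\<^sub>R h)))) (at t within S)"
    unfolding dir_derivative_def
    by (intro DERIV_sum DERIV_cmult smooth_has_real_derivative smooth_iterated_partial assms)
  also have "(\<Sum>js | length js = k. coord_prod h js *
      (\<Sum>i\<in>UNIV. h $ i * partial_derivative i (iterated_partial js f) (a + t *\<^sub>R h)))
      = dir_derivative (Suc k) h f (a + t *\<^sub>R h)"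
    unfolding dir_derivative_def sum_lists_Suc by (simp add: sum_distrib_left mult_ac)
  finally show ?thesis .
qed

text \<open>Density of the integral remainder in Taylor's formula of order m > 0, of total mass 1 /
  m!. The indicator is built in, so that remainders are integrals over the whole line, ready for
  Fubini's theorem.\<close>

definition taylor_weight :: "nat \<Rightarrow> real \<Rightarrow> real" where
  "taylor_weight m t = (1 - t) ^ (m - 1) / fact (m - 1) * indicator {0..1} t"

lemma taylor_weight_nonneg: "0 \<le> taylor_weight m t"
  by (auto simp: taylor_weight_def indicator_def)

lemma taylor_weight_le: "taylor_weight m t \<le> indicator {0..1} t"
proof (cases "t \<in> {0..1}")
  case True
  then have "(1 - t) ^ (m - 1) / fact (m - 1) \<le> 1 / 1"
    by (intro frac_le power_le_one) (auto simp: fact_ge_1)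
  then show ?thesis using True by (simp add: taylor_weight_def)
qed (simp add: taylor_weight_def)

lemma taylor_weight_measurable [measurable]: "taylor_weight m \<in> borel_measurable borel"
  unfolding taylor_weight_def by measurable

lemma integral_taylor_weight:
  assumes "0 < m" shows "(\<integral>t. taylor_weight m t \<partial>lborel) = 1 / fact m"
proof -
  have "((\<lambda>t. - ((1 - t) ^ m / fact m)) has_real_derivative (1 - t) ^ (m - 1) / fact (m - 1)) (at t)" for t :: real
  proof -
    have "((\<lambda>t. (1 - t) ^ m) has_real_derivative real m * (1 - t) ^ (m - 1) * (- 1)) (at t)"
      by (auto intro!: derivative_eq_intros)
    from DERIV_minus[OF DERIV_cdivide[OF this, of "fact m"]]
    show ?thesis using assms by (simp add: fact_reduce)
  qed
  then have "(\<integral>t. (1 - t) ^ (m - 1) / fact (m - 1) * indicator {0..1} t \<partial>lborel)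
      = - ((1 - 1) ^ m / fact m) - - ((1 - 0) ^ m / fact m :: real)"
    by (intro integral_FTC_Icc_real) (auto intro!: continuous_intros)
  then show ?thesis using assms by (simp add: taylor_weight_def)
qed

lemma taylor_smooth:
  assumes "smooth f" "0 < m"
  shows "f (a + h) = (\<Sum>k<m. dir_derivative k h f a / fact k)
    + (\<integral>t. taylor_weight m t * dir_derivative m h f (a + t *\<^sub>R h) \<partial>lborel)"
proof -
  let ?D = "\<lambda>k t. dir_derivative k h f (a + t *\<^sub>R h)"
  let ?i = "\<lambda>t. ((1 - t) ^ (m - 1) / fact (m - 1)) *\<^sub>R ?D m t"
  have "?D 0 1 = (\<Sum>k<m. ((1 - 0) ^ k / fact k) *\<^sub>R ?D k 0) + integral {0..1} ?i"
    by (rule Taylor_integral[OF assms(2)])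
      (auto simp flip: has_real_derivative_iff_has_vector_derivative
        intro: dir_derivative_has_derivative[OF assms(1)])
  moreover have "integral {0..1} ?i = (\<integral>t. taylor_weight m t * ?D m t \<partial>lborel)"
  proof -
    have "continuous_on {0..1} ?i"
      by (intro continuous_intros DERIV_continuous_on)
        (auto intro: dir_derivative_has_derivative[OF assms(1)])
    from set_borel_integral_eq_integral(2)[OF borel_integrable_atLeastAtMost'[OF this]]
    show ?thesis by (simp add: set_lebesgue_integral_def taylor_weight_def mult_ac)
  qed
  ultimately show ?thesis by simp
qed

section \<open>Averages of functions along segments\<close>

lemma norm_le_of_translate:
  fixes x h :: "'a::real_normed_vector"
  assumes "t \<in> {0..1}" "norm (x - t *\<^sub>R h) \<le> R" shows "norm x \<le> R + norm h"
proof -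
  have "norm x \<le> norm (x - t *\<^sub>R h) + norm (t *\<^sub>R h)"
    using norm_triangle_ineq[of "x - t *\<^sub>R h" "t *\<^sub>R h"] by simp
  also have "norm (t *\<^sub>R h) \<le> norm h" using assms(1) by (simp add: mult_left_le_one_le)
  finally show ?thesis using assms(2) by simp
qed

context
  fixes D :: "real ^ 'n \<Rightarrow> real" and w :: "real \<Rightarrow> real" and h :: "real ^ 'n"
  assumes D: "loc_int D" and w [measurable]: "w \<in> borel_measurable borel"
    and w_le: "\<And>t. \<bar>w t\<bar> \<le> indicator {0..1} t"
begin

text \<open>Absolute integrability for the applications of Fubini's theorem below: for t in [0, 1]
  the support of the shifted \<phi> stays in the ball of radius R + |h|, where \<open>D\<close> is
  integrable.\<close>

lemma segment_average_bound:
  assumes R: "\<And>x. R < norm x \<Longrightarrow> \<phi> x = (0 :: real)" and M: "\<And>x. \<bar>\<phi> x\<bar> \<le> M"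
    and [measurable]: "\<phi> \<in> borel_measurable borel"
  shows "(\<integral>\<^sup>+t. \<integral>\<^sup>+x. ennreal \<bar>w t * (D x * \<phi> (x - t *\<^sub>R h))\<bar> \<partial>lborel \<partial>lborel) < \<infinity>"
proof -
  have [measurable]: "D \<in> borel_measurable borel" using D by (simp add: loc_int_def)
  have M0: "0 \<le> M" using M[of 0] by linarith
  let ?c = "ennreal M * (\<integral>\<^sup>+x. ennreal \<bar>D x\<bar> * indicator (cball 0 (R + norm h)) x \<partial>lborel)"
  have "(\<integral>\<^sup>+x. ennreal \<bar>w t * (D x * \<phi> (x - t *\<^sub>R h))\<bar> \<partial>lborel) \<le> ?c * indicator {0..1} t" for t
  proof (cases "t \<in> {0..1}")
    case True
    have "(\<integral>\<^sup>+x. ennreal \<bar>w t * (D x * \<phi> (x - t *\<^sub>R h))\<bar> \<partial>lborel)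
      \<le> (\<integral>\<^sup>+x. ennreal M * (ennreal \<bar>D x\<bar> * indicator (cball 0 (R + norm h)) x) \<partial>lborel)"
    proof (rule nn_integral_mono)
      fix x
      have "\<bar>w t * (D x * \<phi> (x - t *\<^sub>R h))\<bar> \<le> 1 * (\<bar>D x\<bar> * M)"
        unfolding abs_mult using w_le[of t] True M by (intro mult_mono) auto
      then have "ennreal \<bar>w t * (D x * \<phi> (x - t *\<^sub>R h))\<bar> \<le> ennreal M * ennreal \<bar>D x\<bar>"
        using M0 by (simp add: mult.commute flip: ennreal_mult)
      moreover have "\<phi> (x - t *\<^sub>R h) = 0" if "\<not> norm x \<le> R + norm h"
        using norm_le_of_translate[OF True, of x h R] that R by force
      ultimately show "ennreal \<bar>w t * (D x * \<phi> (x - t *\<^sub>R h))\<bar>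
          \<le> ennreal M * (ennreal \<bar>D x\<bar> * indicator (cball 0 (R + norm h)) x)"
        by (cases "norm x \<le> R + norm h") auto
    qed
    also have "\<dots> = ?c" by (rule nn_integral_cmult) measurable
    finally show ?thesis using True by simp
  qed (use w_le[of t] in auto)
  then have "(\<integral>\<^sup>+t. \<integral>\<^sup>+x. ennreal \<bar>w t * (D x * \<phi> (x - t *\<^sub>R h))\<bar> \<partial>lborel \<partial>lborel)
     \<le> (\<integral>\<^sup>+t. ?c * indicator {0..1::real} t \<partial>lborel)"
    by (intro nn_integral_mono)
  also have "\<dots> = ?c" by (simp add: nn_integral_cmult_indicator)
  also have "\<dots> < \<infinity>" using D by (simp add: loc_int_def ennreal_mult_less_top)
  finally show ?thesis .
qed

lemma segment_shift:
  assumes [measurable]: "\<phi> \<in> borel_measurable borel"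
  shows "(\<integral>\<^sup>+x. ennreal \<bar>w t * (D (x + t *\<^sub>R h) * \<phi> x)\<bar> \<partial>lborel)
    = (\<integral>\<^sup>+x. ennreal \<bar>w t * (D x * \<phi> (x - t *\<^sub>R h))\<bar> \<partial>lborel)"
proof -
  have [measurable]: "D \<in> borel_measurable borel" using D by (simp add: loc_int_def)
  show ?thesis
    using nn_integral_translate[of "\<lambda>x. ennreal \<bar>w t * (D x * \<phi> (x - t *\<^sub>R h))\<bar>" "t *\<^sub>R h"]
    by (simp add: add.commute)
qed

text \<open>At points where the average does not exist it is 0 by convention, so its modulus is
  bounded by the integral of the modulus in either case.\<close>

lemma segment_average_loc_int: "loc_int (\<lambda>x. \<integral>t. w t * D (x + t *\<^sub>R h) \<partial>lborel)"
  unfolding loc_int_def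
proof (intro conjI allI)
  have [measurable]: "D \<in> borel_measurable borel" using D by (simp add: loc_int_def)
  show [measurable]: "(\<lambda>x. \<integral>t. w t * D (x + t *\<^sub>R h) \<partial>lborel) \<in> borel_measurable borel"
    by measurable
  fix R
  let ?\<phi> = "indicator (cball 0 R) :: real ^ 'n \<Rightarrow> real"
  have "(\<integral>\<^sup>+x. ennreal \<bar>\<integral>t. w t * D (x + t *\<^sub>R h) \<partial>lborel\<bar> * indicator (cball 0 R) x \<partial>lborel)
     \<le> (\<integral>\<^sup>+x. \<integral>\<^sup>+t. ennreal \<bar>w t * (D (x + t *\<^sub>R h) * ?\<phi> x)\<bar> \<partial>lborel \<partial>lborel)"
  proof (rule nn_integral_mono)
    fix x
    have "ennreal \<bar>\<integral>t. w t * D (x + t *\<^sub>R h) \<partial>lborel\<bar> \<le> (\<integral>\<^sup>+t. ennreal \<bar>w t * D (x + t *\<^sub>R h)\<bar> \<partial>lborel)"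
      using integral_norm_bound_ennreal[of lborel "\<lambda>t. w t * D (x + t *\<^sub>R h)"]
      by (cases "integrable lborel (\<lambda>t. w t * D (x + t *\<^sub>R h))") (auto simp: not_integrable_integral_eq)
    then show "ennreal \<bar>\<integral>t. w t * D (x + t *\<^sub>R h) \<partial>lborel\<bar> * indicator (cball 0 R) x
      \<le> (\<integral>\<^sup>+t. ennreal \<bar>w t * (D (x + t *\<^sub>R h) * ?\<phi> x)\<bar> \<partial>lborel)"
      by (auto simp: indicator_def)
  qed
  also have "\<dots> = (\<integral>\<^sup>+t. \<integral>\<^sup>+x. ennreal \<bar>w t * (D (x + t *\<^sub>R h) * ?\<phi> x)\<bar> \<partial>lborel \<partial>lborel)"
    by (rule lborel_pair.Fubini') measurable
  also have "\<dots> < \<infinity>"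
    unfolding segment_shift[of ?\<phi>, simplified]
    by (rule segment_average_bound[where M=1 and R=R]) (auto simp: indicator_def)
  finally show "(\<integral>\<^sup>+x. ennreal \<bar>\<integral>t. w t * D (x + t *\<^sub>R h) \<partial>lborel\<bar> * indicator (cball 0 R) x \<partial>lborel) < \<infinity>" .
qed

text \<open>Averaging may be moved from \<open>D\<close> to the test function, where the direction
  is reversed. Both sides are compared with one iterated integral, so that a weak derivative can be
  exchanged for each fixed t.\<close>

lemma segment_average_test:
  assumes \<phi>: "test_function \<phi>"
  shows "(\<integral>x. (\<integral>t. w t * D (x + t *\<^sub>R h) \<partial>lborel) * \<phi> x \<partial>lborel)
      = (\<integral>t. w t * (\<integral>x. D x * \<phi> (x - t *\<^sub>R h) \<partial>lborel) \<partial>lborel)"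
    and "(\<integral>x. D x * (\<integral>t. w t * \<phi> (x - t *\<^sub>R h) \<partial>lborel) \<partial>lborel)
      = (\<integral>t. w t * (\<integral>x. D x * \<phi> (x - t *\<^sub>R h) \<partial>lborel) \<partial>lborel)"
proof -
  have [measurable]: "D \<in> borel_measurable borel" using D by (simp add: loc_int_def)
  have m[measurable]: "\<phi> \<in> borel_measurable borel" by (rule smooth_measurable[OF test_function_smooth[OF \<phi>]])
  obtain R where R: "\<And>x. R < norm x \<Longrightarrow> \<phi> x = 0" using test_function_bound[OF \<phi>] by blast
  obtain M where M: "\<And>x. \<bar>\<phi> x\<bar> \<le> M" using test_function_bounded[OF \<phi>] by blast
  note b = segment_average_bound[of R \<phi> M, OF R M m]
  have i2: "integrable (lborel \<Otimes>\<^sub>M lborel) (\<lambda>(t, x). w t * (D x * \<phi> (x - t *\<^sub>R h)))"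
    using b by (intro integrableI_bounded) (simp_all add: lborel.nn_integral_fst[symmetric] split_beta')
  have i1: "integrable (lborel \<Otimes>\<^sub>M lborel) (\<lambda>(t, x). w t * (D (x + t *\<^sub>R h) * \<phi> x))"
    using b unfolding segment_shift[OF m, symmetric]
    by (intro integrableI_bounded) (simp_all add: lborel.nn_integral_fst[symmetric] split_beta')
  have "(\<integral>x. (\<integral>t. w t * D (x + t *\<^sub>R h) \<partial>lborel) * \<phi> x \<partial>lborel)
     = (\<integral>x. (\<integral>t. w t * (D (x + t *\<^sub>R h) * \<phi> x) \<partial>lborel) \<partial>lborel)"
    by (simp flip: integral_mult_left_zero add: mult.assoc)
  also have "\<dots> = (\<integral>t. (\<integral>x. w t * (D (x + t *\<^sub>R h) * \<phi> x) \<partial>lborel) \<partial>lborel)"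
    by (rule lborel_pair.Fubini_integral) (use i1 in simp)
  also have "\<dots> = (\<integral>t. w t * (\<integral>x. D (x + t *\<^sub>R h) * \<phi> x \<partial>lborel) \<partial>lborel)" by simp
  also have "\<dots> = (\<integral>t. w t * (\<integral>x. D x * \<phi> (x - t *\<^sub>R h) \<partial>lborel) \<partial>lborel)"
    using integral_translate[of "\<lambda>x. D x * \<phi> (x - t *\<^sub>R h)" "t *\<^sub>R h" for t] by (simp add: add.commute)
  finally show "(\<integral>x. (\<integral>t. w t * D (x + t *\<^sub>R h) \<partial>lborel) * \<phi> x \<partial>lborel)
      = (\<integral>t. w t * (\<integral>x. D x * \<phi> (x - t *\<^sub>R h) \<partial>lborel) \<partial>lborel)" .
  have "(\<integral>x. D x * (\<integral>t. w t * \<phi> (x - t *\<^sub>R h) \<partial>lborel) \<partial>lborel)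
      = (\<integral>x. (\<integral>t. w t * (D x * \<phi> (x - t *\<^sub>R h)) \<partial>lborel) \<partial>lborel)"
    by (simp flip: integral_mult_right_zero add: mult.left_commute)
  also have "\<dots> = (\<integral>t. (\<integral>x. w t * (D x * \<phi> (x - t *\<^sub>R h)) \<partial>lborel) \<partial>lborel)"
    by (rule lborel_pair.Fubini_integral) (use i2 in simp)
  finally show "(\<integral>x. D x * (\<integral>t. w t * \<phi> (x - t *\<^sub>R h) \<partial>lborel) \<partial>lborel)
      = (\<integral>t. w t * (\<integral>x. D x * \<phi> (x - t *\<^sub>R h) \<partial>lborel) \<partial>lborel)" by simp
qed

end

text \<open>A family \<open>D js\<close> of weak derivatives of \<open>u\<close> along lists of coordinates of length at most \<open>m\<close>.\<close>

definition weak_jet :: "nat \<Rightarrow> (real ^ 'n \<Rightarrow> real) \<Rightarrow> ('n list \<Rightarrow> real ^ 'n \<Rightarrow> real) \<Rightarrow> bool" where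
  "weak_jet m u D \<longleftrightarrow> loc_int u \<and> D [] = u \<and> (\<forall>js. length js \<le> m \<longrightarrow> loc_int (D js) \<and>
     (\<forall>\<phi>. test_function \<phi> \<longrightarrow> (\<integral>x. u x * iterated_partial js \<phi> x \<partial>lborel) =
        (- 1) ^ length js * (\<integral>x. D js x * \<phi> x \<partial>lborel)))"

lemma integral_double_sum:
  fixes F F' :: "'n::finite list \<Rightarrow> 'a \<Rightarrow> real"
  assumes F: "\<And>js. length js < m \<Longrightarrow> integrable M (F js)" and F': "\<And>js. length js = m \<Longrightarrow> integrable M (F' js)"
  shows "(\<integral>x. (\<Sum>k<m. \<Sum>js | length js = k. c k js * F js x) + (\<Sum>js | length js = m. c' js * F' js x) \<partial>M)
    = (\<Sum>k<m. \<Sum>js | length js = k. c k js * (\<integral>x. F js x \<partial>M)) + (\<Sum>js | length js = m. c' js * (\<integral>x. F' js x \<partial>M))"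
proof -
  have 1: "integrable M (\<lambda>x. \<Sum>js | length js = k. c k js * F js x)" if "k < m" for k
    using that F by (intro Bochner_Integration.integrable_sum integrable_mult_right) auto
  have 2: "integrable M (\<lambda>x. \<Sum>js | length js = m. c' js * F' js x)"
    using F' by (intro Bochner_Integration.integrable_sum integrable_mult_right) auto
  have 3: "(\<integral>x. (\<Sum>js | length js = k. c k js * F js x) \<partial>M) = (\<Sum>js | length js = k. c k js * (\<integral>x. F js x \<partial>M))" if "k < m" for k
    using that F by (subst Bochner_Integration.integral_sum) (auto intro!: integrable_mult_right)
  have 4: "(\<integral>x. (\<Sum>js | length js = m. c' js * F' js x) \<partial>M) = (\<Sum>js | length js = m. c' js * (\<integral>x. F' js x \<partial>M))"
    using F' by (subst Bochner_Integration.integral_sum) (auto intro!: integrable_mult_right)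
  have 5: "(\<integral>x. (\<Sum>k<m. \<Sum>js | length js = k. c k js * F js x) \<partial>M) = (\<Sum>k<m. \<Sum>js | length js = k. c k js * (\<integral>x. F js x \<partial>M))"
    using 1 3 by (subst Bochner_Integration.integral_sum) auto
  show ?thesis
    unfolding 4[symmetric] 5[symmetric]
    by (intro Bochner_Integration.integral_add Bochner_Integration.integrable_sum 1 2) auto
qed

text \<open>The formula is dual to Taylor's formula for \<open>\<phi> (x - h)\<close>, with \<open>\<phi>\<close> a test function.\<close>

theorem weak_taylor:
  fixes u :: "real ^ 'n \<Rightarrow> real"
  assumes jet: "weak_jet m u D" and m: "0 < m"
  shows "AE x in lborel. u (x + h) =
    (\<Sum>k<m. (\<Sum>js | length js = k. coord_prod h js * D js x) / fact k) +
    (\<Sum>js | length js = m. coord_prod h js * (\<integral>t. taylor_weight m t * D js (x + t *\<^sub>R h) \<partial>lborel))"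
proof -
  have u: "loc_int u" and D: "\<And>js. length js \<le> m \<Longrightarrow> loc_int (D js)"
    and dual: "\<And>js \<phi>. length js \<le> m \<Longrightarrow> test_function \<phi> \<Longrightarrow>
      (\<integral>x. u x * iterated_partial js \<phi> x \<partial>lborel) = (- 1) ^ length js * (\<integral>x. D js x * \<phi> x \<partial>lborel)"
    using jet by (auto simp: weak_jet_def)
  have [measurable]: "u \<in> borel_measurable borel" using u by (simp add: loc_int_def)
  let ?w = "taylor_weight m"
  have w: "?w \<in> borel_measurable borel" "\<And>t. \<bar>?w t\<bar> \<le> indicator {0..1} t"
    using taylor_weight_le taylor_weight_nonneg by (auto simp: abs_of_nonneg)
  define G where "G js x = (\<integral>t. ?w t * D js (x + t *\<^sub>R h) \<partial>lborel)" for js x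
  have G: "loc_int (G js)" if "length js = m" for js
    unfolding G_def by (rule segment_average_loc_int[OF D w]) (use that in simp)
  define P where "P x = (\<Sum>k<m. (\<Sum>js | length js = k. coord_prod h js * D js x) / fact k)" for x
  define Q where "Q x = (\<Sum>js | length js = m. coord_prod h js * G js x)" for x
  have P': "P x = (\<Sum>k<m. \<Sum>js | length js = k. (coord_prod h js / fact k) * D js x)" for x
    by (simp add: P_def sum_divide_distrib)
  have LP: "loc_int P" unfolding P' by (intro loc_int_sum loc_int_cmult D) auto
  have LQ: "loc_int Q" unfolding Q_def by (intro loc_int_sum loc_int_cmult G) auto
  have Lu: "loc_int (\<lambda>x. u (x + h))" using loc_int_translate[OF u, of h] by (simp add: add.commute)
  have "AE x in lborel. u (x + h) - (P x + Q x) = 0"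
  proof (rule fundamental_lemma)
    show "loc_int (\<lambda>x. u (x + h) - (P x + Q x))"
      by (intro loc_int_diff loc_int_add Lu LP LQ)
    fix \<phi> :: "real ^ 'n \<Rightarrow> real" assume \<phi>: "test_function \<phi>"
    have sm: "smooth \<phi>" by (rule test_function_smooth[OF \<phi>])
    have [measurable]: "\<phi> \<in> borel_measurable borel" by (rule smooth_measurable[OF sm])
    have ut: "integrable lborel (\<lambda>x. u x * iterated_partial js \<phi> x)" for js
      by (rule loc_int_integrable_test[OF u test_function_iterated_partial[OF \<phi>]])
    \<comment> \<open>Remainder terms of Taylor's formula for \<phi>(x - h): derivatives of \<phi>
      averaged over the segment from x to x - h.\<close>
    define E where "E js x = (\<integral>t. ?w t * iterated_partial js \<phi> (x - t *\<^sub>R h) \<partial>lborel)" for js x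
    have iw: "integrable lborel (\<lambda>t. ?w t * iterated_partial js \<phi> (x - t *\<^sub>R h))" for js x
      proof -
        obtain M where M: "0 < M" "\<And>x. \<bar>iterated_partial js \<phi> x\<bar> \<le> M"
          using test_function_bounded[OF test_function_iterated_partial[OF \<phi>]] by blast
        show ?thesis
      proof (rule Bochner_Integration.integrable_bound)
        show "integrable lborel (\<lambda>t. M * indicator {0..1::real} t :: real)"
          by (intro integrable_mult_right integrable_real_indicator) auto
        have [measurable]: "iterated_partial js \<phi> \<in> borel_measurable borel"
          by (rule smooth_measurable[OF smooth_iterated_partial[OF sm]])
        show "(\<lambda>t. ?w t * iterated_partial js \<phi> (x - t *\<^sub>R h)) \<in> borel_measurable lborel" by measurable
        show "AE t in lborel. norm (?w t * iterated_partial js \<phi> (x - t *\<^sub>R h)) \<le> norm (M * indicator {0..1} t)"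
        proof (rule AE_I2)
          fix t
          have "\<bar>?w t\<bar> * \<bar>iterated_partial js \<phi> (x - t *\<^sub>R h)\<bar> \<le> indicator {0..1} t * M"
            using w(2)[of t] M by (intro mult_mono) auto
          then show "norm (?w t * iterated_partial js \<phi> (x - t *\<^sub>R h)) \<le> norm (M * indicator {0..1} t)"
            using M by (simp add: abs_mult mult.commute)
        qed
      qed
      qed
    have taylor: "\<phi> (x - h) = (\<Sum>k<m. \<Sum>js | length js = k. coord_prod (- h) js / fact k * iterated_partial js \<phi> x)
       + (\<Sum>js | length js = m. coord_prod (- h) js * E js x)" for x
    proof -
      have "(\<Sum>js | length js = m. coord_prod (- h) js * E js x)
        = (\<integral>t. (\<Sum>js | length js = m. coord_prod (- h) js * (?w t * iterated_partial js \<phi> (x - t *\<^sub>R h))) \<partial>lborel)"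
        unfolding E_def using iw by (subst Bochner_Integration.integral_sum) auto
      also have "\<dots> = (\<integral>t. ?w t * dir_derivative m (- h) \<phi> (x + t *\<^sub>R (- h)) \<partial>lborel)"
        by (simp add: dir_derivative_def sum_distrib_left mult_ac)
      finally show ?thesis
        using taylor_smooth[OF sm m, of x "- h"] by (simp add: dir_derivative_def sum_divide_distrib)
    qed
    \<comment> \<open>Duality of the top order terms: for fixed t the weak derivative is tested with
      the translate of \<phi> by t h, and then the average is moved from \<phi> to
      \<open>D js\<close>.\<close>
    have uE: "(\<integral>x. u x * E js x \<partial>lborel) = (- 1) ^ m * (\<integral>x. G js x * \<phi> x \<partial>lborel)"
      and iE: "integrable lborel (\<lambda>x. u x * E js x)" if js: "length js = m" for js
    proof -
      have "(\<integral>x. u x * E js x \<partial>lborel) = (\<integral>t. ?w t * (\<integral>x. u x * iterated_partial js \<phi> (x - t *\<^sub>R h) \<partial>lborel) \<partial>lborel)"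
        unfolding E_def by (rule segment_average_test(2)[OF u w test_function_iterated_partial[OF \<phi>]])
      also have "\<dots> = (\<integral>t. ?w t * ((- 1) ^ m * (\<integral>x. D js x * \<phi> (x - t *\<^sub>R h) \<partial>lborel)) \<partial>lborel)"
      proof (intro Bochner_Integration.integral_cong refl arg_cong2[where f="(*)"])
        fix t
        show "(\<integral>x. u x * iterated_partial js \<phi> (x - t *\<^sub>R h) \<partial>lborel)
          = (- 1) ^ m * (\<integral>x. D js x * \<phi> (x - t *\<^sub>R h) \<partial>lborel)"
        using dual[of js "\<lambda>x. \<phi> (- (t *\<^sub>R h) + 1 *\<^sub>R x)"] js test_function_affine[OF \<phi>, of 1 "- (t *\<^sub>R h)"]
        by (simp add: iterated_partial_affine[OF sm, of js "- (t *\<^sub>R h)" 1, simplified])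
      qed
      also have "\<dots> = (- 1) ^ m * (\<integral>t. ?w t * (\<integral>x. D js x * \<phi> (x - t *\<^sub>R h) \<partial>lborel) \<partial>lborel)"
        by (simp only: mult.left_commute[of _ "(- 1) ^ m"] integral_mult_right_zero)
      also have "(\<integral>t. ?w t * (\<integral>x. D js x * \<phi> (x - t *\<^sub>R h) \<partial>lborel) \<partial>lborel) = (\<integral>x. G js x * \<phi> x \<partial>lborel)"
        unfolding G_def by (rule segment_average_test(1)[OF D w \<phi>, symmetric]) (use js in simp)
      finally show "(\<integral>x. u x * E js x \<partial>lborel) = (- 1) ^ m * (\<integral>x. G js x * \<phi> x \<partial>lborel)" .
      obtain R where R: "0 < R" "\<And>x. R < norm x \<Longrightarrow> iterated_partial js \<phi> x = 0"
        using test_function_bound[OF test_function_iterated_partial[OF \<phi>]] by blast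
      obtain M where M: "0 < M" "\<And>x. \<bar>iterated_partial js \<phi> x\<bar> \<le> M"
        using test_function_bounded[OF test_function_iterated_partial[OF \<phi>]] by blast
      have [measurable]: "iterated_partial js \<phi> \<in> borel_measurable borel"
        by (rule smooth_measurable[OF smooth_iterated_partial[OF sm]])
      show "integrable lborel (\<lambda>x. u x * E js x)"
      proof (rule loc_int_integrable_mult[OF u, where M=M and R="R + norm h"])
        show "E js \<in> borel_measurable borel" unfolding E_def by measurable
        fix x
        have "norm (E js x) \<le> (\<integral>t. M * indicator {0..1::real} t \<partial>lborel)"
          unfolding E_def
        proof (rule Bochner_Integration.integral_norm_bound_integral)
          show "norm (?w t * iterated_partial js \<phi> (x - t *\<^sub>R h)) \<le> M * indicator {0..1} t" for t
          proof -
            have "\<bar>?w t\<bar> * \<bar>iterated_partial js \<phi> (x - t *\<^sub>R h)\<bar> \<le> indicator {0..1} t * M"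
              using w(2)[of t] M by (intro mult_mono) auto
            then show ?thesis using M by (simp add: abs_mult mult.commute)
          qed
        qed (auto intro!: integrable_mult_right integrable_real_indicator iw)
        then show "\<bar>E js x\<bar> \<le> M" by simp
        assume "R + norm h < norm x"
        then have "?w t * iterated_partial js \<phi> (x - t *\<^sub>R h) = 0" for t
        proof (cases "t \<in> {0..1}")
          case True
          with \<open>R + norm h < norm x\<close> have "R < norm (x - t *\<^sub>R h)"
            using norm_le_of_translate[of t x h R] by (meson not_le)
          then show ?thesis using R(2) by simp
        qed (use w(2)[of t] in simp)
        then show "E js x = 0" by (simp only: E_def integral_zero)
      qed
    qed
    have iD: "integrable lborel (\<lambda>x. D js x * \<phi> x)" if "length js \<le> m" for js
      by (rule loc_int_integrable_test[OF D[OF that] \<phi>])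
    have iG: "integrable lborel (\<lambda>x. G js x * \<phi> x)" if "length js = m" for js
      by (rule loc_int_integrable_test[OF G[OF that] \<phi>])
    have "(\<integral>x. u (x + h) * \<phi> x \<partial>lborel) = (\<integral>x. u x * \<phi> (x - h) \<partial>lborel)"
      using integral_translate[of "\<lambda>x. u x * \<phi> (x - h)" h] by (simp add: add.commute)
    also have "\<dots> = (\<integral>x. (\<Sum>k<m. \<Sum>js | length js = k. coord_prod (- h) js / fact k * (u x * iterated_partial js \<phi> x))
       + (\<Sum>js | length js = m. coord_prod (- h) js * (u x * E js x)) \<partial>lborel)"
      by (simp add: taylor distrib_left sum_distrib_left mult_ac)
    also have "\<dots> = (\<Sum>k<m. \<Sum>js | length js = k. coord_prod (- h) js / fact k * (\<integral>x. u x * iterated_partial js \<phi> x \<partial>lborel))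
       + (\<Sum>js | length js = m. coord_prod (- h) js * (\<integral>x. u x * E js x \<partial>lborel))"
      by (intro integral_double_sum ut iE)
    also have "\<dots> = (\<Sum>k<m. \<Sum>js | length js = k. coord_prod h js / fact k * (\<integral>x. D js x * \<phi> x \<partial>lborel))
       + (\<Sum>js | length js = m. coord_prod h js * (\<integral>x. G js x * \<phi> x \<partial>lborel))"
    proof -
      \<comment> \<open>The sign of \<open>coord_prod (- h) js\<close> cancels the sign of the weak
        derivative of the same order.\<close>
      have e: "(- 1) ^ k * c / d * ((- 1) ^ k * i) = c / d * i" for k :: nat and c d i :: real
        by (simp add: flip: power_mult_distrib mult.assoc)
      have e': "(- 1) ^ k * c * ((- 1) ^ k * i) = c * i" for k :: nat and c i :: real
        using e[of k c 1 i] by simp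
      show ?thesis
        by (intro arg_cong2[where f="(+)"] sum.cong refl) (simp_all add: dual[OF _ \<phi>] uE coord_prod_minus e e')
    qed
    also have "\<dots> = (\<integral>x. (\<Sum>k<m. \<Sum>js | length js = k. coord_prod h js / fact k * (D js x * \<phi> x))
       + (\<Sum>js | length js = m. coord_prod h js * (G js x * \<phi> x)) \<partial>lborel)"
      by (intro integral_double_sum[symmetric] iD iG) auto
    also have "\<dots> = (\<integral>x. (P x + Q x) * \<phi> x \<partial>lborel)"
      by (simp add: P' Q_def distrib_right sum_distrib_right mult.assoc)
    finally show "(\<integral>x. (u (x + h) - (P x + Q x)) * \<phi> x \<partial>lborel) = 0"
      using loc_int_integrable_test[OF Lu \<phi>] loc_int_integrable_test[OF loc_int_add[OF LP LQ] \<phi>]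
      by (simp add: left_diff_distrib)
  qed
  then show ?thesis
    by eventually_elim (simp add: P_def Q_def G_def)
qed

section \<open>Polynomials and oscillations\<close>

lemma finite_multi_indices [simp]: "finite (multi_indices k :: ('n::finite \<Rightarrow> nat) set)"
proof (rule finite_subset)
  show "(multi_indices k :: ('n \<Rightarrow> nat) set) \<subseteq> PiE UNIV (\<lambda>_. {..k})"
    by (auto simp: multi_indices_def intro: member_le_sum)
qed (auto intro: finite_PiE)

lemma polynomials_add: "p \<in> polynomials m \<Longrightarrow> q \<in> polynomials m \<Longrightarrow> (\<lambda>x. p x + q x) \<in> polynomials m"
  unfolding polynomials_def mem_Collect_eq
proof (elim exE)
  fix c d
  assume "\<forall>x. p x = (\<Sum>k=0..m. \<Sum>\<alpha>\<in>multi_indices k. c \<alpha> * (\<Prod>i\<in>UNIV. (x $ i) ^ \<alpha> i))"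
    "\<forall>x. q x = (\<Sum>k=0..m. \<Sum>\<alpha>\<in>multi_indices k. d \<alpha> * (\<Prod>i\<in>UNIV. (x $ i) ^ \<alpha> i))"
  then show "\<exists>e. \<forall>x. p x + q x = (\<Sum>k=0..m. \<Sum>\<alpha>\<in>multi_indices k. e \<alpha> * (\<Prod>i\<in>UNIV. (x $ i) ^ \<alpha> i))"
    by (intro exI[of _ "\<lambda>\<alpha>. c \<alpha> + d \<alpha>"]) (simp add: distrib_right sum.distrib)
qed

lemma polynomials_cmult: "p \<in> polynomials m \<Longrightarrow> (\<lambda>x. a * p x) \<in> polynomials m"
  unfolding polynomials_def mem_Collect_eq
proof (elim exE)
  fix c assume "\<forall>x. p x = (\<Sum>k=0..m. \<Sum>\<alpha>\<in>multi_indices k. c \<alpha> * (\<Prod>i\<in>UNIV. (x $ i) ^ \<alpha> i))"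
  then show "\<exists>e. \<forall>x. a * p x = (\<Sum>k=0..m. \<Sum>\<alpha>\<in>multi_indices k. e \<alpha> * (\<Prod>i\<in>UNIV. (x $ i) ^ \<alpha> i))"
    by (intro exI[of _ "\<lambda>\<alpha>. a * c \<alpha>"]) (simp add: sum_distrib_left mult.assoc)
qed

lemma monomial_polynomials:
  assumes "(\<Sum>i\<in>UNIV. \<alpha> i) \<le> m"
  shows "(\<lambda>x. \<Prod>i\<in>UNIV. (x $ i) ^ \<alpha> i) \<in> polynomials m"
proof -
  have "(\<Sum>k=0..m. \<Sum>\<beta>\<in>multi_indices k. (if \<beta> = \<alpha> then 1 else 0) * (\<Prod>i\<in>UNIV. (x $ i) ^ \<beta> i))
     = (\<Prod>i\<in>UNIV. (x $ i) ^ \<alpha> i)" for x :: "real ^ 'a"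
  proof -
    have "(\<Sum>\<beta>\<in>multi_indices k. (if \<beta> = \<alpha> then 1 else 0) * (\<Prod>i\<in>UNIV. (x $ i) ^ \<beta> i))
      = (if k = (\<Sum>i\<in>UNIV. \<alpha> i) then (\<Prod>i\<in>UNIV. (x $ i) ^ \<alpha> i) else 0)" for k
    proof -
      have "\<alpha> \<in> multi_indices k \<longleftrightarrow> k = (\<Sum>i\<in>UNIV. \<alpha> i)" by (auto simp: multi_indices_def)
      then show ?thesis by (simp add: if_distrib[of "\<lambda>x. x * _"] sum.delta cong: if_cong)
    qed
    then show ?thesis using assms by simp
  qed
  then show ?thesis unfolding polynomials_def by (auto intro!: exI[of _ "\<lambda>\<beta>. if \<beta> = \<alpha> then 1 else 0"])
qed

lemma const_polynomials: "(\<lambda>x. c) \<in> polynomials m"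
  using polynomials_cmult[OF monomial_polynomials[of "\<lambda>_. 0" m], of c] by simp

lemma polynomials_sum: "(\<And>i. i \<in> I \<Longrightarrow> f i \<in> polynomials m) \<Longrightarrow> (\<lambda>x. \<Sum>i\<in>I. f i x) \<in> polynomials m"
  by (induction I rule: infinite_finite_induct) (simp_all add: polynomials_add const_polynomials)

lemma polynomials_induct [consumes 1, case_names monomial]:
  assumes "q \<in> polynomials m"
    and "\<And>\<alpha>. (\<Sum>i\<in>UNIV. \<alpha> i) \<le> m \<Longrightarrow> P (\<lambda>x. \<Prod>i\<in>UNIV. (x $ i) ^ \<alpha> i)"
    and "\<And>p q. P p \<Longrightarrow> P q \<Longrightarrow> P (\<lambda>x. p x + q x)" "\<And>c p. P p \<Longrightarrow> P (\<lambda>x. c * p x)"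
    and "P (\<lambda>x. 0)"
  shows "P q"
proof -
  obtain c where q: "q = (\<lambda>x. \<Sum>k=0..m. \<Sum>\<alpha>\<in>multi_indices k. c \<alpha> * (\<Prod>i\<in>UNIV. (x $ i) ^ \<alpha> i))"
    using assms(1) by (auto simp: polynomials_def)
  have sum: "P (\<lambda>x. \<Sum>i\<in>I. f i x)" if "\<And>i. i \<in> I \<Longrightarrow> P (f i)" for I :: "'z set" and f
    using that by (induction I rule: infinite_finite_induct) (simp_all add: assms(3,5))
  have sum': "P (\<lambda>x. \<Sum>i\<in>I. f i x)" if "\<And>i. i \<in> I \<Longrightarrow> P (f i)" for I :: "nat set" and f
    using that by (induction I rule: infinite_finite_induct) (simp_all add: assms(3,5))
  have sum'': "P (\<lambda>x. \<Sum>i\<in>I. f i x)" if "\<And>i. i \<in> I \<Longrightarrow> P (f i)" for I :: "('a \<Rightarrow> nat) set" and f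
    using that by (induction I rule: infinite_finite_induct) (simp_all add: assms(3,5))
  show ?thesis unfolding q
    by (intro sum' sum'' assms(4) assms(2)) (auto simp: multi_indices_def)
qed

lemma polynomials_mono: "q \<in> polynomials k \<Longrightarrow> k \<le> m \<Longrightarrow> q \<in> polynomials m"
proof (induction rule: polynomials_induct)
  case (monomial \<alpha>)
  then show ?case by (intro monomial_polynomials) simp
qed (simp_all add: polynomials_add polynomials_cmult const_polynomials)

lemma polynomials_coord_mult:
  assumes "q \<in> polynomials k" shows "(\<lambda>x. x $ j * q x) \<in> polynomials (Suc k)"
  using assms
proof (induction rule: polynomials_induct)
  case (monomial \<alpha>)
  have eq: "x $ j * (\<Prod>i\<in>UNIV. (x $ i) ^ \<alpha> i) = (\<Prod>i\<in>UNIV. (x $ i) ^ (\<alpha>(j := Suc (\<alpha> j))) i)" for x :: "real ^ 'a"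
  proof -
    have "(\<Prod>i\<in>UNIV. (x $ i) ^ (\<alpha>(j := Suc (\<alpha> j))) i) = (\<Prod>i\<in>UNIV. (if i = j then x $ j else 1) * (x $ i) ^ \<alpha> i)"
      by (intro prod.cong) auto
    then show ?thesis by (simp add: prod.distrib)
  qed
  have "(\<Sum>i\<in>UNIV. (\<alpha>(j := Suc (\<alpha> j))) i) \<le> Suc k"
  proof -
    have "(\<Sum>i\<in>UNIV. (\<alpha>(j := Suc (\<alpha> j))) i) = (\<Sum>i\<in>UNIV. (if i = j then 1 else 0) + \<alpha> i)"
      by (intro sum.cong) auto
    then show ?thesis using monomial by (simp add: sum.distrib)
  qed
  from monomial_polynomials[OF this] show ?case by (simp only: eq)
next
  show "(\<lambda>x. x $ j * (p x + q x)) \<in> polynomials (Suc k)"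
    if "(\<lambda>x. x $ j * p x) \<in> polynomials (Suc k)" "(\<lambda>x. x $ j * q x) \<in> polynomials (Suc k)" for p q
    using polynomials_add[OF that] by (simp add: distrib_left)
  show "(\<lambda>x. x $ j * (c * p x)) \<in> polynomials (Suc k)"
    if "(\<lambda>x. x $ j * p x) \<in> polynomials (Suc k)" for c p
    using polynomials_cmult[OF that, of c] by (simp add: mult.left_commute)
qed (simp add: const_polynomials)

lemma coord_prod_polynomials: "(\<lambda>y. coord_prod (y - x) js) \<in> polynomials (length js)"
proof (induction js)
  case (Cons j js)
  have "(\<lambda>y. y $ j * coord_prod (y - x) js + (- (x $ j)) * coord_prod (y - x) js) \<in> polynomials (Suc (length js))"
    using polynomials_mono[OF Cons, of "Suc (length js)"] Cons
    by (intro polynomials_add polynomials_coord_mult polynomials_cmult) simp_all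
  then show ?case by (simp add: left_diff_distrib)
qed (simp add: const_polynomials)

lemma smooth_coordinate: "smooth (\<lambda>x. x $ i)"
proof -
  have d: "((\<lambda>x. x $ i) has_derivative (\<lambda>h. h $ i)) (at x)" for x :: "real ^ 'a"
    by (rule bounded_linear_imp_has_derivative[OF bounded_linear_vec_nth])
  have "partial_derivative j (\<lambda>x. x $ i) = (\<lambda>x. axis j 1 $ i)" for j
    by (rule ext) (rule partial_derivative_eq[OF d])
  moreover have "(\<lambda>x. x $ i) differentiable at x" for x :: "real ^ 'a"
    using d by (auto simp: differentiable_def)
  ultimately have "smooth_upto k (\<lambda>x. x $ i)" for k
    by (cases k) (auto simp: smooth_upto_0 smooth_upto_Suc smooth_upto_const)
  then show ?thesis by (simp add: smooth_iff)
qed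

lemma smooth_power: "smooth f \<Longrightarrow> smooth (\<lambda>x. f x ^ k)"
  by (induction k) (simp_all add: smooth_mult smooth_const)

lemma polynomials_smooth: "q \<in> polynomials m \<Longrightarrow> smooth q"
proof (induction rule: polynomials_induct)
  case (monomial \<alpha>)
  show ?case by (intro smooth_prod smooth_power smooth_coordinate)
qed (simp_all add: smooth_add smooth_cmult smooth_const)

lemma polynomials_measurable: "q \<in> polynomials m \<Longrightarrow> q \<in> borel_measurable borel"
  by (intro smooth_measurable polynomials_smooth)

section \<open>Ball means and the oscillation\<close>

definition ball_mean :: "real \<Rightarrow> (real ^ 'n \<Rightarrow> ennreal) \<Rightarrow> ennreal" where
  "ball_mean r f = ennreal (1 / (unit_ball_vol (real CARD('n)) * r ^ CARD('n))) *
     (\<integral>\<^sup>+h. f h * indicator (ball 0 r) h \<partial>lborel)"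

lemma unit_ball_vol_pos': "0 < unit_ball_vol (real k)"
  by (rule unit_ball_vol_pos) simp

lemma ball_mean_mono: "(\<And>h. norm h < r \<Longrightarrow> f h \<le> g h) \<Longrightarrow> ball_mean r f \<le> ball_mean r g"
  unfolding ball_mean_def by (intro mult_left_mono nn_integral_mono) (auto simp: indicator_def)

lemma ball_mean_mono_AE: "(AE h in lborel. norm h < r \<longrightarrow> f h \<le> g h) \<Longrightarrow> ball_mean r f \<le> ball_mean r g"
  unfolding ball_mean_def
  by (intro mult_left_mono nn_integral_mono_AE) (auto simp: indicator_def elim!: eventually_mono)

lemma ball_mean_measurable [measurable]:
  assumes [measurable]: "(\<lambda>(x, h). f x h) \<in> borel_measurable (M \<Otimes>\<^sub>M borel)"
  shows "(\<lambda>x. ball_mean r (f x)) \<in> borel_measurable M"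
  unfolding ball_mean_def by measurable

lemma ball_mean_jensen:
  fixes f :: "real ^ 'n \<Rightarrow> ennreal"
  assumes A: "young_function A" and r: "0 < r" and [measurable]: "f \<in> borel_measurable borel"
  shows "young_ext A (ball_mean r f) \<le> ball_mean r (\<lambda>h. young_ext A (f h))"
proof -
  note [measurable] = young_ext_measurable[OF A]
  let ?c = "ennreal (1 / (unit_ball_vol (real CARD('n)) * r ^ CARD('n)))"
  let ?M = "density lborel (\<lambda>h :: real ^ 'n. ?c * indicator (ball 0 r) h)"
  have mean: "(\<integral>\<^sup>+h. g h \<partial>?M) = ball_mean r g" if [measurable]: "g \<in> borel_measurable borel" for g
    unfolding ball_mean_def by (subst nn_integral_cmult[symmetric]) (auto simp: nn_integral_density mult_ac)
  have "emeasure ?M (space ?M) = ball_mean r (\<lambda>h :: real ^ 'n. 1)"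
    by (subst nn_integral_indicator[symmetric]) (auto simp: mean ball_mean_def simp del: nn_integral_indicator nn_integral_const)
  also have "\<dots> = 1"
    using r unit_ball_vol_pos'[of "CARD('n)"]
    by (simp add: ball_mean_def emeasure_ball less_imp_neq[symmetric] flip: ennreal_mult)
  finally have M: "emeasure ?M (space ?M) = 1" .
  show ?thesis using young_jensen[OF A M, of f] by (simp add: mean)
qed

lemma nn_integral_ball_mean:
  fixes f :: "real ^ 'n \<Rightarrow> ennreal"
  assumes [measurable]: "f \<in> borel_measurable borel" and r: "0 < r"
  shows "(\<integral>\<^sup>+y. f y * indicator (ball x r) y \<partial>lborel) / emeasure lborel (ball x r) = ball_mean r (\<lambda>h. f (x + h))"
proof -
  have "(\<integral>\<^sup>+y. f y * indicator (ball x r) y \<partial>lborel) = (\<integral>\<^sup>+h. f (x + h) * indicator (ball 0 r) h \<partial>lborel)"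
    using nn_integral_translate[of "\<lambda>y. f y * indicator (ball x r) y" x]
    by (simp add: indicator_def dist_norm)
  then show ?thesis using r unit_ball_vol_pos'[of "CARD('n)"]
    by (simp add: ball_mean_def emeasure_ball divide_ennreal_def inverse_ennreal mult.commute inverse_eq_divide)
qed

lemma osc_altdef:
  fixes u :: "real ^ 'n \<Rightarrow> real"
  assumes [measurable]: "u \<in> borel_measurable borel" and r: "0 < r"
  shows "osc s u x r = (INF q\<in>polynomials (nat \<lfloor>s\<rfloor>). ball_mean r (\<lambda>h. ennreal (\<bar>u (x + h) - q (x + h)\<bar> / r powr s)))"
  unfolding osc_def
proof (intro INF_cong refl)
  fix q :: "real ^ 'n \<Rightarrow> real" assume "q \<in> polynomials (nat \<lfloor>s\<rfloor>)"
  then have [measurable]: "q \<in> borel_measurable borel" by (rule polynomials_measurable)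
  show "(\<integral>\<^sup>+y\<in>ball x r. ennreal (\<bar>u y - q y\<bar> / r powr s) \<partial>lebesgue) / emeasure lebesgue (ball x r)
    = ball_mean r (\<lambda>h. ennreal (\<bar>u (x + h) - q (x + h)\<bar> / r powr s))"
    unfolding nn_integral_completion using nn_integral_ball_mean[of "\<lambda>y. ennreal (\<bar>u y - q y\<bar> / r powr s)" r x] r
    by simp
qed

section \<open>From fractional Sobolev spaces to oscillation spaces\<close>

text \<open>Integration over the radii r > |h| turns the ball normalisation r^(-n) and the measure
  dr / r into |h|^(-n), the weight of the fractional seminorm. Raising the numerator from 1 to n
  gives an exact antiderivative.\<close>

lemma nn_integral_radii:
  fixes a b :: real
  assumes "0 < a" and that: "0 < b" "0 < n"
  shows "(\<integral>\<^sup>+r. ennreal (1 / (b * r ^ Suc n)) * indicator {a<..<1} r \<partial>lborel) \<le> ennreal (1 / (b * a ^ n))"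
proof -
  have "(\<integral>\<^sup>+r. ennreal (1 / (b * r ^ Suc n)) * indicator {a<..<1} r \<partial>lborel)
     \<le> (\<integral>\<^sup>+r. ennreal (real n / (b * r ^ Suc n)) * indicator {a..} r \<partial>lborel)"
    using that assms by (intro nn_integral_mono) (auto simp: indicator_def intro!: ennreal_leI divide_right_mono)
  also have "\<dots> = ennreal (0 - (- (1 / (b * a ^ n))))"
  proof (rule nn_integral_FTC_atLeast)
    fix r :: real assume r: "a \<le> r"
    show "0 \<le> real n / (b * r ^ Suc n)" using r assms that by simp
    have "((\<lambda>r. - (1 / b) * inverse (r ^ n)) has_real_derivative
        (- (1 / b)) * (- (inverse (r ^ n) * (real n * r ^ (n - 1)) * inverse (r ^ n)))) (at r)"
      using r assms by (auto intro!: derivative_eq_intros)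
    moreover have "(- (1 / b)) * (- (inverse (r ^ n) * (real n * r ^ (n - 1)) * inverse (r ^ n))) = real n / (b * r ^ Suc n)"
    proof -
      have "r ^ n = r * r ^ (n - 1)" using that by (metis power_minus_mult mult.commute)
      then show ?thesis using r assms that by (simp add: field_simps)
    qed
    ultimately show "((\<lambda>r. - (1 / (b * r ^ n))) has_real_derivative real n / (b * r ^ Suc n)) (at r)"
      by (simp add: field_simps)
  next
    have "((\<lambda>r::real. inverse (r ^ n)) \<longlongrightarrow> 0) at_top"
      using that by (intro tendsto_inverse_0_at_top filterlim_pow_at_top filterlim_ident)
    from tendsto_mult[OF tendsto_const[of "- (1 / b)"] this]
    show "((\<lambda>r. - (1 / (b * r ^ n))) \<longlongrightarrow> 0) at_top" by (simp add: field_simps)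
  qed measurable
  finally show ?thesis by simp
qed

text \<open>The measure dh / |h|^n is invariant under dilations; this removes the position t on the
  segment from the final bound.\<close>

lemma nn_integral_scale_invariant:
  fixes f :: "real ^ 'n \<Rightarrow> ennreal"
  assumes [measurable]: "f \<in> borel_measurable borel" and t: "0 < t"
  shows "(\<integral>\<^sup>+h. f (t *\<^sub>R h) * ennreal (1 / norm h ^ CARD('n)) \<partial>lborel) = (\<integral>\<^sup>+z. f z * ennreal (1 / norm z ^ CARD('n)) \<partial>lborel)"
proof -
  have "(\<integral>\<^sup>+z. f z * ennreal (1 / norm z ^ CARD('n)) \<partial>lborel)
    = ennreal (\<bar>t\<bar> ^ CARD('n)) * (\<integral>\<^sup>+h. f (0 + t *\<^sub>R h) * ennreal (1 / norm (0 + t *\<^sub>R h) ^ CARD('n)) \<partial>lborel)"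
    by (subst nn_integral_affine[of _ t 0]) (use t in auto)
  also have "\<dots> = (\<integral>\<^sup>+h. ennreal (\<bar>t\<bar> ^ CARD('n)) * (f (0 + t *\<^sub>R h) * ennreal (1 / norm (0 + t *\<^sub>R h) ^ CARD('n))) \<partial>lborel)"
    by (subst nn_integral_cmult) auto
  also have "\<dots> = (\<integral>\<^sup>+h. f (t *\<^sub>R h) * ennreal (1 / norm h ^ CARD('n)) \<partial>lborel)"
  proof (intro nn_integral_cong)
    fix h :: "real ^ 'n"
    have "ennreal (\<bar>t\<bar> ^ CARD('n)) * ennreal (1 / norm (t *\<^sub>R h) ^ CARD('n)) = ennreal (1 / norm h ^ CARD('n))"
      using t by (simp add: power_mult_distrib flip: ennreal_mult)
    then show "ennreal (\<bar>t\<bar> ^ CARD('n)) * (f (0 + t *\<^sub>R h) * ennreal (1 / norm (0 + t *\<^sub>R h) ^ CARD('n)))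
      = f (t *\<^sub>R h) * ennreal (1 / norm h ^ CARD('n))"
      by (simp add: mult.left_commute)
  qed
  finally show ?thesis by simp
qed

text \<open>\<open>N\<close> averages over the segment from \<open>x\<close> to \<open>x + h\<close>: it is uniform on \<open>[0, 1]\<close> when \<open>[s] > 0\<close>,
  and the point mass at \<open>1\<close> when \<open>[s] = 0\<close>.\<close>

lemma osc_modular_le:
  fixes V :: "real ^ 'n \<Rightarrow> real ^ 'n \<Rightarrow> real" and w :: "real ^ 'n \<Rightarrow> real \<Rightarrow> ennreal"
  assumes A: "young_function A"
    and V_meas [measurable]: "(\<lambda>(x, y). V x y) \<in> borel_measurable (borel \<Otimes>\<^sub>M borel)" and V0: "\<And>x y. 0 \<le> V x y"
    and \<sigma>: "0 < \<sigma>" and C: "0 < C" and l: "0 < l"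
    and N: "sigma_finite_measure N" and N_sets [measurable_cong]: "sets N = sets borel"
    and N1: "emeasure N (space N) = 1" and N01: "AE t in N. 0 < t \<and> t \<le> 1"
    and bound: "AE x in lborel. \<forall>r\<in>{0<..<1}. w x r \<le>
      ball_mean r (\<lambda>h. \<integral>\<^sup>+t. ennreal (C * V (x + t *\<^sub>R h) x / r powr \<sigma>) \<partial>N)"
  shows "(\<integral>\<^sup>+r\<in>{0<..<1}. ((\<integral>\<^sup>+x. young_ext A (w x r / ennreal (C * l)) \<partial>lborel) / ennreal r) \<partial>lborel)
    \<le> ennreal (1 / unit_ball_vol (real CARD('n))) *
      (\<integral>\<^sup>+x. \<integral>\<^sup>+z. young_ext A (ennreal (V (x + z) x / (l * norm z powr \<sigma>))) * ennreal (1 / norm z ^ CARD('n)) \<partial>lborel \<partial>lborel)"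
proof -
  note [measurable] = young_ext_measurable[OF A]
  interpret N: sigma_finite_measure N by (rule N)
  interpret LN: pair_sigma_finite "lborel :: (real ^ 'n) measure" N ..
  let ?om = "unit_ball_vol (real CARD('n))"
  have om: "0 < ?om" by (rule unit_ball_vol_pos')
  have V_meas': "(\<lambda>x. V (f x) (g x)) \<in> borel_measurable M" if "f \<in> measurable M borel" "g \<in> measurable M borel" for f g and M :: "'b measure"
    using measurable_compose[OF measurable_Pair[OF that] V_meas] by simp
  define F where "F x z = young_ext A (ennreal (V (x + z) x / (l * norm z powr \<sigma>)))" for x z
  have F_meas [measurable]: "(\<lambda>(x, z). F x z) \<in> borel_measurable (borel \<Otimes>\<^sub>M borel)"
    unfolding F_def using measurable_compose[OF measurable_Pair V_meas, of "\<lambda>(x, z). x + z" "borel \<Otimes>\<^sub>M borel" fst]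
    by (simp add: case_prod_unfold)
  have V_meas2 [measurable]: "(\<lambda>(x, y, r). V (x + y) x) \<in> borel_measurable (borel \<Otimes>\<^sub>M borel \<Otimes>\<^sub>M borel)"
    using measurable_compose[OF measurable_Pair V_meas, of "\<lambda>(x, z, r). x + z" "borel \<Otimes>\<^sub>M borel \<Otimes>\<^sub>M borel" fst]
    by (simp add: case_prod_unfold)
  define P where "P x h = (\<integral>\<^sup>+t. F x (t *\<^sub>R h) \<partial>N)" for x h
  have P_meas [measurable]: "(\<lambda>(x, h). P x h) \<in> borel_measurable (borel \<Otimes>\<^sub>M borel)"
    unfolding P_def by measurable
  \<comment> \<open>Ball normalisation, the factor 1 / r and the restrictions |h| < r < 1 in one
    kernel, ready for interchanging the integrals.\<close>
  define \<kappa> where "\<kappa> r h = ennreal (1 / (?om * r ^ Suc CARD('n))) * (if norm h < r \<and> r < 1 then 1 else 0)" for r and h :: "real ^ 'n"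
  have \<kappa>_meas [measurable]: "(\<lambda>(r, h). \<kappa> r h) \<in> borel_measurable (borel \<Otimes>\<^sub>M borel)"
    unfolding \<kappa>_def by measurable
  have pointwise: "(\<integral>\<^sup>+x. young_ext A (w x r / ennreal (C * l)) \<partial>lborel) / ennreal r \<le> (\<integral>\<^sup>+x. \<integral>\<^sup>+h. P x h * \<kappa> r h \<partial>lborel \<partial>lborel)"
    if r: "r \<in> {0<..<1}" for r
  proof -
    have r0: "0 < r" "r < 1" using r by auto
    have "AE x in lborel. young_ext A (w x r / ennreal (C * l)) \<le> ball_mean r (P x)"
      using bound
    proof eventually_elim
      case (elim x)
      have Vx [measurable]: "(\<lambda>z. V (x + z) x) \<in> borel_measurable borel" by measurable
      have "w x r / ennreal (C * l) = ennreal (1 / (C * l)) * w x r"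
        using C l by (simp add: divide_ennreal_def inverse_ennreal mult.commute inverse_eq_divide)
      also have "\<dots> \<le> ennreal (1 / (C * l)) * ball_mean r (\<lambda>h. \<integral>\<^sup>+t. ennreal (C * V (x + t *\<^sub>R h) x / r powr \<sigma>) \<partial>N)"
        using elim r by (intro mult_left_mono) auto
      also have "\<dots> = ball_mean r (\<lambda>h. \<integral>\<^sup>+t. ennreal (V (x + t *\<^sub>R h) x / (l * r powr \<sigma>)) \<partial>N)"
      proof -
        have "ball_mean r (\<lambda>h. \<integral>\<^sup>+t. ennreal (V (x + t *\<^sub>R h) x / (l * r powr \<sigma>)) \<partial>N)
          = ball_mean r (\<lambda>h. ennreal (1 / (C * l)) * (\<integral>\<^sup>+t. ennreal (C * V (x + t *\<^sub>R h) x / r powr \<sigma>) \<partial>N))"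
        proof (rule arg_cong[where f="ball_mean r"], rule ext)
          fix h
          have "(\<integral>\<^sup>+t. ennreal (V (x + t *\<^sub>R h) x / (l * r powr \<sigma>)) \<partial>N)
            = (\<integral>\<^sup>+t. ennreal (1 / (C * l)) * ennreal (C * V (x + t *\<^sub>R h) x / r powr \<sigma>) \<partial>N)"
            using C l r0 V0 by (intro nn_integral_cong) (simp flip: ennreal_mult)
          also have "\<dots> = ennreal (1 / (C * l)) * (\<integral>\<^sup>+t. ennreal (C * V (x + t *\<^sub>R h) x / r powr \<sigma>) \<partial>N)"
            by (rule nn_integral_cmult) measurable
          finally show "(\<integral>\<^sup>+t. ennreal (V (x + t *\<^sub>R h) x / (l * r powr \<sigma>)) \<partial>N) = \<dots>" .
        qed
        also have "\<dots> = ennreal (1 / (C * l)) * ball_mean r (\<lambda>h. \<integral>\<^sup>+t. ennreal (C * V (x + t *\<^sub>R h) x / r powr \<sigma>) \<partial>N)"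
          unfolding ball_mean_def by (simp only: mult.assoc) (subst nn_integral_cmult, measurable, simp add: mult.left_commute)
        finally show ?thesis by simp
      qed
      finally have "young_ext A (w x r / ennreal (C * l)) \<le> young_ext A (ball_mean r (\<lambda>h. \<integral>\<^sup>+t. ennreal (V (x + t *\<^sub>R h) x / (l * r powr \<sigma>)) \<partial>N))"
        by (rule young_ext_mono[OF A])
      \<comment> \<open>Jensen's inequality twice: over the ball, then over the segment.\<close>
      also have "\<dots> \<le> ball_mean r (\<lambda>h. young_ext A (\<integral>\<^sup>+t. ennreal (V (x + t *\<^sub>R h) x / (l * r powr \<sigma>)) \<partial>N))"
        by (rule ball_mean_jensen[OF A r0(1)]) measurable
      also have "\<dots> \<le> ball_mean r (\<lambda>h. \<integral>\<^sup>+t. young_ext A (ennreal (V (x + t *\<^sub>R h) x / (l * r powr \<sigma>))) \<partial>N)"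
        by (intro ball_mean_mono young_jensen[OF A N1]) measurable
      also have "\<dots> \<le> ball_mean r (P x)"
      proof (rule ball_mean_mono_AE)
        have "AE h :: real ^ 'n in lborel. h \<noteq> 0" by (rule AE_lborel_singleton)
        then show "AE h in lborel. norm h < r \<longrightarrow>
          (\<integral>\<^sup>+t. young_ext A (ennreal (V (x + t *\<^sub>R h) x / (l * r powr \<sigma>))) \<partial>N) \<le> P x h"
        proof eventually_elim
          case (elim h)
          show ?case unfolding P_def
          proof (intro impI nn_integral_mono_AE)
            assume h: "norm h < r"
            show "AE t in N. young_ext A (ennreal (V (x + t *\<^sub>R h) x / (l * r powr \<sigma>))) \<le> F x (t *\<^sub>R h)"
              using N01
            proof eventually_elim
              case (elim t)
              \<comment> \<open>Points of the segment have distance at most |h| < r from x, so r may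
                be replaced by |t h| in the denominator. Here t h is nonzero almost
                everywhere.\<close>
              have "norm (t *\<^sub>R h) \<le> 1 * norm h" using elim by (simp add: mult_left_le_one_le)
              then have "norm (t *\<^sub>R h) powr \<sigma> \<le> r powr \<sigma>"
                using h \<sigma> by (intro powr_mono2) auto
              moreover have "0 < norm (t *\<^sub>R h) powr \<sigma>" using elim \<open>h \<noteq> 0\<close> by simp
              ultimately have "V (x + t *\<^sub>R h) x / (l * r powr \<sigma>) \<le> V (x + t *\<^sub>R h) x / (l * norm (t *\<^sub>R h) powr \<sigma>)"
                using l V0 by (intro divide_left_mono mult_left_mono mult_pos_pos) auto
              then show ?case unfolding F_def by (intro young_ext_mono[OF A] ennreal_leI)
            qed
          qed
        qed
      qed
      finally show ?case .
    qed
    then have "(\<integral>\<^sup>+x. young_ext A (w x r / ennreal (C * l)) \<partial>lborel) \<le> (\<integral>\<^sup>+x. ball_mean r (P x) \<partial>lborel)"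
      by (rule nn_integral_mono_AE)
    then have "(\<integral>\<^sup>+x. young_ext A (w x r / ennreal (C * l)) \<partial>lborel) / ennreal r \<le> (\<integral>\<^sup>+x. ball_mean r (P x) \<partial>lborel) / ennreal r"
      by (rule divide_right_mono_ennreal)
    also have "\<dots> = ennreal (1 / r) * (\<integral>\<^sup>+x. ball_mean r (P x) \<partial>lborel)"
      using r0 by (simp add: divide_ennreal_def inverse_ennreal mult.commute inverse_eq_divide)
    also have "\<dots> = (\<integral>\<^sup>+x. ennreal (1 / r) * ball_mean r (P x) \<partial>lborel)"
      by (rule nn_integral_cmult[symmetric]) measurable
    also have "\<dots> = (\<integral>\<^sup>+x. \<integral>\<^sup>+h. P x h * \<kappa> r h \<partial>lborel \<partial>lborel)"
    proof (rule nn_integral_cong)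
      fix x :: "real ^ 'n"
      have "ennreal (1 / r) * ball_mean r (P x) = ennreal (1 / (?om * r ^ Suc CARD('n))) * (\<integral>\<^sup>+h. P x h * indicator (ball 0 r) h \<partial>lborel)"
        unfolding ball_mean_def mult.assoc[symmetric] using r0 om by (simp flip: ennreal_mult add: mult_ac)
      also have "\<dots> = (\<integral>\<^sup>+h. ennreal (1 / (?om * r ^ Suc CARD('n))) * (P x h * indicator (ball 0 r) h) \<partial>lborel)"
        by (rule nn_integral_cmult[symmetric]) measurable
      also have "\<dots> = (\<integral>\<^sup>+h. P x h * \<kappa> r h \<partial>lborel)"
        using r0 by (intro nn_integral_cong) (auto simp: \<kappa>_def indicator_def mult_ac)
      finally show "ennreal (1 / r) * ball_mean r (P x) = (\<integral>\<^sup>+h. P x h * \<kappa> r h \<partial>lborel)" .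
    qed
    finally show ?thesis .
  qed
  have "(\<integral>\<^sup>+r\<in>{0<..<1}. ((\<integral>\<^sup>+x. young_ext A (w x r / ennreal (C * l)) \<partial>lborel) / ennreal r) \<partial>lborel)
     \<le> (\<integral>\<^sup>+r. \<integral>\<^sup>+x. \<integral>\<^sup>+h. P x h * \<kappa> r h \<partial>lborel \<partial>lborel \<partial>lborel)"
    by (intro nn_integral_mono) (use pointwise in \<open>auto simp: indicator_def\<close>)
  also have "\<dots> = (\<integral>\<^sup>+x. \<integral>\<^sup>+r. \<integral>\<^sup>+h. P x h * \<kappa> r h \<partial>lborel \<partial>lborel \<partial>lborel)"
    by (rule lborel_pair.Fubini') measurable
  also have "\<dots> = (\<integral>\<^sup>+x. \<integral>\<^sup>+h. \<integral>\<^sup>+r. P x h * \<kappa> r h \<partial>lborel \<partial>lborel \<partial>lborel)"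
    by (intro nn_integral_cong lborel_pair.Fubini') measurable
  \<comment> \<open>The radius is integrated out for each h other than 0.\<close>
  also have "\<dots> \<le> (\<integral>\<^sup>+x. \<integral>\<^sup>+h. ennreal (1 / ?om) * (P x h * ennreal (1 / norm h ^ CARD('n))) \<partial>lborel \<partial>lborel)"
  proof (rule nn_integral_mono, rule nn_integral_mono_AE)
    fix x :: "real ^ 'n"
    have "AE h :: real ^ 'n in lborel. h \<noteq> 0" by (rule AE_lborel_singleton)
    then show "AE h in lborel. (\<integral>\<^sup>+r. P x h * \<kappa> r h \<partial>lborel) \<le> ennreal (1 / ?om) * (P x h * ennreal (1 / norm h ^ CARD('n)))"
    proof eventually_elim
      case (elim h)
      have "(\<integral>\<^sup>+r. P x h * \<kappa> r h \<partial>lborel) = P x h * (\<integral>\<^sup>+r. \<kappa> r h \<partial>lborel)"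
        by (rule nn_integral_cmult) measurable
      also have "(\<integral>\<^sup>+r. \<kappa> r h \<partial>lborel) \<le> ennreal (1 / (?om * norm h ^ CARD('n)))"
        using nn_integral_radii[of "norm h" ?om "CARD('n)"] elim om by (simp add: \<kappa>_def indicator_def of_bool_def)
      also have "ennreal (1 / (?om * norm h ^ CARD('n))) = ennreal (1 / ?om) * ennreal (1 / norm h ^ CARD('n))"
        using om by (simp flip: ennreal_mult)
      finally show ?case by (simp add: mult.left_commute mult_left_mono)
    qed
  qed
  also have "\<dots> = (\<integral>\<^sup>+x. ennreal (1 / ?om) * (\<integral>\<^sup>+h. P x h * ennreal (1 / norm h ^ CARD('n)) \<partial>lborel) \<partial>lborel)"
    by (intro nn_integral_cong nn_integral_cmult) measurable
  also have "\<dots> = ennreal (1 / ?om) * (\<integral>\<^sup>+x. \<integral>\<^sup>+h. P x h * ennreal (1 / norm h ^ CARD('n)) \<partial>lborel \<partial>lborel)"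
    by (intro nn_integral_cmult) measurable
  also have "(\<integral>\<^sup>+x. \<integral>\<^sup>+h. P x h * ennreal (1 / norm h ^ CARD('n)) \<partial>lborel \<partial>lborel)
    = (\<integral>\<^sup>+x. \<integral>\<^sup>+z. F x z * ennreal (1 / norm z ^ CARD('n)) \<partial>lborel \<partial>lborel)"
  proof (rule nn_integral_cong)
    fix x :: "real ^ 'n"
    have [measurable]: "F x \<in> borel_measurable borel" by measurable
    have "(\<integral>\<^sup>+h. P x h * ennreal (1 / norm h ^ CARD('n)) \<partial>lborel)
      = (\<integral>\<^sup>+h. \<integral>\<^sup>+t. F x (t *\<^sub>R h) * ennreal (1 / norm h ^ CARD('n)) \<partial>N \<partial>lborel)"
      unfolding P_def by (intro nn_integral_cong nn_integral_multc[symmetric]) measurable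
    also have "\<dots> = (\<integral>\<^sup>+t. \<integral>\<^sup>+h. F x (t *\<^sub>R h) * ennreal (1 / norm h ^ CARD('n)) \<partial>lborel \<partial>N)"
      by (rule LN.Fubini'[symmetric]) measurable
    also have "\<dots> = (\<integral>\<^sup>+t. (\<integral>\<^sup>+z. F x z * ennreal (1 / norm z ^ CARD('n)) \<partial>lborel) \<partial>N)"
      by (rule nn_integral_cong_AE) (use N01 nn_integral_scale_invariant[of "F x"] in \<open>auto elim!: eventually_mono\<close>)
    also have "\<dots> = (\<integral>\<^sup>+z. F x z * ennreal (1 / norm z ^ CARD('n)) \<partial>lborel)"
      using N1 by simp
    finally show "(\<integral>\<^sup>+h. P x h * ennreal (1 / norm h ^ CARD('n)) \<partial>lborel)
      = (\<integral>\<^sup>+z. F x z * ennreal (1 / norm z ^ CARD('n)) \<partial>lborel)" .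
  qed
  finally show ?thesis by (simp add: F_def)
qed

section \<open>Modulars of Borel representatives\<close>

lemma luxemburg_finite_iff: "luxemburg \<Phi> < \<infinity> \<longleftrightarrow> (\<exists>l>0. \<Phi> l \<le> 1)"
proof
  assume "luxemburg \<Phi> < \<infinity>"
  then show "\<exists>l>0. \<Phi> l \<le> 1" unfolding luxemburg_def Inf_less_iff by auto
next
  assume "\<exists>l>0. \<Phi> l \<le> 1"
  then obtain l where "0 < l" "\<Phi> l \<le> 1" by blast
  then have "luxemburg \<Phi> \<le> ennreal l" unfolding luxemburg_def by (intro Inf_lower) auto
  then show "luxemburg \<Phi> < \<infinity>" by (simp add: order_le_less_trans)
qed

lemma orlicz_modular_eq:
  fixes u u' :: "real ^ 'n \<Rightarrow> real"
  assumes eq: "AE x in lebesgue. u x = u' x" and "0 < l"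
  shows "(\<integral>\<^sup>+x. A (\<bar>u x\<bar> / l) \<partial>lebesgue) = (\<integral>\<^sup>+x. young_ext A (ennreal (\<bar>u' x\<bar> / l)) \<partial>lborel)"
proof -
  have "(\<integral>\<^sup>+x. A (\<bar>u x\<bar> / l) \<partial>lebesgue) = (\<integral>\<^sup>+x. young_ext A (ennreal (\<bar>u' x\<bar> / l)) \<partial>lebesgue)"
    by (rule nn_integral_cong_AE) (use eq assms(2) in \<open>auto elim!: eventually_mono\<close>)
  then show ?thesis by (simp add: nn_integral_completion)
qed

text \<open>Linear growth of \<open>A\<close> bounds |u| by a multiple of the integrand of the
  modular plus a constant, and constants are integrable over balls.\<close>

lemma orlicz_finite_imp_loc_int:
  fixes u :: "real ^ 'n \<Rightarrow> real"
  assumes A: "young_function A" and [measurable]: "u \<in> borel_measurable borel"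
    and l: "0 < l" and fin: "(\<integral>\<^sup>+x. young_ext A (ennreal (\<bar>u x\<bar> / l)) \<partial>lborel) < \<infinity>"
  shows "loc_int u"
  unfolding loc_int_def
proof (intro conjI allI)
  note [measurable] = young_ext_measurable[OF A]
  fix R
  obtain a c where a: "0 < a" "0 \<le> c" and le: "\<And>t. ennreal a * t \<le> young_ext A t + ennreal c"
    using young_linear_growth[OF A] by blast
  have "(\<integral>\<^sup>+x. ennreal \<bar>u x\<bar> * indicator (cball 0 R) x \<partial>lborel)
    \<le> (\<integral>\<^sup>+x. ennreal (l / a) * (young_ext A (ennreal (\<bar>u x\<bar> / l)) + ennreal c * indicator (cball 0 R) x) \<partial>lborel)"
  proof (intro nn_integral_mono)
    fix x :: "real ^ 'n"
    have "ennreal \<bar>u x\<bar> = ennreal (l / a) * (ennreal a * ennreal (\<bar>u x\<bar> / l))"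
      using a l by (simp flip: ennreal_mult)
    also have "\<dots> \<le> ennreal (l / a) * (young_ext A (ennreal (\<bar>u x\<bar> / l)) + ennreal c)"
      by (intro mult_left_mono le) auto
    finally show "ennreal \<bar>u x\<bar> * indicator (cball 0 R) x
      \<le> ennreal (l / a) * (young_ext A (ennreal (\<bar>u x\<bar> / l)) + ennreal c * indicator (cball 0 R) x)"
      by (auto simp: indicator_def)
  qed
  also have "\<dots> = ennreal (l / a) * ((\<integral>\<^sup>+x. young_ext A (ennreal (\<bar>u x\<bar> / l)) \<partial>lborel)
      + ennreal c * emeasure lborel (cball (0 :: real ^ 'n) R))"
    by (subst nn_integral_cmult, measurable, subst nn_integral_add) (auto simp: nn_integral_cmult_indicator)
  also have "\<dots> < \<infinity>" using fin emeasure_bounded_finite[of "cball (0 :: real ^ 'n) R"]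
    by (simp add: ennreal_mult_less_top)
  finally show "(\<integral>\<^sup>+x. ennreal \<bar>u x\<bar> * indicator (cball 0 R) x \<partial>lborel) < \<infinity>" .
qed measurable

lemma osc_cong_AE:
  fixes u u' :: "real ^ 'n \<Rightarrow> real"
  assumes "AE x in lebesgue. u x = u' x"
  shows "osc s u x r = osc s u' x r"
proof -
  have "(\<integral>\<^sup>+y\<in>ball x r. ennreal (\<bar>u y - q y\<bar> / r powr s) \<partial>lebesgue) = (\<integral>\<^sup>+y\<in>ball x r. ennreal (\<bar>u' y - q y\<bar> / r powr s) \<partial>lebesgue)" for q
    by (rule nn_integral_cong_AE) (use assms in \<open>auto elim!: eventually_mono\<close>)
  then show ?thesis by (simp add: osc_def)
qed

text \<open>The modular of \<open>frac_seminorm\<close> in terms of the base point x and the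
  increment z, since oscillations are centred at x.\<close>

definition frac_modular ::
    "real \<Rightarrow> (real \<Rightarrow> ennreal) \<Rightarrow> 'i set \<Rightarrow> ('i \<Rightarrow> real ^ 'n \<Rightarrow> real) \<Rightarrow> real \<Rightarrow> ennreal" where
  "frac_modular \<sigma> A I W l = (\<integral>\<^sup>+x. \<integral>\<^sup>+z. young_ext A (ennreal (L2_set (\<lambda>i. W i (x + z) - W i x) I / (l * norm z powr \<sigma>)))
     * ennreal (1 / norm z ^ CARD('n)) \<partial>lborel \<partial>lborel)"

lemma L2_set_measurable [measurable]:
  assumes "\<And>i. i \<in> I \<Longrightarrow> f i \<in> borel_measurable M"
  shows "(\<lambda>x. L2_set (\<lambda>i. f i x) I) \<in> borel_measurable M"
  unfolding L2_set_def using assms by measurable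

lemma frac_modular_eq:
  fixes U W :: "'i \<Rightarrow> real ^ 'n \<Rightarrow> real"
  assumes A: "young_function A" and I: "finite I" and l: "0 < l"
    and W: "\<And>i. i \<in> I \<Longrightarrow> W i \<in> borel_measurable borel"
    and eq: "\<And>i. i \<in> I \<Longrightarrow> AE x in lebesgue. U i x = W i x"
  shows "(\<integral>\<^sup>+y. \<integral>\<^sup>+x. A (L2_set (\<lambda>i. U i x - U i y) I / (l * norm (x - y) powr \<sigma>)) /
     ennreal (norm (x - y) ^ CARD('n)) \<partial>lebesgue \<partial>lebesgue) = frac_modular \<sigma> A I W l"
proof -
  note [measurable] = young_ext_measurable[OF A]
  have ae: "AE x in lebesgue. \<forall>i\<in>I. U i x = W i x"
    by (rule AE_finite_allI[OF I eq])
  have div: "A (t / (l * norm z powr \<sigma>)) / ennreal (norm z ^ CARD('n))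
    = young_ext A (ennreal (t / (l * norm z powr \<sigma>))) * ennreal (1 / norm z ^ CARD('n))"
    if "0 \<le> t" for t and z :: "real ^ 'n"
  proof (cases "z = 0")
    \<comment> \<open>On the diagonal the argument of \<open>A\<close> is 0 by the convention for
      division, so both sides vanish.\<close>
    case True
    then show ?thesis by (simp add: young_0[OF A] young_ext_0[OF A])
  next
    case False
    then show ?thesis using l that
      by (simp add: divide_ennreal_def inverse_ennreal inverse_eq_divide)
  qed
  define K where "K x y = young_ext A (ennreal (L2_set (\<lambda>i. W i x - W i y) I / (l * norm (x - y) powr \<sigma>)))
     * ennreal (1 / norm (x - y) ^ CARD('n))" for x y
  have "(\<integral>\<^sup>+y. \<integral>\<^sup>+x. A (L2_set (\<lambda>i. U i x - U i y) I / (l * norm (x - y) powr \<sigma>)) /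
     ennreal (norm (x - y) ^ CARD('n)) \<partial>lebesgue \<partial>lebesgue) = (\<integral>\<^sup>+y. \<integral>\<^sup>+x. K x y \<partial>lebesgue \<partial>lebesgue)"
  proof (rule nn_integral_cong_AE, use ae in eventually_elim)
    case (elim y)
    show ?case
    proof (rule nn_integral_cong_AE, use ae in eventually_elim)
      case (elim x)
      have "L2_set (\<lambda>i. U i x - U i y) I = L2_set (\<lambda>i. W i x - W i y) I"
        using elim \<open>\<forall>i\<in>I. U i y = W i y\<close> by (intro L2_set_cong) auto
      then show ?case by (simp add: K_def div L2_set_nonneg)
    qed
  qed
  also have "\<dots> = (\<integral>\<^sup>+y. \<integral>\<^sup>+x. K x y \<partial>lborel \<partial>lborel)" by (simp add: nn_integral_completion)
  also have "\<dots> = frac_modular \<sigma> A I W l"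
    unfolding frac_modular_def
  proof (rule nn_integral_cong)
    fix y
    have [measurable]: "(\<lambda>x. L2_set (\<lambda>i. W i x - W i y) I) \<in> borel_measurable borel"
      using W by measurable
    have "(\<lambda>x. K x y) \<in> borel_measurable borel"
      unfolding K_def by measurable
    from nn_integral_translate[OF this, of y, symmetric]
    show "(\<integral>\<^sup>+x. K x y \<partial>lborel) = (\<integral>\<^sup>+z. young_ext A (ennreal (L2_set (\<lambda>i. W i (y + z) - W i y) I / (l * norm z powr \<sigma>)))
     * ennreal (1 / norm z ^ CARD('n)) \<partial>lborel)"
      by (simp add: K_def)
  qed
  finally show ?thesis .
qed

lemma frac_modular_antimono:
  assumes A: "young_function A" and l: "0 < l" "l \<le> l'"
  shows "frac_modular \<sigma> A I W l' \<le> frac_modular \<sigma> A I W l"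
  unfolding frac_modular_def
proof (intro nn_integral_mono mult_right_mono young_ext_mono[OF A] ennreal_leI)
  fix x z :: "real ^ 'b"
  show "L2_set (\<lambda>i. W i (x + z) - W i x) I / (l' * norm z powr \<sigma>) \<le> L2_set (\<lambda>i. W i (x + z) - W i x) I / (l * norm z powr \<sigma>)"
    by (cases "z = 0") (use l in \<open>auto intro!: divide_left_mono mult_right_mono mult_pos_pos simp: L2_set_nonneg\<close>)
qed simp

lemma sum_count_list: "(\<Sum>i\<in>UNIV. count_list js i) = length (js :: 'n::finite list)"
proof (induction js)
  case (Cons j js)
  have "(\<Sum>i\<in>UNIV. count_list (j # js) i) = (\<Sum>i\<in>UNIV. count_list js i + (if i = j then 1 else 0))"
    by (intro sum.cong) auto
  then show ?case using Cons by (simp add: sum.distrib)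
qed simp

lemma count_list_multi_indices: "length js = k \<Longrightarrow> count_list js \<in> multi_indices k"
  by (simp add: multi_indices_def sum_count_list)

definition sobolev_rep :: "nat \<Rightarrow> (real ^ 'n \<Rightarrow> real) \<Rightarrow> (('n \<Rightarrow> nat) \<Rightarrow> real ^ 'n \<Rightarrow> real) \<Rightarrow> bool" where
  "sobolev_rep m u W \<longleftrightarrow> (\<forall>k\<le>m. \<forall>\<alpha>\<in>multi_indices k. W \<alpha> \<in> borel_measurable borel \<and>
     (AE x in lebesgue. weak_derivative u \<alpha> x = W \<alpha> x))"

lemma has_weak_derivative_some:
  assumes "\<exists>v. has_weak_derivative u \<alpha> v" "\<alpha> \<noteq> (\<lambda>_. 0)"
  shows "has_weak_derivative u \<alpha> (weak_derivative u \<alpha>)"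
  using someI_ex[OF assms(1)] assms(2) by (simp add: weak_derivative_def)

lemma multi_indices_nonzero: "\<alpha> \<in> multi_indices k \<Longrightarrow> k \<noteq> 0 \<Longrightarrow> \<alpha> \<noteq> (\<lambda>_. 0)"
  by (auto simp: multi_indices_def)

lemma sobolev_rep_exists:
  fixes u :: "real ^ 'n \<Rightarrow> real"
  assumes u: "u \<in> sobolev_space m A"
  obtains W where "sobolev_rep m u W"
proof -
  have "\<exists>w. w \<in> borel_measurable borel \<and> (AE x in lebesgue. weak_derivative u \<alpha> x = w x)"
    if "k \<le> m" "\<alpha> \<in> multi_indices k" for k \<alpha>
  proof -
    have "weak_derivative u \<alpha> \<in> borel_measurable lebesgue"
    proof (cases "k = 0")
      case True
      then show ?thesis using u that
        by (simp add: multi_indices_0 weak_derivative_def sobolev_space_def orlicz_space_def)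
    next
      case False
      then have "\<exists>v. has_weak_derivative u \<alpha> v" using u that by (auto simp: sobolev_space_def)
      from has_weak_derivative_some[OF this multi_indices_nonzero[OF that(2) False]]
      show ?thesis by (simp add: has_weak_derivative_def locally_integrable_measurable)
    qed
    then show ?thesis using borel_representative by metis
  qed
  then have "\<forall>\<alpha>. \<exists>w. (\<exists>k\<le>m. \<alpha> \<in> multi_indices k) \<longrightarrow>
      w \<in> borel_measurable borel \<and> (AE x in lebesgue. weak_derivative u \<alpha> x = w x)" by blast
  then obtain W where "\<forall>\<alpha>. (\<exists>k\<le>m. \<alpha> \<in> multi_indices k) \<longrightarrow>
      W \<alpha> \<in> borel_measurable borel \<and> (AE x in lebesgue. weak_derivative u \<alpha> x = W \<alpha> x)" by metis
  then show thesis by (intro that[of W]) (auto simp: sobolev_rep_def)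
qed

text \<open>Weak derivatives are indexed by multi-indices, Taylor's formula by lists; a list stands
  for the multi-index that counts its entries. For order 0 local integrability comes from the Orlicz
  norm, for higher orders it is part of the weak derivative.\<close>

lemma sobolev_rep_weak_jet:
  fixes u :: "real ^ 'n \<Rightarrow> real"
  assumes A: "young_function A" and u: "u \<in> sobolev_space m A" and W: "sobolev_rep m u W"
  shows "weak_jet m (W (\<lambda>_. 0)) (\<lambda>js. W (count_list js))"
proof -
  have W0: "W (\<lambda>_. 0) \<in> borel_measurable borel" "AE x in lebesgue. u x = W (\<lambda>_. 0) x"
    using W by (auto simp: sobolev_rep_def multi_indices_0 weak_derivative_def)
  have u_meas: "u \<in> borel_measurable lebesgue" and "orlicz_norm A u < \<infinity>"
    using u by (auto simp: sobolev_space_def orlicz_space_def)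
  then obtain l where l: "0 < l" "(\<integral>\<^sup>+x. A (\<bar>u x\<bar> / l) \<partial>lebesgue) \<le> 1"
    unfolding orlicz_norm_def luxemburg_finite_iff by blast
  then have "(\<integral>\<^sup>+x. young_ext A (ennreal (\<bar>W (\<lambda>_. 0) x\<bar> / l)) \<partial>lborel) < \<infinity>"
    using orlicz_modular_eq[OF W0(2) l(1), of A] by (simp add: order_le_less_trans)
  then have L0: "loc_int (W (\<lambda>_. 0))" by (rule orlicz_finite_imp_loc_int[OF A W0(1) l(1)])
  have c0: "count_list [] = (\<lambda>_. 0)" by auto
  show ?thesis
    unfolding weak_jet_def
  proof (intro conjI allI impI)
    show "loc_int (W (\<lambda>_. 0))" by (rule L0)
    show "W (count_list []) = W (\<lambda>_. 0)" by (simp add: c0)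
    fix js :: "'n list" assume js: "length js \<le> m"
    define \<alpha> where "\<alpha> = count_list js"
    have \<alpha>: "\<alpha> \<in> multi_indices (length js)" unfolding \<alpha>_def by (rule count_list_multi_indices) simp
    have Wa: "W \<alpha> \<in> borel_measurable borel" "AE x in lebesgue. weak_derivative u \<alpha> x = W \<alpha> x"
      using W js \<alpha> by (auto simp: sobolev_rep_def)
    have "loc_int (W \<alpha>) \<and> (\<forall>\<phi>. test_function \<phi> \<longrightarrow> (\<integral>x. W (\<lambda>_. 0) x * iterated_partial js \<phi> x \<partial>lborel) =
      (- 1) ^ length js * (\<integral>x. W \<alpha> x * \<phi> x \<partial>lborel))"
    proof (cases "js = []")
      case True
      then show ?thesis using L0 by (simp add: \<alpha>_def c0)
    next
      case False
      then have wd: "has_weak_derivative u \<alpha> (weak_derivative u \<alpha>)"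
        using u js \<alpha> by (intro has_weak_derivative_some multi_indices_nonzero[OF \<alpha>])
          (auto simp: sobolev_space_def Suc_le_eq)
      have li: "locally_integrable (weak_derivative u \<alpha>)" using wd by (simp add: has_weak_derivative_def)
      have "locally_integrable (W \<alpha>)"
        by (rule locally_integrable_cong_AE[OF Wa(2) measurable_completion li]) (use Wa(1) in simp)
      then have "loc_int (W \<alpha>)" by (simp add: locally_integrable_iff_loc_int[OF Wa(1)])
      moreover have "(\<integral>x. W (\<lambda>_. 0) x * iterated_partial js \<phi> x \<partial>lborel) =
        (- 1) ^ length js * (\<integral>x. W \<alpha> x * \<phi> x \<partial>lborel)" if \<phi>: "test_function \<phi>" for \<phi>
      proof -
        have m: "\<phi> \<in> borel_measurable borel" "iterated_partial js \<phi> \<in> borel_measurable borel"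
          using \<phi> by (auto intro!: smooth_measurable test_function_smooth smooth_iterated_partial)
        have "(\<integral>x. u x * iterated_partial js \<phi> x \<partial>lebesgue) =
          (- 1) ^ (\<Sum>i\<in>UNIV. \<alpha> i) * (\<integral>x. weak_derivative u \<alpha> x * \<phi> x \<partial>lebesgue)"
          using wd \<phi> by (simp add: has_weak_derivative_def \<alpha>_def)
        then show ?thesis
          unfolding integral_lebesgue_cong_AE_borel[OF W0(2) u_meas W0(1) m(2)]
            integral_lebesgue_cong_AE_borel[OF Wa(2) locally_integrable_measurable[OF li] Wa(1) m(1)]
          by (simp add: \<alpha>_def sum_count_list)
      qed
      ultimately show ?thesis by blast
    qed
    then show "loc_int (W (count_list js))"
      "test_function \<phi> \<Longrightarrow> (\<integral>x. W (\<lambda>_. 0) x * iterated_partial js \<phi> x \<partial>lborel) =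
      (- 1) ^ length js * (\<integral>x. W (count_list js) x * \<phi> x \<partial>lborel)" for \<phi>
      by (auto simp: \<alpha>_def)
  qed
qed

section \<open>Pointwise bound of the oscillation by averaged increments of the top
  derivatives\<close>

lemma coord_prod_measurable [measurable]: "(\<lambda>h. coord_prod h js) \<in> borel_measurable borel"
proof (induction js)
  case (Cons i js)
  have "(\<lambda>h. h $ i) \<in> borel_measurable borel"
    by (intro borel_measurable_continuous_onI continuous_intros)
  then show ?case using Cons by (simp add: borel_measurable_times)
qed simp

text \<open>For m = 0 the remainder is the increment u(x + h) - u(x) itself, at the end t = 1. Both
  cases are probability measures and share one modular estimate.\<close>

definition segment_measure :: "nat \<Rightarrow> real measure" where
  "segment_measure m = (let U = density lborel (indicator {0..1}) in
    if m = 0 then distr U borel (\<lambda>_. 1) else U)"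

lemma sets_segment_measure [measurable_cong]: "sets (segment_measure m) = sets borel"
  by (simp add: segment_measure_def Let_def)

lemma emeasure_segment_measure: "emeasure (segment_measure m) (space (segment_measure m)) = 1"
  by (simp add: segment_measure_def Let_def emeasure_density emeasure_distr space_density)

lemma sigma_finite_segment_measure: "sigma_finite_measure (segment_measure m)"
proof -
  have "finite_measure (segment_measure m)"
    by (rule finite_measureI) (simp add: emeasure_segment_measure)
  then show ?thesis by (rule finite_measure.axioms(1))
qed

lemma AE_segment_measure: "AE t in segment_measure m. 0 < t \<and> t \<le> 1"
proof (cases "m = 0")
  case True
  then show ?thesis unfolding segment_measure_def Let_def by (simp add: AE_distr_iff)
next
  case False
  have "AE t in density lborel (indicator {0..1::real}). 0 < t \<and> t \<le> 1"
  proof (subst AE_density)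
    show "AE x in lborel. 0 < (indicator {0..1::real} x :: ennreal) \<longrightarrow> 0 < x \<and> x \<le> 1"
      using AE_lborel_singleton[of "0 :: real"]
      by eventually_elim (auto simp: indicator_def less_le split: if_splits)
  qed simp
  then show ?thesis using False unfolding segment_measure_def Let_def by simp
qed

text \<open>\<open>Q\<close> is the Taylor polynomial of degree m, one more than in
  \<open>weak_taylor\<close>: since the weight has mass 1 / m!, its top terms turn D(x + t h) in the
  remainder into D(x + t h) - D(x), which \<open>V\<close> dominates.\<close>

lemma taylor_remainder_le:
  fixes u :: "real ^ 'n \<Rightarrow> real"
  assumes jet: "weak_jet m u D" and [measurable]: "(\<lambda>(x, y). V x y) \<in> borel_measurable (borel \<Otimes>\<^sub>M borel)"
    and V: "\<And>js x y. length js = m \<Longrightarrow> \<bar>D js x - D js y\<bar> \<le> V x y"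
  defines "Q \<equiv> \<lambda>x h. \<Sum>k\<le>m. (\<Sum>js | length js = k. coord_prod h js * D js x) / fact k"
  shows "AE x in lborel. ennreal \<bar>u (x + h) - Q x h\<bar> \<le>
    ennreal (real (card {js :: 'n list. length js = m}) * norm h ^ m) * (\<integral>\<^sup>+t. ennreal (V (x + t *\<^sub>R h) x) \<partial>segment_measure m)"
proof (cases "m = 0")
  case True
  have c: "{js :: 'n list. length js = 0} = {[]}" by auto
  have Vx [measurable]: "(\<lambda>t. ennreal (V (x + t *\<^sub>R h) x)) \<in> borel_measurable borel" for x by measurable
  have "D [] = u" using jet by (simp add: weak_jet_def)
  then have "\<bar>u (x + h) - Q x h\<bar> \<le> V (x + h) x" for x
    using V[of "[]" "x + h" x] True by (simp add: Q_def c del: length_0_conv)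
  then show ?thesis using True
    by (intro AE_I2) (simp add: segment_measure_def Let_def nn_integral_distr emeasure_density c ennreal_leI del: length_0_conv)
next
  case False
  have D: "\<And>js. length js \<le> m \<Longrightarrow> loc_int (D js)" using jet by (auto simp: weak_jet_def)
  let ?w = "taylor_weight m"
  have iw: "integrable lborel ?w"
  proof (rule Bochner_Integration.integrable_bound)
    show "integrable lborel (indicator {0..1::real} :: real \<Rightarrow> real)" by (intro integrable_real_indicator) auto
    show "AE x in lborel. norm (?w x) \<le> norm (indicator {0..1} x :: real)"
      using taylor_weight_le[of m] taylor_weight_nonneg[of m] by (intro AE_I2) (simp add: abs_of_nonneg)
  qed measurable
  have seg: "(\<integral>\<^sup>+t. f t \<partial>segment_measure m) = (\<integral>\<^sup>+t. f t * indicator {0..1} t \<partial>lborel)"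
    if [measurable]: "f \<in> borel_measurable borel" for f
    using False by (simp add: segment_measure_def Let_def nn_integral_density mult.commute)
  have dev: "ennreal \<bar>(\<integral>t. ?w t * D js (x + t *\<^sub>R h) \<partial>lborel) - D js x / fact m\<bar>
    \<le> (\<integral>\<^sup>+t. ennreal (V (x + t *\<^sub>R h) x) \<partial>segment_measure m)" if js: "length js = m" for js x
  proof -
    have [measurable]: "D js \<in> borel_measurable borel" using D js by (simp add: loc_int_def)
    have le: "(\<integral>\<^sup>+t. ennreal (norm (?w t * (D js (x + t *\<^sub>R h) - D js x))) \<partial>lborel)
      \<le> (\<integral>\<^sup>+t. ennreal (V (x + t *\<^sub>R h) x) \<partial>segment_measure m)"
    proof (subst seg)
      show "(\<integral>\<^sup>+t. ennreal (norm (?w t * (D js (x + t *\<^sub>R h) - D js x))) \<partial>lborel)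
        \<le> (\<integral>\<^sup>+t. ennreal (V (x + t *\<^sub>R h) x) * indicator {0..1} t \<partial>lborel)"
      proof (rule nn_integral_mono)
        fix t
        have "norm (?w t * (D js (x + t *\<^sub>R h) - D js x)) \<le> indicator {0..1} t * V (x + t *\<^sub>R h) x"
          unfolding norm_mult using taylor_weight_le[of m t] taylor_weight_nonneg[of m t] V[OF js, of "x + t *\<^sub>R h" x]
          by (intro mult_mono) auto
        then show "ennreal (norm (?w t * (D js (x + t *\<^sub>R h) - D js x))) \<le> ennreal (V (x + t *\<^sub>R h) x) * indicator {0..1} t"
          by (cases "t \<in> {0..1}") (auto simp: ennreal_leI)
      qed
    qed measurable
    show ?thesis
    proof (cases "integrable lborel (\<lambda>t. ?w t * (D js (x + t *\<^sub>R h) - D js x))")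
      case True
      have "integrable lborel (\<lambda>t. ?w t * (D js (x + t *\<^sub>R h) - D js x) + ?w t * D js x)"
        by (intro Bochner_Integration.integrable_add True integrable_mult_left iw)
      then have i: "integrable lborel (\<lambda>t. ?w t * D js (x + t *\<^sub>R h))" by (simp add: algebra_simps)
      have "(\<integral>t. ?w t * (D js (x + t *\<^sub>R h) - D js x) \<partial>lborel) = (\<integral>t. ?w t * D js (x + t *\<^sub>R h) \<partial>lborel) - D js x / fact m"
        using i iw False by (simp add: right_diff_distrib integral_taylor_weight)
      then show ?thesis using integral_norm_bound_ennreal[OF True] le by simp
    next
      \<comment> \<open>If the weighted increment is not integrable along the segment, the Bochner
        integral carries no information, but then the right side is infinite.\<close>
      case False
      have "\<not> (\<integral>\<^sup>+t. ennreal (norm (?w t * (D js (x + t *\<^sub>R h) - D js x))) \<partial>lborel) < \<infinity>"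
      proof
        assume "(\<integral>\<^sup>+t. ennreal (norm (?w t * (D js (x + t *\<^sub>R h) - D js x))) \<partial>lborel) < \<infinity>"
        then have "integrable lborel (\<lambda>t. ?w t * (D js (x + t *\<^sub>R h) - D js x))"
          by (intro integrableI_bounded) measurable
        then show False using False by simp
      qed
      then show ?thesis using le by (simp add: not_less top_unique)
    qed
  qed
  from False have "0 < m" by simp
  from weak_taylor[OF jet this, of h] show ?thesis
  proof eventually_elim
    case (elim x)
    let ?J = "{js :: 'n list. length js = m}"
    have "u (x + h) - Q x h = (\<Sum>js\<in>?J. coord_prod h js * ((\<integral>t. ?w t * D js (x + t *\<^sub>R h) \<partial>lborel) - D js x / fact m))"
    proof -
      have "Q x h = (\<Sum>k<m. (\<Sum>js | length js = k. coord_prod h js * D js x) / fact k)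
        + (\<Sum>js\<in>?J. coord_prod h js * D js x) / fact m"
        unfolding Q_def by (simp add: lessThan_Suc_atMost[symmetric])
      then show ?thesis using elim by (simp add: right_diff_distrib sum_subtractf sum_divide_distrib)
    qed
    then have "\<bar>u (x + h) - Q x h\<bar> \<le> (\<Sum>js\<in>?J. norm h ^ m * \<bar>(\<integral>t. ?w t * D js (x + t *\<^sub>R h) \<partial>lborel) - D js x / fact m\<bar>)"
      using abs_coord_prod_le[of h]
      by (auto intro!: order_trans[OF sum_abs] sum_mono simp: abs_mult intro!: mult_right_mono)
    then have "ennreal \<bar>u (x + h) - Q x h\<bar> \<le> (\<Sum>js\<in>?J. ennreal (norm h ^ m) * ennreal \<bar>(\<integral>t. ?w t * D js (x + t *\<^sub>R h) \<partial>lborel) - D js x / fact m\<bar>)"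
      by (subst (asm) ennreal_le_iff[symmetric]) (auto simp: ennreal_mult intro!: sum_nonneg simp flip: sum_ennreal)
    also have "\<dots> \<le> (\<Sum>js\<in>?J. ennreal (norm h ^ m) * (\<integral>\<^sup>+t. ennreal (V (x + t *\<^sub>R h) x) \<partial>segment_measure m))"
      by (intro sum_mono mult_left_mono dev) auto
    also have "\<dots> = ennreal (real (card ?J) * norm h ^ m) * (\<integral>\<^sup>+t. ennreal (V (x + t *\<^sub>R h) x) \<partial>segment_measure m)"
      by (simp add: ennreal_mult ennreal_of_nat_eq_real_of_nat mult.assoc)
    finally show ?case .
  qed
qed

text \<open>The Taylor polynomial at x is admissible in the infimum of \<open>osc\<close>, for all
  radii at once. As |h| < r, the factor |h|^m is absorbed by the integer part of the power
  r^s.\<close>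

lemma osc_le_segment_mean:
  fixes u :: "real ^ 'n \<Rightarrow> real"
  assumes s: "0 < s" and m: "m = nat \<lfloor>s\<rfloor>" and \<sigma>: "\<sigma> = frac s"
    and jet: "weak_jet m u D" and V_meas [measurable]: "(\<lambda>(x, y). V x y) \<in> borel_measurable (borel \<Otimes>\<^sub>M borel)"
    and V: "\<And>js x y. length js = m \<Longrightarrow> \<bar>D js x - D js y\<bar> \<le> V x y" and V0: "\<And>x y. 0 \<le> V x y"
  shows "AE x in lborel. \<forall>r\<in>{0<..<1}. osc s u x r \<le>
    ball_mean r (\<lambda>h. \<integral>\<^sup>+t. ennreal (real (card {js :: 'n list. length js = m}) * V (x + t *\<^sub>R h) x / r powr \<sigma>) \<partial>segment_measure m)"
proof -
  let ?c = "real (card {js :: 'n list. length js = m})"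
  interpret N: sigma_finite_measure "segment_measure m" by (rule sigma_finite_segment_measure)
  have D [measurable]: "length js \<le> m \<Longrightarrow> D js \<in> borel_measurable borel" for js
    using jet by (auto simp: weak_jet_def loc_int_def)
  have [measurable]: "u \<in> borel_measurable borel" using jet by (simp add: weak_jet_def loc_int_def)
  define Q where "Q x h = (\<Sum>k\<le>m. (\<Sum>js | length js = k. coord_prod h js * D js x) / fact k)" for x h
  have [measurable]: "(\<lambda>(x, h). Q x h) \<in> borel_measurable (borel \<Otimes>\<^sub>M borel)"
    unfolding Q_def split_beta'
    by (intro borel_measurable_sum borel_measurable_divide borel_measurable_times borel_measurable_const
        measurable_compose[OF measurable_snd coord_prod_measurable] measurable_compose[OF measurable_fst D]) auto
  have Q: "(\<lambda>y. Q x (y - x)) \<in> polynomials m" for x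
  proof -
    have "(\<lambda>y. \<Sum>k\<le>m. \<Sum>js | length js = k. (D js x / fact k) * coord_prod (y - x) js) \<in> polynomials m"
      by (intro polynomials_sum polynomials_cmult polynomials_mono[OF coord_prod_polynomials]) auto
    then show ?thesis by (simp add: Q_def sum_divide_distrib mult.commute)
  qed
  have [measurable]: "(\<lambda>((x, h), t). V (x + t *\<^sub>R h) x) \<in> borel_measurable ((borel \<Otimes>\<^sub>M borel) \<Otimes>\<^sub>M borel)"
    using measurable_compose[OF measurable_Pair V_meas, of "\<lambda>((x, h), t). x + t *\<^sub>R h" "(borel \<Otimes>\<^sub>M borel) \<Otimes>\<^sub>M borel" "\<lambda>((x, h), t). x"]
    by (simp add: case_prod_unfold)
  let ?P = "\<lambda>x h. ennreal \<bar>u (x + h) - Q x h\<bar> \<le> ennreal (?c * norm h ^ m) * (\<integral>\<^sup>+t. ennreal (V (x + t *\<^sub>R h) x) \<partial>segment_measure m)"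
  have "AE h in lborel. AE x in lborel. ?P x h"
    unfolding Q_def by (intro AE_I2 taylor_remainder_le[OF jet V_meas V])
  moreover have "{x \<in> space (lborel \<Otimes>\<^sub>M lborel). ?P (fst x) (snd x)} \<in> sets (lborel \<Otimes>\<^sub>M lborel)"
    by measurable
  \<comment> \<open>The null set in Taylor's formula depends on h. Fubini's theorem turns this into:
    for almost every x the bound holds for almost every h, as needed for a ball mean around
    x.\<close>
  ultimately have "AE x in lborel. AE h in lborel. ?P x h"
    by (subst lborel_pair.AE_commute)
  then show ?thesis
  proof eventually_elim
    case (elim x)
    show ?case
    proof
      fix r :: real assume r: "r \<in> {0<..<1}"
      have Vx [measurable]: "(\<lambda>z. V (x + z) x) \<in> borel_measurable borel" by measurable
      have "osc s u x r \<le> ball_mean r (\<lambda>h. ennreal (\<bar>u (x + h) - Q x (x + h - x)\<bar> / r powr s))"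
        using INF_lower[OF Q[of x, unfolded m], of "\<lambda>q. ball_mean r (\<lambda>h. ennreal (\<bar>u (x + h) - q (x + h)\<bar> / r powr s))"] r
        by (simp add: osc_altdef)
      also have "\<dots> \<le> ball_mean r (\<lambda>h. \<integral>\<^sup>+t. ennreal (?c * V (x + t *\<^sub>R h) x / r powr \<sigma>) \<partial>segment_measure m)"
      proof (rule ball_mean_mono_AE, use elim in eventually_elim)
        case (elim h)
        show ?case
        proof
          assume h: "norm h < r"
          have s_eq: "s = real m + \<sigma>" using s by (simp add: m \<sigma> frac_def)
          have rs: "r powr s = r ^ m * r powr \<sigma>" using r by (simp add: s_eq powr_add powr_realpow)
          have "ennreal (\<bar>u (x + h) - Q x (x + h - x)\<bar> / r powr s) = ennreal (1 / r powr s) * ennreal \<bar>u (x + h) - Q x h\<bar>"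
            by (simp flip: ennreal_mult)
          also have "\<dots> \<le> ennreal (1 / r powr s) * (ennreal (?c * norm h ^ m) * (\<integral>\<^sup>+t. ennreal (V (x + t *\<^sub>R h) x) \<partial>segment_measure m))"
            by (intro mult_left_mono elim) auto
          also have "\<dots> = ennreal (1 / r powr s * (?c * norm h ^ m)) * (\<integral>\<^sup>+t. ennreal (V (x + t *\<^sub>R h) x) \<partial>segment_measure m)"
            by (subst ennreal_mult) (auto simp: mult.assoc)
          also have "\<dots> \<le> ennreal (?c / r powr \<sigma>) * (\<integral>\<^sup>+t. ennreal (V (x + t *\<^sub>R h) x) \<partial>segment_measure m)"
          proof (intro mult_right_mono ennreal_leI)
            have "norm h ^ m \<le> r ^ m" using h by (intro power_mono) auto
            then have "1 / r powr s * (?c * norm h ^ m) \<le> 1 / r powr s * (?c * r ^ m)"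
              using r by (intro mult_left_mono) auto
            then show "1 / r powr s * (?c * norm h ^ m) \<le> ?c / r powr \<sigma>"
              using r by (simp add: rs)
          qed auto
          also have "\<dots> = (\<integral>\<^sup>+t. ennreal (?c / r powr \<sigma>) * ennreal (V (x + t *\<^sub>R h) x) \<partial>segment_measure m)"
            by (rule nn_integral_cmult[symmetric]) measurable
          also have "\<dots> = (\<integral>\<^sup>+t. ennreal (?c * V (x + t *\<^sub>R h) x / r powr \<sigma>) \<partial>segment_measure m)"
            using V0 by (intro nn_integral_cong) (simp flip: ennreal_mult)
          finally show "ennreal (\<bar>u (x + h) - Q x (x + h - x)\<bar> / r powr s)
            \<le> (\<integral>\<^sup>+t. ennreal (?c * V (x + t *\<^sub>R h) x / r powr \<sigma>) \<partial>segment_measure m)" .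
        qed
      qed
      finally show "osc s u x r \<le> ball_mean r (\<lambda>h. \<integral>\<^sup>+t. ennreal (?c * V (x + t *\<^sub>R h) x / r powr \<sigma>) \<partial>segment_measure m)" .
    qed
  qed
qed

section \<open>Measurability of the oscillation\<close>

text \<open>Indicators of moving balls converge off the limiting sphere, which is a null
  set.\<close>

lemma continuous_ball_integral:
  fixes f :: "real ^ 'n \<Rightarrow> real"
  assumes f: "loc_int f"
  shows "continuous_on UNIV (\<lambda>(x, r). \<integral>y. f y * indicator (ball x r) y \<partial>lborel)"
  unfolding continuous_on_sequentially
proof (intro allI ballI impI)
  have [measurable]: "f \<in> borel_measurable borel" using f by (simp add: loc_int_def)
  fix X :: "nat \<Rightarrow> (real ^ 'n) \<times> real" and a
  assume "a \<in> UNIV" and "(\<forall>n. X n \<in> UNIV) \<and> X \<longlonglongrightarrow> a"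
  then have X: "X \<longlonglongrightarrow> a" by simp
  obtain x r where a: "a = (x, r)" by (cases a)
  have Xf: "(\<lambda>k. fst (X k)) \<longlonglongrightarrow> x" and Xs: "(\<lambda>k. snd (X k)) \<longlonglongrightarrow> r"
    using tendsto_fst[OF X] tendsto_snd[OF X] by (simp_all add: a)
  obtain B where B: "\<And>k. norm (fst (X k)) \<le> B"
    using convergent_imp_bounded[OF Xf] by (auto simp: bounded_iff)
  obtain S where S: "\<And>k. \<bar>snd (X k)\<bar> \<le> S"
    using convergent_imp_bounded[OF Xs] by (auto simp: bounded_iff)
  have "(\<lambda>k. \<integral>y. f y * indicator (ball (fst (X k)) (snd (X k))) y \<partial>lborel) \<longlonglongrightarrow> (\<integral>y. f y * indicator (ball x r) y \<partial>lborel)"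
  proof (rule integral_dominated_convergence)
    show "integrable lborel (\<lambda>y. \<bar>f y * indicator (cball 0 (B + S)) y\<bar>)"
      by (intro integrable_abs loc_int_integrable_mult[OF f, where M=1 and R="B + S"]) (auto simp: indicator_def)
    show "AE y in lborel. norm (f y * indicator (ball (fst (X k)) (snd (X k))) y) \<le> \<bar>f y * indicator (cball 0 (B + S)) y\<bar>" for k
    proof (rule AE_I2)
      fix y
      have "norm y \<le> B + S" if "dist (fst (X k)) y < snd (X k)"
      proof -
        have "norm y \<le> norm (fst (X k)) + dist (fst (X k)) y"
          by (metis add.commute dist_commute dist_norm norm_triangle_sub)
        then show ?thesis using B[of k] S[of k] that by linarith
      qed
      then show "norm (f y * indicator (ball (fst (X k)) (snd (X k))) y) \<le> \<bar>f y * indicator (cball 0 (B + S)) y\<bar>"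
        by (auto simp: indicator_def)
    qed
    have "sphere x r \<in> null_sets lborel"
      using negligible_sphere[of x r]
      by (auto simp: null_sets_completion_iff negligible_iff_null_sets)
    then have "AE y in lborel. y \<notin> sphere x r" by (rule AE_not_in)
    then show "AE y in lborel. (\<lambda>k. f y * indicator (ball (fst (X k)) (snd (X k))) y) \<longlonglongrightarrow> f y * indicator (ball x r) y"
    proof eventually_elim
      case (elim y)
      have d: "(\<lambda>k. dist (fst (X k)) y - snd (X k)) \<longlonglongrightarrow> dist x y - r"
        by (intro tendsto_intros Xf Xs)
      have "\<forall>\<^sub>F k in sequentially. f y * indicator (ball (fst (X k)) (snd (X k))) y = f y * indicator (ball x r) y"
      proof (cases "dist x y < r")
        case True
        then have "\<forall>\<^sub>F k in sequentially. dist (fst (X k)) y - snd (X k) < 0"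
          by (intro order_tendstoD(2)[OF d]) simp
        then show ?thesis by eventually_elim (use True in simp)
      next
        case False
        then have "r < dist x y" using elim by auto
        then have "\<forall>\<^sub>F k in sequentially. dist (fst (X k)) y - snd (X k) > 0"
          by (intro order_tendstoD(1)[OF d]) simp
        then show ?thesis by eventually_elim (use False in simp)
      qed
      then show ?case by (rule tendsto_eventually)
    qed
  qed measurable
  then show "((\<lambda>(x, r). \<integral>y. f y * indicator (ball x r) y \<partial>lborel) \<circ> X) \<longlonglongrightarrow> (case a of (x, r) \<Rightarrow> \<integral>y. f y * indicator (ball x r) y \<partial>lborel)"
    by (simp add: a o_def case_prod_unfold)
qed

lemma ball_mean_eq_integral:
  fixes f :: "real ^ 'n \<Rightarrow> real"
  assumes f: "loc_int f" and r: "0 < r" and c: "0 < c"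
  shows "ball_mean r (\<lambda>h. ennreal (\<bar>f (x + h)\<bar> / c)) =
    ennreal (1 / (unit_ball_vol (real CARD('n)) * r ^ CARD('n)) * (1 / c * (\<integral>y. \<bar>f y\<bar> * indicator (ball x r) y \<partial>lborel)))"
proof -
  have [measurable]: "f \<in> borel_measurable borel" using f by (simp add: loc_int_def)
  have int: "integrable lborel (\<lambda>y. \<bar>f y * indicator (ball x r) y\<bar>)"
  proof (intro integrable_abs loc_int_integrable_mult[OF f, where M=1 and R="norm x + r"])
    fix y :: "real ^ 'n" assume "norm x + r < norm y"
    then have "\<not> dist x y < r" using norm_triangle_sub[of y x] by (simp add: dist_norm norm_minus_commute)
    then show "indicator (ball x r) y = (0 :: real)" by simp
  qed (auto simp: indicator_def)
  have "(\<integral>\<^sup>+h. ennreal (\<bar>f (x + h)\<bar> / c) * indicator (ball 0 r) h \<partial>lborel)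
    = (\<integral>\<^sup>+y. ennreal (\<bar>f y\<bar> / c) * indicator (ball x r) y \<partial>lborel)"
    using nn_integral_translate[of "\<lambda>y. ennreal (\<bar>f y\<bar> / c) * indicator (ball x r) y" x]
    by (simp add: indicator_def dist_norm)
  also have "\<dots> = (\<integral>\<^sup>+y. ennreal (1 / c * \<bar>f y * indicator (ball x r) y\<bar>) \<partial>lborel)"
    by (intro nn_integral_cong) (auto simp: indicator_def)
  also have "\<dots> = ennreal (\<integral>y. 1 / c * \<bar>f y * indicator (ball x r) y\<bar> \<partial>lborel)"
    using c by (intro nn_integral_eq_integral integrable_mult_right int AE_I2) auto
  also have "(\<integral>y. 1 / c * \<bar>f y * indicator (ball x r) y\<bar> \<partial>lborel) = 1 / c * (\<integral>y. \<bar>f y\<bar> * indicator (ball x r) y \<partial>lborel)"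
    by (simp add: abs_mult)
  moreover have "0 \<le> (\<integral>y. \<bar>f y\<bar> * indicator (ball x r) y \<partial>lborel)" by (rule Bochner_Integration.integral_nonneg) simp
  ultimately show ?thesis
    using r c by (simp add: ball_mean_def flip: ennreal_mult)
qed

text \<open>The infimum runs over uncountably many polynomials, so measurability of the terms is not
  enough. Each term is continuous in (x, r) for r > 0, hence the sublevel sets of the infimum are
  unions of open sets.\<close>

lemma osc_measurable:
  fixes u :: "real ^ 'n \<Rightarrow> real"
  assumes u: "loc_int u"
  shows "(\<lambda>(x, r). if 0 < r then osc s u x r else 0) \<in> borel_measurable (borel \<Otimes>\<^sub>M borel)"
proof -
  let ?P = "polynomials (nat \<lfloor>s\<rfloor>) :: (real ^ 'n \<Rightarrow> real) set"
  let ?H = "UNIV \<times> {0<..} :: ((real ^ 'n) \<times> real) set"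
  define g where "g q = (\<lambda>(x, r). 1 / (unit_ball_vol (real CARD('n)) * r ^ CARD('n)) *
    (1 / r powr s * (\<integral>y. \<bar>u y - q y\<bar> * indicator (ball x r) y \<partial>lborel)))" for q :: "real ^ 'n \<Rightarrow> real"
  have u' [measurable]: "u \<in> borel_measurable borel" using u by (simp add: loc_int_def)
  have L: "loc_int (\<lambda>y. u y - q y)" if "q \<in> ?P" for q
    using that by (intro loc_int_diff u loc_int_continuous smooth_continuous polynomials_smooth)
  have osc_g: "osc s u x r = (INF q\<in>?P. ennreal (g q (x, r)))" if "0 < r" for x r
    unfolding osc_altdef[OF u' that] g_def
    by (intro INF_cong refl) (use ball_mean_eq_integral[OF L that] that in simp)
  have cont: "continuous_on ?H (g q)" if "q \<in> ?P" for q
  proof -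
    have "loc_int (\<lambda>y. \<bar>u y - q y\<bar>)" using L[OF that] unfolding loc_int_def by (auto intro: borel_measurable_abs)
    from continuous_on_subset[OF continuous_ball_integral[OF this] subset_UNIV[of ?H]]
    show ?thesis unfolding g_def case_prod_unfold
      by (intro continuous_intros) (auto simp: less_imp_neq[OF unit_ball_vol_pos', symmetric])
  qed
  have "open {z \<in> ?H. osc s u (fst z) (snd z) < y}" for y
  proof -
    have "{z \<in> ?H. osc s u (fst z) (snd z) < y} = (\<Union>q\<in>?P. {z \<in> ?H. ennreal (g q z) < y})"
      by (auto simp: osc_g INF_less_iff)
    moreover have "open {z \<in> ?H. ennreal (g q z) < y}" if "q \<in> ?P" for q
    proof -
      have "open ((\<lambda>z. ennreal (g q z)) -` {..<y} \<inter> ?H)"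
        by (intro continuous_on_open_vimage[THEN iffD1, rule_format] continuous_on_ennreal cont that open_Times) auto
      then show ?thesis by (simp add: vimage_def Int_def conj_commute)
    qed
    ultimately show ?thesis by auto
  qed
  then have b: "{z \<in> ?H. osc s u (fst z) (snd z) < y} \<in> sets borel" for y by simp
  have H: "?H \<in> sets borel" by (intro borel_open open_Times) auto
  have "(\<lambda>z. if 0 < snd z then osc s u (fst z) (snd z) else 0) \<in> borel_measurable borel"
  proof (rule borel_measurableI_less)
    fix y :: ennreal
    have eq: "{z \<in> space borel. (if 0 < snd z then osc s u (fst z) (snd z) else 0) < y}
      = {z \<in> ?H. osc s u (fst z) (snd z) < y} \<union> (if 0 < y then - ?H else {})"
      by auto
    have "- ?H \<in> sets borel" using H by (rule borel_comp)
    then show "{z \<in> space borel. (if 0 < snd z then osc s u (fst z) (snd z) else 0) < y} \<in> sets borel"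
      unfolding eq using b[of y] by (cases "0 < y") (simp_all only: if_True if_False sets.Un Un_empty_right)
  qed
  then show ?thesis by (simp add: borel_prod case_prod_unfold)
qed

lemma osc_measurable_fst:
  fixes u :: "real ^ 'n \<Rightarrow> real"
  assumes "loc_int u" "0 < r"
  shows "(\<lambda>x. osc s u x r) \<in> borel_measurable borel"
proof -
  have "(\<lambda>x. (x, r)) \<in> borel \<rightarrow>\<^sub>M borel \<Otimes>\<^sub>M borel" by measurable
  from measurable_compose[OF this osc_measurable[OF assms(1), of s]] show ?thesis using assms(2) by simp
qed

definition osc_modular :: "real \<Rightarrow> (real \<Rightarrow> ennreal) \<Rightarrow> (real ^ 'n \<Rightarrow> real) \<Rightarrow> real \<Rightarrow> ennreal" where
  "osc_modular s A u l =
    (\<integral>\<^sup>+r\<in>{0<..<1}. ((\<integral>\<^sup>+x. young_ext A (osc s u x r / ennreal l) \<partial>lborel) / ennreal r) \<partial>lborel)"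

lemma osc_seminorm_eq:
  fixes u u' :: "real ^ 'n \<Rightarrow> real"
  assumes "AE x in lebesgue. u x = u' x"
  shows "osc_seminorm s A u = luxemburg (osc_modular s A u')"
  unfolding osc_seminorm_def osc_modular_def nn_integral_completion osc_cong_AE[OF assms] ..

lemma osc_modular_antimono:
  assumes A: "young_function A" and l: "0 < l" "l \<le> l'"
  shows "osc_modular s A u l' \<le> osc_modular s A u l"
  unfolding osc_modular_def
proof (intro nn_integral_mono mult_right_mono divide_right_mono_ennreal young_ext_mono[OF A])
  fix r x
  have "inverse (ennreal l') \<le> inverse (ennreal l)"
    using l by (simp add: inverse_ennreal ennreal_leI le_imp_inverse_le)
  then show "osc s u x r / ennreal l' \<le> osc s u x r / ennreal l"
    by (simp add: divide_ennreal_def mult_left_mono)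
qed simp

text \<open>Turns a constant K in front of the modular into a factor K in the Luxemburg parameter.
  Joint measurability of the oscillation in (x, r) is what allows 1 / K to leave both
  integrals.\<close>

lemma osc_modular_scale:
  fixes u :: "real ^ 'n \<Rightarrow> real"
  assumes A: "young_function A" and u: "loc_int u" and K: "1 \<le> K" and l: "0 < l"
  shows "osc_modular s A u (K * l) \<le> ennreal (1 / K) * osc_modular s A u l"
proof -
  note [measurable] = young_ext_measurable[OF A]
  define w where "w x r = (if 0 < r then osc s u x r else 0)" for x r
  have [measurable]: "(\<lambda>(x, r). w x r) \<in> borel_measurable (borel \<Otimes>\<^sub>M borel)"
    unfolding w_def by (rule osc_measurable[OF u])
  have eq: "osc_modular s A u l = (\<integral>\<^sup>+r. (\<integral>\<^sup>+x. young_ext A (w x r / ennreal l) \<partial>lborel) * (inverse (ennreal r) * indicator {0<..<1} r) \<partial>lborel)" for l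
    unfolding osc_modular_def by (intro nn_integral_cong) (auto simp: w_def indicator_def divide_ennreal_def)
  have "osc_modular s A u (K * l) \<le> (\<integral>\<^sup>+r. ennreal (1 / K) * ((\<integral>\<^sup>+x. young_ext A (w x r / ennreal l) \<partial>lborel) * (inverse (ennreal r) * indicator {0<..<1} r)) \<partial>lborel)"
    unfolding eq
  proof (rule nn_integral_mono)
    fix r :: real
    have "(\<integral>\<^sup>+x. young_ext A (w x r / ennreal (K * l)) \<partial>lborel) \<le> (\<integral>\<^sup>+x. ennreal (1 / K) * young_ext A (w x r / ennreal l) \<partial>lborel)"
    proof (rule nn_integral_mono)
      fix x
      have "w x r / ennreal (K * l) = ennreal (1 / K) * (w x r / ennreal l)"
      proof -
        have "inverse (ennreal (K * l)) = ennreal (1 / K) * inverse (ennreal l)"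
          using K l by (simp add: inverse_ennreal flip: ennreal_mult) (simp add: field_simps)
        then show ?thesis by (simp add: divide_ennreal_def mult.left_commute)
      qed
      then show "young_ext A (w x r / ennreal (K * l)) \<le> ennreal (1 / K) * young_ext A (w x r / ennreal l)"
        using young_ext_scale[OF A, of "1 / K" "w x r / ennreal l"] K by simp
    qed
    also have "\<dots> = ennreal (1 / K) * (\<integral>\<^sup>+x. young_ext A (w x r / ennreal l) \<partial>lborel)"
      by (rule nn_integral_cmult) measurable
    finally have le: "(\<integral>\<^sup>+x. young_ext A (w x r / ennreal (K * l)) \<partial>lborel)
      \<le> ennreal (1 / K) * (\<integral>\<^sup>+x. young_ext A (w x r / ennreal l) \<partial>lborel)" .
    show "(\<integral>\<^sup>+x. young_ext A (w x r / ennreal (K * l)) \<partial>lborel) * (inverse (ennreal r) * indicator {0<..<1} r)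
      \<le> ennreal (1 / K) * ((\<integral>\<^sup>+x. young_ext A (w x r / ennreal l) \<partial>lborel) * (inverse (ennreal r) * indicator {0<..<1} r))"
      using mult_right_mono[OF le, of "inverse (ennreal r) * indicator {0<..<1} r"] by (simp add: mult.assoc)
  qed
  also have "\<dots> = ennreal (1 / K) * osc_modular s A u l"
    unfolding eq by (rule nn_integral_cmult) measurable
  finally show ?thesis .
qed

lemma luxemburg_cong: "(\<And>l. 0 < l \<Longrightarrow> \<Phi> l = \<Psi> l) \<Longrightarrow> luxemburg \<Phi> = luxemburg \<Psi>"
  unfolding luxemburg_def by (rule arg_cong[where f=Inf]) auto

lemma frac_pos_if_not_nat:
  fixes s :: real
  assumes s: "0 < s" "s \<notin> \<nat>"
  shows "0 < frac s"
proof -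
  have "s \<notin> \<int>"
  proof
    assume "s \<in> \<int>"
    then obtain k where "s = of_int k" by (elim Ints_cases)
    then have "s = real (nat k)" using s by simp
    then have "s \<in> \<nat>" by (metis of_nat_in_Nats)
    then show False using s by simp
  qed
  then show ?thesis by (simp add: frac_gt_0_iff)
qed

text \<open>Two factors arise: the number of lists of length m, from summing the Taylor terms, and
  \<open>K\<close>, which absorbs the inverse volume of the unit ball left over in
  \<open>osc_modular_le\<close>.\<close>

theorem osc_seminorm_le_frac_seminorm:
  fixes s :: real
  assumes s: "0 < s" "s \<notin> \<nat>"
  shows "\<exists>C>0. \<forall>A. young_function A \<longrightarrow> (\<forall>u\<in>(frac_sobolev_space s A :: (real ^ 'n \<Rightarrow> real) set).
    osc_seminorm s A u \<le> ennreal C * frac_seminorm (frac s) A (multi_indices (nat \<lfloor>s\<rfloor>)) (weak_derivative u))"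
proof -
  define m where "m = nat \<lfloor>s\<rfloor>"
  define \<sigma> where "\<sigma> = frac s"
  have \<sigma>: "0 < \<sigma>" unfolding \<sigma>_def by (rule frac_pos_if_not_nat[OF s])
  let ?J = "{js :: 'n list. length js = m}"
  let ?C = "real (card ?J)"
  let ?om = "unit_ball_vol (real CARD('n))"
  have "replicate m undefined \<in> ?J" by simp
  then have "?J \<noteq> {}" by blast
  then have C: "0 < ?C" by (simp only: card_gt_0_iff of_nat_0_less_iff finite_lists_length) simp
  have om: "0 < ?om" by (rule unit_ball_vol_pos')
  define K where "K = max 1 (1 / ?om)"
  have K: "1 \<le> K" "1 / ?om \<le> K" by (auto simp: K_def)
  show ?thesis
  proof (intro exI[of _ "2 * (K * ?C)"] conjI allI impI ballI)
    show "0 < 2 * (K * ?C)" using K C by simp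
    fix A and u :: "real ^ 'n \<Rightarrow> real"
    assume A: "young_function A" and u: "u \<in> frac_sobolev_space s A"
    then have us: "u \<in> sobolev_space m A" by (simp add: frac_sobolev_space_def m_def)
    obtain W where W: "sobolev_rep m u W" using sobolev_rep_exists[OF us] by blast
    have jet: "weak_jet m (W (\<lambda>_. 0)) (\<lambda>js. W (count_list js))" by (rule sobolev_rep_weak_jet[OF A us W])
    let ?u = "W (\<lambda>_. 0)" and ?I = "multi_indices m :: ('n \<Rightarrow> nat) set"
    have Lu: "loc_int ?u" using jet by (simp add: weak_jet_def)
    have ae: "AE x in lebesgue. u x = ?u x"
      using W by (auto simp: sobolev_rep_def multi_indices_0 weak_derivative_def)
    have WI: "W \<alpha> \<in> borel_measurable borel" "AE x in lebesgue. weak_derivative u \<alpha> x = W \<alpha> x" if "\<alpha> \<in> ?I" for \<alpha>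
      using W that by (auto simp: sobolev_rep_def)
    define V where "V x y = L2_set (\<lambda>\<alpha>. W \<alpha> x - W \<alpha> y) ?I" for x y
    have V_meas: "(\<lambda>(x, y). V x y) \<in> borel_measurable (borel \<Otimes>\<^sub>M borel)"
      unfolding V_def case_prod_unfold
      by (intro L2_set_measurable borel_measurable_diff measurable_compose[OF measurable_fst WI(1)] measurable_compose[OF measurable_snd WI(1)])
    have V0: "0 \<le> V x y" for x y by (simp add: V_def L2_set_nonneg)
    have V: "\<bar>W (count_list js) x - W (count_list js) y\<bar> \<le> V x y" if "length js = m" for js x y
      unfolding V_def using member_le_L2_set[OF finite_multi_indices count_list_multi_indices[OF that], of "\<lambda>\<alpha>. \<bar>W \<alpha> x - W \<alpha> y\<bar>"]
      by (simp add: L2_set_def)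
    have main: "osc_modular s A ?u (?C * l) \<le> ennreal (1 / ?om) * frac_modular \<sigma> A ?I W l" if l: "0 < l" for l
      unfolding osc_modular_def frac_modular_def V_def[symmetric]
      by (rule osc_modular_le[OF A V_meas V0 \<sigma> C l sigma_finite_segment_measure sets_segment_measure
          emeasure_segment_measure AE_segment_measure osc_le_segment_mean[OF s(1) m_def \<sigma>_def jet V_meas V V0]])
    \<comment> \<open>The same modular takes both places in \<open>luxemburg_le_add\<close>, which
      costs the factor 2.\<close>
    have "luxemburg (osc_modular s A ?u) \<le> ennreal (K * ?C) * (luxemburg (frac_modular \<sigma> A ?I W) + luxemburg (frac_modular \<sigma> A ?I W))"
    proof (rule luxemburg_le_add)
      fix l :: real assume l: "0 < l" and le: "frac_modular \<sigma> A ?I W l \<le> 1"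
      have "osc_modular s A ?u (K * (?C * l)) \<le> ennreal (1 / K) * osc_modular s A ?u (?C * l)"
        using C l by (intro osc_modular_scale[OF A Lu K(1)]) auto
      also have "\<dots> \<le> ennreal (1 / K) * (ennreal (1 / ?om) * 1)"
        by (intro mult_left_mono order_trans[OF main[OF l]] le) auto
      also have "\<dots> = ennreal (1 / K * (1 / ?om))" using K om by (simp flip: ennreal_mult)
      also have "\<dots> \<le> ennreal 1" using K om by (intro ennreal_leI) (simp add: field_simps)
      finally show "osc_modular s A ?u (K * ?C * l) \<le> 1" by (simp add: mult.assoc)
    next
      show "0 < K * ?C" using K C by simp
    qed (rule frac_modular_antimono[OF A], assumption, assumption)+
    also have "\<dots> = ennreal (2 * (K * ?C)) * luxemburg (frac_modular \<sigma> A ?I W)"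
    proof -
      have "ennreal (2 * (K * ?C)) = 2 * ennreal (K * ?C)" using K C by (subst ennreal_mult) auto
      then show ?thesis by (simp only: mult_2[symmetric] mult_ac)
    qed
    finally have fin: "luxemburg (osc_modular s A ?u) \<le> \<dots>" .
    have "luxemburg (frac_modular \<sigma> A ?I W) = frac_seminorm \<sigma> A ?I (weak_derivative u)"
      unfolding frac_seminorm_def by (intro luxemburg_cong frac_modular_eq[OF A finite_multi_indices _ WI, symmetric])
    then show "osc_seminorm s A u \<le> ennreal (2 * (K * ?C)) * frac_seminorm (frac s) A (multi_indices (nat \<lfloor>s\<rfloor>)) (weak_derivative u)"
      using fin by (simp add: osc_seminorm_eq[OF ae] m_def \<sigma>_def)
  qed
qed

section \<open>A kernel reproducing polynomials\<close>

text \<open>Strong induction on the power: j (M choose j) = M (M - 1 choose j - 1) removes one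
  factor j, and the binomial expansion of (i + 1)^(k - 1) leaves lower powers with M - 1 in place of
  M.\<close>

lemma alternating_binomial_power:
  "k < M \<Longrightarrow> (\<Sum>j\<le>M. (- 1) ^ j * real (M choose j) * real j ^ k) = 0"
proof (induction k arbitrary: M rule: less_induct)
  case (less k)
  show ?case
  proof (cases k)
    case 0
    then show ?thesis using less.prems choose_alternating_sum[of M, where 'a = real] by simp
  next
    case (Suc k')
    obtain N where M: "M = Suc N" using less.prems by (cases M) auto
    have "(\<Sum>j\<le>M. (- 1) ^ j * real (M choose j) * real j ^ k)
      = (\<Sum>i\<le>N. (- 1) ^ Suc i * real (M choose Suc i) * real (Suc i) ^ k)"
      unfolding M sum.atMost_Suc_shift by (simp add: Suc)
    also have "\<dots> = (\<Sum>i\<le>N. - real M * ((- 1) ^ i * real (N choose i) * (\<Sum>l\<le>k'. real (k' choose l) * real i ^ l)))"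
    proof (rule sum.cong[OF refl])
      fix i
      have "real (Suc i) * real (M choose Suc i) = real M * real (N choose i)"
        using Suc_times_binomial_eq[of N i] unfolding M by (metis mult.commute of_nat_mult)
      moreover have "real (Suc i) ^ k' = (\<Sum>l\<le>k'. real (k' choose l) * real i ^ l)"
        using binomial_ring[of "real i" 1 k'] by (simp add: add.commute)
      moreover have "(- 1) ^ Suc i * real (M choose Suc i) * real (Suc i) ^ k
        = - ((- 1) ^ i * (real (Suc i) * real (M choose Suc i)) * real (Suc i) ^ k')"
        by (simp add: Suc mult_ac)
      ultimately show "(- 1) ^ Suc i * real (M choose Suc i) * real (Suc i) ^ k
        = - real M * ((- 1) ^ i * real (N choose i) * (\<Sum>l\<le>k'. real (k' choose l) * real i ^ l))"
        by (simp add: mult_ac)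
    qed
    also have "\<dots> = - real M * (\<Sum>l\<le>k'. real (k' choose l) * (\<Sum>i\<le>N. (- 1) ^ i * real (N choose i) * real i ^ l))"
      by (subst sum_distrib_left[symmetric], simp only: sum_distrib_left) (subst sum.swap, simp add: mult_ac)
    also have "\<dots> = 0"
    proof -
      have "(\<Sum>i\<le>N. (- 1) ^ i * real (N choose i) * real i ^ l) = 0" if "l \<le> k'" for l
        using that less.prems by (intro less.IH) (auto simp: Suc M)
      then show ?thesis by simp
    qed
    finally show ?thesis .
  qed
qed

lemma alternating_binomial_poly:
  assumes "degree p < M"
  shows "(\<Sum>j\<le>M. (- 1) ^ j * real (M choose j) * poly p (real j)) = 0"
proof -
  have "(\<Sum>j\<le>M. (- 1) ^ j * real (M choose j) * poly p (real j))
    = (\<Sum>i\<le>degree p. coeff p i * (\<Sum>j\<le>M. (- 1) ^ j * real (M choose j) * real j ^ i))"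
    unfolding poly_altdef by (simp only: sum_distrib_left) (subst sum.swap, simp add: mult_ac)
  also have "\<dots> = 0" using assms by (simp add: alternating_binomial_power)
  finally show ?thesis .
qed

text \<open>Reduces finite differences of q along a line to those of a univariate
  polynomial.\<close>

lemma polynomials_line:
  assumes "q \<in> polynomials m"
  obtains p where "degree p \<le> m" "\<And>t. q (x + t *\<^sub>R w) = poly p t"
proof -
  have "\<exists>p. degree p \<le> m \<and> (\<forall>t. q (x + t *\<^sub>R w) = poly p t)"
    using assms
  proof (induction rule: polynomials_induct)
    case (monomial \<alpha>)
    have "degree (\<Prod>i\<in>UNIV. [:x $ i, w $ i:] ^ \<alpha> i) \<le> (\<Sum>i\<in>UNIV. \<alpha> i)"
    proof -
      have "(\<Sum>i\<in>UNIV. degree ([:x $ i, w $ i:] ^ \<alpha> i)) \<le> (\<Sum>i\<in>UNIV. \<alpha> i)"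
      proof (rule sum_mono)
        fix i
        have "degree ([:x $ i, w $ i:] ^ \<alpha> i) \<le> degree [:x $ i, w $ i:] * \<alpha> i" by (rule degree_power_le)
        also have "\<dots> \<le> 1 * \<alpha> i" by (intro mult_right_mono) (auto simp: degree_pCons_eq_if)
        finally show "degree ([:x $ i, w $ i:] ^ \<alpha> i) \<le> \<alpha> i" by simp
      qed
      then show ?thesis
        using degree_prod_sum_le[of UNIV "\<lambda>i. [:x $ i, w $ i:] ^ \<alpha> i"] by (simp add: o_def)
    qed
    then show ?case using monomial
      by (intro exI[of _ "\<Prod>i\<in>UNIV. [:x $ i, w $ i:] ^ \<alpha> i"]) (auto simp: poly_prod)
  next
    fix p q assume "\<exists>a. degree a \<le> m \<and> (\<forall>t. p (x + t *\<^sub>R w) = poly a t)" "\<exists>a. degree a \<le> m \<and> (\<forall>t. q (x + t *\<^sub>R w) = poly a t)"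
    then obtain a b where "degree a \<le> m" "\<forall>t. p (x + t *\<^sub>R w) = poly a t" "degree b \<le> m" "\<forall>t. q (x + t *\<^sub>R w) = poly b t" by blast
    then show "\<exists>a. degree a \<le> m \<and> (\<forall>t. p (x + t *\<^sub>R w) + q (x + t *\<^sub>R w) = poly a t)"
      by (intro exI[of _ "a + b"]) (auto simp: degree_add_le)
  next
    fix c p assume "\<exists>a. degree a \<le> m \<and> (\<forall>t. p (x + t *\<^sub>R w) = poly a t)"
    then obtain a where "degree a \<le> m" "\<forall>t. p (x + t *\<^sub>R w) = poly a t" by blast
    then show "\<exists>a. degree a \<le> m \<and> (\<forall>t. c * p (x + t *\<^sub>R w) = poly a t)"
      by (intro exI[of _ "smult c a"]) (auto intro: order_trans[OF degree_smult_le])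
  next
    show "\<exists>a. degree a \<le> m \<and> (\<forall>t. 0 = poly a t)" by (intro exI[of _ 0]) auto
  qed
  then show thesis using that by blast
qed

lemma polynomials_0_const:
  assumes "q \<in> polynomials 0" shows "q x = q y"
  using assms by (auto simp: polynomials_def multi_indices_0)

text \<open>After one coordinate factor x_j is split off, the product rule leaves the rest of the
  monomial and x_j times the derivative of the rest, both of degree one less than the whole.
  Truncated subtraction covers constants.\<close>

lemma partial_derivative_monomial:
  "(\<Sum>i\<in>UNIV. \<alpha> i) \<le> k \<Longrightarrow> partial_derivative i (\<lambda>x. \<Prod>l\<in>UNIV. (x $ l) ^ \<alpha> l) \<in> polynomials (k - 1)"
proof (induction k arbitrary: \<alpha>)
  case 0
  then have "\<alpha> = (\<lambda>_. 0)" by auto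
  then show ?case by (simp add: const_polynomials)
next
  case (Suc k)
  show ?case
  proof (cases "\<alpha> = (\<lambda>_. 0)")
    case True
    then show ?thesis by (simp add: const_polynomials)
  next
    case False
    then obtain j where j: "0 < \<alpha> j" by auto
    define \<beta> where "\<beta> = \<alpha>(j := \<alpha> j - 1)"
    define b where "b = (\<lambda>x :: real ^ 'a. \<Prod>l\<in>UNIV. (x $ l) ^ \<beta> l)"
    have "(\<Sum>i\<in>UNIV. \<alpha> i) = (\<Sum>i\<in>UNIV. \<beta> i + (if i = j then 1 else 0))"
      unfolding \<beta>_def using j by (intro sum.cong) auto
    then have \<beta>: "(\<Sum>i\<in>UNIV. \<beta> i) \<le> k" using Suc.prems by (simp add: sum.distrib)
    have b: "b \<in> polynomials k" unfolding b_def by (rule monomial_polynomials[OF \<beta>])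
    have "(\<Prod>l\<in>UNIV. (x $ l) ^ \<alpha> l) = x $ j * b x" for x :: "real ^ 'a"
    proof -
      have "(\<Prod>l\<in>UNIV. (x $ l) ^ \<alpha> l) = (\<Prod>l\<in>UNIV. (if l = j then x $ j else 1) * (x $ l) ^ \<beta> l)"
        unfolding \<beta>_def using j by (intro prod.cong) (auto simp flip: power_Suc)
      then show ?thesis by (simp add: prod.distrib b_def)
    qed
    moreover have "partial_derivative i (\<lambda>x. x $ j * b x) = (\<lambda>x. x $ j * partial_derivative i b x + (axis i 1 $ j) * b x)"
    proof
      fix x :: "real ^ 'a"
      have "partial_derivative i (\<lambda>x. x $ j) x = axis i 1 $ j"
        by (rule partial_derivative_eq[OF bounded_linear_imp_has_derivative[OF bounded_linear_vec_nth]])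
      then show "partial_derivative i (\<lambda>x. x $ j * b x) x = x $ j * partial_derivative i b x + (axis i 1 $ j) * b x"
        by (subst partial_derivative_mult)
          (simp_all add: smooth_differentiable smooth_coordinate polynomials_smooth[OF b])
    qed
    moreover have "(\<lambda>x. x $ j * partial_derivative i b x) \<in> polynomials k"
    proof (cases k)
      case 0
      then have "\<beta> = (\<lambda>_. 0)" using \<beta> by auto
      then show ?thesis by (simp add: b_def const_polynomials)
    next
      case (Suc k')
      then show ?thesis using polynomials_coord_mult[OF Suc.IH[OF \<beta>]] Suc.IH[OF \<beta>]
        unfolding b_def by simp
    qed
    ultimately show ?thesis
      by (simp add: polynomials_add polynomials_cmult b)
  qed
qed

lemma polynomials_partial_derivative:
  assumes "q \<in> polynomials k"
  shows "partial_derivative i q \<in> polynomials (k - 1)"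
proof -
  have "smooth q \<and> partial_derivative i q \<in> polynomials (k - 1)"
    using assms
  proof (induction rule: polynomials_induct)
    case (monomial \<alpha>)
    show ?case using partial_derivative_monomial[OF monomial] polynomials_smooth[OF monomial_polynomials[OF monomial]] by simp
  next
    fix p q :: "real ^ 'a \<Rightarrow> real"
    assume *: "smooth p \<and> partial_derivative i p \<in> polynomials (k - 1)" "smooth q \<and> partial_derivative i q \<in> polynomials (k - 1)"
    then have "partial_derivative i (\<lambda>x. p x + q x) = (\<lambda>x. partial_derivative i p x + partial_derivative i q x)"
      by (intro ext partial_derivative_add) (simp_all add: smooth_differentiable)
    then show "smooth (\<lambda>x. p x + q x) \<and> partial_derivative i (\<lambda>x. p x + q x) \<in> polynomials (k - 1)"
      using * by (simp add: smooth_add polynomials_add)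
  next
    fix c and p :: "real ^ 'a \<Rightarrow> real" assume *: "smooth p \<and> partial_derivative i p \<in> polynomials (k - 1)"
    then have "partial_derivative i (\<lambda>x. c * p x) = (\<lambda>x. c * partial_derivative i p x)"
      using iterated_partial_cmult[of p "[i]" c] by simp
    then show "smooth (\<lambda>x. c * p x) \<and> partial_derivative i (\<lambda>x. c * p x) \<in> polynomials (k - 1)"
      using * by (simp add: smooth_cmult polynomials_cmult)
  qed (simp add: smooth_const const_polynomials)
  then show ?thesis ..
qed

lemma polynomials_iterated_partial:
  "q \<in> polynomials m \<Longrightarrow> iterated_partial js q \<in> polynomials (m - length js)"
  by (induction js) (simp_all, metis diff_Suc_eq_diff_pred diff_commute diff_Suc_1 polynomials_partial_derivative diff_diff_left plus_1_eq_Suc add.commute)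

lemma bump_kernel_exists:
  assumes "0 < \<delta>"
  obtains \<rho> :: "real ^ 'n \<Rightarrow> real" where "test_function \<rho>" "\<And>x. \<delta> \<le> norm x \<Longrightarrow> \<rho> x = 0" "(\<integral>x. \<rho> x \<partial>lborel) = 1"
proof -
  \<comment> \<open>The box of half-width \<delta> / n lies in the ball of radius \<delta>, because
    the Euclidean norm is at most the sum of the moduli of the coordinates.\<close>
  define d where "d = \<delta> / real CARD('n)"
  have d: "0 < d" using assms by (simp add: d_def)
  define b :: "real ^ 'n" where "b = (\<chi> i. d)"
  let ?\<phi> = "bump (- b) b 1"
  have t: "test_function ?\<phi>" by (rule test_function_bump) simp
  have out: "?\<phi> x = 0" if "\<delta> \<le> norm x" for x
  proof (rule bump_eq_0)
    show "x \<notin> box (- b) b"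
    proof
      assume "x \<in> box (- b) b"
      then have "\<bar>x $ i\<bar> < d" for i by (auto simp: mem_box_cart b_def abs_less_iff minus_less_iff)
      then have "(\<Sum>i\<in>UNIV. \<bar>x $ i\<bar>) < (\<Sum>i\<in>(UNIV :: 'n set). d)" by (intro sum_strict_mono) auto
      then have "norm x < \<delta>" using norm_le_l1_cart[of x] by (simp add: d_def)
      then show False using that by simp
    qed
  qed simp
  have int: "integrable lborel ?\<phi>" by (rule test_function_integrable[OF t])
  have "0 < (\<integral>x. ?\<phi> x \<partial>lborel)"
  proof -
    have "(\<integral>x. ?\<phi> x \<partial>lborel) \<noteq> 0"
    proof
      assume "(\<integral>x. ?\<phi> x \<partial>lborel) = 0"
      then have "AE x in lborel. ?\<phi> x = 0"
        using integral_nonneg_eq_0_iff_AE[OF int] bump_nonneg[of "- b" b 1] by simp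
      then have "AE x in lborel. x \<notin> box (- b) b"
        by eventually_elim (use bump_pos_iff[of 1 "- b" b] in force)
      then have "emeasure lborel (box (- b) b) = 0"
        by (subst (asm) AE_iff_measurable[of "box (- b) b"]) auto
      moreover have "emeasure lborel (box (- b) b) = ennreal (\<Prod>i\<in>Basis. (b - - b) \<bullet> i)"
        by (intro emeasure_lborel_box) (use d in \<open>auto simp: Basis_vec_def b_def inner_axis\<close>)
      moreover have "0 < (\<Prod>i\<in>Basis. (b - - b) \<bullet> i)"
        by (intro prod_pos) (use d in \<open>auto simp: Basis_vec_def b_def inner_axis\<close>)
      ultimately show False by (metis ennreal_eq_0_iff not_le)
    qed
    moreover have "0 \<le> (\<integral>x. ?\<phi> x \<partial>lborel)" by (intro Bochner_Integration.integral_nonneg bump_nonneg)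
    ultimately show ?thesis by simp
  qed
  then show thesis
    by (intro that[OF test_function_cmult[OF t, of "1 / (\<integral>x. ?\<phi> x \<partial>lborel)"]]) (simp_all add: out)
qed

text \<open>The kernel is \<open>\<Sum>\<^sub>j c\<^sub>j j\<^sup>-\<^sup>n \<rho>(z/j)\<close>, \<open>1 \<le> j \<le> m + 1\<close>, where \<open>c\<^sub>j\<close> are the coefficients of the
  finite difference of order \<open>m + 1\<close>, which annihilates polynomials of degree at most \<open>m\<close>.\<close>

lemma reproducing_kernel_exists:
  obtains K :: "real ^ 'n \<Rightarrow> real" where "test_function K" "\<And>z. 1 / 2 \<le> norm z \<Longrightarrow> K z = 0"
    "\<And>q x t. q \<in> polynomials m \<Longrightarrow> (\<integral>z. K z * q (x - t *\<^sub>R z) \<partial>lborel) = q x"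
proof -
  define M where "M = Suc m"
  \<comment> \<open>Dilation by j <= M enlarges the support of \<rho> at most to radius 1/2.\<close>
  define \<delta> where "\<delta> = 1 / (2 * real M)"
  have \<delta>: "0 < \<delta>" by (simp add: \<delta>_def M_def)
  obtain \<rho> :: "real ^ 'n \<Rightarrow> real" where \<rho>: "test_function \<rho>" "\<And>x. \<delta> \<le> norm x \<Longrightarrow> \<rho> x = 0" "(\<integral>x. \<rho> x \<partial>lborel) = 1"
    using bump_kernel_exists[OF \<delta>] by blast
  have [measurable]: "\<rho> \<in> borel_measurable borel" by (rule smooth_measurable[OF test_function_smooth[OF \<rho>(1)]])
  \<comment> \<open>The term j = 0 of the vanishing finite difference is q x; hence the minus sign,
    with which the other terms sum to q x.\<close>
  define c where "c j = - ((- 1) ^ j * real (M choose j))" for j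
  define K where "K z = (\<Sum>j\<in>{1..M}. (c j / real j ^ CARD('n)) * \<rho> (0 + (1 / real j) *\<^sub>R z))" for z
  show thesis
  proof (rule that)
    show "test_function K" unfolding K_def
      by (intro test_function_sum test_function_cmult test_function_affine[OF \<rho>(1)]) auto
    show "K z = 0" if z: "1 / 2 \<le> norm z" for z
    proof -
      have "\<rho> (0 + (1 / real j) *\<^sub>R z) = 0" if j: "j \<in> {1..M}" for j
      proof (rule \<rho>(2))
        have "\<delta> * real j \<le> \<delta> * real M" using j \<delta> by (intro mult_left_mono) auto
        also have "\<dots> = 1 / 2" by (simp add: \<delta>_def M_def)
        finally show "\<delta> \<le> norm (0 + (1 / real j) *\<^sub>R z)" using z j by (simp add: field_simps)
      qed
      then show ?thesis by (simp add: K_def)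
    qed
    show "(\<integral>z. K z * q (x - t *\<^sub>R z) \<partial>lborel) = q x" if q: "q \<in> polynomials m" for q x t
    proof -
      have [measurable]: "q \<in> borel_measurable borel" by (rule polynomials_measurable[OF q])
      have sq: "smooth q" by (rule polynomials_smooth[OF q])
      have sm: "smooth (\<lambda>w. q (x - (t * a) *\<^sub>R w))" for a
        using smooth_affine[OF sq, of x "- (t * a)"] by simp
      have i: "integrable lborel (\<lambda>w. q (x - (t * a) *\<^sub>R w) * \<rho> w)" for a
        by (rule test_function_integrable[OF test_function_mult[OF \<rho>(1) sm]])
      have scale: "(\<integral>z. \<rho> ((1 / real j) *\<^sub>R z) * q (x - t *\<^sub>R z) \<partial>lborel)
          = real j ^ CARD('n) * (\<integral>w. q (x - (t * real j) *\<^sub>R w) * \<rho> w \<partial>lborel)"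
        and intj: "integrable lborel (\<lambda>z. \<rho> ((1 / real j) *\<^sub>R z) * q (x - t *\<^sub>R z))" if "j \<in> {1..M}" for j
      proof -
        have j: "0 < real j" using that by simp
        show "(\<integral>z. \<rho> ((1 / real j) *\<^sub>R z) * q (x - t *\<^sub>R z) \<partial>lborel)
          = real j ^ CARD('n) * (\<integral>w. q (x - (t * real j) *\<^sub>R w) * \<rho> w \<partial>lborel)"
          using integral_affine[of "\<lambda>z. \<rho> ((1 / real j) *\<^sub>R z) * q (x - t *\<^sub>R z)" "real j" 0] j
          by (simp add: mult.commute)
        show "integrable lborel (\<lambda>z. \<rho> ((1 / real j) *\<^sub>R z) * q (x - t *\<^sub>R z))"
          using integrable_affine[OF i[of "real j"], of "1 / real j" 0] j by (simp add: mult.commute)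
      qed
      have "(\<integral>z. K z * q (x - t *\<^sub>R z) \<partial>lborel)
        = (\<integral>z. (\<Sum>j\<in>{1..M}. (c j / real j ^ CARD('n)) * (\<rho> ((1 / real j) *\<^sub>R z) * q (x - t *\<^sub>R z))) \<partial>lborel)"
        by (simp add: K_def sum_distrib_right mult.assoc)
      also have "\<dots> = (\<Sum>j\<in>{1..M}. (c j / real j ^ CARD('n)) * (\<integral>z. \<rho> ((1 / real j) *\<^sub>R z) * q (x - t *\<^sub>R z) \<partial>lborel))"
        by (subst Bochner_Integration.integral_sum) (simp_all add: intj)
      also have "\<dots> = (\<Sum>j\<in>{1..M}. c j * (\<integral>w. q (x - (t * real j) *\<^sub>R w) * \<rho> w \<partial>lborel))"
        by (intro sum.cong refl) (simp add: scale)
      also have "\<dots> = (\<integral>w. (\<Sum>j\<in>{1..M}. c j * (q (x - (t * real j) *\<^sub>R w) * \<rho> w)) \<partial>lborel)"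
        by (subst Bochner_Integration.integral_sum) (auto intro: i)
      also have "\<dots> = (\<integral>w. q x * \<rho> w \<partial>lborel)"
      proof (rule Bochner_Integration.integral_cong[OF refl])
        fix w
        obtain p where p: "degree p \<le> m" "\<And>a. q (x + a *\<^sub>R (- (t *\<^sub>R w))) = poly p a"
          using polynomials_line[OF q] by blast
        have "0 = (\<Sum>j\<le>M. (- 1) ^ j * real (M choose j) * poly p (real j))"
          using p(1) by (intro alternating_binomial_poly[symmetric]) (simp add: M_def)
        also have "\<dots> = q x - (\<Sum>j\<in>{1..M}. c j * q (x - (t * real j) *\<^sub>R w))"
        proof -
          have "{..M} = insert 0 {1..M}" by auto
          moreover have "poly p 0 = q x" using p(2)[of 0] by simp
          moreover have "poly p a = q (x - (t * a) *\<^sub>R w)" for a using p(2)[of a] by (simp add: mult.commute)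
          ultimately show ?thesis by (simp add: c_def sum_negf)
        qed
        finally have "(\<Sum>j\<in>{1..M}. c j * q (x - (t * real j) *\<^sub>R w)) = q x" by simp
        then show "(\<Sum>j\<in>{1..M}. c j * (q (x - (t * real j) *\<^sub>R w) * \<rho> w)) = q x * \<rho> w"
          by (simp add: sum_distrib_right[symmetric] mult.assoc[symmetric])
      qed
      also have "\<dots> = q x" using \<rho>(3) by simp
      finally show ?thesis .
    qed
  qed
qed

text \<open>As the kernel annihilates polynomials, any q may be subtracted from \<open>u\<close>
  under the integral. The rest is bounded by the supremum of the kernel times an integral over the
  ball, and the infimum over q is taken last.\<close>

lemma pairing_le_osc:
  fixes u g :: "real ^ 'n \<Rightarrow> real"
  assumes u: "loc_int u" and s: "m = nat \<lfloor>s\<rfloor>" and [measurable]: "g \<in> borel_measurable borel"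
    and g: "\<And>z. \<bar>g z\<bar> \<le> B" "\<And>z. R \<le> norm z \<Longrightarrow> g z = 0" and B: "0 < B" and R: "0 < R"
    and ann: "\<And>q. q \<in> polynomials m \<Longrightarrow> (\<integral>y. q y * g (x - y) \<partial>lborel) = 0"
  shows "ennreal \<bar>\<integral>y. u y * g (x - y) \<partial>lborel\<bar> \<le>
    ennreal (B * unit_ball_vol (real CARD('n)) * R ^ CARD('n) * R powr s) * osc s u x R"
proof -
  let ?om = "unit_ball_vol (real CARD('n))"
  have om: "0 < ?om" by (rule unit_ball_vol_pos')
  let ?c = "B * ?om * R ^ CARD('n) * R powr s"
  have c: "0 < ?c" using B om R by simp
  have [measurable]: "u \<in> borel_measurable borel" using u by (simp add: loc_int_def)
  have out: "g (x - y) = 0" if "norm x + R < norm y" for y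
  proof (rule g(2))
    have "norm y \<le> norm x + norm (x - y)" by (metis norm_minus_commute norm_triangle_sub)
    then show "R \<le> norm (x - y)" using that by simp
  qed
  \<comment> \<open>Dividing by the constant first leaves a bare infimum on the right, to be checked
    for each q.\<close>
  have "ennreal (1 / ?c) * ennreal \<bar>\<integral>y. u y * g (x - y) \<partial>lborel\<bar> \<le> osc s u x R"
    unfolding osc_altdef[OF \<open>u \<in> borel_measurable borel\<close> R]
  proof (rule INF_greatest)
    fix q :: "real ^ 'n \<Rightarrow> real" assume q: "q \<in> polynomials (nat \<lfloor>s\<rfloor>)"
    have Lq: "loc_int q" by (intro loc_int_continuous smooth_continuous polynomials_smooth[OF q])
    have L: "loc_int (\<lambda>y. u y - q y)" by (intro loc_int_diff u Lq)
    have int: "integrable lborel (\<lambda>y. f y * g (x - y))" if "loc_int f" for f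
      by (rule loc_int_integrable_mult[OF that, where M=B and R="norm x + R"]) (use g(1) out in auto)
    have i0: "integrable lborel (\<lambda>y. \<bar>(u y - q y) * indicator (ball x R) y\<bar>)"
    proof (intro integrable_abs loc_int_integrable_mult[OF L, where M=1 and R="norm x + R"])
      fix y :: "real ^ 'n" assume "norm x + R < norm y"
      then have "\<not> dist x y < R" using norm_triangle_sub[of y x] by (simp add: dist_norm norm_minus_commute)
      then show "indicator (ball x R) y = (0 :: real)" by simp
    qed (auto simp: indicator_def)
    have "(\<integral>y. u y * g (x - y) \<partial>lborel) = (\<integral>y. (u y - q y) * g (x - y) \<partial>lborel)"
      using ann[of q] q int[OF u] int[OF Lq] by (simp add: s left_diff_distrib)
    also have "\<bar>\<dots>\<bar> \<le> (\<integral>y. B * \<bar>(u y - q y) * indicator (ball x R) y\<bar> \<partial>lborel)"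
      unfolding real_norm_def[symmetric]
    proof (rule Bochner_Integration.integral_norm_bound_integral)
      show "integrable lborel (\<lambda>y. (u y - q y) * g (x - y))" by (rule int[OF L])
      show "integrable lborel (\<lambda>y. B * norm ((u y - q y) * indicator (ball x R) y))"
        using i0 by (intro integrable_mult_right) simp
      fix y
      show "norm ((u y - q y) * g (x - y)) \<le> B * norm ((u y - q y) * indicator (ball x R) y)"
        using g(1)[of "x - y"] g(2)[of "x - y"]
        by (cases "dist x y < R") (auto simp: abs_mult dist_norm mult.commute intro: mult_right_mono)
    qed
    also have "\<dots> = B * (\<integral>y. \<bar>u y - q y\<bar> * indicator (ball x R) y \<partial>lborel)"
      by (simp add: abs_mult)
    finally have "1 / ?c * \<bar>\<integral>y. u y * g (x - y) \<partial>lborel\<bar> \<le> 1 / ?c * (B * (\<integral>y. \<bar>u y - q y\<bar> * indicator (ball x R) y \<partial>lborel))"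
      using c by (intro mult_left_mono) auto
    also have "\<dots> = 1 / (?om * R ^ CARD('n)) * (1 / R powr s * (\<integral>y. \<bar>u y - q y\<bar> * indicator (ball x R) y \<partial>lborel))"
      using B by simp
    finally have "ennreal (1 / ?c * \<bar>\<integral>y. u y * g (x - y) \<partial>lborel\<bar>) \<le> ball_mean R (\<lambda>h. ennreal (\<bar>u (x + h) - q (x + h)\<bar> / R powr s))"
      unfolding ball_mean_eq_integral[OF L R, of "R powr s" x, simplified powr_gt_zero, OF R[THEN less_imp_neq, symmetric]]
      by (rule ennreal_leI)
    then show "ennreal (1 / ?c) * ennreal \<bar>\<integral>y. u y * g (x - y) \<partial>lborel\<bar> \<le> ball_mean R (\<lambda>h. ennreal (\<bar>u (x + h) - q (x + h)\<bar> / R powr s))"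
      using c by (simp only: ennreal_mult[symmetric] abs_ge_zero zero_le_divide_1_iff less_imp_le)
  qed
  then have "ennreal ?c * (ennreal (1 / ?c) * ennreal \<bar>\<integral>y. u y * g (x - y) \<partial>lborel\<bar>) \<le> ennreal ?c * osc s u x R"
    by (intro mult_left_mono) auto
  moreover have "ennreal ?c * (ennreal (1 / ?c) * z) = z" for z
  proof -
    have "ennreal c * ennreal (1 / c) = 1" if "0 < c" for c
      using that by (simp flip: ennreal_mult)
    from this[OF c] show ?thesis by (simp only: mult.assoc[symmetric] mult_1)
  qed
  ultimately show ?thesis by (simp only:)
qed

section \<open>Mollified derivatives\<close>

text \<open>The derivative along \<open>js\<close> of K_t, where K_t(z) = t^(-n) K(z / t).\<close>

definition scaled_kernel :: "(real ^ 'n \<Rightarrow> real) \<Rightarrow> real \<Rightarrow> 'n list \<Rightarrow> real ^ 'n \<Rightarrow> real" where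
  "scaled_kernel K t js z = (1 / t) ^ (CARD('n) + length js) * iterated_partial js K ((1 / t) *\<^sub>R z)"

text \<open>The derivative along \<open>js\<close> of the convolution of \<open>u\<close> with K_t,
  written with all derivatives on the kernel; differentiability of the convolution never has to be
  shown.\<close>

definition mollified :: "(real ^ 'n \<Rightarrow> real) \<Rightarrow> (real ^ 'n \<Rightarrow> real) \<Rightarrow> 'n list \<Rightarrow> real \<Rightarrow> real ^ 'n \<Rightarrow> real" where
  "mollified K u js t x = (\<integral>y. u y * scaled_kernel K t js (x - y) \<partial>lborel)"

text \<open>The support radius 1/2 leaves room: the kernels at scales t and t / 2 stay in the ball
  of radius t, and a shift by at most t keeps them in the ball of radius 2 t.\<close>

locale reproducing_kernel =
  fixes K :: "real ^ 'n \<Rightarrow> real" and m :: nat and M :: real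
  assumes K_test: "test_function K"
    and K_support: "\<And>z. 1 / 2 \<le> norm z \<Longrightarrow> K z = 0"
    and K_reproducing: "\<And>q x t. q \<in> polynomials m \<Longrightarrow> (\<integral>z. K z * q (x - t *\<^sub>R z) \<partial>lborel) = q x"
    and M: "0 < M" and K_bound: "\<And>js z. length js \<le> m \<Longrightarrow> \<bar>iterated_partial js K z\<bar> \<le> M"
begin

lemma K_smooth: "smooth K"
  by (rule test_function_smooth[OF K_test])

lemma K_measurable [measurable]: "K \<in> borel_measurable borel"
  by (rule smooth_measurable[OF K_smooth])

lemma scaled_kernel_eq:
  "iterated_partial js (\<lambda>z. (1 / t) ^ CARD('n) * K (0 + (1 / t) *\<^sub>R z)) = scaled_kernel K t js"
  unfolding iterated_partial_cmult[OF smooth_affine[OF K_smooth]] iterated_partial_affine[OF K_smooth]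
  by (rule ext) (simp add: scaled_kernel_def power_add)

lemma test_kernel: "0 < t \<Longrightarrow> test_function (scaled_kernel K t [])"
  unfolding scaled_kernel_eq[symmetric] iterated_partial_Nil
  by (intro test_function_cmult test_function_affine[OF K_test]) simp

lemma iterated_scaled_kernel: "iterated_partial js (scaled_kernel K t []) = scaled_kernel K t js"
  unfolding scaled_kernel_eq[of "[]", symmetric] iterated_partial_Nil by (rule scaled_kernel_eq)

lemma test_scaled_kernel: "0 < t \<Longrightarrow> test_function (scaled_kernel K t js)"
  using test_function_iterated_partial[OF test_kernel, of t js] by (simp only: iterated_scaled_kernel)

lemma scaled_kernel_measurable [measurable]: "scaled_kernel K t js \<in> borel_measurable borel"
proof -
  have [measurable]: "iterated_partial js K \<in> borel_measurable borel"
    by (intro smooth_measurable smooth_iterated_partial K_smooth)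
  show ?thesis unfolding scaled_kernel_def by measurable
qed

text \<open>For t <= 1 the exponent is raised to n + m for every \<open>js\<close>, so that all
  orders up to m get the common rate t^(frac s). For lower orders this is weaker than the natural
  rate, but it still tends to 0.\<close>

lemma scaled_kernel_bound:
  assumes "length js \<le> m" "0 < t" "t \<le> 1" shows "\<bar>scaled_kernel K t js z\<bar> \<le> M * (1 / t) ^ (CARD('n) + m)"
proof -
  have "\<bar>scaled_kernel K t js z\<bar> = (1 / t) ^ (CARD('n) + length js) * \<bar>iterated_partial js K ((1 / t) *\<^sub>R z)\<bar>"
    using assms(2) by (simp add: scaled_kernel_def abs_mult)
  also have "\<dots> \<le> (1 / t) ^ (CARD('n) + m) * M"
    using assms by (intro mult_mono K_bound power_increasing) auto
  finally show ?thesis by (simp add: mult.commute)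
qed

lemma scaled_kernel_vanish: "0 < t \<Longrightarrow> t / 2 < norm z \<Longrightarrow> scaled_kernel K t js z = 0"
  unfolding scaled_kernel_def
  by (subst iterated_partial_vanish[where R="1 / 2"]) (auto simp: K_support field_simps)

text \<open>Integration by parts moves the derivatives to q, and the reproducing property applies to
  the resulting polynomial. The value does not depend on t, hence differences between scales
  annihilate polynomials.\<close>

lemma scaled_kernel_polynomial:
  assumes q: "q \<in> polynomials m" and t: "0 < t" and js: "length js \<le> m"
  shows "(\<integral>y. q y * scaled_kernel K t js (x - y) \<partial>lborel) = iterated_partial js q x"
proof -
  let ?\<phi> = "\<lambda>y. scaled_kernel K t [] (x + (-1) *\<^sub>R y)"
  have \<phi>: "test_function ?\<phi>" by (intro test_function_affine test_kernel t) simp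
  have sq: "smooth q" by (rule polynomials_smooth[OF q])
  have q': "iterated_partial js q \<in> polynomials m"
    by (rule polynomials_mono[OF polynomials_iterated_partial[OF q]]) simp
  have [measurable]: "iterated_partial js q \<in> borel_measurable borel" by (rule polynomials_measurable[OF q'])
  have "iterated_partial js ?\<phi> = (\<lambda>y. (- 1) ^ length js * scaled_kernel K t js (x + (-1) *\<^sub>R y))"
    by (simp only: iterated_partial_affine[OF test_function_smooth[OF test_kernel[OF t]]] iterated_scaled_kernel)
  then have "(- 1) ^ length js * (\<integral>y. q y * scaled_kernel K t js (x - y) \<partial>lborel) = (\<integral>y. q y * iterated_partial js ?\<phi> y \<partial>lborel)"
    by (simp add: mult.left_commute[of _ "(- 1) ^ length js"])
  also have "\<dots> = (- 1) ^ length js * (\<integral>y. iterated_partial js q y * ?\<phi> y \<partial>lborel)"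
    by (rule iterated_integration_by_parts[OF sq \<phi>])
  finally have "(\<integral>y. q y * scaled_kernel K t js (x - y) \<partial>lborel) = (\<integral>y. iterated_partial js q y * scaled_kernel K t [] (x - y) \<partial>lborel)"
    by simp
  also have "\<dots> = t ^ CARD('n) * (\<integral>z. iterated_partial js q (x + (- t) *\<^sub>R z) * scaled_kernel K t [] (t *\<^sub>R z) \<partial>lborel)"
    using integral_affine[of "\<lambda>y. iterated_partial js q y * scaled_kernel K t [] (x - y)" "- t" x] t by simp
  also have "\<dots> = (\<integral>z. K z * iterated_partial js q (x - t *\<^sub>R z) \<partial>lborel)"
    using t by (simp add: scaled_kernel_def power_divide mult.commute)
  also have "\<dots> = iterated_partial js q x" by (rule K_reproducing[OF q'])
  finally show ?thesis .
qed

lemma integrable_mollified: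
  assumes u: "loc_int u" and t: "0 < t"
  shows "integrable lborel (\<lambda>y. u y * scaled_kernel K t js (x - y))"
proof -
  have "test_function (\<lambda>y. scaled_kernel K t js (x + (-1) *\<^sub>R y))"
    by (intro test_function_affine test_scaled_kernel t) simp
  then show ?thesis using loc_int_integrable_test[OF u] by simp
qed

lemma mollified_measurable [measurable]:
  assumes "loc_int u" shows "mollified K u js t \<in> borel_measurable borel"
proof -
  have [measurable]: "u \<in> borel_measurable borel" using assms by (simp add: loc_int_def)
  show ?thesis unfolding mollified_def by measurable
qed

text \<open>The difference of the two kernels annihilates polynomials. Its bound of order t^(-n-m),
  times the volume t^n and the normalisation t^s of the oscillation, leaves t^(frac s).\<close>

lemma mollified_step:
  fixes s :: real
  assumes u: "loc_int u" and m: "m = nat \<lfloor>s\<rfloor>" and s: "0 < s" and js: "length js \<le> m" and t: "0 < t" "t \<le> 1"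
  shows "ennreal \<bar>mollified K u js (t / 2) x - mollified K u js t x\<bar> \<le>
    ennreal (M * (2 ^ (CARD('n) + m) + 1) * unit_ball_vol (real CARD('n)) * t powr frac s) * osc s u x t"
proof -
  let ?B = "M * (2 ^ (CARD('n) + m) + 1) * (1 / t) ^ (CARD('n) + m)"
  let ?g = "\<lambda>z. scaled_kernel K (t / 2) js z - scaled_kernel K t js z"
  have "ennreal \<bar>\<integral>y. u y * ?g (x - y) \<partial>lborel\<bar> \<le>
    ennreal (?B * unit_ball_vol (real CARD('n)) * t ^ CARD('n) * t powr s) * osc s u x t"
  proof (rule pairing_le_osc[OF u m])
    show "\<bar>?g z\<bar> \<le> ?B" for z
    proof -
      have "\<bar>?g z\<bar> \<le> M * (1 / (t / 2)) ^ (CARD('n) + m) + M * (1 / t) ^ (CARD('n) + m)"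
        using scaled_kernel_bound[of js "t / 2" z] scaled_kernel_bound[of js t z] js t by linarith
      also have "(1 / (t / 2)) ^ (CARD('n) + m) = 2 ^ (CARD('n) + m) * (1 / t) ^ (CARD('n) + m)"
        by (simp flip: power_mult_distrib)
      finally show ?thesis by (simp add: algebra_simps)
    qed
    show "?g z = 0" if "t \<le> norm z" for z
      using that t by (simp add: scaled_kernel_vanish)
    show "0 < ?B" using M t by (intro mult_pos_pos) (auto intro: add_pos_pos)
    show "(\<integral>y. q y * ?g (x - y) \<partial>lborel) = 0" if q: "q \<in> polynomials m" for q
    proof -
      have "loc_int q" by (intro loc_int_continuous smooth_continuous polynomials_smooth[OF q])
      then show ?thesis
        using scaled_kernel_polynomial[OF q _ js] t integrable_mollified[of q] by (simp add: right_diff_distrib)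
    qed
  qed (use t in auto)
  moreover have "(\<integral>y. u y * ?g (x - y) \<partial>lborel) = mollified K u js (t / 2) x - mollified K u js t x"
    using integrable_mollified[OF u] t by (simp add: mollified_def right_diff_distrib)
  moreover have "?B * unit_ball_vol (real CARD('n)) * t ^ CARD('n) * t powr s
    = M * (2 ^ (CARD('n) + m) + 1) * unit_ball_vol (real CARD('n)) * t powr frac s"
  proof -
    have "s = real m + frac s" using s by (simp add: m frac_def)
    then have "t powr s = t ^ m * t powr frac s" using t by (metis powr_add powr_realpow)
    then show ?thesis using t by (simp add: power_divide power_add)
  qed
  ultimately show ?thesis by (simp only:)
qed

text \<open>Top order matters: the m-th derivatives of a polynomial of degree m are constant, so the
  translation difference of the kernel annihilates it. The shifted support leads to the radius 2
  t.\<close>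

lemma mollified_translate:
  fixes s :: real
  assumes u: "loc_int u" and m: "m = nat \<lfloor>s\<rfloor>" and s: "0 < s" and js: "length js = m" and t: "0 < t" "t \<le> 1"
    and xy: "norm (x - y) \<le> t"
  shows "ennreal \<bar>mollified K u js t x - mollified K u js t y\<bar> \<le>
    ennreal (2 * M * 2 ^ CARD('n) * 2 powr s * unit_ball_vol (real CARD('n)) * t powr frac s) * osc s u x (2 * t)"
proof -
  let ?B = "2 * M * (1 / t) ^ (CARD('n) + m)"
  let ?g = "\<lambda>z. scaled_kernel K t js z - scaled_kernel K t js (z + (y - x))"
  have "ennreal \<bar>\<integral>w. u w * ?g (x - w) \<partial>lborel\<bar> \<le>
    ennreal (?B * unit_ball_vol (real CARD('n)) * (2 * t) ^ CARD('n) * (2 * t) powr s) * osc s u x (2 * t)"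
  proof (rule pairing_le_osc[OF u m])
    show "\<bar>?g z\<bar> \<le> ?B" for z
      using scaled_kernel_bound[of js t z] scaled_kernel_bound[of js t "z + (y - x)"] js t by simp
    show "?g z = 0" if z: "2 * t \<le> norm z" for z
    proof -
      have "norm z \<le> norm (z + (y - x)) + norm (x - y)"
        using norm_triangle_ineq[of "z + (y - x)" "x - y"] by simp
      then have "t / 2 < norm (z + (y - x))" using z xy t by linarith
      then show ?thesis using z t by (simp add: scaled_kernel_vanish)
    qed
    show "0 < ?B" using M t by simp
    show "(\<integral>w. q w * ?g (x - w) \<partial>lborel) = 0" if q: "q \<in> polynomials m" for q
    proof -
      have Lq: "loc_int q" by (intro loc_int_continuous smooth_continuous polynomials_smooth[OF q])
      have "(\<integral>w. q w * ?g (x - w) \<partial>lborel) = iterated_partial js q x - iterated_partial js q y"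
        using scaled_kernel_polynomial[OF q t(1), of js] js integrable_mollified[OF Lq t(1), of js]
        by (simp add: right_diff_distrib)
      moreover have "iterated_partial js q \<in> polynomials 0"
        using polynomials_iterated_partial[OF q, of js] js by simp
      then have "iterated_partial js q x = iterated_partial js q y"
        by (rule polynomials_0_const)
      ultimately show ?thesis by simp
    qed
  qed (use t in auto)
  moreover have "(\<integral>w. u w * ?g (x - w) \<partial>lborel) = mollified K u js t x - mollified K u js t y"
    using integrable_mollified[OF u t(1), of js] by (simp add: mollified_def right_diff_distrib)
  moreover have "?B * unit_ball_vol (real CARD('n)) * (2 * t) ^ CARD('n) * (2 * t) powr s
    = 2 * M * 2 ^ CARD('n) * 2 powr s * unit_ball_vol (real CARD('n)) * t powr frac s"
  proof -
    have "s = real m + frac s" using s by (simp add: m frac_def)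
    then have "t powr s = t ^ m * t powr frac s" using t by (metis powr_add powr_realpow)
    then show ?thesis using t by (simp add: power_divide power_add power_mult_distrib powr_mult)
  qed
  ultimately show ?thesis by (simp only:)
qed

lemma mollified_abs_le:
  assumes u: "loc_int u" and js: "length js \<le> m" and t: "0 < t" "t \<le> 1"
  shows "ennreal \<bar>mollified K u js t x\<bar> \<le>
    ennreal (M * (1 / t) ^ (CARD('n) + m)) * (\<integral>\<^sup>+y. ennreal \<bar>u y\<bar> * indicator (ball x t) y \<partial>lborel)"
proof -
  let ?B = "M * (1 / t) ^ (CARD('n) + m)"
  have B: "0 \<le> ?B" using M t by simp
  have [measurable]: "u \<in> borel_measurable borel" using u by (simp add: loc_int_def)
  have "ennreal \<bar>mollified K u js t x\<bar> \<le> (\<integral>\<^sup>+y. ennreal (norm (u y * scaled_kernel K t js (x - y))) \<partial>lborel)"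
    unfolding mollified_def using integral_norm_bound_ennreal[OF integrable_mollified[OF u t(1)]] by simp
  also have "\<dots> \<le> (\<integral>\<^sup>+y. ennreal ?B * (ennreal \<bar>u y\<bar> * indicator (ball x t) y) \<partial>lborel)"
  proof (rule nn_integral_mono)
    fix y
    have "norm (u y * scaled_kernel K t js (x - y)) \<le> ?B * \<bar>u y\<bar>"
      using mult_left_mono[OF scaled_kernel_bound[OF js t, of "x - y"], of "\<bar>u y\<bar>"]
      by (simp add: abs_mult mult.commute)
    then have "ennreal (norm (u y * scaled_kernel K t js (x - y))) \<le> ennreal (?B * \<bar>u y\<bar>)"
      by (rule ennreal_leI)
    also have "\<dots> = ennreal ?B * ennreal \<bar>u y\<bar>" using B by (intro ennreal_mult) auto
    finally have "ennreal (norm (u y * scaled_kernel K t js (x - y))) \<le> ennreal ?B * ennreal \<bar>u y\<bar>" .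
    moreover have "scaled_kernel K t js (x - y) = 0" if "\<not> dist x y < t"
      using that t by (intro scaled_kernel_vanish) (auto simp: dist_norm)
    ultimately show "ennreal (norm (u y * scaled_kernel K t js (x - y))) \<le> ennreal ?B * (ennreal \<bar>u y\<bar> * indicator (ball x t) y)"
      by (cases "dist x y < t") auto
  qed
  also have "\<dots> = ennreal ?B * (\<integral>\<^sup>+y. ennreal \<bar>u y\<bar> * indicator (ball x t) y \<partial>lborel)"
    by (rule nn_integral_cmult) measurable
  finally show ?thesis .
qed

text \<open>To be used at the fixed scale 1/2, where the power of 1 / t is a constant and the Orlicz
  norm of \<open>u\<close> controls the ball mean.\<close>

lemma mollified_le_ball_mean:
  assumes u: "loc_int u" and js: "length js \<le> m" and t: "0 < t" "t \<le> 1"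
  shows "ennreal \<bar>mollified K u js t x\<bar> \<le>
    ennreal (M * (1 / t) ^ m * unit_ball_vol (real CARD('n))) * ball_mean t (\<lambda>h. ennreal \<bar>u (x + h)\<bar>)"
proof -
  let ?om = "unit_ball_vol (real CARD('n))" and ?B = "M * (1 / t) ^ (CARD('n) + m)"
  have om: "0 < ?om" by (rule unit_ball_vol_pos')
  have [measurable]: "u \<in> borel_measurable borel" using u by (simp add: loc_int_def)
  have "(\<integral>\<^sup>+h. ennreal \<bar>u (x + h)\<bar> * indicator (ball 0 t) h \<partial>lborel) = (\<integral>\<^sup>+y. ennreal \<bar>u y\<bar> * indicator (ball x t) y \<partial>lborel)"
    using nn_integral_translate[of "\<lambda>y. ennreal \<bar>u y\<bar> * indicator (ball x t) y" x] by (simp add: indicator_def dist_norm)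
  moreover have "ennreal (M * (1 / t) ^ m * ?om) * ennreal (1 / (?om * t ^ CARD('n))) = ennreal ?B"
  proof -
    have "M * (1 / t) ^ m * ?om * (1 / (?om * t ^ CARD('n))) = ?B"
      using t om by (simp add: power_add power_divide less_imp_neq[OF om, symmetric])
    moreover have "ennreal (M * (1 / t) ^ m * ?om) * ennreal (1 / (?om * t ^ CARD('n))) = ennreal (M * (1 / t) ^ m * ?om * (1 / (?om * t ^ CARD('n))))"
      by (rule ennreal_mult[symmetric]) (use M t om in simp_all)
    ultimately show ?thesis by (simp only:)
  qed
  ultimately show ?thesis using mollified_abs_le[OF assms, of x] by (simp add: ball_mean_def mult.assoc[symmetric])
qed

lemma loc_int_mollified:
  assumes u: "loc_int u" and js: "length js \<le> m" and t: "0 < t" "t \<le> 1"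
  shows "loc_int (mollified K u js t)"
  unfolding loc_int_def
proof (intro conjI allI)
  show "mollified K u js t \<in> borel_measurable borel" by (rule mollified_measurable[OF u])
  fix R
  let ?c = "ennreal (M * (1 / t) ^ (CARD('n) + m)) * (\<integral>\<^sup>+y. ennreal \<bar>u y\<bar> * indicator (cball 0 (R + 1)) y \<partial>lborel)"
  have le: "ennreal \<bar>mollified K u js t x\<bar> \<le> ?c" if x: "norm x \<le> R" for x
  proof (rule order_trans[OF mollified_abs_le[OF assms]], intro mult_left_mono nn_integral_mono)
    fix y
    have "norm y \<le> R + 1" if "dist x y < t"
    proof -
      have "norm y \<le> norm x + norm (y - x)" by (rule norm_triangle_sub)
      then show ?thesis using that x t by (simp add: dist_norm norm_minus_commute)
    qed
    then show "indicator (ball x t) y \<le> (indicator (cball 0 (R + 1)) y :: ennreal)" by (auto simp: indicator_def)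
  qed auto
  have "(\<integral>\<^sup>+x. ennreal \<bar>mollified K u js t x\<bar> * indicator (cball 0 R) x \<partial>lborel) \<le> (\<integral>\<^sup>+x. ?c * indicator (cball 0 R :: (real ^ 'n) set) x \<partial>lborel)"
    by (intro nn_integral_mono) (use le in \<open>auto simp: indicator_def\<close>)
  also have "\<dots> = ?c * emeasure lborel (cball 0 R :: (real ^ 'n) set)" by (simp add: nn_integral_cmult_indicator)
  also have "\<dots> < \<infinity>" using u emeasure_bounded_finite[of "cball 0 R :: (real ^ 'n) set"]
    by (simp add: loc_int_def ennreal_mult_less_top)
  finally show "(\<integral>\<^sup>+x. ennreal \<bar>mollified K u js t x\<bar> * indicator (cball 0 R) x \<partial>lborel) < \<infinity>" .
qed

text \<open>Fubini's theorem, integration by parts onto \<phi>, and the substitution x = y + t z.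
  Afterwards the dilated kernel acts on the smooth function only.\<close>

lemma integral_mollified_test:
  assumes u: "loc_int u" and js: "length js \<le> m" and t: "0 < t" "t \<le> 1" and \<phi>: "test_function \<phi>"
  shows "(\<integral>x. mollified K u js t x * \<phi> x \<partial>lborel) =
    (- 1) ^ length js * (\<integral>y. u y * (\<integral>z. K z * iterated_partial js \<phi> (y + t *\<^sub>R z) \<partial>lborel) \<partial>lborel)"
proof -
  have [measurable]: "u \<in> borel_measurable borel" using u by (simp add: loc_int_def)
  have sm: "smooth \<phi>" by (rule test_function_smooth[OF \<phi>])
  have [measurable]: "\<phi> \<in> borel_measurable borel" "iterated_partial js \<phi> \<in> borel_measurable borel"
    by (intro smooth_measurable smooth_iterated_partial sm)+
  obtain R where R: "0 < R" "\<And>x. R < norm x \<Longrightarrow> \<phi> x = 0" using test_function_bound[OF \<phi>] by blast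
  obtain B where B: "0 < B" "\<And>x. \<bar>\<phi> x\<bar> \<le> B" using test_function_bounded[OF \<phi>] by blast
  let ?f = "\<lambda>x y. u y * scaled_kernel K t js (x - y) * \<phi> x"
  let ?D = "M * (1 / t) ^ (CARD('n) + m)"
  have D: "0 \<le> ?D" using M t by simp
  have int: "integrable (lborel \<Otimes>\<^sub>M lborel) (\<lambda>(x, y). ?f x y)"
  proof (rule integrableI_bounded)
    show "(\<lambda>(x, y). ?f x y) \<in> borel_measurable (lborel \<Otimes>\<^sub>M lborel)" by measurable
    let ?c = "ennreal (?D * B)"
    have "(\<integral>\<^sup>+p. ennreal (norm (case p of (x, y) \<Rightarrow> ?f x y)) \<partial>(lborel \<Otimes>\<^sub>M lborel))
      = (\<integral>\<^sup>+x. \<integral>\<^sup>+y. ennreal (norm (?f x y)) \<partial>lborel \<partial>lborel)"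
      by (subst lborel.nn_integral_fst[symmetric]) (auto simp: case_prod_unfold)
    also have "\<dots> \<le> (\<integral>\<^sup>+x. \<integral>\<^sup>+y. (?c * indicator (cball 0 R :: (real ^ 'n) set) x) * (ennreal \<bar>u y\<bar> * indicator (cball 0 (R + 1)) y) \<partial>lborel \<partial>lborel)"
    proof (intro nn_integral_mono)
      fix x y :: "real ^ 'n"
      show "ennreal (norm (?f x y)) \<le> (?c * indicator (cball 0 R) x) * (ennreal \<bar>u y\<bar> * indicator (cball 0 (R + 1)) y)"
      proof (cases "norm x \<le> R \<and> norm y \<le> R + 1")
        case True
        have "norm (?f x y) \<le> (\<bar>u y\<bar> * ?D) * B"
          unfolding real_norm_def abs_mult
          by (intro mult_mono scaled_kernel_bound[OF js t] B mult_nonneg_nonneg D) auto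
        then have "ennreal (norm (?f x y)) \<le> ennreal ((?D * B) * \<bar>u y\<bar>)"
          by (intro ennreal_leI) (simp add: mult_ac)
        also have "\<dots> = ?c * ennreal \<bar>u y\<bar>"
          by (rule ennreal_mult[OF mult_nonneg_nonneg[OF D less_imp_le[OF B(1)]] abs_ge_zero])
        finally show ?thesis using True by simp
      next
        case False
        have "?f x y = 0"
        proof (cases "norm x \<le> R")
          case True
          have "norm y \<le> norm x + norm (y - x)" by (rule norm_triangle_sub)
          then have "t / 2 < norm (x - y)" using True False t by (simp add: norm_minus_commute)
          then show ?thesis using t by (simp add: scaled_kernel_vanish)
        qed (simp add: R)
        then show ?thesis by (simp only: norm_zero ennreal_0 zero_le)
      qed
    qed
    also have "\<dots> = (\<integral>\<^sup>+x. (?c * indicator (cball 0 R :: (real ^ 'n) set) x) * (\<integral>\<^sup>+y. ennreal \<bar>u y\<bar> * indicator (cball 0 (R + 1)) y \<partial>lborel) \<partial>lborel)"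
      by (intro nn_integral_cong nn_integral_cmult) measurable
    also have "\<dots> = ?c * emeasure lborel (cball 0 R :: (real ^ 'n) set) * (\<integral>\<^sup>+y. ennreal \<bar>u y\<bar> * indicator (cball 0 (R + 1)) y \<partial>lborel)"
      by (subst nn_integral_multc) (auto simp: nn_integral_cmult_indicator)
    also have "\<dots> < \<infinity>" using u emeasure_bounded_finite[of "cball 0 R :: (real ^ 'n) set"]
      by (simp add: loc_int_def ennreal_mult_less_top)
    finally show "(\<integral>\<^sup>+p. ennreal (norm (case p of (x, y) \<Rightarrow> ?f x y)) \<partial>(lborel \<Otimes>\<^sub>M lborel)) < \<infinity>" .
  qed
  have "(\<integral>x. mollified K u js t x * \<phi> x \<partial>lborel) = (\<integral>x. (\<integral>y. ?f x y \<partial>lborel) \<partial>lborel)"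
    by (simp add: mollified_def)
  also have "\<dots> = (\<integral>y. (\<integral>x. ?f x y \<partial>lborel) \<partial>lborel)"
    by (rule lborel_pair.Fubini_integral[OF int, symmetric])
  also have "\<dots> = (\<integral>y. (- 1) ^ length js * (u y * (\<integral>z. K z * iterated_partial js \<phi> (y + t *\<^sub>R z) \<partial>lborel)) \<partial>lborel)"
  proof (rule Bochner_Integration.integral_cong[OF refl])
    fix y
    let ?k = "\<lambda>x. scaled_kernel K t [] (- y + 1 *\<^sub>R x)"
    have k: "smooth ?k" by (rule smooth_affine[OF test_function_smooth[OF test_kernel[OF t(1)]]])
    have dk: "iterated_partial js ?k = (\<lambda>x. 1 ^ length js * scaled_kernel K t js (- y + 1 *\<^sub>R x))"
      by (simp only: iterated_partial_affine[OF test_function_smooth[OF test_kernel[OF t(1)]]] iterated_scaled_kernel)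
    have one: "(- 1) ^ length js * ((- 1) ^ length js * c) = c" for c :: real
      by (simp flip: power_mult_distrib mult.assoc)
    have "(\<integral>x. scaled_kernel K t [] (x - y) * iterated_partial js \<phi> x \<partial>lborel) = (- 1) ^ length js * (\<integral>x. scaled_kernel K t js (x - y) * \<phi> x \<partial>lborel)"
      using iterated_integration_by_parts[OF k \<phi>, of js] unfolding dk by simp
    then have "(\<integral>x. scaled_kernel K t js (x - y) * \<phi> x \<partial>lborel) = (- 1) ^ length js * (\<integral>x. scaled_kernel K t [] (x - y) * iterated_partial js \<phi> x \<partial>lborel)"
      by (simp only: one)
    also have "(\<integral>x. scaled_kernel K t [] (x - y) * iterated_partial js \<phi> x \<partial>lborel) = (\<integral>z. K z * iterated_partial js \<phi> (y + t *\<^sub>R z) \<partial>lborel)"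
      using integral_affine[of "\<lambda>x. scaled_kernel K t [] (x - y) * iterated_partial js \<phi> x" t y] t
      by (simp add: scaled_kernel_def power_divide)
    finally have "u y * (\<integral>x. scaled_kernel K t js (x - y) * \<phi> x \<partial>lborel) = (- 1) ^ length js * (u y * (\<integral>z. K z * iterated_partial js \<phi> (y + t *\<^sub>R z) \<partial>lborel))"
      by (simp only: mult.left_commute)
    then show "(\<integral>x. ?f x y \<partial>lborel) = (- 1) ^ length js * (u y * (\<integral>z. K z * iterated_partial js \<phi> (y + t *\<^sub>R z) \<partial>lborel))"
      by (simp only: mult.assoc integral_mult_right_zero)
  qed
  finally show ?thesis by simp
qed

text \<open>\<open>K\<close> reproduces constants and so has integral 1; hence it is an approximate
  identity on the continuous derivative of \<phi>. Dominated convergence is used twice, in z for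
  fixed y and then against \<open>u\<close>.\<close>

lemma integral_mollified_test_tendsto:
  assumes u: "loc_int u" and js: "length js \<le> m" and t: "\<And>k. 0 < t k" "\<And>k. t k \<le> 1" "t \<longlonglongrightarrow> 0" and \<phi>: "test_function \<phi>"
  shows "(\<lambda>k. \<integral>x. mollified K u js (t k) x * \<phi> x \<partial>lborel) \<longlonglongrightarrow> (- 1) ^ length js * (\<integral>y. u y * iterated_partial js \<phi> y \<partial>lborel)"
proof -
  have [measurable]: "u \<in> borel_measurable borel" using u by (simp add: loc_int_def)
  let ?\<psi> = "iterated_partial js \<phi>"
  have \<psi>: "test_function ?\<psi>" by (rule test_function_iterated_partial[OF \<phi>])
  have [measurable]: "?\<psi> \<in> borel_measurable borel"
    by (rule smooth_measurable[OF test_function_smooth[OF \<psi>]])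
  obtain R where R: "0 < R" "\<And>x. R < norm x \<Longrightarrow> ?\<psi> x = 0" using test_function_bound[OF \<psi>] by blast
  obtain B where B: "0 < B" "\<And>x. \<bar>?\<psi> x\<bar> \<le> B" using test_function_bounded[OF \<psi>] by blast
  \<comment> \<open>The mollification dual to that of \<open>u\<close>, acting on the derivative of
    \<phi>.\<close>
  define P where "P k y = (\<integral>z. K z * ?\<psi> (y + t k *\<^sub>R z) \<partial>lborel)" for k y
  have iK: "integrable lborel (\<lambda>z. B * \<bar>K z\<bar>)"
    by (rule integrable_mult_right[OF integrable_abs[OF test_function_integrable[OF K_test]]])
  have K1: "(\<integral>z. K z \<partial>lborel) = 1" using K_reproducing[OF const_polynomials[of 1]] by simp
  have kb: "norm (K z * ?\<psi> w) \<le> B * \<bar>K z\<bar>" for z w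
    using mult_left_mono[OF B(2), of "\<bar>K z\<bar>" w] by (simp add: abs_mult mult.commute)
  have lim: "(\<lambda>k. P k y) \<longlonglongrightarrow> ?\<psi> y" for y
  proof -
    have "(\<lambda>k. P k y) \<longlonglongrightarrow> (\<integral>z. K z * ?\<psi> y \<partial>lborel)"
      unfolding P_def
    proof (rule integral_dominated_convergence[OF _ _ iK])
      show "AE z in lborel. (\<lambda>k. K z * ?\<psi> (y + t k *\<^sub>R z)) \<longlonglongrightarrow> K z * ?\<psi> y"
      proof (rule AE_I2, rule tendsto_mult[OF tendsto_const])
        fix z
        have "(\<lambda>k. y + t k *\<^sub>R z) \<longlonglongrightarrow> y + 0 *\<^sub>R z" by (intro tendsto_intros t(3))
        moreover have "isCont ?\<psi> y"
          by (rule differentiable_imp_continuous_within[OF smooth_differentiable[OF test_function_smooth[OF \<psi>]]])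
        ultimately show "(\<lambda>k. ?\<psi> (y + t k *\<^sub>R z)) \<longlonglongrightarrow> ?\<psi> y"
          using isCont_tendsto_compose[of y ?\<psi> "\<lambda>k. y + t k *\<^sub>R z"] by simp
      qed
      show "AE z in lborel. norm (K z * ?\<psi> (y + t k *\<^sub>R z)) \<le> B * \<bar>K z\<bar>" for k
        by (intro AE_I2 kb)
    qed measurable
    then show ?thesis by (simp add: K1)
  qed
  have Pb: "\<bar>P k y\<bar> \<le> (\<integral>z. B * \<bar>K z\<bar> \<partial>lborel)" for k y
  proof -
    have "integrable lborel (\<lambda>z. K z * ?\<psi> (y + t k *\<^sub>R z))"
    proof (rule Bochner_Integration.integrable_bound[OF iK])
      show "AE z in lborel. norm (K z * ?\<psi> (y + t k *\<^sub>R z)) \<le> norm (B * \<bar>K z\<bar>)"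
      proof (rule AE_I2)
        fix z
        show "norm (K z * ?\<psi> (y + t k *\<^sub>R z)) \<le> norm (B * \<bar>K z\<bar>)"
          using kb[of z "y + t k *\<^sub>R z"] abs_ge_self[of "B * \<bar>K z\<bar>"] unfolding real_norm_def by linarith
      qed
    qed measurable
    then have "norm (P k y) \<le> (\<integral>z. B * \<bar>K z\<bar> \<partial>lborel)" unfolding P_def
      by (rule Bochner_Integration.integral_norm_bound_integral[OF _ iK]) (rule kb)
    then show ?thesis by simp
  qed
  have P0: "P k y = 0" if "R + 1 < norm y" for k y
  proof -
    have "K z * ?\<psi> (y + t k *\<^sub>R z) = 0" for z
    proof (cases "norm z \<le> 1 / 2")
      case True
      have "norm (t k *\<^sub>R z) \<le> 1 * (1 / 2)"
        using t(1,2)[of k] True unfolding norm_scaleR by (intro mult_mono) auto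
      moreover have "norm y \<le> norm (y + t k *\<^sub>R z) + norm (t k *\<^sub>R z)"
        using norm_triangle_ineq4[of "y + t k *\<^sub>R z" "t k *\<^sub>R z"] by simp
      ultimately have "R < norm (y + t k *\<^sub>R z)" using that by linarith
      then show ?thesis by (simp add: R)
    qed (simp add: K_support)
    then show ?thesis by (simp only: P_def integral_zero)
  qed
  obtain b where b: "0 \<le> b" "\<And>k y. \<bar>P k y\<bar> \<le> b"
    using Pb order_trans[OF abs_ge_zero Pb] by blast
  have P_meas [measurable]: "P k \<in> borel_measurable borel" for k
    unfolding P_def by measurable
  have "(\<lambda>k. \<integral>y. u y * P k y \<partial>lborel) \<longlonglongrightarrow> (\<integral>y. u y * ?\<psi> y \<partial>lborel)"
  proof (rule integral_dominated_convergence)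
    show "integrable lborel (\<lambda>y. \<bar>u y * (b * indicator (cball 0 (R + 1)) y)\<bar>)"
      by (rule integrable_abs, rule loc_int_integrable_mult[OF u, where M=b and R="R + 1"])
        (use b(1) in \<open>auto simp: indicator_def\<close>)
    show "AE y in lborel. norm (u y * P k y) \<le> \<bar>u y * (b * indicator (cball 0 (R + 1)) y)\<bar>" for k
    proof (rule AE_I2)
      fix y
      have "\<bar>P k y\<bar> \<le> \<bar>b * indicator (cball 0 (R + 1)) y\<bar>"
        using b(1) b(2)[of k y] P0[where k=k and y=y] by (cases "norm y \<le> R + 1") simp_all
      then have "\<bar>u y\<bar> * \<bar>P k y\<bar> \<le> \<bar>u y\<bar> * \<bar>b * indicator (cball 0 (R + 1)) y\<bar>"
        by (rule mult_left_mono) simp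
      then show "norm (u y * P k y) \<le> \<bar>u y * (b * indicator (cball 0 (R + 1)) y)\<bar>"
        by (simp only: real_norm_def abs_mult)
    qed
    show "AE y in lborel. (\<lambda>k. u y * P k y) \<longlonglongrightarrow> u y * ?\<psi> y"
      by (intro AE_I2 tendsto_mult tendsto_const lim)
  qed measurable
  then have "(\<lambda>k. (- 1) ^ length js * (\<integral>y. u y * P k y \<partial>lborel)) \<longlonglongrightarrow> (- 1) ^ length js * (\<integral>y. u y * ?\<psi> y \<partial>lborel)"
    by (rule tendsto_mult[OF tendsto_const])
  moreover have "(\<integral>x. mollified K u js (t k) x * \<phi> x \<partial>lborel) = (- 1) ^ length js * (\<integral>y. u y * P k y \<partial>lborel)" for k
    unfolding P_def by (rule integral_mollified_test[OF u js t(1,2) \<phi>])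
  ultimately show ?thesis by (simp only:)
qed

end

lemma reproducing_kernel_obtain:
  obtains K :: "real ^ 'n \<Rightarrow> real" and M where "reproducing_kernel K m M"
proof -
  obtain K :: "real ^ 'n \<Rightarrow> real" where K: "test_function K" "\<And>z. 1 / 2 \<le> norm z \<Longrightarrow> K z = 0"
    "\<And>q x t. q \<in> polynomials m \<Longrightarrow> (\<integral>z. K z * q (x - t *\<^sub>R z) \<partial>lborel) = q x"
    using reproducing_kernel_exists[of m] by blast
  have "\<exists>B>0. \<forall>z. \<bar>iterated_partial js K z\<bar> \<le> B" for js
    by (rule test_function_bounded[OF test_function_iterated_partial[OF K(1)], of js]) blast
  then have "\<forall>js. \<exists>B. 0 < B \<and> (\<forall>z. \<bar>iterated_partial js K z\<bar> \<le> B)" by blast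
  from choice[OF this] obtain B where B: "\<And>js. 0 < B js" "\<And>js z. \<bar>iterated_partial js K z\<bar> \<le> B js" by blast
  let ?L = "\<Union>k\<le>m. {js :: 'n list. length js = k}"
  have L: "finite ?L" by (intro finite_UN_I) auto
  have B': "B js \<le> (\<Sum>js\<in>?L. B js)" if "length js \<le> m" for js
    using that by (intro member_le_sum L less_imp_le B(1)) auto
  have "reproducing_kernel K m (\<Sum>js\<in>?L. B js)"
  proof
    show "0 < (\<Sum>js\<in>?L. B js)" using B'[of "[]"] B(1)[of "[]"] by simp
    show "\<bar>iterated_partial js K z\<bar> \<le> (\<Sum>js\<in>?L. B js)" if "length js \<le> m" for js z
      using B(2)[of js z] B'[OF that] by linarith
  qed (use K in auto)
  then show thesis using that by blast
qed

section \<open>Dyadic decomposition of the oscillation seminorm\<close>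

lemma ennreal_cancel:
  assumes "0 < c" shows "ennreal (1 / c) * (ennreal c * z) = z" "ennreal c * (ennreal (1 / c) * z) = z"
proof -
  have "ennreal (1 / c) * ennreal c = 1" "ennreal c * ennreal (1 / c) = 1"
    using assms by (simp_all flip: ennreal_mult)
  then show "ennreal (1 / c) * (ennreal c * z) = z" "ennreal c * (ennreal (1 / c) * z) = z"
    by (simp_all only: mult.assoc[symmetric] mult_1)
qed

lemma ball_mean_doubling:
  fixes f :: "real ^ 'n \<Rightarrow> ennreal"
  assumes \<rho>: "0 < \<rho>" "\<rho> \<le> r" "r \<le> 2 * \<rho>"
  shows "ball_mean \<rho> f \<le> ennreal (2 ^ CARD('n)) * ball_mean r f"
proof -
  let ?om = "unit_ball_vol (real CARD('n))"
  have om: "0 < ?om" by (rule unit_ball_vol_pos')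
  have "r ^ CARD('n) \<le> (2 * \<rho>) ^ CARD('n)" using \<rho> by (intro power_mono) auto
  then have "1 / (?om * \<rho> ^ CARD('n)) \<le> 2 ^ CARD('n) * (1 / (?om * r ^ CARD('n)))"
    using \<rho> om by (simp add: field_simps power_mult_distrib)
  then have "ennreal (1 / (?om * \<rho> ^ CARD('n))) \<le> ennreal (2 ^ CARD('n) * (1 / (?om * r ^ CARD('n))))"
    by (rule ennreal_leI)
  also have "\<dots> = ennreal (2 ^ CARD('n)) * ennreal (1 / (?om * r ^ CARD('n)))"
    by (rule ennreal_mult) (use \<rho> om in simp_all)
  finally have c: "ennreal (1 / (?om * \<rho> ^ CARD('n))) \<le> ennreal (2 ^ CARD('n)) * ennreal (1 / (?om * r ^ CARD('n)))" .
  show ?thesis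
    unfolding ball_mean_def mult.assoc[symmetric]
    by (intro mult_mono c nn_integral_mono) (use \<rho> in \<open>auto simp: indicator_def\<close>)
qed

text \<open>The same polynomial serves both radii; the ball volumes contribute 2^n and the
  normalisations 2^s.\<close>

lemma osc_doubling:
  fixes u :: "real ^ 'n \<Rightarrow> real"
  assumes [measurable]: "u \<in> borel_measurable borel" and s: "0 < s" and \<rho>: "0 < \<rho>" "\<rho> \<le> r" "r \<le> 2 * \<rho>"
  shows "osc s u x \<rho> \<le> ennreal (2 ^ CARD('n) * 2 powr s) * osc s u x r"
proof -
  let ?c = "2 ^ CARD('n) * 2 powr s :: real"
  have c: "0 < ?c" by simp
  have r: "0 < r" using \<rho> by simp
  have um: "u \<in> borel_measurable borel" by fact
  have "ennreal (1 / ?c) * osc s u x \<rho> \<le> osc s u x r"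
    unfolding osc_altdef[OF um r]
  proof (rule INF_greatest)
    fix q :: "real ^ 'n \<Rightarrow> real" assume q: "q \<in> polynomials (nat \<lfloor>s\<rfloor>)"
    have [measurable]: "q \<in> borel_measurable borel" by (rule polynomials_measurable[OF q])
    have "osc s u x \<rho> \<le> ball_mean \<rho> (\<lambda>h. ennreal (\<bar>u (x + h) - q (x + h)\<bar> / \<rho> powr s))"
      unfolding osc_altdef[OF um \<rho>(1)] by (rule INF_lower[OF q])
    also have "\<dots> \<le> ennreal (2 ^ CARD('n)) * ball_mean r (\<lambda>h. ennreal (\<bar>u (x + h) - q (x + h)\<bar> / \<rho> powr s))"
      by (rule ball_mean_doubling[OF \<rho>])
    also have "\<dots> \<le> ennreal (2 ^ CARD('n)) * (ennreal (2 powr s) * ball_mean r (\<lambda>h. ennreal (\<bar>u (x + h) - q (x + h)\<bar> / r powr s)))"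
    proof (intro mult_left_mono)
      have "r powr s \<le> (2 * \<rho>) powr s" using \<rho> s by (intro powr_mono2) auto
      then have rs: "r powr s \<le> 2 powr s * \<rho> powr s" using \<rho> by (simp add: powr_mult)
      have "ball_mean r (\<lambda>h. ennreal (\<bar>u (x + h) - q (x + h)\<bar> / \<rho> powr s))
        \<le> ball_mean r (\<lambda>h. ennreal (2 powr s) * ennreal (\<bar>u (x + h) - q (x + h)\<bar> / r powr s))"
      proof (rule ball_mean_mono)
        fix h
        have "\<bar>u (x + h) - q (x + h)\<bar> / \<rho> powr s \<le> 2 powr s * (\<bar>u (x + h) - q (x + h)\<bar> / r powr s)"
          using mult_right_mono[OF rs, of "\<bar>u (x + h) - q (x + h)\<bar>"] \<rho> r by (simp add: field_simps)
        then have "ennreal (\<bar>u (x + h) - q (x + h)\<bar> / \<rho> powr s) \<le> ennreal (2 powr s * (\<bar>u (x + h) - q (x + h)\<bar> / r powr s))"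
          by (rule ennreal_leI)
        also have "\<dots> = ennreal (2 powr s) * ennreal (\<bar>u (x + h) - q (x + h)\<bar> / r powr s)"
          by (rule ennreal_mult) simp_all
        finally show "ennreal (\<bar>u (x + h) - q (x + h)\<bar> / \<rho> powr s) \<le> \<dots>" .
      qed
      also have "\<dots> = ennreal (2 powr s) * ball_mean r (\<lambda>h. ennreal (\<bar>u (x + h) - q (x + h)\<bar> / r powr s))"
        unfolding ball_mean_def mult.assoc by (subst nn_integral_cmult) (measurable, simp only: mult.left_commute)
      finally show "ball_mean r (\<lambda>h. ennreal (\<bar>u (x + h) - q (x + h)\<bar> / \<rho> powr s)) \<le> \<dots>" .
    qed simp
    also have "\<dots> = ennreal ?c * ball_mean r (\<lambda>h. ennreal (\<bar>u (x + h) - q (x + h)\<bar> / r powr s))"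
      by (simp only: mult.assoc[symmetric] ennreal_mult[symmetric] zero_le_power zero_le_numeral powr_ge_zero)
    finally have "ennreal (1 / ?c) * osc s u x \<rho> \<le> ennreal (1 / ?c) * (ennreal ?c * ball_mean r (\<lambda>h. ennreal (\<bar>u (x + h) - q (x + h)\<bar> / r powr s)))"
      by (rule mult_left_mono) simp
    also have "\<dots> = ball_mean r (\<lambda>h. ennreal (\<bar>u (x + h) - q (x + h)\<bar> / r powr s))"
      by (rule ennreal_cancel[OF c])
    finally show "ennreal (1 / ?c) * osc s u x \<rho> \<le> \<dots>" .
  qed
  then have "ennreal ?c * (ennreal (1 / ?c) * osc s u x \<rho>) \<le> ennreal ?c * osc s u x r"
    by (rule mult_left_mono) simp
  moreover have "ennreal ?c * (ennreal (1 / ?c) * osc s u x \<rho>) = osc s u x \<rho>"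
    by (rule ennreal_cancel[OF c])
  ultimately show ?thesis by (simp only:)
qed

lemma disjoint_dyadic_intervals: "disjoint_family (\<lambda>j. {(1/2) ^ Suc j<..<(1/2::real) ^ j})"
proof -
  have *: "{(1/2) ^ Suc i<..<(1/2::real) ^ i} \<inter> {(1/2) ^ Suc j<..<(1/2::real) ^ j} = {}" if "i < j" for i j
  proof -
    have "(1/2::real) ^ j \<le> (1/2) ^ Suc i" using that by (intro power_decreasing) auto
    then show ?thesis by auto
  qed
  have "{(1/2) ^ Suc i<..<(1/2::real) ^ i} \<inter> {(1/2) ^ Suc j<..<(1/2::real) ^ j} = {}" if "i \<noteq> j" for i j
  proof (cases "i < j")
    case False
    then show ?thesis using *[of j i] that by (simp only: Int_commute)
  qed (rule *)
  then show ?thesis by (simp only: disjoint_family_on_def) blast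
qed

definition dyadic_modular :: "real \<Rightarrow> (real \<Rightarrow> ennreal) \<Rightarrow> (real ^ 'n \<Rightarrow> real) \<Rightarrow> real \<Rightarrow> nat \<Rightarrow> ennreal" where
  "dyadic_modular s A u l j = (\<integral>\<^sup>+x. young_ext A (osc s u x ((1/2) ^ j) / ennreal l) \<partial>lborel)"

text \<open>Between 2^(-j-1) and 2^(-j) the oscillation at the left end is dominated by that at each
  r inside, and the interval has mass at least 1/2 for dr / r. The sum starts at radius 1/2, since
  the modular contains no radius above 1 with which radius 1 could be compared.\<close>

lemma dyadic_modular_sum:
  fixes u :: "real ^ 'n \<Rightarrow> real"
  assumes A: "young_function A" and u: "loc_int u" and s: "0 < s" and l: "0 < l"
  shows "(\<Sum>j. dyadic_modular s A u (2 ^ CARD('n) * 2 powr s * l) (Suc j)) \<le> 2 * osc_modular s A u l"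
proof -
  note [measurable] = young_ext_measurable[OF A]
  have um: "u \<in> borel_measurable borel" using u by (simp add: loc_int_def)
  let ?c = "2 ^ CARD('n) * 2 powr s :: real"
  define w where "w x r = (if 0 < r then osc s u x r else 0)" for x r
  have [measurable]: "(\<lambda>(x, r). w x r) \<in> borel_measurable (borel \<Otimes>\<^sub>M borel)"
    unfolding w_def by (rule osc_measurable[OF u])
  define Z where "Z r = (\<integral>\<^sup>+x. young_ext A (w x r / ennreal l) \<partial>lborel)" for r
  have [measurable]: "Z \<in> borel_measurable borel" unfolding Z_def by measurable
  \<comment> \<open>The integrand in r as a measure, so that disjoint dyadic intervals are summed by
    countable additivity.\<close>
  define \<mu> where "\<mu> = density lborel (\<lambda>r. Z r * inverse (ennreal r))"
  let ?I = "\<lambda>j. {(1/2) ^ Suc j<..<(1/2::real) ^ j}"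
  have pos: "0 < r" if "r \<in> ?I j" for r j
  proof -
    have "(0::real) < (1/2) ^ Suc j" by (rule zero_less_power) simp
    then show ?thesis using that by simp
  qed
  have W: "dyadic_modular s A u (?c * l) (Suc j) \<le> 2 * emeasure \<mu> (?I j)" for j
  proof -
    let ?W = "dyadic_modular s A u (?c * l) (Suc j)"
    have le: "?W \<le> Z r" if r: "r \<in> ?I j" for r
      unfolding dyadic_modular_def Z_def
    proof (intro nn_integral_mono young_ext_mono[OF A])
      fix x
      have r0: "0 < r" by (rule pos[OF r])
      have d: "osc s u x ((1/2) ^ Suc j) \<le> ennreal ?c * osc s u x r"
        by (rule osc_doubling[OF um s]) (use r in auto)
      have "inverse (ennreal (?c * l)) = ennreal (1 / ?c) * inverse (ennreal l)"
        using l by (simp add: inverse_ennreal flip: ennreal_mult) (simp add: field_simps)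
      then have "osc s u x ((1/2) ^ Suc j) / ennreal (?c * l) = ennreal (1 / ?c) * osc s u x ((1/2) ^ Suc j) / ennreal l"
        by (simp add: divide_ennreal_def mult_ac)
      also have "\<dots> \<le> ennreal (1 / ?c) * (ennreal ?c * osc s u x r) / ennreal l"
        by (intro divide_right_mono_ennreal mult_left_mono d) simp
      also have "ennreal (1 / ?c) * (ennreal ?c * osc s u x r) = osc s u x r"
        by (rule ennreal_cancel) simp
      finally show "osc s u x ((1/2) ^ Suc j) / ennreal (?c * l) \<le> w x r / ennreal l"
        using r0 by (simp add: w_def)
    qed
    \<comment> \<open>The interval has length 2^(-j-1), and 1 / r is at least 2^j on it; the product
      is 1/2.\<close>
    have "?W * ennreal (1 / 2) = ?W * (ennreal (2 ^ j) * emeasure lborel (?I j))"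
    proof -
      have "emeasure lborel (?I j) = ennreal ((1/2) ^ j - (1/2) ^ Suc j)"
        by (intro emeasure_lborel_Ioo power_decreasing) auto
      moreover have "ennreal (2 ^ j) * ennreal ((1/2) ^ j - (1/2) ^ Suc j) = ennreal (1 / 2)"
        by (subst ennreal_mult[symmetric]) (auto simp: power_divide right_diff_distrib)
      ultimately show ?thesis by simp
    qed
    also have "\<dots> = (\<integral>\<^sup>+r. ?W * ennreal (2 ^ j) * indicator (?I j) r \<partial>lborel)"
      by (subst nn_integral_cmult_indicator) (auto simp: mult.assoc)
    also have "\<dots> \<le> (\<integral>\<^sup>+r. Z r * inverse (ennreal r) * indicator (?I j) r \<partial>lborel)"
    proof (rule nn_integral_mono)
      fix r
      show "?W * ennreal (2 ^ j) * indicator (?I j) r \<le> Z r * inverse (ennreal r) * indicator (?I j) r"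
      proof (cases "r \<in> ?I j")
        case True
        then have r0: "0 < r" by (rule pos)
        have "2 ^ j \<le> inverse r"
          using True r0 le_imp_inverse_le[of r "(1/2) ^ j"] by (simp add: power_divide)
        then have "ennreal (2 ^ j) \<le> inverse (ennreal r)" using r0 by (simp add: inverse_ennreal ennreal_leI)
        then show ?thesis using le[OF True] by (intro mult_right_mono mult_mono) auto
      qed simp
    qed
    also have "\<dots> = emeasure \<mu> (?I j)" unfolding \<mu>_def by (subst emeasure_density) auto
    finally have "2 * (?W * ennreal (1 / 2)) \<le> 2 * emeasure \<mu> (?I j)" by (rule mult_left_mono) simp
    moreover have "2 * (?W * ennreal (1 / 2)) = ?W"
    proof -
      have "2 * ennreal (1 / 2) = ennreal (2 * (1 / 2))" by (subst ennreal_mult) auto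
      then show ?thesis using mult.left_commute[of 2 ?W "ennreal (1 / 2)"] by simp
    qed
    ultimately show ?thesis by simp
  qed
  have "(\<Sum>j. dyadic_modular s A u (?c * l) (Suc j)) \<le> (\<Sum>j. 2 * emeasure \<mu> (?I j))"
    by (intro suminf_le W) auto
  also have "\<dots> = 2 * (\<Sum>j. emeasure \<mu> (?I j))" by (rule ennreal_suminf_cmult)
  also have "(\<Sum>j. emeasure \<mu> (?I j)) = emeasure \<mu> (\<Union>j. ?I j)"
    by (rule suminf_emeasure[OF _ disjoint_dyadic_intervals]) (auto simp: \<mu>_def)
  also have "\<dots> \<le> emeasure \<mu> {0<..<1}"
  proof (rule emeasure_mono)
    have "x \<in> {0<..<1}" if "x \<in> ?I j" for x j
    proof -
      have "(1/2::real) ^ j \<le> 1" by (rule power_le_one) auto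
      moreover have "(0::real) < (1/2) ^ Suc j" by (rule zero_less_power) simp
      ultimately show ?thesis using that by auto
    qed
    then show "(\<Union>j. ?I j) \<subseteq> {0<..<1}" by blast
  qed (simp add: \<mu>_def)
  also have "\<dots> = (\<integral>\<^sup>+r. Z r * inverse (ennreal r) * indicator {0<..<1} r \<partial>lborel)"
    unfolding \<mu>_def by (rule emeasure_density) measurable
  also have "\<dots> = osc_modular s A u l"
    unfolding osc_modular_def
    by (intro nn_integral_cong) (auto simp: Z_def w_def divide_ennreal_def indicator_def)
  finally show ?thesis by (simp add: mult_left_mono)
qed

section \<open>Sums and averages over dyadic scales\<close>

lemma telescoping_limit:
  fixes d :: "nat \<Rightarrow> real"
  assumes le: "(\<Sum>i. ennreal \<bar>d (Suc i) - d i\<bar>) \<le> X"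
  shows "X < top \<Longrightarrow> convergent d" and "ennreal \<bar>lim d - d 0\<bar> \<le> X"
proof -
  have *: "convergent d \<and> ennreal \<bar>lim d - d 0\<bar> \<le> X" if X: "X < top"
  proof -
    have "(\<Sum>i. ennreal \<bar>d (Suc i) - d i\<bar>) \<noteq> top" using le X by (auto simp: top_unique)
    then have sm: "summable (\<lambda>i. \<bar>d (Suc i) - d i\<bar>)" by (intro summable_suminf_not_top) auto
    then have "summable (\<lambda>i. d (Suc i) - d i)" by (rule summable_rabs_cancel)
    from summable_LIMSEQ[OF this] have "(\<lambda>n. d n - d 0) \<longlonglongrightarrow> (\<Sum>i. d (Suc i) - d i)"
      by (simp only: sum_lessThan_telescope)
    then have "(\<lambda>n. (d n - d 0) + d 0) \<longlonglongrightarrow> (\<Sum>i. d (Suc i) - d i) + d 0" by (intro tendsto_add tendsto_const)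
    then have L: "d \<longlonglongrightarrow> (\<Sum>i. d (Suc i) - d i) + d 0" by simp
    then have "lim d - d 0 = (\<Sum>i. d (Suc i) - d i)" by (simp add: limI)
    then have "\<bar>lim d - d 0\<bar> \<le> (\<Sum>i. \<bar>d (Suc i) - d i\<bar>)" using summable_rabs[OF sm] by simp
    then have "ennreal \<bar>lim d - d 0\<bar> \<le> ennreal (\<Sum>i. \<bar>d (Suc i) - d i\<bar>)" by (rule ennreal_leI)
    also have "\<dots> = (\<Sum>i. ennreal \<bar>d (Suc i) - d i\<bar>)" by (rule suminf_ennreal2[OF _ sm, symmetric]) simp
    finally show ?thesis using L le by (auto simp: convergent_def)
  qed
  show "X < top \<Longrightarrow> convergent d" using * by blast
  \<comment> \<open>If X is infinite, nothing is known about \<open>lim d\<close>, but the bound is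
    trivial.\<close>
  show "ennreal \<bar>lim d - d 0\<bar> \<le> X"
    using * by (cases "X = top") (auto simp: less_top)
qed

lemma suminf_suminf_swap:
  fixes f :: "nat \<Rightarrow> nat \<Rightarrow> ennreal"
  shows "(\<Sum>k. \<Sum>i. f k i) = (\<Sum>i. \<Sum>k. f k i)"
  using nn_integral_suminf[of "\<lambda>i k. f k i" "count_space UNIV"]
  by (simp add: nn_integral_count_space_nat)

lemma suminf_shift_le:
  fixes f :: "nat \<Rightarrow> ennreal"
  shows "(\<Sum>k. f (k + i)) \<le> (\<Sum>k. f k)"
proof (rule suminf_le_const)
  fix N
  have "(\<Sum>k<N. f (k + i)) = (\<Sum>k\<in>{i..<N + i}. f k)"
    using sum.shift_bounds_nat_ivl[of f 0 i N] by (simp add: lessThan_atLeast0)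
  also have "\<dots> \<le> (\<Sum>k. f k)" by (intro sum_le_suminf) auto
  finally show "(\<Sum>k<N. f (k + i)) \<le> (\<Sum>k. f k)" .
qed simp

text \<open>An average over the radii 2^(-k-i) with geometric weights of total mass 1, made for
  Jensen's inequality. Up to the factor C 2^(-k frac s) it bounds the tail of the telescoping sum of
  mollified derivatives, whose terms carry the factor 2^(-i frac s).\<close>

definition osc_avg :: "real \<Rightarrow> (real ^ 'n \<Rightarrow> real) \<Rightarrow> nat \<Rightarrow> real ^ 'n \<Rightarrow> ennreal" where
  "osc_avg s u k x = (\<Sum>i. ennreal ((1 - (1/2) powr frac s) * ((1/2) powr frac s) ^ i) * osc s u x ((1/2) ^ (k + i)))"

lemma osc_avg_measurable:
  assumes "loc_int u" shows "osc_avg s u k \<in> borel_measurable borel"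
proof -
  have [measurable]: "(\<lambda>x. osc s u x ((1/2) ^ k)) \<in> borel_measurable borel" for k
    by (rule osc_measurable_fst[OF assms]) simp
  show ?thesis unfolding osc_avg_def by measurable
qed

text \<open>Jensen's inequality produces a discrete convolution with a sequence of mass 1, which
  does not increase the sum over k.\<close>

lemma nn_integral_osc_avg:
  fixes u :: "real ^ 'n \<Rightarrow> real"
  assumes A: "young_function A" and u: "loc_int u" and \<sigma>: "0 < frac s"
  shows "(\<Sum>k. \<integral>\<^sup>+x. young_ext A (osc_avg s u (Suc k) x / ennreal l) \<partial>lborel) \<le> (\<Sum>k. dyadic_modular s A u l (Suc k))"
proof -
  note [measurable] = young_ext_measurable[OF A]
  let ?q = "(1/2::real) powr frac s"
  let ?W = "dyadic_modular s A u l"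
  define om where "om i = (1 - ?q) * ?q ^ i" for i
  have q: "0 < ?q" "?q < 1" using powr_less_mono2[OF \<sigma>, of "1/2" 1] by simp_all
  have om0: "0 \<le> om i" for i using q by (simp add: om_def)
  have "(\<lambda>i. ?q ^ i) sums (1 / (1 - ?q))" using q by (intro geometric_sums) auto
  note sums = sums_mult[OF this, of "1 - ?q"]
  have inv: "\<And>x :: real. x < 1 \<Longrightarrow> (1 - x) * (1 / (1 - x)) = 1" by simp
  have om1: "om sums 1" using sums unfolding om_def[abs_def] inv[OF q(2)] .
  have om1': "(\<Sum>i. ennreal (om i)) = 1"
    unfolding suminf_ennreal2[OF om0 sums_summable[OF om1]] sums_unique[OF om1, symmetric] by simp
  have [measurable]: "(\<lambda>x. osc s u x ((1/2) ^ k)) \<in> borel_measurable borel" for k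
    by (rule osc_measurable_fst[OF u]) simp
  have B: "(\<integral>\<^sup>+x. young_ext A (osc_avg s u k x / ennreal l) \<partial>lborel) \<le> (\<Sum>i. ennreal (om i) * ?W (k + i))" for k
  proof -
    have "(\<integral>\<^sup>+x. young_ext A (osc_avg s u k x / ennreal l) \<partial>lborel)
      \<le> (\<integral>\<^sup>+x. (\<Sum>i. ennreal (om i) * young_ext A (osc s u x ((1/2) ^ (k + i)) / ennreal l)) \<partial>lborel)"
    proof (rule nn_integral_mono)
      fix x
      have "osc_avg s u k x / ennreal l = (\<Sum>i. ennreal (om i) * osc s u x ((1/2) ^ (k + i))) * inverse (ennreal l)"
        by (simp only: osc_avg_def om_def divide_ennreal_def)
      also have "\<dots> = (\<Sum>i. ennreal (om i) * osc s u x ((1/2) ^ (k + i)) * inverse (ennreal l))"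
        by (rule ennreal_suminf_multc[symmetric])
      also have "\<dots> = (\<Sum>i. ennreal (om i) * (osc s u x ((1/2) ^ (k + i)) / ennreal l))"
        by (simp only: divide_ennreal_def mult.assoc)
      finally show "young_ext A (osc_avg s u k x / ennreal l) \<le> (\<Sum>i. ennreal (om i) * young_ext A (osc s u x ((1/2) ^ (k + i)) / ennreal l))"
        using young_jensen_suminf[OF A om0 om1, of "\<lambda>i. osc s u x ((1/2) ^ (k + i)) / ennreal l"] by (simp only:)
    qed
    also have "\<dots> = (\<Sum>i. \<integral>\<^sup>+x. ennreal (om i) * young_ext A (osc s u x ((1/2) ^ (k + i)) / ennreal l) \<partial>lborel)"
      by (rule nn_integral_suminf) measurable
    also have "\<dots> = (\<Sum>i. ennreal (om i) * ?W (k + i))"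
    proof (rule suminf_cong)
      fix i
      show "(\<integral>\<^sup>+x. ennreal (om i) * young_ext A (osc s u x ((1/2) ^ (k + i)) / ennreal l) \<partial>lborel) = ennreal (om i) * ?W (k + i)"
        unfolding dyadic_modular_def by (rule nn_integral_cmult) measurable
    qed
    finally show ?thesis .
  qed
  have "(\<Sum>k. \<integral>\<^sup>+x. young_ext A (osc_avg s u (Suc k) x / ennreal l) \<partial>lborel) \<le> (\<Sum>k. \<Sum>i. ennreal (om i) * ?W (Suc k + i))"
    by (intro suminf_le B) auto
  also have "\<dots> = (\<Sum>i. \<Sum>k. ennreal (om i) * ?W (Suc k + i))" by (rule suminf_suminf_swap)
  also have "\<dots> \<le> (\<Sum>i. ennreal (om i) * (\<Sum>k. ?W (Suc k)))"
  proof (intro suminf_le)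
    fix i
    have "(\<Sum>k. ennreal (om i) * ?W (Suc k + i)) = ennreal (om i) * (\<Sum>k. ?W (Suc k + i))"
      by (rule ennreal_suminf_cmult)
    also have "\<dots> \<le> ennreal (om i) * (\<Sum>k. ?W (Suc k))"
      using suminf_shift_le[of "\<lambda>k. ?W (Suc k)" i] by (intro mult_left_mono) (simp_all only: add_Suc zero_le)
    finally show "(\<Sum>k. ennreal (om i) * ?W (Suc k + i)) \<le> ennreal (om i) * (\<Sum>k. ?W (Suc k))" .
  qed auto
  also have "\<dots> = (\<Sum>i. ennreal (om i)) * (\<Sum>k. ?W (Suc k))" by (rule ennreal_suminf_multc)
  also have "\<dots> = (\<Sum>k. ?W (Suc k))" unfolding om1' by (rule mult_1)
  finally show ?thesis .
qed

lemma nn_integral_ball_mean_translate: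
  fixes f :: "real ^ 'n \<Rightarrow> ennreal"
  assumes [measurable]: "f \<in> borel_measurable borel" and r: "0 < r"
  shows "(\<integral>\<^sup>+x. ball_mean r (\<lambda>h. f (x + h)) \<partial>lborel) = (\<integral>\<^sup>+x. f x \<partial>lborel)"
proof -
  let ?c = "ennreal (1 / (unit_ball_vol (real CARD('n)) * r ^ CARD('n)))"
  have "(\<integral>\<^sup>+x. ball_mean r (\<lambda>h. f (x + h)) \<partial>lborel) = ?c * (\<integral>\<^sup>+x. \<integral>\<^sup>+h. f (x + h) * indicator (ball 0 r) h \<partial>lborel \<partial>lborel)"
    unfolding ball_mean_def by (rule nn_integral_cmult) measurable
  also have "(\<integral>\<^sup>+x. \<integral>\<^sup>+h. f (x + h) * indicator (ball 0 r) h \<partial>lborel \<partial>lborel) = (\<integral>\<^sup>+h. \<integral>\<^sup>+x. f (x + h) * indicator (ball 0 r) h \<partial>lborel \<partial>lborel)"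
    by (rule lborel_pair.Fubini') measurable
  also have "\<dots> = (\<integral>\<^sup>+h. (\<integral>\<^sup>+x. f x \<partial>lborel) * indicator (ball 0 r :: (real ^ 'n) set) h \<partial>lborel)"
  proof (rule nn_integral_cong)
    fix h :: "real ^ 'n"
    have "(\<integral>\<^sup>+x. f (x + h) * indicator (ball 0 r) h \<partial>lborel) = (\<integral>\<^sup>+x. f (h + x) \<partial>lborel) * indicator (ball 0 r) h"
      by (subst nn_integral_multc) (auto simp: add.commute)
    then show "(\<integral>\<^sup>+x. f (x + h) * indicator (ball 0 r) h \<partial>lborel) = (\<integral>\<^sup>+x. f x \<partial>lborel) * indicator (ball 0 r) h"
      by (simp add: nn_integral_translate)
  qed
  also have "\<dots> = (\<integral>\<^sup>+x. f x \<partial>lborel) * emeasure lborel (ball 0 r :: (real ^ 'n) set)"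
    by (simp add: nn_integral_cmult_indicator)
  also have "?c * \<dots> = (\<integral>\<^sup>+x. f x \<partial>lborel) * (?c * emeasure lborel (ball 0 r :: (real ^ 'n) set))"
    by (simp only: mult.left_commute)
  also have "?c * emeasure lborel (ball 0 r :: (real ^ 'n) set) = 1"
    using r by (simp add: emeasure_ball less_imp_neq[OF unit_ball_vol_pos', symmetric] flip: ennreal_mult)
  finally show ?thesis by simp
qed

lemma young_ext_half:
  assumes A: "young_function A"
  shows "young_ext A ((a + b) / 2) \<le> (young_ext A a + young_ext A b) / 2"
  using young_ext_average[OF A, of "{0, 1 :: nat}" "\<lambda>i. if i = 0 then a else b"] by (simp add: numeral_2_eq_2)

lemma young_ext_third:
  assumes A: "young_function A"
  shows "young_ext A ((a + b + c) / 3) \<le> (young_ext A a + young_ext A b + young_ext A c) / 3"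
  using young_ext_average[OF A, of "{0, 1, 2 :: nat}" "\<lambda>i. if i = 0 then a else if i = 1 then b else c"]
  by (simp add: numeral_3_eq_3 add.assoc)

section \<open>From oscillation spaces to fractional Sobolev spaces\<close>

text \<open>A single level \<open>l\<close> at which both modulars are at most 1, as in the
  hypothesis of \<open>luxemburg_le_add\<close>. The conditions on \<open>C\<close> involve only n,
  s and the kernel, not \<open>A\<close> or \<open>u\<close>.\<close>

locale osc_setting = reproducing_kernel K m M for K :: "real ^ 'n \<Rightarrow> real" and m M +
  fixes s C l :: real and u :: "real ^ 'n \<Rightarrow> real" and A :: "real \<Rightarrow> ennreal"
  assumes A: "young_function A" and u: "loc_int u" and s: "0 < s" and m_eq: "m = nat \<lfloor>s\<rfloor>"
    and frac_pos: "0 < frac s" and l: "0 < l"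
    and C_step: "M * (2 ^ (CARD('n) + m) + 1) * unit_ball_vol (real CARD('n)) \<le> C * (1 - (1/2) powr frac s)"
    and C_translate: "2 * M * 2 ^ CARD('n) * 2 powr s * unit_ball_vol (real CARD('n)) \<le> C"
    and C_mean: "M * 2 ^ m * unit_ball_vol (real CARD('n)) \<le> C" and C_1: "1 \<le> C"
    and osc_le_1: "osc_modular s A u l \<le> 1"
    and orlicz_le_1: "(\<integral>\<^sup>+x. young_ext A (ennreal (\<bar>u x\<bar> / l)) \<partial>lborel) \<le> 1"
begin

abbreviation "\<sigma> \<equiv> frac s"

text \<open>The level after the loss in \<open>dyadic_modular_sum\<close>.\<close>

definition "L = 2 ^ CARD('n) * 2 powr s * l"

definition limit_derivative :: "'n list \<Rightarrow> real ^ 'n \<Rightarrow> real" where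
  "limit_derivative js x = lim (\<lambda>k. mollified K u js ((1/2) ^ k) x)"

lemma u_measurable [measurable]: "u \<in> borel_measurable borel"
  using u by (simp add: loc_int_def)

lemma osc_measurable_dyadic [measurable]: "(\<lambda>x. osc s u x ((1/2) ^ k)) \<in> borel_measurable borel"
  by (rule osc_measurable_fst[OF u]) simp

lemma osc_avg_meas [measurable]: "osc_avg s u k \<in> borel_measurable borel"
  by (rule osc_avg_measurable[OF u])

lemma young_meas [measurable]: "young_ext A \<in> borel_measurable borel"
  by (rule young_ext_measurable[OF A])

lemma limit_derivative_measurable [measurable]: "limit_derivative js \<in> borel_measurable borel"
proof -
  have [measurable]: "mollified K u js ((1/2) ^ k) \<in> borel_measurable borel" for k
    by (rule mollified_measurable[OF u])
  show ?thesis unfolding limit_derivative_def by measurable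
qed

lemma L_pos: "0 < L"
  using l by (simp add: L_def)

lemma l_le_L: "l \<le> L"
proof -
  have "1 * 1 * l \<le> 2 ^ CARD('n) * 2 powr s * l"
    using s l by (intro mult_mono mult_right_mono) (auto intro: ge_one_powr_ge_zero)
  then show ?thesis by (simp add: L_def)
qed

lemma dyadic_sum_le: "(\<Sum>k. dyadic_modular s A u L (Suc k)) \<le> 2"
proof -
  have "(\<Sum>k. dyadic_modular s A u L (Suc k)) \<le> 2 * osc_modular s A u l"
    unfolding L_def by (rule dyadic_modular_sum[OF A u s l])
  also have "\<dots> \<le> 2 * 1" by (intro mult_left_mono osc_le_1) simp
  finally show ?thesis by simp
qed

lemma osc_avg_sum_le: "(\<Sum>k. \<integral>\<^sup>+x. young_ext A (osc_avg s u (Suc k) x / ennreal L) \<partial>lborel) \<le> 2"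
  using nn_integral_osc_avg[OF A u frac_pos, of L] dyadic_sum_le by (rule order_trans)

lemma osc_avg_le: "(\<integral>\<^sup>+x. young_ext A (osc_avg s u (Suc k) x / ennreal L) \<partial>lborel) \<le> 2"
proof -
  have "(\<Sum>i\<in>{k}. \<integral>\<^sup>+x. young_ext A (osc_avg s u (Suc i) x / ennreal L) \<partial>lborel)
    \<le> (\<Sum>k. \<integral>\<^sup>+x. young_ext A (osc_avg s u (Suc k) x / ennreal L) \<partial>lborel)"
    by (rule sum_le_suminf) auto
  then show ?thesis using osc_avg_sum_le by simp
qed

text \<open>The steps from scale 2^(-k) downwards are summed. The factors 2^(-i frac s) supply the
  geometric weights of \<open>osc_avg\<close>, and \<open>C_step\<close> pays for their
  normalisation 1 - q with q = 2^(-frac s).\<close>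

lemma limit_derivative_estimate:
  assumes js: "length js \<le> m"
  shows "ennreal \<bar>limit_derivative js x - mollified K u js ((1/2) ^ k) x\<bar> \<le>
    ennreal (C * ((1/2) ^ k) powr \<sigma>) * osc_avg s u k x"
proof (cases "ennreal (C * ((1/2) ^ k) powr \<sigma>) * osc_avg s u k x = top")
  case False
  let ?X = "ennreal (C * ((1/2) ^ k) powr \<sigma>) * osc_avg s u k x"
  let ?q = "(1/2::real) powr \<sigma>"
  have q1: "?q < 1" using powr_less_mono2[OF frac_pos, of "1/2" 1] by simp
  define d where "d i = mollified K u js ((1/2) ^ (k + i)) x" for i
  have step: "ennreal \<bar>d (Suc i) - d i\<bar> \<le> ennreal (C * ((1/2) ^ k) powr \<sigma>) * (ennreal ((1 - ?q) * ?q ^ i) * osc s u x ((1/2) ^ (k + i)))" for i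
  proof -
    let ?t = "(1/2::real) ^ (k + i)"
    have t: "0 < ?t" "?t \<le> 1" by (auto intro: power_le_one)
    have half: "(1/2::real) ^ (k + Suc i) = ?t / 2" by simp
    have pw: "?t powr \<sigma> = ((1/2) ^ k) powr \<sigma> * ?q ^ i"
      by (simp add: power_add powr_mult powr_power[symmetric] powr_powr mult.commute flip: powr_realpow)
    have "ennreal \<bar>d (Suc i) - d i\<bar> \<le> ennreal (M * (2 ^ (CARD('n) + m) + 1) * unit_ball_vol (real CARD('n)) * ?t powr \<sigma>) * osc s u x ?t"
      unfolding d_def half by (rule mollified_step[OF u m_eq s js t])
    also have "\<dots> \<le> ennreal (C * (1 - ?q) * ?t powr \<sigma>) * osc s u x ?t"
      by (intro mult_right_mono ennreal_leI C_step) auto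
    also have "C * (1 - ?q) * ?t powr \<sigma> = (C * ((1/2) ^ k) powr \<sigma>) * ((1 - ?q) * ?q ^ i)"
      by (simp only: pw mult_ac)
    also have "ennreal \<dots> = ennreal (C * ((1/2) ^ k) powr \<sigma>) * ennreal ((1 - ?q) * ?q ^ i)"
      by (rule ennreal_mult) (use C_1 q1 in simp_all)
    finally show ?thesis by (simp only: mult.assoc)
  qed
  have le: "(\<Sum>i. ennreal \<bar>d (Suc i) - d i\<bar>) \<le> ?X"
  proof -
    have "(\<Sum>i. ennreal \<bar>d (Suc i) - d i\<bar>) \<le> (\<Sum>i. ennreal (C * ((1/2) ^ k) powr \<sigma>) * (ennreal ((1 - ?q) * ?q ^ i) * osc s u x ((1/2) ^ (k + i))))"
      by (rule suminf_le[OF step]) auto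
    then show ?thesis unfolding ennreal_suminf_cmult osc_avg_def .
  qed
  have X: "?X < top" using False by (simp only: less_top)
  obtain b where b: "d \<longlonglongrightarrow> b" using telescoping_limit(1)[OF le X] by (auto simp: convergent_def)
  have "(\<lambda>i. mollified K u js ((1/2) ^ (i + k)) x) \<longlonglongrightarrow> b" using b unfolding d_def by (simp only: add.commute)
  then have "(\<lambda>i. mollified K u js ((1/2) ^ i) x) \<longlonglongrightarrow> b" by (rule LIMSEQ_offset)
  then have "limit_derivative js x = lim d" unfolding limit_derivative_def using limI[OF b] limI by blast
  moreover have "d 0 = mollified K u js ((1/2) ^ k) x" by (simp add: d_def)
  ultimately show ?thesis using telescoping_limit(2)[OF le] by (simp only:)
next
  case True
  then show ?thesis by (simp only: top_greatest)
qed

text \<open>Linear growth of \<open>A\<close> turns the modular bound into an L^1 bound on balls,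
  uniform in k. The index \<open>Suc k\<close> excludes radius 1, for which there is no dyadic
  bound.\<close>

lemma osc_avg_local:
  obtains c where "0 \<le> c" "\<And>k. (\<integral>\<^sup>+x. osc_avg s u (Suc k) x * indicator (cball 0 R) x \<partial>lborel) \<le> ennreal c"
proof -
  obtain a b where ab: "0 < a" "0 \<le> b" and le: "\<And>t. ennreal a * t \<le> young_ext A t + ennreal b"
    using young_linear_growth[OF A] by blast
  let ?Q = "cball 0 R :: (real ^ 'n) set"
  let ?c = "ennreal (L / a) * (2 + ennreal b * emeasure lborel ?Q)"
  have fin: "?c < top" using emeasure_bounded_finite[of ?Q] by (simp add: ennreal_mult_less_top)
  have bound: "(\<integral>\<^sup>+x. osc_avg s u (Suc k) x * indicator ?Q x \<partial>lborel) \<le> ?c" for k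
  proof -
    have "(\<integral>\<^sup>+x. osc_avg s u (Suc k) x * indicator ?Q x \<partial>lborel)
      \<le> (\<integral>\<^sup>+x. ennreal (L / a) * (young_ext A (osc_avg s u (Suc k) x / ennreal L) + ennreal b * indicator ?Q x) \<partial>lborel)"
    proof (rule nn_integral_mono)
      fix x :: "real ^ 'n"
      let ?e = "osc_avg s u (Suc k) x"
      have "ennreal (L / a) * (ennreal a * (?e / ennreal L)) = ?e"
      proof -
        have "ennreal (L / a) * ennreal a * inverse (ennreal L) = 1"
          using L_pos ab by (simp add: inverse_ennreal flip: ennreal_mult)
        moreover have "ennreal (L / a) * (ennreal a * (?e / ennreal L)) = (ennreal (L / a) * ennreal a * inverse (ennreal L)) * ?e"
          by (simp only: divide_ennreal_def mult_ac)
        ultimately show ?thesis by (simp only: mult_1)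
      qed
      moreover have "ennreal (L / a) * (ennreal a * (?e / ennreal L)) \<le> ennreal (L / a) * (young_ext A (?e / ennreal L) + ennreal b)"
        by (intro mult_left_mono le) simp
      ultimately show "?e * indicator ?Q x \<le> ennreal (L / a) * (young_ext A (?e / ennreal L) + ennreal b * indicator ?Q x)"
        by (cases "x \<in> ?Q") simp_all
    qed
    also have "\<dots> = ennreal (L / a) * (\<integral>\<^sup>+x. young_ext A (osc_avg s u (Suc k) x / ennreal L) + ennreal b * indicator ?Q x \<partial>lborel)"
      by (rule nn_integral_cmult) measurable
    also have "(\<integral>\<^sup>+x. young_ext A (osc_avg s u (Suc k) x / ennreal L) + ennreal b * indicator ?Q x \<partial>lborel)
      = (\<integral>\<^sup>+x. young_ext A (osc_avg s u (Suc k) x / ennreal L) \<partial>lborel) + (\<integral>\<^sup>+x. ennreal b * indicator ?Q x \<partial>lborel)"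
      by (rule nn_integral_add) measurable
    also have "(\<integral>\<^sup>+x. ennreal b * indicator ?Q x \<partial>lborel) = ennreal b * emeasure lborel ?Q"
      by (rule nn_integral_cmult_indicator) simp
    also have "ennreal (L / a) * ((\<integral>\<^sup>+x. young_ext A (osc_avg s u (Suc k) x / ennreal L) \<partial>lborel) + ennreal b * emeasure lborel ?Q) \<le> ?c"
      by (intro mult_left_mono add_right_mono osc_avg_le) simp
    finally show ?thesis .
  qed
  show thesis
  proof (rule that)
    show "0 \<le> enn2real ?c" by simp
    show "(\<integral>\<^sup>+x. osc_avg s u (Suc k) x * indicator ?Q x \<partial>lborel) \<le> ennreal (enn2real ?c)" for k
      using bound[of k] fin by (simp only: ennreal_enn2real)
  qed
qed

text \<open>Convergence in L^1 on balls, with a rate; pointwise convergence alone would not pass to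
  integrals against test functions.\<close>

lemma limit_derivative_local:
  assumes js: "length js \<le> m"
  obtains c where "0 \<le> c" "\<And>k. (\<integral>\<^sup>+x. ennreal \<bar>limit_derivative js x - mollified K u js ((1/2) ^ Suc k) x\<bar> * indicator (cball 0 R) x \<partial>lborel)
    \<le> ennreal (c * ((1/2) ^ Suc k) powr \<sigma>)"
proof -
  obtain c where c: "0 \<le> c" "\<And>k. (\<integral>\<^sup>+x. osc_avg s u (Suc k) x * indicator (cball 0 R) x \<partial>lborel) \<le> ennreal c"
    using osc_avg_local by blast
  show thesis
  proof (rule that)
    show "0 \<le> C * c" using c C_1 by simp
    fix k
    let ?a = "C * ((1/2) ^ Suc k) powr \<sigma>"
    have "(\<integral>\<^sup>+x. ennreal \<bar>limit_derivative js x - mollified K u js ((1/2) ^ Suc k) x\<bar> * indicator (cball 0 R) x \<partial>lborel)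
      \<le> (\<integral>\<^sup>+x. ennreal ?a * (osc_avg s u (Suc k) x * indicator (cball 0 R) x) \<partial>lborel)"
      unfolding mult.assoc[symmetric] by (intro nn_integral_mono mult_right_mono limit_derivative_estimate js) simp
    also have "\<dots> = ennreal ?a * (\<integral>\<^sup>+x. osc_avg s u (Suc k) x * indicator (cball 0 R) x \<partial>lborel)"
      by (rule nn_integral_cmult) measurable
    also have "\<dots> \<le> ennreal ?a * ennreal c" by (intro mult_left_mono c) simp
    also have "\<dots> = ennreal (?a * c)" by (rule ennreal_mult[symmetric]) (use C_1 c in simp_all)
    also have "?a * c = C * c * ((1/2) ^ Suc k) powr \<sigma>" by (simp only: mult_ac)
    finally show "(\<integral>\<^sup>+x. ennreal \<bar>limit_derivative js x - mollified K u js ((1/2) ^ Suc k) x\<bar> * indicator (cball 0 R) x \<partial>lborel)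
      \<le> ennreal (C * c * ((1/2) ^ Suc k) powr \<sigma>)" .
  qed
qed

lemma limit_derivative_loc_int:
  assumes js: "length js \<le> m" shows "loc_int (limit_derivative js)"
  unfolding loc_int_def
proof (intro conjI allI limit_derivative_measurable)
  fix R
  have "(1/2::real) ^ Suc 0 \<le> 1" "0 < (1/2::real) ^ Suc 0" by simp_all
  then have D: "loc_int (mollified K u js ((1/2) ^ Suc 0))" by (intro loc_int_mollified[OF u js])
  then have [measurable]: "mollified K u js ((1/2) ^ Suc 0) \<in> borel_measurable borel" by (simp add: loc_int_def)
  obtain c where c: "(\<integral>\<^sup>+x. ennreal \<bar>limit_derivative js x - mollified K u js ((1/2) ^ Suc 0) x\<bar> * indicator (cball 0 R) x \<partial>lborel)
    \<le> ennreal (c * ((1/2) ^ Suc 0) powr \<sigma>)" using limit_derivative_local[OF js] by blast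
  have "(\<integral>\<^sup>+x. ennreal \<bar>limit_derivative js x\<bar> * indicator (cball 0 R) x \<partial>lborel)
    \<le> (\<integral>\<^sup>+x. ennreal \<bar>limit_derivative js x - mollified K u js ((1/2) ^ Suc 0) x\<bar> * indicator (cball 0 R) x
      + ennreal \<bar>mollified K u js ((1/2) ^ Suc 0) x\<bar> * indicator (cball 0 R) x \<partial>lborel)"
  proof (intro nn_integral_mono)
    fix x :: "real ^ 'n"
    let ?v = "limit_derivative js x" and ?d = "mollified K u js ((1/2) ^ Suc 0) x"
    have "ennreal \<bar>?v\<bar> \<le> ennreal (\<bar>?v - ?d\<bar> + \<bar>?d\<bar>)" by (rule ennreal_leI) linarith
    also have "\<dots> = ennreal \<bar>?v - ?d\<bar> + ennreal \<bar>?d\<bar>" by (rule ennreal_plus) simp_all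
    finally show "ennreal \<bar>?v\<bar> * indicator (cball 0 R) x \<le> ennreal \<bar>?v - ?d\<bar> * indicator (cball 0 R) x + ennreal \<bar>?d\<bar> * indicator (cball 0 R) x"
      by (cases "x \<in> cball 0 R") simp_all
  qed
  also have "\<dots> = (\<integral>\<^sup>+x. ennreal \<bar>limit_derivative js x - mollified K u js ((1/2) ^ Suc 0) x\<bar> * indicator (cball 0 R) x \<partial>lborel)
      + (\<integral>\<^sup>+x. ennreal \<bar>mollified K u js ((1/2) ^ Suc 0) x\<bar> * indicator (cball 0 R) x \<partial>lborel)"
    by (rule nn_integral_add) measurable
  also have "\<dots> < \<infinity>"
  proof -
    have "(\<integral>\<^sup>+x. ennreal \<bar>mollified K u js ((1/2) ^ Suc 0) x\<bar> * indicator (cball 0 R) x \<partial>lborel) < \<infinity>"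
      using D unfolding loc_int_def by blast
    then show ?thesis using order_le_less_trans[OF c ennreal_less_top] by (simp only: infinity_ennreal_def ennreal_add_less_top) 
  qed
  finally show "(\<integral>\<^sup>+x. ennreal \<bar>limit_derivative js x\<bar> * indicator (cball 0 R) x \<partial>lborel) < \<infinity>" .
qed

text \<open>The integrals of the mollified derivatives against \<phi> have two descriptions of their
  limit: one by L^1 convergence on the support of \<phi>, the other by moving the derivatives to
  \<phi>.\<close>

lemma limit_derivative_weak:
  assumes js: "length js \<le> m" and \<phi>: "test_function \<phi>"
  shows "(\<integral>x. u x * iterated_partial js \<phi> x \<partial>lborel) = (- 1) ^ length js * (\<integral>x. limit_derivative js x * \<phi> x \<partial>lborel)"
proof -
  let ?v = "limit_derivative js" and ?d = "\<lambda>k. mollified K u js ((1/2) ^ Suc k)"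
  have t: "0 < (1/2::real) ^ Suc k" "(1/2::real) ^ Suc k \<le> 1" for k
    by (rule zero_less_power, simp, rule power_le_one, simp_all)
  have t0: "(\<lambda>k. (1/2::real) ^ Suc k) \<longlonglongrightarrow> 0"
    by (rule LIMSEQ_Suc[OF LIMSEQ_realpow_zero]) simp_all
  have Lv: "loc_int ?v" by (rule limit_derivative_loc_int[OF js])
  have Ld: "loc_int (?d k)" for k by (rule loc_int_mollified[OF u js t])
  have [measurable]: "?d k \<in> borel_measurable borel" for k using Ld[of k] by (simp add: loc_int_def)
  obtain R where R: "0 < R" "\<And>x. R < norm x \<Longrightarrow> \<phi> x = 0" using test_function_bound[OF \<phi>] by blast
  obtain B where B: "0 < B" "\<And>x. \<bar>\<phi> x\<bar> \<le> B" using test_function_bounded[OF \<phi>] by blast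
  obtain c where c: "0 \<le> c" "\<And>k. (\<integral>\<^sup>+x. ennreal \<bar>?v x - ?d k x\<bar> * indicator (cball 0 R) x \<partial>lborel) \<le> ennreal (c * ((1/2) ^ Suc k) powr \<sigma>)"
    using limit_derivative_local[OF js] by blast
  have diff: "\<bar>(\<integral>x. ?d k x * \<phi> x \<partial>lborel) - (\<integral>x. ?v x * \<phi> x \<partial>lborel)\<bar> \<le> B * (c * ((1/2) ^ Suc k) powr \<sigma>)" for k
  proof -
    have i: "integrable lborel (\<lambda>x. ?d k x * \<phi> x)" "integrable lborel (\<lambda>x. ?v x * \<phi> x)"
      by (rule loc_int_integrable_test[OF Ld \<phi>], rule loc_int_integrable_test[OF Lv \<phi>])
    have i': "integrable lborel (\<lambda>x. ?d k x * \<phi> x - ?v x * \<phi> x)" by (rule Bochner_Integration.integrable_diff[OF i])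
    have "ennreal \<bar>\<integral>x. ?d k x * \<phi> x - ?v x * \<phi> x \<partial>lborel\<bar> \<le> (\<integral>\<^sup>+x. ennreal (norm (?d k x * \<phi> x - ?v x * \<phi> x)) \<partial>lborel)"
      using integral_norm_bound_ennreal[OF i'] by (simp only: real_norm_def)
    also have "\<dots> \<le> (\<integral>\<^sup>+x. ennreal B * (ennreal \<bar>?v x - ?d k x\<bar> * indicator (cball 0 R) x) \<partial>lborel)"
    proof (rule nn_integral_mono)
      fix x :: "real ^ 'n"
      have eq: "?d k x * \<phi> x - ?v x * \<phi> x = (?d k x - ?v x) * \<phi> x" by (simp only: left_diff_distrib)
      have "norm (?d k x * \<phi> x - ?v x * \<phi> x) \<le> B * \<bar>?v x - ?d k x\<bar>"
        unfolding eq real_norm_def abs_mult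
        using mult_left_mono[OF B(2)[of x], of "\<bar>?d k x - ?v x\<bar>"] by (simp only: abs_minus_commute mult.commute)
      then have "ennreal (norm (?d k x * \<phi> x - ?v x * \<phi> x)) \<le> ennreal (B * \<bar>?v x - ?d k x\<bar>)" by (rule ennreal_leI)
      also have "\<dots> = ennreal B * ennreal \<bar>?v x - ?d k x\<bar>" by (rule ennreal_mult) (use B in simp_all)
      finally have 1: "ennreal (norm (?d k x * \<phi> x - ?v x * \<phi> x)) \<le> ennreal B * ennreal \<bar>?v x - ?d k x\<bar>" .
      show "ennreal (norm (?d k x * \<phi> x - ?v x * \<phi> x)) \<le> ennreal B * (ennreal \<bar>?v x - ?d k x\<bar> * indicator (cball 0 R) x)"
      proof (cases "norm x \<le> R")
        case True
        then show ?thesis using 1 by simp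
      next
        case False
        then show ?thesis using R(2)[of x] by simp
      qed
    qed
    also have "\<dots> = ennreal B * (\<integral>\<^sup>+x. ennreal \<bar>?v x - ?d k x\<bar> * indicator (cball 0 R) x \<partial>lborel)"
      by (rule nn_integral_cmult) measurable
    also have "\<dots> \<le> ennreal B * ennreal (c * ((1/2) ^ Suc k) powr \<sigma>)" by (rule mult_left_mono[OF c(2)]) simp
    also have "\<dots> = ennreal (B * (c * ((1/2) ^ Suc k) powr \<sigma>))" by (rule ennreal_mult[symmetric]) (use B c in simp_all)
    finally have "\<bar>\<integral>x. ?d k x * \<phi> x - ?v x * \<phi> x \<partial>lborel\<bar> \<le> B * (c * ((1/2) ^ Suc k) powr \<sigma>)"
      by (subst (asm) ennreal_le_iff) (use B c in simp_all)
    then show ?thesis by (simp only: Bochner_Integration.integral_diff[OF i])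
  qed
  have "(\<lambda>k. ((1/2::real) ^ Suc k) powr \<sigma>) \<longlonglongrightarrow> 0 powr \<sigma>"
    by (rule tendsto_powr'[OF t0 tendsto_const]) (use frac_pos in simp)
  then have "(\<lambda>k. B * (c * ((1/2::real) ^ Suc k) powr \<sigma>)) \<longlonglongrightarrow> B * (c * 0 powr \<sigma>)"
    by (intro tendsto_mult tendsto_const)
  then have z: "(\<lambda>k. B * (c * ((1/2::real) ^ Suc k) powr \<sigma>)) \<longlonglongrightarrow> 0" by simp
  have "(\<lambda>k. (\<integral>x. ?d k x * \<phi> x \<partial>lborel) - (\<integral>x. ?v x * \<phi> x \<partial>lborel)) \<longlonglongrightarrow> 0"
    by (rule Lim_null_comparison[OF _ z]) (simp only: real_norm_def diff eventually_True)
  then have 1: "(\<lambda>k. \<integral>x. ?d k x * \<phi> x \<partial>lborel) \<longlonglongrightarrow> (\<integral>x. ?v x * \<phi> x \<partial>lborel)" by (rule LIM_zero_cancel)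
  have 2: "(\<lambda>k. \<integral>x. ?d k x * \<phi> x \<partial>lborel) \<longlonglongrightarrow> (- 1) ^ length js * (\<integral>y. u y * iterated_partial js \<phi> y \<partial>lborel)"
    by (rule integral_mollified_test_tendsto[OF u js t t0 \<phi>])
  have eq: "(\<integral>x. ?v x * \<phi> x \<partial>lborel) = (- 1) ^ length js * (\<integral>y. u y * iterated_partial js \<phi> y \<partial>lborel)"
    by (rule LIMSEQ_unique[OF 1 2])
  show ?thesis unfolding eq by (simp flip: power_mult_distrib mult.assoc)
qed

text \<open>The limit is split at scale 1/2. The mollified derivative there is dominated by a ball
  mean of \<open>u\<close>, the rest by \<open>osc_avg\<close>; the factor 2 in the level makes
  their sum an average, to which convexity applies.\<close>

lemma limit_derivative_orlicz:
  assumes js: "length js \<le> m"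
  shows "(\<integral>\<^sup>+x. young_ext A (ennreal (\<bar>limit_derivative js x\<bar> / (2 * C * L))) \<partial>lborel) \<le> 2"
proof -
  define b where "b x = ball_mean (1/2) (\<lambda>h. ennreal (\<bar>u (x + h)\<bar> / L))" for x
  have b_meas [measurable]: "b \<in> borel_measurable borel" unfolding b_def by measurable
  have half: "(1/2::real) ^ Suc 0 = 1 / 2" by simp
  have bL: "ball_mean (1/2) (\<lambda>h. ennreal \<bar>u (x + h)\<bar>) = ennreal L * b x" for x
  proof -
    have "ennreal L * b x = ball_mean (1/2) (\<lambda>h. ennreal L * ennreal (\<bar>u (x + h)\<bar> / L))"
      unfolding b_def ball_mean_def mult.assoc by (subst nn_integral_cmult) (measurable, simp only: mult.left_commute)
    also have "(\<lambda>h. ennreal L * ennreal (\<bar>u (x + h)\<bar> / L)) = (\<lambda>h. ennreal \<bar>u (x + h)\<bar>)"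
      using L_pos by (simp add: fun_eq_iff flip: ennreal_mult)
    finally show ?thesis by simp
  qed
  have pw: "young_ext A (ennreal (\<bar>limit_derivative js x\<bar> / (2 * C * L))) \<le> (young_ext A (b x) + young_ext A (osc_avg s u (Suc 0) x / ennreal L)) / 2" for x
  proof -
    let ?v = "limit_derivative js x" and ?d = "mollified K u js (1 / 2) x"
    have "ennreal \<bar>?v\<bar> \<le> ennreal (\<bar>?d\<bar> + \<bar>?v - ?d\<bar>)" by (rule ennreal_leI) linarith
    also have "\<dots> = ennreal \<bar>?d\<bar> + ennreal \<bar>?v - ?d\<bar>" by (rule ennreal_plus) simp_all
    also have "\<dots> \<le> ennreal C * (ennreal L * b x) + ennreal C * osc_avg s u (Suc 0) x"
    proof (rule add_mono)
      have "ennreal \<bar>?d\<bar> \<le> ennreal (M * (1 / (1/2)) ^ m * unit_ball_vol (real CARD('n))) * ball_mean (1/2) (\<lambda>h. ennreal \<bar>u (x + h)\<bar>)"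
        by (rule mollified_le_ball_mean[OF u js]) simp_all
      also have "\<dots> \<le> ennreal C * (ennreal L * b x)"
        unfolding bL using C_mean by (intro mult_right_mono ennreal_leI) simp_all
      finally show "ennreal \<bar>?d\<bar> \<le> ennreal C * (ennreal L * b x)" .
      have "ennreal \<bar>?v - ?d\<bar> \<le> ennreal (C * (1/2) powr \<sigma>) * osc_avg s u (Suc 0) x"
        using limit_derivative_estimate[OF js, of x "Suc 0"] unfolding half .
      also have "\<dots> \<le> ennreal C * osc_avg s u (Suc 0) x"
      proof (intro mult_right_mono ennreal_leI)
        have "(1/2) powr \<sigma> \<le> 1" using powr_less_mono2[OF frac_pos, of "1/2" 1] by simp
        then show "C * (1/2) powr \<sigma> \<le> C" using C_1 by (simp add: mult_left_le)
      qed simp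
      finally show "ennreal \<bar>?v - ?d\<bar> \<le> ennreal C * osc_avg s u (Suc 0) x" .
    qed
    finally have le: "ennreal \<bar>?v\<bar> \<le> ennreal C * (ennreal L * b x) + ennreal C * osc_avg s u (Suc 0) x" .
    have cl: "0 < C * L" using C_1 L_pos by simp
    have "ennreal (\<bar>?v\<bar> / (2 * C * L)) = ennreal (1 / (C * L)) * ennreal \<bar>?v\<bar> / 2"
    proof -
      have "ennreal (\<bar>?v\<bar> / (2 * C * L)) = ennreal (1 / (C * L) * \<bar>?v\<bar> / 2)" by (simp add: mult_ac)
      also have "\<dots> = ennreal (1 / (C * L) * \<bar>?v\<bar>) / ennreal 2" by (rule divide_ennreal[symmetric]) (use cl in simp_all)
      also have "ennreal (1 / (C * L) * \<bar>?v\<bar>) = ennreal (1 / (C * L)) * ennreal \<bar>?v\<bar>" by (rule ennreal_mult) (use cl in simp_all)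
      finally show ?thesis by simp
    qed
    also have "\<dots> \<le> ennreal (1 / (C * L)) * (ennreal C * (ennreal L * b x) + ennreal C * osc_avg s u (Suc 0) x) / 2"
      by (intro divide_right_mono_ennreal mult_left_mono le) simp
    also have "ennreal (1 / (C * L)) * (ennreal C * (ennreal L * b x) + ennreal C * osc_avg s u (Suc 0) x) = b x + osc_avg s u (Suc 0) x / ennreal L"
    proof -
      have 1: "ennreal C * (ennreal L * b x) = ennreal (C * L) * b x" using C_1 L_pos by (simp add: ennreal_mult mult.assoc)
      have "ennreal (1 / (C * L)) * ennreal C = inverse (ennreal L)"
        using C_1 L_pos by (simp add: inverse_ennreal inverse_eq_divide flip: ennreal_mult)
      then have 2: "ennreal (1 / (C * L)) * (ennreal C * osc_avg s u (Suc 0) x) = osc_avg s u (Suc 0) x / ennreal L"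
        by (simp only: mult.assoc[symmetric] divide_ennreal_def) (simp only: mult.commute)
      show ?thesis unfolding distrib_left 1 2 ennreal_cancel(1)[OF cl] ..
    qed
    finally have "young_ext A (ennreal (\<bar>?v\<bar> / (2 * C * L))) \<le> young_ext A ((b x + osc_avg s u (Suc 0) x / ennreal L) / 2)"
      by (rule young_ext_mono[OF A])
    also have "\<dots> \<le> (young_ext A (b x) + young_ext A (osc_avg s u (Suc 0) x / ennreal L)) / 2" by (rule young_ext_half[OF A])
    finally show ?thesis .
  qed
  have b_le: "(\<integral>\<^sup>+x. young_ext A (b x) \<partial>lborel) \<le> 1"
  proof -
    have "(\<integral>\<^sup>+x. young_ext A (b x) \<partial>lborel) \<le> (\<integral>\<^sup>+x. ball_mean (1/2) (\<lambda>h. young_ext A (ennreal (\<bar>u (x + h)\<bar> / L))) \<partial>lborel)"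
      unfolding b_def by (intro nn_integral_mono ball_mean_jensen[OF A]) simp_all
    also have "\<dots> = (\<integral>\<^sup>+x. young_ext A (ennreal (\<bar>u x\<bar> / L)) \<partial>lborel)"
      by (rule nn_integral_ball_mean_translate[of "\<lambda>x. young_ext A (ennreal (\<bar>u x\<bar> / L))"]) simp_all
    also have "\<dots> \<le> (\<integral>\<^sup>+x. young_ext A (ennreal (\<bar>u x\<bar> / l)) \<partial>lborel)"
      using l l_le_L by (intro nn_integral_mono young_ext_mono[OF A] ennreal_leI divide_left_mono) auto
    also note orlicz_le_1
    finally show ?thesis .
  qed
  have "(\<integral>\<^sup>+x. young_ext A (ennreal (\<bar>limit_derivative js x\<bar> / (2 * C * L))) \<partial>lborel)
    \<le> (\<integral>\<^sup>+x. (young_ext A (b x) + young_ext A (osc_avg s u (Suc 0) x / ennreal L)) / 2 \<partial>lborel)"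
    by (intro nn_integral_mono pw)
  also have "\<dots> = (\<integral>\<^sup>+x. young_ext A (b x) + young_ext A (osc_avg s u (Suc 0) x / ennreal L) \<partial>lborel) / 2"
    by (rule nn_integral_divide) measurable
  also have "(\<integral>\<^sup>+x. young_ext A (b x) + young_ext A (osc_avg s u (Suc 0) x / ennreal L) \<partial>lborel)
    = (\<integral>\<^sup>+x. young_ext A (b x) \<partial>lborel) + (\<integral>\<^sup>+x. young_ext A (osc_avg s u (Suc 0) x / ennreal L) \<partial>lborel)"
    by (rule nn_integral_add) measurable
  \<comment> \<open>The ball mean has modular at most 1 by Jensen's inequality and translation
    invariance, and \<open>osc_avg\<close> has modular at most 2.\<close>
  also have "\<dots> / 2 \<le> (1 + 2) / 2" by (intro divide_right_mono_ennreal add_mono b_le osc_avg_le)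
  also have "(1 + 2 :: ennreal) / 2 \<le> 2"
  proof -
    have "(1 + 2 :: ennreal) / 2 = ennreal (3 / 2)" using divide_ennreal[of 3 2] by simp
    also have "\<dots> \<le> ennreal 2" by (rule ennreal_leI) simp
    finally show ?thesis by simp
  qed
  finally show ?thesis .
qed

end

section \<open>Increments over dyadic shells\<close>

lemma ennreal_divide_le: "(x :: ennreal) / 2 \<le> x" "(x :: ennreal) / 3 \<le> x"
proof (atomize (full), cases x)
  case (real r)
  then have "x / 2 = ennreal (r / 2)" "x / 3 = ennreal (r / 3)"
    using divide_ennreal[of r 2] divide_ennreal[of r 3] by simp_all
  then show "x / 2 \<le> x \<and> x / 3 \<le> x" using real by (auto intro!: ennreal_leI)
qed simp

definition shell :: "real \<Rightarrow> (real ^ 'n) set" where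
  "shell a = {z. a < norm z \<and> norm z \<le> 2 * a}"

lemma shell_measurable [measurable]: "(shell a :: (real ^ 'n) set) \<in> sets borel"
proof -
  have "(shell a :: (real ^ 'n) set) = cball 0 (2 * a) - cball 0 a" by (auto simp: shell_def)
  then show ?thesis by simp
qed

lemma shell_weight:
  assumes a: "0 < a"
  shows "(\<integral>\<^sup>+z. indicator (shell a) z * ennreal (1 / norm (z :: real ^ 'n) ^ CARD('n)) \<partial>lborel)
    \<le> ennreal (unit_ball_vol (real CARD('n)) * 2 ^ CARD('n))"
proof -
  let ?om = "unit_ball_vol (real CARD('n))"
  have om: "0 < ?om" by (rule unit_ball_vol_pos')
  have "(\<integral>\<^sup>+z. indicator (shell a) z * ennreal (1 / norm (z :: real ^ 'n) ^ CARD('n)) \<partial>lborel)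
    \<le> (\<integral>\<^sup>+z. ennreal (1 / a ^ CARD('n)) * indicator (cball 0 (2 * a) :: (real ^ 'n) set) z \<partial>lborel)"
  proof (rule nn_integral_mono)
    fix z :: "real ^ 'n"
    show "indicator (shell a) z * ennreal (1 / norm z ^ CARD('n)) \<le> ennreal (1 / a ^ CARD('n)) * indicator (cball 0 (2 * a)) z"
    proof (cases "z \<in> shell a")
      case True
      then have "1 / norm z ^ CARD('n) \<le> 1 / a ^ CARD('n)"
        using a by (intro divide_left_mono power_mono mult_pos_pos zero_less_power) (auto simp: shell_def)
      then show ?thesis using True by (simp add: shell_def ennreal_leI)
    qed simp
  qed
  also have "\<dots> = ennreal (1 / a ^ CARD('n)) * emeasure lborel (cball 0 (2 * a) :: (real ^ 'n) set)"
    by (simp add: nn_integral_cmult_indicator)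
  also have "emeasure lborel (cball 0 (2 * a) :: (real ^ 'n) set) = ennreal (?om * (2 * a) ^ CARD('n))"
    using a by (simp add: emeasure_cball)
  also have "ennreal (1 / a ^ CARD('n)) * \<dots> = ennreal (1 / a ^ CARD('n) * (?om * (2 * a) ^ CARD('n)))"
    by (rule ennreal_mult[symmetric]) (use a om in simp_all)
  also have "1 / a ^ CARD('n) * (?om * (2 * a) ^ CARD('n)) = ?om * 2 ^ CARD('n)"
    using a by (simp add: power_mult_distrib)
  finally show ?thesis .
qed

text \<open>A majorant that depends on x or on x + z alone becomes independent of z after
  integration in x, and the weight of a shell is bounded uniformly in its radius.\<close>

lemma shell_integral:
  fixes H :: "real ^ 'n \<Rightarrow> real ^ 'n \<Rightarrow> ennreal"
  assumes a: "0 < a" and [measurable]: "G1 \<in> borel_measurable borel" "G2 \<in> borel_measurable borel"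
    and H: "\<And>x z. z \<in> shell a \<Longrightarrow> H x z \<le> G1 x + G2 (x + z)"
  shows "(\<integral>\<^sup>+x. \<integral>\<^sup>+z. H x z * (indicator (shell a) z * ennreal (1 / norm z ^ CARD('n))) \<partial>lborel \<partial>lborel)
    \<le> ennreal (unit_ball_vol (real CARD('n)) * 2 ^ CARD('n)) * ((\<integral>\<^sup>+x. G1 x \<partial>lborel) + (\<integral>\<^sup>+x. G2 x \<partial>lborel))"
proof -
  define \<kappa> where "\<kappa> z = indicator (shell a) z * ennreal (1 / norm z ^ CARD('n))" for z :: "real ^ 'n"
  have [measurable]: "\<kappa> \<in> borel_measurable borel" unfolding \<kappa>_def by measurable
  have "(\<integral>\<^sup>+x. \<integral>\<^sup>+z. H x z * \<kappa> z \<partial>lborel \<partial>lborel) \<le> (\<integral>\<^sup>+x. \<integral>\<^sup>+z. (G1 x + G2 (x + z)) * \<kappa> z \<partial>lborel \<partial>lborel)"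
  proof (intro nn_integral_mono)
    fix x z
    show "H x z * \<kappa> z \<le> (G1 x + G2 (x + z)) * \<kappa> z"
      using H[of z x] by (cases "z \<in> shell a") (auto simp: \<kappa>_def intro: mult_right_mono)
  qed
  also have "\<dots> = (\<integral>\<^sup>+z. \<integral>\<^sup>+x. (G1 x + G2 (x + z)) * \<kappa> z \<partial>lborel \<partial>lborel)"
    by (rule lborel_pair.Fubini') measurable
  also have "\<dots> = (\<integral>\<^sup>+z. ((\<integral>\<^sup>+x. G1 x \<partial>lborel) + (\<integral>\<^sup>+x. G2 x \<partial>lborel)) * \<kappa> z \<partial>lborel)"
  proof (rule nn_integral_cong)
    fix z
    have "(\<integral>\<^sup>+x. (G1 x + G2 (x + z)) * \<kappa> z \<partial>lborel) = (\<integral>\<^sup>+x. G1 x + G2 (x + z) \<partial>lborel) * \<kappa> z"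
      by (rule nn_integral_multc) measurable
    also have "(\<integral>\<^sup>+x. G1 x + G2 (x + z) \<partial>lborel) = (\<integral>\<^sup>+x. G1 x \<partial>lborel) + (\<integral>\<^sup>+x. G2 (x + z) \<partial>lborel)"
      by (rule nn_integral_add) measurable
    also have "(\<integral>\<^sup>+x. G2 (x + z) \<partial>lborel) = (\<integral>\<^sup>+x. G2 x \<partial>lborel)"
      using nn_integral_translate[of G2 z] by (simp add: add.commute)
    finally show "(\<integral>\<^sup>+x. (G1 x + G2 (x + z)) * \<kappa> z \<partial>lborel) = ((\<integral>\<^sup>+x. G1 x \<partial>lborel) + (\<integral>\<^sup>+x. G2 x \<partial>lborel)) * \<kappa> z" .
  qed
  also have "\<dots> = ((\<integral>\<^sup>+x. G1 x \<partial>lborel) + (\<integral>\<^sup>+x. G2 x \<partial>lborel)) * (\<integral>\<^sup>+z. \<kappa> z \<partial>lborel)"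
    by (rule nn_integral_cmult) measurable
  also have "\<dots> \<le> ((\<integral>\<^sup>+x. G1 x \<partial>lborel) + (\<integral>\<^sup>+x. G2 x \<partial>lborel)) * ennreal (unit_ball_vol (real CARD('n)) * 2 ^ CARD('n))"
    unfolding \<kappa>_def by (intro mult_left_mono shell_weight a) simp
  finally show ?thesis by (simp only: \<kappa>_def mult.commute)
qed

text \<open>The offset 3 serves \<open>increment_near\<close>: with t = 2^(-k-2) one has |z| <= t,
  and the radius 2 t = 2^(-k-1) is among the controlled dyadic radii.\<close>

lemma in_near_shell:
  assumes "z \<noteq> 0" "norm z \<le> 1 / 4"
  obtains k where "z \<in> shell ((1/2) ^ (k + 3))"
proof -
  have "\<exists>k. (1/2::real) ^ k < norm z" using assms(1) by (intro real_arch_pow_inv) auto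
  then obtain k0 where k0: "(1/2::real) ^ k0 < norm z" by blast
  have "(1/2::real) ^ (k0 + 3) \<le> (1/2) ^ k0" by (rule power_decreasing) auto
  with k0 have ex: "\<exists>k. (1/2::real) ^ (k + 3) < norm z" by (intro exI[of _ k0]) linarith
  \<comment> \<open>For the least such index, the failure at its predecessor gives the upper bound;
    for k = 0 the assumption |z| <= 1/4 takes its place.\<close>
  define k where "k = (LEAST k. (1/2::real) ^ (k + 3) < norm z)"
  have 1: "(1/2::real) ^ (k + 3) < norm z" unfolding k_def by (rule LeastI_ex[OF ex])
  have 2: "norm z \<le> 2 * (1/2) ^ (k + 3)"
  proof (cases k)
    case 0
    then show ?thesis using assms(2) by (simp add: power3_eq_cube)
  next
    case (Suc j)
    then have "\<not> (1/2::real) ^ (j + 3) < norm z" unfolding k_def by (intro not_less_Least) simp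
    moreover have "(1/2::real) ^ (k + 3) = (1/2) * (1/2) ^ (j + 3)" by (simp only: Suc add_Suc power_Suc)
    ultimately show ?thesis by linarith
  qed
  show thesis by (rule that[of k]) (use 1 2 in \<open>simp add: shell_def\<close>)
qed

lemma in_far_shell:
  assumes "1 / 4 < norm z"
  obtains i where "z \<in> shell ((1/4) * 2 ^ i)"
proof -
  obtain i0 where "norm z < 2 ^ i0" using real_arch_pow[of 2 "norm z"] by auto
  moreover have "2 ^ i0 \<le> (1/4) * 2 ^ (Suc (i0 + 1) :: nat) * (1 :: real)" by simp
  ultimately have ex: "\<exists>i. norm z \<le> (1/4) * 2 ^ Suc i" by (intro exI[of _ "i0 + 1"]) linarith
  define i where "i = (LEAST i. norm z \<le> (1/4) * 2 ^ Suc i)"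
  have 1: "norm z \<le> (1/4) * 2 ^ Suc i" unfolding i_def by (rule LeastI_ex[OF ex])
  have 2: "(1/4) * 2 ^ i < norm z"
  proof (cases i)
    case 0
    then show ?thesis using assms by simp
  next
    case (Suc j)
    then have "\<not> norm z \<le> (1/4) * 2 ^ Suc j" unfolding i_def by (intro not_less_Least) simp
    then show ?thesis using Suc by simp
  qed
  show thesis by (rule that[of i]) (use 1 2 in \<open>simp add: shell_def\<close>)
qed

context osc_setting
begin

text \<open>The constant 16 is made for the far shells: 4 from the bound of |z|^(-frac s), 2 for the
  mean of two terms, and 2 from the level 2 C L of \<open>limit_derivative_orlicz\<close>. The near
  shells would ask for 6.\<close>

definition "increment js x z = young_ext A (ennreal (\<bar>limit_derivative js (x + z) - limit_derivative js x\<bar> / (16 * C * L * norm z powr \<sigma>)))"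

text \<open>The path from x to x + z goes through the mollified derivatives at scale t = 2^(-k-2):
  one approximation error at each end and one translation difference between them. The three terms
  are treated as three times their mean.\<close>

lemma increment_near:
  assumes js: "length js = m" and z: "z \<in> shell ((1/2) ^ (k + 3))"
  shows "increment js x z \<le>
    (young_ext A (osc_avg s u (Suc (Suc k)) x / ennreal L) + young_ext A (osc s u x ((1/2) ^ Suc k) / ennreal L))
    + young_ext A (osc_avg s u (Suc (Suc k)) (x + z) / ennreal L)"
proof -
  let ?j = "Suc (Suc k)"
  let ?t = "(1/2::real) ^ ?j"
  let ?v = "limit_derivative js" and ?d = "mollified K u js ?t"
  let ?a = "osc_avg s u ?j x" and ?b = "osc s u x ((1/2) ^ Suc k)" and ?c = "osc_avg s u ?j (x + z)"
  have t: "0 < ?t" "?t \<le> 1" by (rule zero_less_power, simp, rule power_le_one, simp_all)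
  have "k + 3 = Suc ?j" by simp
  then have "(1/2::real) ^ (k + 3) = (1/2) * ?t" by (simp only: power_Suc)
  moreover have "(1/2) ^ (k + 3) < norm z" "norm z \<le> 2 * (1/2) ^ (k + 3)" using z by (simp_all only: shell_def mem_Collect_eq)
  ultimately have z1: "norm z \<le> ?t" and z2: "?t \<le> 2 * norm z" by linarith+
  have z0: "0 < norm z" using z2 t by linarith
  have js': "length js \<le> m" using js by simp
  have Ct: "0 \<le> C * ?t powr \<sigma>" using C_1 by simp
  have "ennreal \<bar>?v (x + z) - ?v x\<bar> \<le> ennreal ((\<bar>?v x - ?d x\<bar> + \<bar>?d x - ?d (x + z)\<bar>) + \<bar>?v (x + z) - ?d (x + z)\<bar>)"
    by (rule ennreal_leI) linarith
  also have "\<dots> = (ennreal \<bar>?v x - ?d x\<bar> + ennreal \<bar>?d x - ?d (x + z)\<bar>) + ennreal \<bar>?v (x + z) - ?d (x + z)\<bar>"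
    by (simp only: ennreal_plus abs_ge_zero add_nonneg_nonneg)
  also have "\<dots> \<le> (ennreal (C * ?t powr \<sigma>) * ?a + ennreal (C * ?t powr \<sigma>) * ?b) + ennreal (C * ?t powr \<sigma>) * ?c"
  proof (intro add_mono limit_derivative_estimate[OF js'])
    have "norm (x - (x + z)) \<le> ?t" using z1 by simp
    from mollified_translate[OF u m_eq s js t this]
    have "ennreal \<bar>?d x - ?d (x + z)\<bar> \<le> ennreal (2 * M * 2 ^ CARD('n) * 2 powr s * unit_ball_vol (real CARD('n)) * ?t powr \<sigma>) * osc s u x (2 * ?t)" .
    also have "\<dots> \<le> ennreal (C * ?t powr \<sigma>) * osc s u x (2 * ?t)"
      by (intro mult_right_mono ennreal_leI C_translate) auto
    also have "2 * ?t = (1/2) ^ Suc k" by simp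
    finally show "ennreal \<bar>?d x - ?d (x + z)\<bar> \<le> ennreal (C * ?t powr \<sigma>) * ?b" .
  qed
  also have "\<dots> = ennreal (C * ?t powr \<sigma>) * ((?a + ?b) + ?c)" by (simp only: distrib_left)
  finally have le: "ennreal \<bar>?v (x + z) - ?v x\<bar> \<le> ennreal (C * ?t powr \<sigma>) * ((?a + ?b) + ?c)" .
  let ?r = "16 * C * L * norm z powr \<sigma>"
  have r: "0 < ?r" using C_1 L_pos z0 by simp
  \<comment> \<open>On the shell t <= 2 |z|, and frac s < 1 bounds 2^(frac s) by 2.\<close>
  have "?t powr \<sigma> \<le> (2 * norm z) powr \<sigma>" using t z2 frac_pos by (intro powr_mono2) auto
  also have "\<dots> = 2 powr \<sigma> * norm z powr \<sigma>" by (rule powr_mult)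
  also have "\<dots> \<le> 2 powr 1 * norm z powr \<sigma>"
    using frac_lt_1[of s] by (intro mult_right_mono powr_mono) auto
  finally have tz: "?t powr \<sigma> \<le> 2 * norm z powr \<sigma>" by simp
  \<comment> \<open>The 16 against the 2 just obtained leaves 1 / (8 L), which is below the 1 / (3
    L) of a mean of three terms.\<close>
  have coef: "1 / ?r * (C * ?t powr \<sigma>) \<le> 1 / (3 * L)"
  proof -
    have "C * ?t powr \<sigma> \<le> C * (2 * norm z powr \<sigma>)" by (rule mult_left_mono[OF tz]) (use C_1 in simp)
    then have "1 / ?r * (C * ?t powr \<sigma>) \<le> 1 / ?r * (C * (2 * norm z powr \<sigma>))"
      by (rule mult_left_mono) (use r in simp)
    also have "\<dots> = 1 / (8 * L)" using C_1 L_pos z0 by simp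
    also have "\<dots> \<le> 1 / (3 * L)" using L_pos by (intro divide_left_mono) auto
    finally show ?thesis .
  qed
  have "ennreal (\<bar>?v (x + z) - ?v x\<bar> / ?r) = ennreal (1 / ?r * \<bar>?v (x + z) - ?v x\<bar>)" by simp
  also have "\<dots> = ennreal (1 / ?r) * ennreal \<bar>?v (x + z) - ?v x\<bar>" by (rule ennreal_mult) (use r in simp_all)
  also have "\<dots> \<le> ennreal (1 / ?r) * (ennreal (C * ?t powr \<sigma>) * ((?a + ?b) + ?c))" by (rule mult_left_mono[OF le]) simp
  also have "\<dots> = ennreal (1 / ?r * (C * ?t powr \<sigma>)) * ((?a + ?b) + ?c)"
    using ennreal_mult[of "1 / ?r" "C * ?t powr \<sigma>"] r Ct by (simp only: mult.assoc less_imp_le zero_le_divide_1_iff)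
  also have "\<dots> \<le> ennreal (1 / (3 * L)) * ((?a + ?b) + ?c)" by (intro mult_right_mono ennreal_leI coef) simp
  also have "\<dots> = (?a / ennreal L + ?b / ennreal L + ?c / ennreal L) / 3"
  proof -
    have "ennreal (1 / (3 * L)) = inverse (ennreal L) * inverse 3"
      using L_pos inverse_ennreal[of 3] by (simp add: inverse_ennreal inverse_eq_divide flip: ennreal_mult)
    then show ?thesis by (simp only: divide_ennreal_def distrib_left distrib_right mult_ac)
  qed
  finally have "increment js x z \<le> young_ext A ((?a / ennreal L + ?b / ennreal L + ?c / ennreal L) / 3)"
    unfolding increment_def by (rule young_ext_mono[OF A])
  also have "\<dots> \<le> (young_ext A (?a / ennreal L) + young_ext A (?b / ennreal L) + young_ext A (?c / ennreal L)) / 3"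
    by (rule young_ext_third[OF A])
  also have "\<dots> \<le> young_ext A (?a / ennreal L) + young_ext A (?b / ennreal L) + young_ext A (?c / ennreal L)"
    by (rule ennreal_divide_le)
  finally show ?thesis .
qed

text \<open>The triangle inequality suffices, since |z|^(-frac s) is at most 4 q^i with q = 2^(-frac
  s). Convexity takes q^i out of \<open>A\<close>, so the shells sum geometrically.\<close>

lemma increment_far:
  assumes z: "z \<in> shell ((1/4) * 2 ^ i)"
  shows "increment js x z \<le>
    ennreal (((1/2) powr \<sigma>) ^ i) * young_ext A (ennreal (\<bar>limit_derivative js x\<bar> / (2 * C * L)))
    + ennreal (((1/2) powr \<sigma>) ^ i) * young_ext A (ennreal (\<bar>limit_derivative js (x + z)\<bar> / (2 * C * L)))"
proof -
  let ?v = "limit_derivative js" and ?q = "((1/2::real) powr \<sigma>) ^ i"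
  have q: "0 < ?q" "?q \<le> 1" using powr_less_mono2[OF frac_pos, of "1/2" 1] by (simp_all add: power_le_one)
  have CL: "0 < C * L" using C_1 L_pos by simp
  have z1: "(1/4) * 2 ^ i < norm z" using z by (simp add: shell_def)
  have z0: "0 < norm z" using z1 by (rule le_less_trans[rotated]) simp
  have zq: "1 \<le> 4 * ?q * norm z powr \<sigma>"
  proof -
    have p: "((1/4) * 2 ^ i) powr \<sigma> \<le> norm z powr \<sigma>" using z1 frac_pos by (intro powr_mono2) auto
    have p': "((1/4) * 2 ^ i) powr \<sigma> = (1/4) powr \<sigma> * (2 ^ i) powr \<sigma>" by (rule powr_mult)
    have p'': "(1/4) * (2 ^ i) powr \<sigma> \<le> (1/4) powr \<sigma> * (2 ^ i) powr \<sigma>"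
    proof (rule mult_right_mono)
      have "(1/4::real) powr 1 \<le> (1/4) powr \<sigma>" using frac_lt_1[of s] frac_pos by (intro powr_mono') auto
      then show "1/4 \<le> (1/4::real) powr \<sigma>" by simp
    qed simp
    have "(2 ^ i) powr \<sigma> * ?q = (1::real)"
    proof -
      have "(2 ^ i) powr \<sigma> = (2 powr \<sigma>) ^ i" by (simp add: powr_powr mult.commute flip: powr_realpow)
      then have "(2 ^ i) powr \<sigma> * ?q = (2 powr \<sigma> * (1/2) powr \<sigma>) ^ i" by (simp only: power_mult_distrib)
      also have "2 powr \<sigma> * (1/2) powr \<sigma> = (2 * (1/2)) powr \<sigma>" by (rule powr_mult[symmetric])
      finally show ?thesis by simp
    qed
    have "(1/4) * (2 ^ i) powr \<sigma> \<le> norm z powr \<sigma>" using p p' p'' by linarith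
    then have "4 * ?q * ((1/4) * (2 ^ i) powr \<sigma>) \<le> 4 * ?q * norm z powr \<sigma>" using q by (intro mult_left_mono) auto
    then show ?thesis using \<open>(2 ^ i) powr \<sigma> * ?q = 1\<close> by (simp add: mult.commute mult.left_commute)
  qed
  let ?a = "\<bar>?v x\<bar> / (2 * C * L)" and ?b = "\<bar>?v (x + z)\<bar> / (2 * C * L)"
  have "\<bar>?v (x + z) - ?v x\<bar> / (16 * C * L * norm z powr \<sigma>) \<le> ?q * ((?a + ?b) / 2)"
  proof -
    have "\<bar>?v (x + z) - ?v x\<bar> \<le> (\<bar>?v x\<bar> + \<bar>?v (x + z)\<bar>) * 1" unfolding mult_1_right by linarith
    also have "\<dots> \<le> (\<bar>?v x\<bar> + \<bar>?v (x + z)\<bar>) * (4 * ?q * norm z powr \<sigma>)" by (intro mult_left_mono zq) simp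
    finally have "\<bar>?v (x + z) - ?v x\<bar> / (16 * C * L * norm z powr \<sigma>)
      \<le> (\<bar>?v x\<bar> + \<bar>?v (x + z)\<bar>) * (4 * ?q * norm z powr \<sigma>) / (16 * C * L * norm z powr \<sigma>)"
      using C_1 L_pos by (intro divide_right_mono) auto
    also have "\<dots> = ?q * ((?a + ?b) / 2)" using C_1 L_pos z0 by (simp add: field_simps)
    finally show ?thesis .
  qed
  then have "ennreal (\<bar>?v (x + z) - ?v x\<bar> / (16 * C * L * norm z powr \<sigma>)) \<le> ennreal (?q * ((?a + ?b) / 2))" by (rule ennreal_leI)
  also have "\<dots> = ennreal ?q * ((ennreal ?a + ennreal ?b) / 2)"
  proof -
    have ab: "0 \<le> ?a" "0 \<le> ?b" using C_1 L_pos by simp_all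
    have "ennreal (?q * ((?a + ?b) / 2)) = ennreal ?q * ennreal ((?a + ?b) / 2)" by (rule ennreal_mult) (use q ab in simp_all)
    also have "ennreal ((?a + ?b) / 2) = ennreal (?a + ?b) / ennreal 2" by (rule divide_ennreal[symmetric]) (use ab in simp_all)
    also have "ennreal (?a + ?b) = ennreal ?a + ennreal ?b" by (rule ennreal_plus[OF ab])
    finally show ?thesis by simp
  qed
  finally have "increment js x z \<le> young_ext A (ennreal ?q * ((ennreal ?a + ennreal ?b) / 2))"
    unfolding increment_def by (rule young_ext_mono[OF A])
  also have "\<dots> \<le> ennreal ?q * young_ext A ((ennreal ?a + ennreal ?b) / 2)" by (rule young_ext_scale[OF A]) (use q in simp_all)
  also have "\<dots> \<le> ennreal ?q * ((young_ext A (ennreal ?a) + young_ext A (ennreal ?b)) / 2)" by (rule mult_left_mono[OF young_ext_half[OF A]]) simp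
  also have "\<dots> \<le> ennreal ?q * (young_ext A (ennreal ?a) + young_ext A (ennreal ?b))"
    by (rule mult_left_mono[OF ennreal_divide_le(1)]) simp
  finally show ?thesis by (simp only: distrib_left)
qed

text \<open>The 6 collects three sums over the near shells, each at most 2. The other term has 2 + 2
  for the two Orlicz modulars on each far shell, times the geometric series 1 / (1 - q) with q =
  2^(-frac s).\<close>

lemma increment_integral:
  assumes js: "length js = m"
  shows "(\<integral>\<^sup>+x. \<integral>\<^sup>+z. increment js x z * ennreal (1 / norm z ^ CARD('n)) \<partial>lborel \<partial>lborel)
    \<le> ennreal (unit_ball_vol (real CARD('n)) * 2 ^ CARD('n)) * (6 + 4 * ennreal (1 / (1 - (1/2) powr \<sigma>)))"
proof -
  let ?v = "limit_derivative js"
  let ?c = "ennreal (unit_ball_vol (real CARD('n)) * 2 ^ CARD('n))"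
  let ?wt = "\<lambda>z :: real ^ 'n. ennreal (1 / norm z ^ CARD('n))"
  let ?q = "(1/2::real) powr \<sigma>"
  let ?N = "\<lambda>k. shell ((1/2) ^ (k + 3)) :: (real ^ 'n) set" and ?F = "\<lambda>i. shell ((1/4) * 2 ^ i) :: (real ^ 'n) set"
  let ?B = "\<lambda>k. \<integral>\<^sup>+x. young_ext A (osc_avg s u k x / ennreal L) \<partial>lborel"
  have q: "0 < ?q" "?q < 1" using powr_less_mono2[OF frac_pos, of "1/2" 1] by simp_all
  have inc_meas [measurable]: "(\<lambda>(x, z). increment js x z) \<in> borel_measurable (borel \<Otimes>\<^sub>M borel)"
    unfolding increment_def by measurable
  define n where "n k = (\<integral>\<^sup>+x. \<integral>\<^sup>+z. increment js x z * (indicator (?N k) z * ?wt z) \<partial>lborel \<partial>lborel)" for k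
  define f where "f i = (\<integral>\<^sup>+x. \<integral>\<^sup>+z. increment js x z * (indicator (?F i) z * ?wt z) \<partial>lborel \<partial>lborel)" for i
  have "(\<integral>\<^sup>+x. \<integral>\<^sup>+z. increment js x z * ?wt z \<partial>lborel \<partial>lborel)
    \<le> (\<integral>\<^sup>+x. \<integral>\<^sup>+z. (\<Sum>k. increment js x z * (indicator (?N k) z * ?wt z)) + (\<Sum>i. increment js x z * (indicator (?F i) z * ?wt z)) \<partial>lborel \<partial>lborel)"
  proof (intro nn_integral_mono)
    fix x z :: "real ^ 'n"
    have single: "g (k :: nat) \<le> (\<Sum>k. g k)" for g :: "nat \<Rightarrow> ennreal" and k
      using sum_le_suminf[of g "{k}"] by simp
    consider "z = 0" | "z \<noteq> 0" "norm z \<le> 1 / 4" | "1 / 4 < norm z" by linarith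
    then show "increment js x z * ?wt z \<le> (\<Sum>k. increment js x z * (indicator (?N k) z * ?wt z)) + (\<Sum>i. increment js x z * (indicator (?F i) z * ?wt z))"
    proof cases
      case 1
      \<comment> \<open>The origin lies in no shell, but its weight is 0 by the convention for
        division.\<close>
      then have "?wt z = 0" by (simp add: zero_power)
      then show ?thesis by (simp only: mult_zero_right zero_le)
    next
      case 2
      then obtain k where "z \<in> ?N k" using in_near_shell by blast
      then have "increment js x z * ?wt z = increment js x z * (indicator (?N k) z * ?wt z)" by simp
      also have "\<dots> \<le> (\<Sum>k. increment js x z * (indicator (?N k) z * ?wt z))" by (rule single)
      finally show ?thesis by (rule add_increasing2[rotated]) simp
    next
      case 3
      then obtain i where "z \<in> ?F i" using in_far_shell by blast
      then have "increment js x z * ?wt z = increment js x z * (indicator (?F i) z * ?wt z)" by simp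
      also have "\<dots> \<le> (\<Sum>i. increment js x z * (indicator (?F i) z * ?wt z))" by (rule single)
      finally show ?thesis by (rule add_increasing[rotated]) simp
    qed
  qed
  also have "\<dots> = (\<integral>\<^sup>+x. (\<Sum>k. \<integral>\<^sup>+z. increment js x z * (indicator (?N k) z * ?wt z) \<partial>lborel) + (\<Sum>i. \<integral>\<^sup>+z. increment js x z * (indicator (?F i) z * ?wt z) \<partial>lborel) \<partial>lborel)"
  proof (rule nn_integral_cong)
    fix x :: "real ^ 'n"
    have [measurable]: "increment js x \<in> borel_measurable borel" by measurable
    show "(\<integral>\<^sup>+z. (\<Sum>k. increment js x z * (indicator (?N k) z * ?wt z)) + (\<Sum>i. increment js x z * (indicator (?F i) z * ?wt z)) \<partial>lborel)
      = (\<Sum>k. \<integral>\<^sup>+z. increment js x z * (indicator (?N k) z * ?wt z) \<partial>lborel) + (\<Sum>i. \<integral>\<^sup>+z. increment js x z * (indicator (?F i) z * ?wt z) \<partial>lborel)"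
      by (subst nn_integral_add, measurable, intro arg_cong2[where f="(+)"] nn_integral_suminf) measurable
  qed
  also have "\<dots> = (\<Sum>k. n k) + (\<Sum>i. f i)"
    unfolding n_def f_def
    by (subst nn_integral_add, measurable, intro arg_cong2[where f="(+)"] nn_integral_suminf) measurable
  also have "\<dots> \<le> ?c * 6 + ?c * (4 * ennreal (1 / (1 - ?q)))"
  proof (rule add_mono)
    have "n k \<le> ?c * ((?B (Suc (Suc k)) + dyadic_modular s A u L (Suc k)) + ?B (Suc (Suc k)))" for k
    proof -
      have "n k \<le> ?c * ((\<integral>\<^sup>+x. young_ext A (osc_avg s u (Suc (Suc k)) x / ennreal L) + young_ext A (osc s u x ((1/2) ^ Suc k) / ennreal L) \<partial>lborel)
        + ?B (Suc (Suc k)))"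
        unfolding n_def
      proof (rule shell_integral[where H="increment js"
            and ?G1.0="\<lambda>x. young_ext A (osc_avg s u (Suc (Suc k)) x / ennreal L) + young_ext A (osc s u x ((1/2) ^ Suc k) / ennreal L)"
            and ?G2.0="\<lambda>x. young_ext A (osc_avg s u (Suc (Suc k)) x / ennreal L)"])
        fix x z :: "real ^ 'n" assume "z \<in> ?N k"
        then show "increment js x z \<le> (young_ext A (osc_avg s u (Suc (Suc k)) x / ennreal L) + young_ext A (osc s u x ((1/2) ^ Suc k) / ennreal L))
          + young_ext A (osc_avg s u (Suc (Suc k)) (x + z) / ennreal L)" by (rule increment_near[OF js])
      qed (simp, measurable)
      also have "(\<integral>\<^sup>+x. young_ext A (osc_avg s u (Suc (Suc k)) x / ennreal L) + young_ext A (osc s u x ((1/2) ^ Suc k) / ennreal L) \<partial>lborel)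
        = ?B (Suc (Suc k)) + dyadic_modular s A u L (Suc k)"
        unfolding dyadic_modular_def by (rule nn_integral_add) measurable
      finally show ?thesis .
    qed
    then have "(\<Sum>k. n k) \<le> (\<Sum>k. ?c * ((?B (Suc (Suc k)) + dyadic_modular s A u L (Suc k)) + ?B (Suc (Suc k))))"
      by (rule suminf_le) auto
    also have "\<dots> = ?c * (((\<Sum>k. ?B (Suc (Suc k))) + (\<Sum>k. dyadic_modular s A u L (Suc k))) + (\<Sum>k. ?B (Suc (Suc k))))"
      unfolding ennreal_suminf_cmult by (simp only: suminf_add[OF summableI summableI])
    also have "\<dots> \<le> ?c * ((2 + 2) + 2)"
    proof -
      have "(\<Sum>k. ?B (Suc (Suc k))) \<le> (\<Sum>k. ?B (Suc k))" using suminf_shift_le[of "\<lambda>k. ?B (Suc k)" 1] by simp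
      then have "(\<Sum>k. ?B (Suc (Suc k))) \<le> 2" using osc_avg_sum_le by (rule order_trans)
      then show ?thesis by (intro mult_left_mono add_mono dyadic_sum_le) auto
    qed
    finally show "(\<Sum>k. n k) \<le> ?c * 6" by simp
    have "f i \<le> ?c * 4 * ennreal (?q ^ i)" for i
    proof -
      let ?g = "\<lambda>x. ennreal (?q ^ i) * young_ext A (ennreal (\<bar>?v x\<bar> / (2 * C * L)))"
      have "f i \<le> ?c * ((\<integral>\<^sup>+x. ?g x \<partial>lborel) + (\<integral>\<^sup>+x. ?g x \<partial>lborel))"
        unfolding f_def
        by (rule shell_integral[where H="increment js" and ?G1.0="?g" and ?G2.0="?g", OF _ _ _ increment_far]) (simp, measurable)
      also have "(\<integral>\<^sup>+x. ?g x \<partial>lborel) = ennreal (?q ^ i) * (\<integral>\<^sup>+x. young_ext A (ennreal (\<bar>?v x\<bar> / (2 * C * L))) \<partial>lborel)"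
        by (rule nn_integral_cmult) measurable
      also have "?c * (\<dots> + \<dots>) \<le> ?c * (ennreal (?q ^ i) * 2 + ennreal (?q ^ i) * 2)"
        using js by (intro mult_left_mono add_mono limit_derivative_orlicz) auto
      also have "\<dots> = ?c * 4 * ennreal (?q ^ i)"
      proof -
        have "ennreal (?q ^ i) * 2 + ennreal (?q ^ i) * 2 = ennreal (?q ^ i) * (2 + 2)" by (simp only: distrib_left)
        also have "(2 + 2 :: ennreal) = 4" by simp
        finally have "ennreal (?q ^ i) * 2 + ennreal (?q ^ i) * 2 = ennreal (?q ^ i) * 4" .
        then show ?thesis by (simp only: mult_ac)
      qed
      finally show ?thesis .
    qed
    then have "(\<Sum>i. f i) \<le> (\<Sum>i. ?c * 4 * ennreal (?q ^ i))" by (rule suminf_le) auto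
    also have "\<dots> = ?c * 4 * (\<Sum>i. ennreal (?q ^ i))" by (rule ennreal_suminf_cmult)
    also have "(\<Sum>i. ennreal (?q ^ i)) = ennreal (1 / (1 - ?q))"
    proof -
      have g: "norm ?q < 1" using q by simp
      have "(\<Sum>i. ennreal (?q ^ i)) = ennreal (\<Sum>i. ?q ^ i)" using q by (intro suminf_ennreal2 summable_geometric g) auto
      then show ?thesis using suminf_geometric[OF g] by (simp only:)
    qed
    finally show "(\<Sum>i. f i) \<le> ?c * (4 * ennreal (1 / (1 - ?q)))" by (simp only: mult.assoc)
  qed
  finally show ?thesis by (simp only: distrib_left)
qed

end

text \<open>The Euclidean norm is at most the sum of the moduli. The factor \<open>card I\<close> in
  the level turns this sum into a mean, and \<open>k\<close> divides the modular once more.\<close>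

lemma young_ext_L2_set:
  fixes f :: "'i \<Rightarrow> real"
  assumes A: "young_function A" and I: "finite I" "I \<noteq> {}" and c: "0 \<le> c" and k: "1 \<le> k"
  shows "young_ext A (ennreal (L2_set f I / (k * real (card I) * c)))
    \<le> ennreal (1 / (k * real (card I))) * (\<Sum>i\<in>I. young_ext A (ennreal (\<bar>f i\<bar> / c)))"
proof -
  let ?N = "real (card I)"
  have N: "0 < ?N" using I by (simp add: card_gt_0_iff)
  have div: "x / of_nat (card I) = ennreal (1 / ?N) * x" for x :: ennreal
    using N by (simp add: divide_ennreal_def mult.commute inverse_ennreal ennreal_of_nat_eq_real_of_nat inverse_eq_divide)
  have "L2_set f I / (k * ?N * c) \<le> (\<Sum>i\<in>I. \<bar>f i\<bar>) / (k * ?N * c)"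
    using c k N by (intro divide_right_mono L2_set_le_sum_abs) simp
  also have "\<dots> = (1 / k) * ((1 / ?N) * (\<Sum>i\<in>I. \<bar>f i\<bar> / c))"
    by (simp add: sum_divide_distrib mult_ac)
  finally have "ennreal (L2_set f I / (k * ?N * c)) \<le> ennreal ((1 / k) * ((1 / ?N) * (\<Sum>i\<in>I. \<bar>f i\<bar> / c)))"
    by (rule ennreal_leI)
  also have "\<dots> = ennreal (1 / k) * ennreal ((1 / ?N) * (\<Sum>i\<in>I. \<bar>f i\<bar> / c))"
    by (rule ennreal_mult) (use c k in \<open>auto intro!: mult_nonneg_nonneg divide_nonneg_nonneg sum_nonneg\<close>)
  also have "ennreal ((1 / ?N) * (\<Sum>i\<in>I. \<bar>f i\<bar> / c)) = ennreal (1 / ?N) * ennreal (\<Sum>i\<in>I. \<bar>f i\<bar> / c)"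
    by (rule ennreal_mult) (use c in \<open>auto intro!: sum_nonneg\<close>)
  also have "ennreal (\<Sum>i\<in>I. \<bar>f i\<bar> / c) = (\<Sum>i\<in>I. ennreal (\<bar>f i\<bar> / c))"
    using c by (intro sum_ennreal[symmetric]) simp
  finally have "young_ext A (ennreal (L2_set f I / (k * ?N * c)))
    \<le> young_ext A (ennreal (1 / k) * ((\<Sum>i\<in>I. ennreal (\<bar>f i\<bar> / c)) / of_nat (card I)))"
    unfolding div by (rule young_ext_mono[OF A])
  also have "\<dots> \<le> ennreal (1 / k) * young_ext A ((\<Sum>i\<in>I. ennreal (\<bar>f i\<bar> / c)) / of_nat (card I))"
    using k by (intro young_ext_scale[OF A]) auto
  also have "\<dots> \<le> ennreal (1 / k) * ((\<Sum>i\<in>I. young_ext A (ennreal (\<bar>f i\<bar> / c))) / of_nat (card I))"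
    by (intro mult_left_mono young_ext_average[OF A] I) simp
  also have "\<dots> = ennreal (1 / k * (1 / ?N)) * (\<Sum>i\<in>I. young_ext A (ennreal (\<bar>f i\<bar> / c)))"
  proof -
    have "ennreal (1 / k * (1 / ?N)) = ennreal (1 / k) * ennreal (1 / ?N)"
      by (rule ennreal_mult) (use k in simp_all)
    then show ?thesis unfolding div by (simp only: mult.assoc)
  qed
  finally show ?thesis by simp
qed

section \<open>Identification of the limits with the weak derivatives\<close>

lemma count_list_surj:
  fixes \<alpha> :: "'n::finite \<Rightarrow> nat"
  shows "\<exists>js. count_list js = \<alpha>"
proof (induction "\<Sum>i\<in>UNIV. \<alpha> i" arbitrary: \<alpha>)
  case 0
  then have "count_list [] = \<alpha>" by (auto simp: fun_eq_iff)
  then show ?case by blast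
next
  case (Suc n)
  then have "(\<Sum>i\<in>UNIV. \<alpha> i) \<noteq> 0" by linarith
  then obtain i where i: "\<alpha> i \<noteq> 0" by (meson sum.neutral)
  have "(\<Sum>j\<in>UNIV. \<alpha> j) = Suc (\<Sum>j\<in>UNIV. (\<alpha>(i := \<alpha> i - 1)) j)"
    using i by (simp add: sum.remove[of UNIV i])
  then have "n = (\<Sum>j\<in>UNIV. (\<alpha>(i := \<alpha> i - 1)) j)" using Suc(2) by simp
  from Suc(1)[OF this] obtain js where js: "count_list js = \<alpha>(i := \<alpha> i - 1)" by blast
  have "count_list (i # js) = \<alpha>" using i by (auto simp: js fun_eq_iff)
  then show ?case by blast
qed

definition index_list :: "('n::finite \<Rightarrow> nat) \<Rightarrow> 'n list" where
  "index_list \<alpha> = (SOME js. count_list js = \<alpha>)"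

lemma count_index_list: "count_list (index_list \<alpha>) = \<alpha>"
  unfolding index_list_def by (rule someI_ex[OF count_list_surj])

lemma length_index_list: "\<alpha> \<in> multi_indices k \<Longrightarrow> length (index_list \<alpha>) = k"
  using sum_count_list[of "index_list \<alpha>"] by (simp add: count_index_list multi_indices_def)

text \<open>A list with the given counts exists, so both candidates have equal integrals against
  every test function, and the fundamental lemma applies to their representatives.\<close>

lemma has_weak_derivative_unique:
  assumes v: "has_weak_derivative u \<alpha> v" and w: "has_weak_derivative u \<alpha> w"
  shows "AE x in lebesgue. v x = w x"
proof -
  have lv: "locally_integrable v" and lw: "locally_integrable w"
    using v w by (simp_all add: has_weak_derivative_def)
  obtain v' where v': "v' \<in> borel_measurable borel" "AE x in lebesgue. v x = v' x"
    using borel_representative[OF locally_integrable_measurable[OF lv]] by blast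
  obtain w' where w': "w' \<in> borel_measurable borel" "AE x in lebesgue. w x = w' x"
    using borel_representative[OF locally_integrable_measurable[OF lw]] by blast
  have "locally_integrable v'"
    by (rule locally_integrable_cong_AE[OF v'(2) measurable_completion lv]) (use v'(1) in simp)
  then have Lv: "loc_int v'" by (simp add: locally_integrable_iff_loc_int[OF v'(1)])
  have "locally_integrable w'"
    by (rule locally_integrable_cong_AE[OF w'(2) measurable_completion lw]) (use w'(1) in simp)
  then have Lw: "loc_int w'" by (simp add: locally_integrable_iff_loc_int[OF w'(1)])
  have "AE x in lborel. v' x - w' x = 0"
  proof (rule fundamental_lemma[OF loc_int_diff[OF Lv Lw]])
    fix \<phi> :: "real ^ 'a \<Rightarrow> real" assume \<phi>: "test_function \<phi>"
    have m: "\<phi> \<in> borel_measurable borel" by (intro smooth_measurable test_function_smooth[OF \<phi>])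
    have c: "test_function \<phi> \<and> (\<forall>i. count_list (index_list \<alpha>) i = \<alpha> i)" using \<phi> by (simp add: count_index_list)
    have "(- 1) ^ (\<Sum>i\<in>UNIV. \<alpha> i) * (\<integral>x. v x * \<phi> x \<partial>lebesgue) = (- 1) ^ (\<Sum>i\<in>UNIV. \<alpha> i) * (\<integral>x. w x * \<phi> x \<partial>lebesgue)"
    proof -
      have "(\<integral>x. u x * iterated_partial (index_list \<alpha>) \<phi> x \<partial>lebesgue) = (- 1) ^ (\<Sum>i\<in>UNIV. \<alpha> i) * (\<integral>x. v x * \<phi> x \<partial>lebesgue)"
        using v c unfolding has_weak_derivative_def by blast
      moreover have "(\<integral>x. u x * iterated_partial (index_list \<alpha>) \<phi> x \<partial>lebesgue) = (- 1) ^ (\<Sum>i\<in>UNIV. \<alpha> i) * (\<integral>x. w x * \<phi> x \<partial>lebesgue)"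
        using w c unfolding has_weak_derivative_def by blast
      ultimately show ?thesis by (simp only:)
    qed
    then have "(\<integral>x. v x * \<phi> x \<partial>lebesgue) = (\<integral>x. w x * \<phi> x \<partial>lebesgue)" by simp
    then have "(\<integral>x. v' x * \<phi> x \<partial>lborel) = (\<integral>x. w' x * \<phi> x \<partial>lborel)"
      unfolding integral_lebesgue_cong_AE_borel[OF v'(2) locally_integrable_measurable[OF lv] v'(1) m]
        integral_lebesgue_cong_AE_borel[OF w'(2) locally_integrable_measurable[OF lw] w'(1) m] .
    then show "(\<integral>x. (v' x - w' x) * \<phi> x \<partial>lborel) = 0"
      by (simp add: left_diff_distrib Bochner_Integration.integral_diff
          loc_int_integrable_test[OF Lv \<phi>] loc_int_integrable_test[OF Lw \<phi>])
  qed
  then have "AE x in lebesgue. v' x - w' x = 0" by (rule AE_completion)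
  with v'(2) w'(2) show ?thesis by eventually_elim simp
qed

lemma has_weak_derivative_0: "locally_integrable u \<Longrightarrow> has_weak_derivative u (\<lambda>_. 0) u"
  unfolding has_weak_derivative_def
proof (intro conjI allI impI)
  fix \<phi> :: "real ^ 'a \<Rightarrow> real" and js :: "'a list"
  assume "test_function \<phi> \<and> (\<forall>i. count_list js i = 0)"
  then have 0: "count_list js i = 0" for i by blast
  have "js = []"
  proof (cases js)
    case (Cons j ks)
    with 0[of j] show ?thesis by simp
  qed
  then show "(\<integral>x. u x * iterated_partial js \<phi> x \<partial>lebesgue) = (- 1) ^ (\<Sum>i\<in>(UNIV :: 'a set). 0 :: nat) * (\<integral>x. u x * \<phi> x \<partial>lebesgue)"
    by (simp add: iterated_partial_def)
qed

context osc_setting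
begin

text \<open>\<open>increment_integral\<close> bounds each component by at most k, and the factor
  \<open>k * real (card I)\<close> in the level divides the sum over the components by just that
  amount.\<close>

lemma frac_modular_limit_derivative:
  fixes js :: "'i \<Rightarrow> 'n list"
  assumes I: "finite I" "I \<noteq> {}" and js: "\<And>i. i \<in> I \<Longrightarrow> length (js i) = m" and k: "1 \<le> k"
    and le: "unit_ball_vol (real CARD('n)) * 2 ^ CARD('n) * (6 + 4 / (1 - (1/2) powr \<sigma>)) \<le> k"
  shows "frac_modular \<sigma> A I (\<lambda>i. limit_derivative (js i)) (k * real (card I) * (16 * C * L)) \<le> 1"
proof -
  let ?wt = "\<lambda>z :: real ^ 'n. ennreal (1 / norm z ^ CARD('n))" and ?N = "real (card I)"
  let ?om = "unit_ball_vol (real CARD('n))" and ?q = "(1/2::real) powr \<sigma>"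
  have N: "0 < ?N" using I by (simp add: card_gt_0_iff)
  have q: "?q < 1" using powr_less_mono2[OF frac_pos, of "1/2" 1] by simp
  have om: "0 < ?om" by (rule unit_ball_vol_pos')
  have [measurable]: "(\<lambda>(x, z). increment ks x z) \<in> borel_measurable (borel \<Otimes>\<^sub>M borel)" for ks
    unfolding increment_def by measurable
  have [measurable]: "increment ks x \<in> borel_measurable borel" for ks x by measurable
  have "frac_modular \<sigma> A I (\<lambda>i. limit_derivative (js i)) (k * ?N * (16 * C * L))
    \<le> (\<integral>\<^sup>+x. \<integral>\<^sup>+z. ennreal (1 / (k * ?N)) * (\<Sum>i\<in>I. increment (js i) x z * ?wt z) \<partial>lborel \<partial>lborel)"
    unfolding frac_modular_def
  proof (intro nn_integral_mono)
    fix x z :: "real ^ 'n"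
    let ?f = "\<lambda>i. limit_derivative (js i) (x + z) - limit_derivative (js i) x"
    have "young_ext A (ennreal (L2_set ?f I / (k * ?N * (16 * C * L * norm z powr \<sigma>))))
      \<le> ennreal (1 / (k * ?N)) * (\<Sum>i\<in>I. increment (js i) x z)"
      unfolding increment_def using C_1 L_pos by (intro young_ext_L2_set[OF A I _ k]) simp
    from mult_right_mono[OF this, of "?wt z"]
    show "young_ext A (ennreal (L2_set ?f I / (k * ?N * (16 * C * L) * norm z powr \<sigma>))) * ?wt z
      \<le> ennreal (1 / (k * ?N)) * (\<Sum>i\<in>I. increment (js i) x z * ?wt z)"
      by (simp only: mult.assoc sum_distrib_right zero_le)
  qed
  also have "\<dots> = (\<integral>\<^sup>+x. ennreal (1 / (k * ?N)) * (\<integral>\<^sup>+z. (\<Sum>i\<in>I. increment (js i) x z * ?wt z) \<partial>lborel) \<partial>lborel)"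
    by (intro nn_integral_cong nn_integral_cmult) measurable
  also have "\<dots> = ennreal (1 / (k * ?N)) * (\<integral>\<^sup>+x. \<integral>\<^sup>+z. (\<Sum>i\<in>I. increment (js i) x z * ?wt z) \<partial>lborel \<partial>lborel)"
    by (rule nn_integral_cmult) measurable
  also have "\<dots> \<le> ennreal (1 / (k * ?N)) * ennreal (?N * k)"
  proof (rule mult_left_mono)
  have "(\<integral>\<^sup>+x. \<integral>\<^sup>+z. (\<Sum>i\<in>I. increment (js i) x z * ?wt z) \<partial>lborel \<partial>lborel)
    = (\<integral>\<^sup>+x. (\<Sum>i\<in>I. \<integral>\<^sup>+z. increment (js i) x z * ?wt z \<partial>lborel) \<partial>lborel)"
    by (intro nn_integral_cong nn_integral_sum) measurable
  also have "\<dots> = (\<Sum>i\<in>I. \<integral>\<^sup>+x. \<integral>\<^sup>+z. increment (js i) x z * ?wt z \<partial>lborel \<partial>lborel)"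
    by (rule nn_integral_sum) measurable
  also have "\<dots> \<le> (\<Sum>i\<in>I. ennreal (?om * 2 ^ CARD('n)) * (6 + 4 * ennreal (1 / (1 - ?q))))"
    by (intro sum_mono increment_integral js)
  also have "(\<Sum>i\<in>I. ennreal (?om * 2 ^ CARD('n)) * (6 + 4 * ennreal (1 / (1 - ?q)))) = (\<Sum>i\<in>I. ennreal (?om * 2 ^ CARD('n) * (6 + 4 / (1 - ?q))))"
  proof (rule sum.cong[OF refl])
    show "ennreal (?om * 2 ^ CARD('n)) * (6 + 4 * ennreal (1 / (1 - ?q))) = ennreal (?om * 2 ^ CARD('n) * (6 + 4 / (1 - ?q)))"
    proof -
    have "4 * ennreal (1 / (1 - ?q)) = ennreal (4 / (1 - ?q))"
      using q ennreal_mult[of 4 "1 / (1 - ?q)"] by simp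
    then have "6 + 4 * ennreal (1 / (1 - ?q)) = ennreal (6 + 4 / (1 - ?q))"
      using q ennreal_plus[of 6 "4 / (1 - ?q)"] by simp
    then show ?thesis using q om ennreal_mult[of "?om * 2 ^ CARD('n)" "6 + 4 / (1 - ?q)"] by simp
    qed
  qed
  also have "\<dots> \<le> (\<Sum>i\<in>I. ennreal k)"
    by (intro sum_mono ennreal_leI le)
  also have "\<dots> = ennreal (?N * k)"
    using k by (simp add: ennreal_mult ennreal_of_nat_eq_real_of_nat)
  finally show "(\<integral>\<^sup>+x. \<integral>\<^sup>+z. (\<Sum>i\<in>I. increment (js i) x z * ?wt z) \<partial>lborel \<partial>lborel) \<le> ennreal (?N * k)" .
  qed simp
  also have "ennreal (1 / (k * ?N)) * ennreal (?N * k) = ennreal (1 / (k * ?N) * (?N * k))"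
    using k by (intro ennreal_mult[symmetric]) auto
  also have "1 / (k * ?N) * (?N * k) = 1" using k N by simp
  finally show ?thesis by simp
qed

text \<open>The additional factor 2 in the level compensates the modular bound 2 of each
  component.\<close>

lemma limit_derivative_L2_orlicz:
  fixes js :: "'i \<Rightarrow> 'n list"
  assumes I: "finite I" "I \<noteq> {}" and js: "\<And>i. i \<in> I \<Longrightarrow> length (js i) \<le> m"
  shows "(\<integral>\<^sup>+x. young_ext A (ennreal (\<bar>L2_set (\<lambda>i. limit_derivative (js i) x) I\<bar> / (2 * real (card I) * (2 * C * L)))) \<partial>lborel) \<le> 1"
proof -
  let ?N = "real (card I)"
  have N: "0 < ?N" using I by (simp add: card_gt_0_iff)
  have "(\<integral>\<^sup>+x. young_ext A (ennreal (\<bar>L2_set (\<lambda>i. limit_derivative (js i) x) I\<bar> / (2 * ?N * (2 * C * L)))) \<partial>lborel)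
    \<le> (\<integral>\<^sup>+x. ennreal (1 / (2 * ?N)) * (\<Sum>i\<in>I. young_ext A (ennreal (\<bar>limit_derivative (js i) x\<bar> / (2 * C * L)))) \<partial>lborel)"
    unfolding abs_of_nonneg[OF L2_set_nonneg]
    using C_1 L_pos by (intro nn_integral_mono young_ext_L2_set[OF A I]) auto
  also have "\<dots> = ennreal (1 / (2 * ?N)) * (\<integral>\<^sup>+x. (\<Sum>i\<in>I. young_ext A (ennreal (\<bar>limit_derivative (js i) x\<bar> / (2 * C * L)))) \<partial>lborel)"
    by (rule nn_integral_cmult) measurable
  also have "\<dots> \<le> ennreal (1 / (2 * ?N)) * ennreal (?N * 2)"
  proof (rule mult_left_mono)
  have "(\<integral>\<^sup>+x. (\<Sum>i\<in>I. young_ext A (ennreal (\<bar>limit_derivative (js i) x\<bar> / (2 * C * L)))) \<partial>lborel)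
    = (\<Sum>i\<in>I. \<integral>\<^sup>+x. young_ext A (ennreal (\<bar>limit_derivative (js i) x\<bar> / (2 * C * L))) \<partial>lborel)"
    by (rule nn_integral_sum) measurable
  also have "\<dots> \<le> (\<Sum>i\<in>I. ennreal 2)"
    using limit_derivative_orlicz[OF js] by (intro sum_mono) simp
  also have "\<dots> = ennreal (?N * 2)"
    by (simp add: ennreal_mult ennreal_of_nat_eq_real_of_nat)
  finally show "(\<integral>\<^sup>+x. (\<Sum>i\<in>I. young_ext A (ennreal (\<bar>limit_derivative (js i) x\<bar> / (2 * C * L)))) \<partial>lborel) \<le> ennreal (?N * 2)" .
  qed simp
  also have "ennreal (1 / (2 * ?N)) * ennreal (?N * 2) = ennreal (1 / (2 * ?N) * (?N * 2))"
    by (intro ennreal_mult[symmetric]) auto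
  also have "1 / (2 * ?N) * (?N * 2) = 1" using N by simp
  finally show ?thesis by simp
qed

text \<open>All lists with the same counts have to be tested; on a test function they give the same
  derivative as the one list used with the kernel.\<close>

lemma limit_derivative_has_weak_derivative:
  assumes w: "w \<in> borel_measurable lebesgue" "AE x in lebesgue. w x = u x" and js: "length js \<le> m"
  shows "has_weak_derivative w (count_list js) (limit_derivative js)"
  unfolding has_weak_derivative_def
proof (intro conjI allI impI)
  have "locally_integrable u" using u locally_integrable_iff_loc_int[OF u_measurable] by simp
  then show "locally_integrable w"
    by (rule locally_integrable_cong_AE[rotated 2]) (use w in \<open>auto elim: eventually_mono\<close>)
  show "locally_integrable (limit_derivative js)"
    using limit_derivative_loc_int[OF js] locally_integrable_iff_loc_int[OF limit_derivative_measurable] by blast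
  fix \<phi> :: "real ^ 'n \<Rightarrow> real" and ks
  assume "test_function \<phi> \<and> (\<forall>i. count_list ks i = count_list js i)"
  then have \<phi>: "test_function \<phi>" and ks: "\<And>i. count_list ks i = count_list js i" by auto
  have m: "\<phi> \<in> borel_measurable borel" "iterated_partial js \<phi> \<in> borel_measurable borel"
    using \<phi> by (auto intro!: smooth_measurable test_function_smooth smooth_iterated_partial)
  have vm: "limit_derivative js \<in> borel_measurable lebesgue"
    by (rule measurable_completion) measurable
  show "(\<integral>x. w x * iterated_partial ks \<phi> x \<partial>lebesgue) =
    (- 1) ^ (\<Sum>i\<in>UNIV. count_list js i) * (\<integral>x. limit_derivative js x * \<phi> x \<partial>lebesgue)"
    unfolding iterated_partial_cong_count[OF test_function_smooth[OF \<phi>] ks]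
      integral_lebesgue_cong_AE_borel[OF w(2,1) u_measurable m(2)]
      integral_lebesgue_cong_AE_borel[OF AE_I2[OF refl] vm limit_derivative_measurable m(1)] sum_count_list
    by (rule limit_derivative_weak[OF js \<phi>])
qed

text \<open>For nonzero \<alpha> \<open>weak_derivative\<close> is an arbitrary choice, which
  uniqueness identifies with the limit almost everywhere; for \<alpha> = 0 it is \<open>w\<close>
  itself.\<close>

lemma weak_derivative_eq_limit_derivative:
  assumes w: "w \<in> borel_measurable lebesgue" "AE x in lebesgue. w x = u x"
    and \<alpha>: "\<alpha> \<in> multi_indices k" "k \<le> m"
  shows "has_weak_derivative w \<alpha> (weak_derivative w \<alpha>)"
    and "AE x in lebesgue. weak_derivative w \<alpha> x = limit_derivative (index_list \<alpha>) x"
proof -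
  have d: "has_weak_derivative w \<alpha> (limit_derivative (index_list \<alpha>))"
    using limit_derivative_has_weak_derivative[OF w, of "index_list \<alpha>"] \<alpha>
    by (simp add: count_index_list length_index_list)
  show e: "has_weak_derivative w \<alpha> (weak_derivative w \<alpha>)"
  proof (cases "\<alpha> = (\<lambda>_. 0)")
    case True
    then show ?thesis using d has_weak_derivative_0[of w] by (simp add: has_weak_derivative_def weak_derivative_def)
  next
    case False
    then show ?thesis using d has_weak_derivative_some by blast
  qed
  show "AE x in lebesgue. weak_derivative w \<alpha> x = limit_derivative (index_list \<alpha>) x"
    by (rule has_weak_derivative_unique[OF e d])
qed

end

lemma multi_indices_nonempty: "(multi_indices k :: ('n::finite \<Rightarrow> nat) set) \<noteq> {}"
proof -
  have "count_list (replicate k (undefined :: 'n)) \<in> multi_indices k"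
    by (rule count_list_multi_indices) simp
  then show ?thesis by blast
qed

text \<open>Kernel and constants are fixed before \<open>A\<close> and \<open>w\<close>, which makes
  them depend on n and s only. Each gradient norm and the fractional seminorm are then estimated at
  an arbitrary level where both modulars are at most 1.\<close>

theorem frac_sobolev_norm_le_osc_norm:
  fixes s :: real
  assumes s: "0 < s" "s \<notin> \<nat>"
  shows "\<exists>c>0. \<forall>A. young_function A \<longrightarrow> (\<forall>w\<in>(osc_space s A :: (real ^ 'n \<Rightarrow> real) set).
    w \<in> frac_sobolev_space s A \<and> frac_sobolev_norm s A w \<le> ennreal c * osc_norm s A w)"
proof -
  define m where "m = nat \<lfloor>s\<rfloor>"
  have frac: "0 < frac s" by (rule frac_pos_if_not_nat[OF s])
  obtain K :: "real ^ 'n \<Rightarrow> real" and M where K: "reproducing_kernel K m M"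
    using reproducing_kernel_obtain by blast
  let ?om = "unit_ball_vol (real CARD('n))" and ?q = "(1/2::real) powr frac s"
  have om: "0 < ?om" by (rule unit_ball_vol_pos')
  have q: "?q < 1" using powr_less_mono2[OF frac, of "1/2" 1] by simp
  \<comment> \<open>The maximum of the four lower bounds that \<open>osc_setting\<close>
    imposes.\<close>
  define C where "C = max 1 (max (M * (2 ^ (CARD('n) + m) + 1) * ?om / (1 - ?q))
    (max (2 * M * 2 ^ CARD('n) * 2 powr s * ?om) (M * 2 ^ m * ?om)))"
  have C: "1 \<le> C" "M * (2 ^ (CARD('n) + m) + 1) * ?om / (1 - ?q) \<le> C"
    "2 * M * 2 ^ CARD('n) * 2 powr s * ?om \<le> C" "M * 2 ^ m * ?om \<le> C"
    by (simp_all add: C_def le_max_iff_disj)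
  have C_step: "M * (2 ^ (CARD('n) + m) + 1) * ?om \<le> C * (1 - ?q)"
    using C(2) q by (simp only: pos_divide_le_eq diff_gt_0_iff_gt)
  \<comment> \<open>The ratio of the level \<open>L\<close> to l.\<close>
  define D where "D = 2 ^ CARD('n) * 2 powr s"
  have D: "0 < D" by (simp add: D_def)
  define k where "k = max 1 (?om * 2 ^ CARD('n) * (6 + 4 / (1 - ?q)))"
  have k: "1 \<le> k" "?om * 2 ^ CARD('n) * (6 + 4 / (1 - ?q)) \<le> k" by (simp_all add: k_def)
  define N where "N j = real (card (multi_indices j :: ('n \<Rightarrow> nat) set))" for j
  have N: "0 < N j" for j by (simp add: N_def card_gt_0_iff multi_indices_nonempty)
  \<comment> \<open>\<open>c\<close> and \<open>cf\<close> are the levels in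
    \<open>limit_derivative_L2_orlicz\<close> and \<open>frac_modular_limit_derivative\<close>,
    divided by l.\<close>
  define c where "c j = 2 * N j * (2 * C * D)" for j
  define cf where "cf = k * N m * (16 * C * D)"
  have c: "0 < c j" for j using C(1) D N[of j] by (simp add: c_def)
  have cf: "0 < cf" using C(1) D N[of m] k(1) by (simp add: cf_def)
  show ?thesis
  proof (intro exI[of _ "(\<Sum>j=0..m. c j) + cf"] conjI allI impI ballI)
    show pos: "0 < (\<Sum>j=0..m. c j) + cf" using c cf by (simp add: add_nonneg_pos sum_nonneg less_imp_le)
    fix A and w :: "real ^ 'n \<Rightarrow> real"
    assume A: "young_function A" and w: "w \<in> osc_space s A"
    have w_meas: "w \<in> borel_measurable lebesgue" and w_fin: "orlicz_norm A w < \<infinity>" "osc_seminorm s A w < \<infinity>"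
      using w by (auto simp: osc_space_def orlicz_space_def)
    obtain u where u: "u \<in> borel_measurable borel" and wu: "AE x in lebesgue. w x = u x"
      using borel_representative[OF w_meas] by blast
    define \<Phi>1 where "\<Phi>1 l = (\<integral>\<^sup>+x. young_ext A (ennreal (\<bar>u x\<bar> / l)) \<partial>lborel)" for l
    define \<Phi>2 where "\<Phi>2 = osc_modular s A u"
    have orlicz: "orlicz_norm A w = luxemburg \<Phi>1"
      unfolding orlicz_norm_def \<Phi>1_def by (intro luxemburg_cong orlicz_modular_eq[OF wu])
    have osc: "osc_seminorm s A w = luxemburg \<Phi>2" unfolding \<Phi>2_def by (rule osc_seminorm_eq[OF wu])
    have anti1: "\<Phi>1 l' \<le> \<Phi>1 l" if "0 < l" "l \<le> l'" for l l'
      unfolding \<Phi>1_def using that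
      by (intro nn_integral_mono young_ext_mono[OF A] ennreal_leI divide_left_mono) auto
    have anti2: "\<Phi>2 l' \<le> \<Phi>2 l" if "0 < l" "l \<le> l'" for l l'
      unfolding \<Phi>2_def using that by (rule osc_modular_antimono[OF A])
    have setting: "osc_setting K m M s C l u A" if l: "0 < l" "\<Phi>1 l \<le> 1" "\<Phi>2 l \<le> 1" for l
    proof (intro osc_setting.intro K osc_setting_axioms.intro A s(1) m_def frac l(1) C_step C(1,3,4))
      show "osc_modular s A u l \<le> 1" using l(3) by (simp only: \<Phi>2_def)
      show *: "(\<integral>\<^sup>+x. young_ext A (ennreal (\<bar>u x\<bar> / l)) \<partial>lborel) \<le> 1" using l(2) by (simp only: \<Phi>1_def)
      show "loc_int u" by (rule orlicz_finite_imp_loc_int[OF A u l(1) order_le_less_trans[OF *]]) simp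
    qed
    \<comment> \<open>The limits depend on the kernel and \<open>u\<close> only, not on the level,
      so they stay fixed while l varies below.\<close>
    define v where "v js = osc_setting.limit_derivative K u js" for js
    obtain l1 l2 where l: "0 < l1" "\<Phi>1 l1 \<le> 1" "0 < l2" "\<Phi>2 l2 \<le> 1"
      using w_fin unfolding orlicz osc luxemburg_finite_iff by blast
    \<comment> \<open>Finiteness of the Orlicz norm and of the oscillation seminorm yields one
      common level, which is enough to identify the weak derivatives.\<close>
    interpret osc_setting K m M s C "max l1 l2" u A
      using l by (intro setting) (auto intro: order_trans[OF anti1] order_trans[OF anti2])
    have der: "has_weak_derivative w \<alpha> (weak_derivative w \<alpha>)" "AE x in lebesgue. weak_derivative w \<alpha> x = v (index_list \<alpha>) x"
      if "\<alpha> \<in> multi_indices j" "j \<le> m" for \<alpha> j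
      unfolding v_def using weak_derivative_eq_limit_derivative[OF w_meas wu that] by auto
    have grad: "orlicz_norm A (weak_gradient_norm j w) \<le> ennreal (c j) * osc_norm s A w" if j: "j \<le> m" for j
    proof -
      let ?I = "multi_indices j :: ('n \<Rightarrow> nat) set"
      have "AE x in lebesgue. \<forall>\<alpha>\<in>?I. weak_derivative w \<alpha> x = v (index_list \<alpha>) x"
        using der(2)[OF _ j] by (intro AE_finite_allI) auto
      then have "AE x in lebesgue. weak_gradient_norm j w x = L2_set (\<lambda>\<alpha>. v (index_list \<alpha>) x) ?I"
        by (rule eventually_mono) (simp add: weak_gradient_norm_def L2_set_def)
      then have "orlicz_norm A (weak_gradient_norm j w) =
        luxemburg (\<lambda>l. \<integral>\<^sup>+x. young_ext A (ennreal (\<bar>L2_set (\<lambda>\<alpha>. v (index_list \<alpha>) x) ?I\<bar> / l)) \<partial>lborel)"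
        unfolding orlicz_norm_def by (intro luxemburg_cong orlicz_modular_eq)
      also have "\<dots> \<le> ennreal (c j) * (luxemburg \<Phi>1 + luxemburg \<Phi>2)"
      proof (rule luxemburg_le_add[OF c _ anti1 anti2])
        fix l assume l: "0 < l" "\<Phi>1 l \<le> 1" "\<Phi>2 l \<le> 1"
        interpret l: osc_setting K m M s C l u A using l by (rule setting)
        have "2 * N j * (2 * C * l.L) = c j * l" by (simp add: c_def l.L_def D_def)
        moreover have "length (index_list \<alpha>) \<le> m" if "\<alpha> \<in> ?I" for \<alpha>
          using length_index_list[OF that] j by simp
        ultimately show "(\<integral>\<^sup>+x. young_ext A (ennreal (\<bar>L2_set (\<lambda>\<alpha>. v (index_list \<alpha>) x) ?I\<bar> / (c j * l))) \<partial>lborel) \<le> 1"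
          using l.limit_derivative_L2_orlicz[OF finite_multi_indices multi_indices_nonempty[of j], of index_list]
          by (simp add: N_def v_def)
      qed
      finally show ?thesis by (simp only: osc_norm_def orlicz osc)
    qed
    have "frac_seminorm (frac s) A (multi_indices m) (weak_derivative w) =
      luxemburg (frac_modular (frac s) A (multi_indices m) (\<lambda>\<alpha>. v (index_list \<alpha>)))"
      unfolding frac_seminorm_def
    proof (intro luxemburg_cong frac_modular_eq[OF A finite_multi_indices])
      show "v (index_list \<alpha>) \<in> borel_measurable borel" for \<alpha> unfolding v_def by (rule limit_derivative_measurable)
    qed (use der(2) in auto)
    also have "\<dots> \<le> ennreal cf * (luxemburg \<Phi>1 + luxemburg \<Phi>2)"
    proof (rule luxemburg_le_add[OF cf _ anti1 anti2])
      fix l assume l: "0 < l" "\<Phi>1 l \<le> 1" "\<Phi>2 l \<le> 1"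
      interpret l: osc_setting K m M s C l u A using l by (rule setting)
      have "k * N m * (16 * C * l.L) = cf * l" by (simp add: cf_def l.L_def D_def)
      moreover have "frac_modular (frac s) A (multi_indices m) (\<lambda>\<alpha>. v (index_list \<alpha>)) (k * N m * (16 * C * l.L)) \<le> 1"
        unfolding N_def v_def
        by (rule l.frac_modular_limit_derivative[OF finite_multi_indices multi_indices_nonempty _ k]) (rule length_index_list)
      ultimately show "frac_modular (frac s) A (multi_indices m) (\<lambda>\<alpha>. v (index_list \<alpha>)) (cf * l) \<le> 1"
        by (simp only:)
    qed
    finally have frac_le: "frac_seminorm (frac s) A (multi_indices m) (weak_derivative w) \<le> ennreal cf * osc_norm s A w"
      by (simp only: osc_norm_def orlicz osc)
    have fin: "osc_norm s A w < \<infinity>" using w_fin by (simp add: osc_norm_def)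
    have "weak_gradient_norm j w \<in> orlicz_space A" if j: "j \<le> m" for j
    proof -
      have "weak_gradient_norm j w \<in> borel_measurable lebesgue"
        unfolding weak_gradient_norm_def
        using der(1)[OF _ j] by (intro L2_set_measurable locally_integrable_measurable) (auto simp: has_weak_derivative_def)
      moreover have "orlicz_norm A (weak_gradient_norm j w) < \<infinity>"
        by (rule order_le_less_trans[OF grad[OF j]]) (use fin in \<open>simp add: ennreal_mult_less_top\<close>)
      ultimately show ?thesis by (simp add: orlicz_space_def)
    qed
    moreover have "\<exists>v. has_weak_derivative w \<alpha> v" if "j \<le> m" "\<alpha> \<in> multi_indices j" for j \<alpha>
      using der(1)[OF that(2,1)] by blast
    moreover have "w \<in> orlicz_space A" using w by (simp add: osc_space_def)
    ultimately have "w \<in> sobolev_space m A" unfolding sobolev_space_def by auto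
    moreover have "frac_seminorm (frac s) A (multi_indices m) (weak_derivative w) < \<infinity>"
      by (rule order_le_less_trans[OF frac_le]) (use fin in \<open>simp add: ennreal_mult_less_top\<close>)
    ultimately show "w \<in> frac_sobolev_space s A"
      unfolding frac_sobolev_space_def m_def by simp
    have "sobolev_norm m A w \<le> (\<Sum>j=0..m. ennreal (c j) * osc_norm s A w)"
      unfolding sobolev_norm_def by (intro sum_mono grad) simp
    also have "\<dots> = ennreal (\<Sum>j=0..m. c j) * osc_norm s A w"
      using c by (simp add: less_imp_le flip: sum_distrib_right)
    finally have "frac_sobolev_norm s A w \<le> ennreal (\<Sum>j=0..m. c j) * osc_norm s A w + ennreal cf * osc_norm s A w"
      unfolding frac_sobolev_norm_def m_def[symmetric] by (rule add_mono[OF _ frac_le])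
    also have "\<dots> = ennreal ((\<Sum>j=0..m. c j) + cf) * osc_norm s A w"
      using c cf by (simp add: ennreal_plus less_imp_le sum_nonneg distrib_right)
    finally show "frac_sobolev_norm s A w \<le> ennreal ((\<Sum>j=0..m. c j) + cf) * osc_norm s A w" .
  qed
qed

theorem theorem3p2:
  fixes s :: real
  assumes "s > 0" and "s \<notin> \<nat>"
  shows "\<exists>c1 > 0. \<exists>c2 > 0. \<forall>A. young_function A \<longrightarrow>
    (osc_space s A :: (real ^ 'n \<Rightarrow> real) set) = frac_sobolev_space s A \<and>
    (\<forall>u \<in> (osc_space s A :: (real ^ 'n \<Rightarrow> real) set).
       ennreal c1 * osc_norm s A u \<le> frac_sobolev_norm s A u \<and>
       frac_sobolev_norm s A u \<le> ennreal c2 * osc_norm s A u)"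
proof -
  obtain c2 where c2: "0 < c2" "\<And>A u. young_function A \<Longrightarrow> u \<in> (osc_space s A :: (real ^ 'n \<Rightarrow> real) set) \<Longrightarrow>
    u \<in> frac_sobolev_space s A \<and> frac_sobolev_norm s A u \<le> ennreal c2 * osc_norm s A u"
    using frac_sobolev_norm_le_osc_norm[OF assms] by blast
  obtain C where C: "0 < C" "\<And>A u. young_function A \<Longrightarrow> u \<in> (frac_sobolev_space s A :: (real ^ 'n \<Rightarrow> real) set) \<Longrightarrow>
    osc_seminorm s A u \<le> ennreal C * frac_seminorm (frac s) A (multi_indices (nat \<lfloor>s\<rfloor>)) (weak_derivative u)"
    using osc_seminorm_le_frac_seminorm[OF assms] by blast
  \<comment> \<open>At most 1 for the Orlicz norms, and at most 1 / C for the seminorms.\<close>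
  define c1 where "c1 = 1 / max 1 C"
  have c1: "0 < c1" "c1 \<le> 1" "c1 * C \<le> 1" using C(1) by (auto simp: c1_def field_simps max_def)
  show ?thesis
  proof (rule exI[of _ c1], rule conjI[OF c1(1)], rule exI[of _ c2], intro conjI allI impI ballI c2(1))
    fix A assume A: "young_function A"
    have fin: "osc_seminorm s A u < \<infinity>" if u: "u \<in> frac_sobolev_space s A" for u :: "real ^ 'n \<Rightarrow> real"
      by (rule order_le_less_trans[OF C(2)[OF A u]]) (use u in \<open>simp add: frac_sobolev_space_def ennreal_mult_less_top\<close>)
    show eq: "(osc_space s A :: (real ^ 'n \<Rightarrow> real) set) = frac_sobolev_space s A"
    proof (intro subset_antisym subsetI)
      fix u :: "real ^ 'n \<Rightarrow> real" assume u: "u \<in> frac_sobolev_space s A"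
      then show "u \<in> osc_space s A" using fin[OF u]
        unfolding osc_space_def frac_sobolev_space_def sobolev_space_def by blast
    qed (use c2(2)[OF A] in blast)
    fix u :: "real ^ 'n \<Rightarrow> real" assume u: "u \<in> osc_space s A"
    then show "frac_sobolev_norm s A u \<le> ennreal c2 * osc_norm s A u" using c2(2)[OF A] by blast
    let ?f = "frac_seminorm (frac s) A (multi_indices (nat \<lfloor>s\<rfloor>)) (weak_derivative u)"
    \<comment> \<open>The Orlicz norm of u is the term of order 0 in the Sobolev norm.\<close>
    have "orlicz_norm A (weak_gradient_norm 0 u) \<le> sobolev_norm (nat \<lfloor>s\<rfloor>) A u"
      unfolding sobolev_norm_def by (rule member_le_sum) auto
    then have orlicz: "orlicz_norm A u \<le> sobolev_norm (nat \<lfloor>s\<rfloor>) A u" by (simp only: orlicz_norm_gradient_0)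
    have "ennreal c1 * orlicz_norm A u \<le> ennreal 1 * sobolev_norm (nat \<lfloor>s\<rfloor>) A u"
      by (intro mult_mono ennreal_leI c1 orlicz) auto
    moreover have "ennreal c1 * osc_seminorm s A u \<le> ?f"
    proof -
      have "ennreal c1 * osc_seminorm s A u \<le> ennreal c1 * (ennreal C * ?f)"
        using C(2)[OF A] u unfolding eq by (intro mult_left_mono) auto
      also have "\<dots> = ennreal (c1 * C) * ?f" using c1 C by (simp add: ennreal_mult mult.assoc)
      also have "\<dots> \<le> ennreal 1 * ?f" by (intro mult_right_mono ennreal_leI c1) simp
      finally show ?thesis by simp
    qed
    ultimately show "ennreal c1 * osc_norm s A u \<le> frac_sobolev_norm s A u"
      unfolding osc_norm_def frac_sobolev_norm_def distrib_left by (intro add_mono) simp_all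
  qed
qed

end
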